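(* For each $k=1,2,3,4$, the category of distributive restriction semigroups (resp. distributive restriction $\wedge$-semigroups, distributive restriction monoids, distributive restriction $\wedge$-monoids) and their morphisms of type $k$ is dually equivalent to the category of spectral (resp. strongly spectral, compact spectral, compact strongly spectral) étale topological categories and their coherent morphisms of type $k$.
   Context: **Distributive restriction semigroups.** An Ehresmann semigroup is a semigroup $S$ with a non-empty set $E$ of idempotents (the projections) and maps $\lambda,\rho:S\to E$ such that: $E$ is a commutative subsemigroup; $\lambda(a)=\rho(a)=a$ for $a\in E$; $a\lambda(a)=a$ and $\rho(a)a=a$; $\lambda(\lambda(a)b)=\lambda(ab)$ and $\rho(a\rho(b))=\rho(ab)$. It is a restriction semigroup if moreover $fa=a\lambda(fa)$ and $af=\rho(af)a$ for all $a\in S$, $f\in E$. Natural partial order: $a\le b$ iff $a=gb=bf$ for some $f,g\in E$. Elements $a,b$ are compatible if $a\lambda(b)=b\lambda(a)$ and $\rho(b)a=\rho(a)b$. $S$ is a distributive restriction semigroup if $E$ is a distributive lattice (with bottom $0$, not necessarily with a top), the bottom $0$ is the least element (zero) of $S$, and $a\vee b$ exists in $S$ for all compatible $a,b$. It is a $\wedge$-semigroup if in addition $a\wedge b$ exists for all $a,b\in S$; a ($\wedge$-)monoid if in addition $S$ has an identity. A morphism $f:S\to T$ of distributive restriction semigroups is a semigroup homomorphism commuting with $\lambda,\rho$ whose restriction $E_S\to E_T$ is a morphism of distributive lattices: it preserves $0,\vee,\wedge$ and for every $a\in E_T$ there is $b\in E_S$ with $f(b)\ge a$. It is proper if for every $t\in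 T$ there are $n\ge1$, $t_1,\dots,t_n\in T$, $s_1,\dots,s_n\in S$ with $t=\bigvee t_i$ and $f(s_i)\ge t_i$ for all $i$. It is weakly meet-preserving if $t\le f(a),f(b)$ implies that there is $c\le a,b$ with $t\le f(c)$. Types: 1 morphisms; 2 proper morphisms; 3 weakly meet-preserving morphisms; 4 proper and weakly meet-preserving morphisms. **Étale topological categories.** A topological category $C=(C_1,C_0,u,d,r,m)$ is an internal category in topological spaces ($u$ unit, $d$ domain, $r$ codomain, $m$ defined on $C_1\times_{C_0}C_1=\{(a,b):d(a)=r(b)\}$). It is étale if $d,r$ are local homeomorphisms and $u,m$ are open. A relational covering morphism $f=(f_1,f_0):C\to D$ consists of a continuous $f_0:C_0\to D_0$ and a function $f_1:C_1\to\mathcal P(D_1)$ (power set) such that: (RM1) $b\in f_1(a)$ implies $d(b)=f_0d(a)$ and $r(b)=f_0r(a)$; (RM2) if $(a,b)\in C_1\times_{C_0}C_1$, $(s,t)\in D_1\times_{D_0}D_1$, $s\in f_1(a)$, $t\in f_1(b)$, then $st\in f_1(ab)$; (RM3) if $d(a)=d(b)$ or $r(a)=r(b)$, and $f_1(a)\cap f_1(b)\ne\varnothing$, then $a=b$; (RM4) if $p=f_0(q)$ and $d(s)=p$ (resp. $r(s)=p$) with $q\in C_0$, $s\in D_1$, there is $t\in C_1$ with $d(t)=q$ (resp. $r(t)=q$) and $s\in f_1(t)$; (RM5) $\{x\in C_1:f_1(x)\cap A\ne\varnothing\}$ is open for every open $A\subseteq D_1$; (RM6) $uf_0(t)\in f_1u(t)$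 for $t\in C_0$. Composition: $(gf)_1(a)=\bigcup_{b\in f_1(a)}g_1(b)$, $(gf)_0=g_0f_0$. Types: 1 all relational covering morphisms; 2 those with $|f_1(c)|\ge1$ for all $c$; 3 those with $|f_1(c)|\le1$; 4 those with $|f_1(c)|=1$. $f$ is coherent if $f_0^{-1}$ maps compact-open sets to compact-open sets. A space is spectral if it is sober and has a basis of compact-open sets closed under finite non-empty intersections (it need not be compact). An étale topological category $C$ is spectral if $C_0$ is spectral and strongly spectral if $C_1$ is spectral; "compact" means in addition that $C_0$ is compact. *)

theory Defs
  imports "HOL-Analysis.Analysis" "HOL-Algebra.Lattice"
begin

section \<open>Categories, functors, natural isomorphisms\<close>

text \<open>
  Hom-sets need not be disjoint, so identities, composition and the action of a functor on
  arrows take the objects involved as arguments: \<open>Cmp \<C> x y z g f\<close> is the composite of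
  \<open>f : x \<rightarrow> y\<close> and \<open>g : y \<rightarrow> z\<close>.
\<close>

record ('o, 'm) cat =
  Ob :: "'o set"
  Hom :: "'o \<Rightarrow> 'o \<Rightarrow> 'm set"
  Idn :: "'o \<Rightarrow> 'm"
  Cmp :: "'o \<Rightarrow> 'o \<Rightarrow> 'o \<Rightarrow> 'm \<Rightarrow> 'm \<Rightarrow> 'm"

definition category :: "('o, 'm) cat \<Rightarrow> bool" where
  "category \<C> \<longleftrightarrow>
    (\<forall>x\<in>Ob \<C>. Idn \<C> x \<in> Hom \<C> x x) \<and>
    (\<forall>x\<in>Ob \<C>. \<forall>y\<in>Ob \<C>. \<forall>z\<in>Ob \<C>. \<forall>f\<in>Hom \<C> x y. \<forall>g\<in>Hom \<C> y z. Cmp \<C> x y z g f \<in> Hom \<C> x z) \<and>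
    (\<forall>x\<in>Ob \<C>. \<forall>y\<in>Ob \<C>. \<forall>f\<in>Hom \<C> x y.
        Cmp \<C> x x y f (Idn \<C> x) = f \<and> Cmp \<C> x y y (Idn \<C> y) f = f) \<and>
    (\<forall>w\<in>Ob \<C>. \<forall>x\<in>Ob \<C>. \<forall>y\<in>Ob \<C>. \<forall>z\<in>Ob \<C>. \<forall>f\<in>Hom \<C> w x. \<forall>g\<in>Hom \<C> x y. \<forall>h\<in>Hom \<C> y z.
        Cmp \<C> w x z (Cmp \<C> x y z h g) f = Cmp \<C> w y z h (Cmp \<C> w x y g f))"

definition is_iso :: "('o, 'm) cat \<Rightarrow> 'o \<Rightarrow> 'o \<Rightarrow> 'm \<Rightarrow> bool" where
  "is_iso \<C> x y f \<longleftrightarrow> f \<in> Hom \<C> x y \<and>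
    (\<exists>g\<in>Hom \<C> y x. Cmp \<C> x y x g f = Idn \<C> x \<and> Cmp \<C> y x y f g = Idn \<C> y)"

record ('o, 'm, 'p, 'n) fctr =
  on_ob :: "'o \<Rightarrow> 'p"
  on_ar :: "'o \<Rightarrow> 'o \<Rightarrow> 'm \<Rightarrow> 'n"

definition covariant :: "('o, 'm) cat \<Rightarrow> ('p, 'n) cat \<Rightarrow> ('o, 'm, 'p, 'n) fctr \<Rightarrow> bool" where
  "covariant \<C> \<D> F \<longleftrightarrow>
    (\<forall>x\<in>Ob \<C>. on_ob F x \<in> Ob \<D>) \<and>
    (\<forall>x\<in>Ob \<C>. \<forall>y\<in>Ob \<C>. \<forall>f\<in>Hom \<C> x y. on_ar F x y f \<in> Hom \<D> (on_ob F x) (on_ob F y)) \<and>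
    (\<forall>x\<in>Ob \<C>. on_ar F x x (Idn \<C> x) = Idn \<D> (on_ob F x)) \<and>
    (\<forall>x\<in>Ob \<C>. \<forall>y\<in>Ob \<C>. \<forall>z\<in>Ob \<C>. \<forall>f\<in>Hom \<C> x y. \<forall>g\<in>Hom \<C> y z.
        on_ar F x z (Cmp \<C> x y z g f) =
        Cmp \<D> (on_ob F x) (on_ob F y) (on_ob F z) (on_ar F y z g) (on_ar F x y f))"

definition contravariant :: "('o, 'm) cat \<Rightarrow> ('p, 'n) cat \<Rightarrow> ('o, 'm, 'p, 'n) fctr \<Rightarrow> bool" where
  "contravariant \<C> \<D> F \<longleftrightarrow>
    (\<forall>x\<in>Ob \<C>. on_ob F x \<in> Ob \<D>) \<and>
    (\<forall>x\<in>Ob \<C>. \<forall>y\<in>Ob \<C>. \<forall>f\<in>Hom \<C> x y. on_ar F x y f \<in> Hom \<D> (on_ob F y) (on_ob F x)) \<and>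
    (\<forall>x\<in>Ob \<C>. on_ar F x x (Idn \<C> x) = Idn \<D> (on_ob F x)) \<and>
    (\<forall>x\<in>Ob \<C>. \<forall>y\<in>Ob \<C>. \<forall>z\<in>Ob \<C>. \<forall>f\<in>Hom \<C> x y. \<forall>g\<in>Hom \<C> y z.
        on_ar F x z (Cmp \<C> x y z g f) =
        Cmp \<D> (on_ob F z) (on_ob F y) (on_ob F x) (on_ar F x y f) (on_ar F y z g))"

definition fully_faithful :: "('o, 'm) cat \<Rightarrow> ('p, 'n) cat \<Rightarrow> ('o, 'm, 'p, 'n) fctr \<Rightarrow> bool" where
  "fully_faithful \<C> \<D> F \<longleftrightarrow> covariant \<C> \<D> F \<and>
    (\<forall>x\<in>Ob \<C>. \<forall>y\<in>Ob \<C>. bij_betw (on_ar F x y) (Hom \<C> x y) (Hom \<D> (on_ob F x) (on_ob F y)))"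

text \<open>The composite of two contravariant functors, \<open>F\<close> first; it is covariant.\<close>

definition contra_comp ::
    "('p, 'n, 'q, 'l) fctr \<Rightarrow> ('o, 'm, 'p, 'n) fctr \<Rightarrow> ('o, 'm, 'q, 'l) fctr" where
  "contra_comp G F =
    \<lparr> on_ob = (\<lambda>x. on_ob G (on_ob F x)),
      on_ar = (\<lambda>x y f. on_ar G (on_ob F y) (on_ob F x) (on_ar F x y f)) \<rparr>"

definition naturally_isomorphic ::
    "('o, 'm) cat \<Rightarrow> ('p, 'n) cat \<Rightarrow> ('o, 'm, 'p, 'n) fctr \<Rightarrow> ('o, 'm, 'p, 'n) fctr \<Rightarrow> bool" where
  "naturally_isomorphic \<C> \<D> F G \<longleftrightarrow> covariant \<C> \<D> F \<and> covariant \<C> \<D> G \<and>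
    (\<exists>\<eta>. (\<forall>x\<in>Ob \<C>. is_iso \<D> (on_ob F x) (on_ob G x) (\<eta> x)) \<and>
      (\<forall>x\<in>Ob \<C>. \<forall>y\<in>Ob \<C>. \<forall>f\<in>Hom \<C> x y.
        Cmp \<D> (on_ob F x) (on_ob G x) (on_ob G y) (on_ar G x y f) (\<eta> x) =
        Cmp \<D> (on_ob F x) (on_ob F y) (on_ob G y) (\<eta> y) (on_ar F x y f)))"

text \<open>
  The four versions of the two categories below: semigroups, \<open>\<and>\<close>-semigroups, monoids,
  \<open>\<and>\<close>-monoids on one side; spectral, strongly spectral, compact spectral, compact
  strongly spectral etale categories on the other.
\<close>

datatype version = Plain | Meets | Unital | Meets_Unital


section \<open>Distributive restriction semigroups\<close>

text \<open>\<open>rs_dom\<close> and \<open>rs_cod\<close> are the maps \<open>\<lambda>\<close> and \<open>\<rho>\<close>.\<close>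

record 'a rsg = "'a partial_object" +
  rs_mult :: "'a \<Rightarrow> 'a \<Rightarrow> 'a"
  rs_proj :: "'a set"
  rs_dom :: "'a \<Rightarrow> 'a"
  rs_cod :: "'a \<Rightarrow> 'a"

definition ehresmann_semigroup :: "'a rsg \<Rightarrow> bool" where
  "ehresmann_semigroup S \<longleftrightarrow>
    (\<forall>a\<in>carrier S. \<forall>b\<in>carrier S. rs_mult S a b \<in> carrier S) \<and>
    (\<forall>a\<in>carrier S. \<forall>b\<in>carrier S. \<forall>c\<in>carrier S.
        rs_mult S (rs_mult S a b) c = rs_mult S a (rs_mult S b c)) \<and>
    rs_proj S \<subseteq> carrier S \<and> rs_proj S \<noteq> {} \<and>
    (\<forall>e\<in>rs_proj S. rs_mult S e e = e) \<and>
    (\<forall>e\<in>rs_proj S. \<forall>f\<in>rs_proj S. rs_mult S e f \<in> rs_proj S \<and> rs_mult S e f = rs_mult S f e) \<and>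
    (\<forall>a\<in>carrier S. rs_dom S a \<in> rs_proj S \<and> rs_cod S a \<in> rs_proj S) \<and>
    (\<forall>e\<in>rs_proj S. rs_dom S e = e \<and> rs_cod S e = e) \<and>
    (\<forall>a\<in>carrier S. rs_mult S a (rs_dom S a) = a \<and> rs_mult S (rs_cod S a) a = a) \<and>
    (\<forall>a\<in>carrier S. \<forall>b\<in>carrier S.
        rs_dom S (rs_mult S (rs_dom S a) b) = rs_dom S (rs_mult S a b) \<and>
        rs_cod S (rs_mult S a (rs_cod S b)) = rs_cod S (rs_mult S a b))"

definition restriction_semigroup :: "'a rsg \<Rightarrow> bool" where
  "restriction_semigroup S \<longleftrightarrow> ehresmann_semigroup S \<and>
    (\<forall>a\<in>carrier S. \<forall>f\<in>rs_proj S.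
        rs_mult S f a = rs_mult S a (rs_dom S (rs_mult S f a)) \<and>
        rs_mult S a f = rs_mult S (rs_cod S (rs_mult S a f)) a)"

definition natural_order :: "'a rsg \<Rightarrow> 'a gorder" where
  "natural_order S =
    \<lparr> carrier = carrier S, eq = (=),
      le = (\<lambda>a b. \<exists>g\<in>rs_proj S. \<exists>f\<in>rs_proj S. a = rs_mult S g b \<and> a = rs_mult S b f) \<rparr>"

definition projection_order :: "'a rsg \<Rightarrow> 'a gorder" where
  "projection_order S = natural_order S \<lparr> carrier := rs_proj S \<rparr>"

definition compatible :: "'a rsg \<Rightarrow> 'a \<Rightarrow> 'a \<Rightarrow> bool" where
  "compatible S a b \<longleftrightarrow>
    rs_mult S a (rs_dom S b) = rs_mult S b (rs_dom S a) \<and>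
    rs_mult S (rs_cod S b) a = rs_mult S (rs_cod S a) b"

definition distributive_lattice :: "'a gorder \<Rightarrow> bool" where
  "distributive_lattice L \<longleftrightarrow> lattice L \<and>
    (\<forall>x\<in>carrier L. \<forall>y\<in>carrier L. \<forall>z\<in>carrier L.
        x \<sqinter>\<^bsub>L\<^esub> (y \<squnion>\<^bsub>L\<^esub> z) = (x \<sqinter>\<^bsub>L\<^esub> y) \<squnion>\<^bsub>L\<^esub> (x \<sqinter>\<^bsub>L\<^esub> z))"

definition distributive_restriction_semigroup :: "'a rsg \<Rightarrow> bool" where
  "distributive_restriction_semigroup S \<longleftrightarrow> restriction_semigroup S \<and>
    distributive_lattice (projection_order S) \<and>
    (\<exists>z. least (projection_order S) z (rs_proj S) \<and> least (natural_order S) z (carrier S) \<and>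
        (\<forall>a\<in>carrier S. rs_mult S a z = z \<and> rs_mult S z a = z)) \<and>
    (\<forall>a\<in>carrier S. \<forall>b\<in>carrier S. compatible S a b \<longrightarrow> (\<exists>c. is_lub (natural_order S) c {a, b}))"

definition has_meets :: "'a rsg \<Rightarrow> bool" where
  "has_meets S \<longleftrightarrow> (\<forall>a\<in>carrier S. \<forall>b\<in>carrier S. \<exists>c. is_glb (natural_order S) c {a, b})"

definition has_identity :: "'a rsg \<Rightarrow> bool" where
  "has_identity S \<longleftrightarrow>
    (\<exists>i\<in>carrier S. \<forall>a\<in>carrier S. rs_mult S i a = a \<and> rs_mult S a i = a)"

fun drs_object :: "version \<Rightarrow> 'a rsg \<Rightarrow> bool" where
  "drs_object Plain S \<longleftrightarrow> distributive_restriction_semigroup S"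
| "drs_object Meets S \<longleftrightarrow> distributive_restriction_semigroup S \<and> has_meets S"
| "drs_object Unital S \<longleftrightarrow> distributive_restriction_semigroup S \<and> has_identity S"
| "drs_object Meets_Unital S \<longleftrightarrow>
    distributive_restriction_semigroup S \<and> has_meets S \<and> has_identity S"

text \<open>Morphisms are extensional functions on the carrier, so that equality of arrows is equality
  on the carrier.\<close>

definition drs_morphism :: "'a rsg \<Rightarrow> 'b rsg \<Rightarrow> ('a \<Rightarrow> 'b) \<Rightarrow> bool" where
  "drs_morphism S T f \<longleftrightarrow> f \<in> carrier S \<rightarrow>\<^sub>E carrier T \<and>
    (\<forall>a\<in>carrier S. \<forall>b\<in>carrier S. f (rs_mult S a b) = rs_mult T (f a) (f b)) \<and>
    (\<forall>a\<in>carrier S. f (rs_dom S a) = rs_dom T (f a) \<and> f (rs_cod S a) = rs_cod T (f a)) \<and>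
    f \<bottom>\<^bsub>projection_order S\<^esub> = \<bottom>\<^bsub>projection_order T\<^esub> \<and>
    (\<forall>e\<in>rs_proj S. \<forall>e'\<in>rs_proj S.
        f (e \<squnion>\<^bsub>projection_order S\<^esub> e') = f e \<squnion>\<^bsub>projection_order T\<^esub> f e' \<and>
        f (e \<sqinter>\<^bsub>projection_order S\<^esub> e') = f e \<sqinter>\<^bsub>projection_order T\<^esub> f e') \<and>
    (\<forall>a\<in>rs_proj T. \<exists>b\<in>rs_proj S. a \<sqsubseteq>\<^bsub>projection_order T\<^esub> f b)"

definition proper_morphism :: "'a rsg \<Rightarrow> 'b rsg \<Rightarrow> ('a \<Rightarrow> 'b) \<Rightarrow> bool" where
  "proper_morphism S T f \<longleftrightarrow>
    (\<forall>t\<in>carrier T. \<exists>n\<ge>1. \<exists>(ts :: nat \<Rightarrow> 'b) (ss :: nat \<Rightarrow> 'a).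
        (\<forall>i\<in>{1..n}. ts i \<in> carrier T \<and> ss i \<in> carrier S \<and> ts i \<sqsubseteq>\<^bsub>natural_order T\<^esub> f (ss i)) \<and>
        is_lub (natural_order T) t (ts ` {1..n}))"

definition weakly_meet_preserving :: "'a rsg \<Rightarrow> 'b rsg \<Rightarrow> ('a \<Rightarrow> 'b) \<Rightarrow> bool" where
  "weakly_meet_preserving S T f \<longleftrightarrow>
    (\<forall>t\<in>carrier T. \<forall>a\<in>carrier S. \<forall>b\<in>carrier S.
        t \<sqsubseteq>\<^bsub>natural_order T\<^esub> f a \<and> t \<sqsubseteq>\<^bsub>natural_order T\<^esub> f b \<longrightarrow>
        (\<exists>c\<in>carrier S. c \<sqsubseteq>\<^bsub>natural_order S\<^esub> a \<and> c \<sqsubseteq>\<^bsub>natural_order S\<^esub> b \<and> t \<sqsubseteq>\<^bsub>natural_order T\<^esub> f c))"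

definition drs_morphism_of_type :: "nat \<Rightarrow> 'a rsg \<Rightarrow> 'b rsg \<Rightarrow> ('a \<Rightarrow> 'b) \<Rightarrow> bool" where
  "drs_morphism_of_type k S T f \<longleftrightarrow> drs_morphism S T f \<and>
    (k \<in> {2, 4} \<longrightarrow> proper_morphism S T f) \<and>
    (k \<in> {3, 4} \<longrightarrow> weakly_meet_preserving S T f)"

definition DRS :: "version \<Rightarrow> nat \<Rightarrow> ('a rsg, 'a \<Rightarrow> 'a) cat" where
  "DRS v k =
    \<lparr> Ob = {S. drs_object v S},
      Hom = (\<lambda>S T. {f. drs_morphism_of_type k S T f}),
      Idn = (\<lambda>S. restrict id (carrier S)),
      Cmp = (\<lambda>S T U g f. compose (carrier S) g f) \<rparr>"


section \<open>Etale topological categories\<close>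

text \<open>The operations are total HOL functions; only their values on the object space, the arrow
  space and the composable pairs matter.  Objects and arrows live in one HOL type but are not
  related otherwise.\<close>

record 'c tcat =
  tc_arr :: "'c topology"
  tc_obj :: "'c topology"
  tc_unit :: "'c \<Rightarrow> 'c"
  tc_dom :: "'c \<Rightarrow> 'c"
  tc_cod :: "'c \<Rightarrow> 'c"
  tc_comp :: "'c \<Rightarrow> 'c \<Rightarrow> 'c"

abbreviation arrows :: "'c tcat \<Rightarrow> 'c set" where
  "arrows C \<equiv> topspace (tc_arr C)"

abbreviation objects :: "'c tcat \<Rightarrow> 'c set" where
  "objects C \<equiv> topspace (tc_obj C)"

definition composable :: "'c tcat \<Rightarrow> ('c \<times> 'c) set" where
  "composable C = {(a, b). a \<in> arrows C \<and> b \<in> arrows C \<and> tc_dom C a = tc_cod C b}"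

definition composable_space :: "'c tcat \<Rightarrow> ('c \<times> 'c) topology" where
  "composable_space C = subtopology (prod_topology (tc_arr C) (tc_arr C)) (composable C)"

definition topological_category :: "'c tcat \<Rightarrow> bool" where
  "topological_category C \<longleftrightarrow>
    continuous_map (tc_obj C) (tc_arr C) (tc_unit C) \<and>
    continuous_map (tc_arr C) (tc_obj C) (tc_dom C) \<and>
    continuous_map (tc_arr C) (tc_obj C) (tc_cod C) \<and>
    continuous_map (composable_space C) (tc_arr C) (\<lambda>(a, b). tc_comp C a b) \<and>
    (\<forall>p\<in>objects C. tc_dom C (tc_unit C p) = p \<and> tc_cod C (tc_unit C p) = p) \<and>
    (\<forall>(a, b)\<in>composable C.
        tc_dom C (tc_comp C a b) = tc_dom C b \<and> tc_cod C (tc_comp C a b) = tc_cod C a) \<and>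
    (\<forall>a\<in>arrows C. tc_comp C a (tc_unit C (tc_dom C a)) = a \<and>
        tc_comp C (tc_unit C (tc_cod C a)) a = a) \<and>
    (\<forall>a b c. (a, b) \<in> composable C \<and> (b, c) \<in> composable C \<longrightarrow>
        tc_comp C (tc_comp C a b) c = tc_comp C a (tc_comp C b c))"

definition local_homeomorphism :: "'a topology \<Rightarrow> 'b topology \<Rightarrow> ('a \<Rightarrow> 'b) \<Rightarrow> bool" where
  "local_homeomorphism X Y f \<longleftrightarrow> continuous_map X Y f \<and>
    (\<forall>x\<in>topspace X. \<exists>U. openin X U \<and> x \<in> U \<and> openin Y (f ` U) \<and>
        homeomorphic_map (subtopology X U) (subtopology Y (f ` U)) f)"

definition etale_category :: "'c tcat \<Rightarrow> bool" where
  "etale_category C \<longleftrightarrow> topological_category C \<and>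
    local_homeomorphism (tc_arr C) (tc_obj C) (tc_dom C) \<and>
    local_homeomorphism (tc_arr C) (tc_obj C) (tc_cod C) \<and>
    open_map (tc_obj C) (tc_arr C) (tc_unit C) \<and>
    open_map (composable_space C) (tc_arr C) (\<lambda>(a, b). tc_comp C a b)"

definition compact_open :: "'a topology \<Rightarrow> 'a set \<Rightarrow> bool" where
  "compact_open X U \<longleftrightarrow> openin X U \<and> compactin X U"

definition irreducible_closed :: "'a topology \<Rightarrow> 'a set \<Rightarrow> bool" where
  "irreducible_closed X Z \<longleftrightarrow> closedin X Z \<and> Z \<noteq> {} \<and>
    (\<forall>A B. closedin X A \<and> closedin X B \<and> Z = A \<union> B \<longrightarrow> Z = A \<or> Z = B)"

definition sober_space :: "'a topology \<Rightarrow> bool" where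
  "sober_space X \<longleftrightarrow>
    (\<forall>Z. irreducible_closed X Z \<longrightarrow> (\<exists>!x. x \<in> topspace X \<and> Z = X closure_of {x}))"

definition spectral_space :: "'a topology \<Rightarrow> bool" where
  "spectral_space X \<longleftrightarrow> sober_space X \<and>
    (\<exists>\<B>. (\<forall>B\<in>\<B>. compact_open X B) \<and>
        openin X = arbitrary union_of (\<lambda>B. B \<in> \<B>) \<and>
        (\<forall>\<F>. finite \<F> \<and> \<F> \<noteq> {} \<and> \<F> \<subseteq> \<B> \<longrightarrow> \<Inter>\<F> \<in> \<B>))"

definition spectral_category :: "'c tcat \<Rightarrow> bool" where
  "spectral_category C \<longleftrightarrow> etale_category C \<and> spectral_space (tc_obj C)"

definition strongly_spectral_category :: "'c tcat \<Rightarrow> bool" where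
  "strongly_spectral_category C \<longleftrightarrow> etale_category C \<and> spectral_space (tc_arr C)"

fun etc_object :: "version \<Rightarrow> 'c tcat \<Rightarrow> bool" where
  "etc_object Plain C \<longleftrightarrow> spectral_category C"
| "etc_object Meets C \<longleftrightarrow> strongly_spectral_category C"
| "etc_object Unital C \<longleftrightarrow> spectral_category C \<and> compact_space (tc_obj C)"
| "etc_object Meets_Unital C \<longleftrightarrow> strongly_spectral_category C \<and> compact_space (tc_obj C)"

text \<open>A relational covering morphism is the pair \<open>(f\<^sub>1, f\<^sub>0)\<close>; both components are extensional
  functions, on the arrows and on the objects.\<close>

type_synonym ('c, 'd) rel_map = "('c \<Rightarrow> 'd set) \<times> ('c \<Rightarrow> 'd)"

definition relational_covering_morphism :: "'c tcat \<Rightarrow> 'd tcat \<Rightarrow> ('c, 'd) rel_map \<Rightarrow> bool" where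
  "relational_covering_morphism C D f \<longleftrightarrow> (case f of (f1, f0) \<Rightarrow>
    f1 \<in> arrows C \<rightarrow>\<^sub>E Pow (arrows D) \<and>
    f0 \<in> objects C \<rightarrow>\<^sub>E objects D \<and>
    continuous_map (tc_obj C) (tc_obj D) f0 \<and>
    \<comment> \<open>(RM1)\<close>
    (\<forall>a\<in>arrows C. \<forall>b\<in>f1 a. tc_dom D b = f0 (tc_dom C a) \<and> tc_cod D b = f0 (tc_cod C a)) \<and>
    \<comment> \<open>(RM2)\<close>
    (\<forall>(a, b)\<in>composable C. \<forall>(s, t)\<in>composable D.
        s \<in> f1 a \<and> t \<in> f1 b \<longrightarrow> tc_comp D s t \<in> f1 (tc_comp C a b)) \<and>
    \<comment> \<open>(RM3)\<close>
    (\<forall>a\<in>arrows C. \<forall>b\<in>arrows C. (tc_dom C a = tc_dom C b \<or> tc_cod C a = tc_cod C b) \<and>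
        f1 a \<inter> f1 b \<noteq> {} \<longrightarrow> a = b) \<and>
    \<comment> \<open>(RM4)\<close>
    (\<forall>q\<in>objects C. \<forall>s\<in>arrows D.
        (tc_dom D s = f0 q \<longrightarrow> (\<exists>t\<in>arrows C. tc_dom C t = q \<and> s \<in> f1 t)) \<and>
        (tc_cod D s = f0 q \<longrightarrow> (\<exists>t\<in>arrows C. tc_cod C t = q \<and> s \<in> f1 t))) \<and>
    \<comment> \<open>(RM5)\<close>
    (\<forall>A. openin (tc_arr D) A \<longrightarrow> openin (tc_arr C) {x\<in>arrows C. f1 x \<inter> A \<noteq> {}}) \<and>
    \<comment> \<open>(RM6)\<close>
    (\<forall>t\<in>objects C. tc_unit D (f0 t) \<in> f1 (tc_unit C t)))"

definition coherent :: "'c tcat \<Rightarrow> 'd tcat \<Rightarrow> ('c, 'd) rel_map \<Rightarrow> bool" where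
  "coherent C D f \<longleftrightarrow>
    (\<forall>U. compact_open (tc_obj D) U \<longrightarrow> compact_open (tc_obj C) {p\<in>objects C. snd f p \<in> U})"

definition etc_morphism_of_type :: "nat \<Rightarrow> 'c tcat \<Rightarrow> 'd tcat \<Rightarrow> ('c, 'd) rel_map \<Rightarrow> bool" where
  "etc_morphism_of_type k C D f \<longleftrightarrow> relational_covering_morphism C D f \<and> coherent C D f \<and>
    (k \<in> {2, 4} \<longrightarrow> (\<forall>c\<in>arrows C. fst f c \<noteq> {})) \<and>
    (k \<in> {3, 4} \<longrightarrow> (\<forall>c\<in>arrows C. \<forall>x\<in>fst f c. \<forall>y\<in>fst f c. x = y))"

definition ETC :: "version \<Rightarrow> nat \<Rightarrow> ('c tcat, ('c, 'c) rel_map) cat" where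
  "ETC v k =
    \<lparr> Ob = {C. etc_object v C},
      Hom = (\<lambda>C D. {f. etc_morphism_of_type k C D f}),
      Idn = (\<lambda>C. (\<lambda>a\<in>arrows C. {a}, \<lambda>p\<in>objects C. p)),
      Cmp = (\<lambda>C D B g f.
        (\<lambda>a\<in>arrows C. \<Union>b\<in>fst f a. fst g b, \<lambda>p\<in>objects C. snd g (snd f p))) \<rparr>"


section \<open>The two functors\<close>

text \<open>
  A HOL type of carriers plays the role of a universe.  Prime filters of a semigroup over \<open>'a\<close>
  and local bisections of a category over \<open>'c\<close> are sets, of types \<open>'a set\<close> and \<open>'c set\<close>; a
  round trip therefore ends in the same category over the larger type.  This is why the functors
  of the duality are given as polymorphic constants, and why the identity functor has to be
  composed with the inclusion of universes \<open>x \<mapsto> {{x}}\<close>.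
\<close>

subsection \<open>From semigroups to categories: prime filters\<close>

text \<open>A pair with a join in the natural order of a restriction semigroup is compatible, so
  primeness may refer to all existing binary joins; a filter omits the bottom element exactly if it
  is a proper subset.\<close>

definition prime_filters :: "'a gorder \<Rightarrow> 'a set set" where
  "prime_filters L = {A. A \<subseteq> carrier L \<and> A \<noteq> {} \<and> A \<noteq> carrier L \<and>
    (\<forall>a\<in>A. \<forall>b\<in>carrier L. a \<sqsubseteq>\<^bsub>L\<^esub> b \<longrightarrow> b \<in> A) \<and>
    (\<forall>a\<in>A. \<forall>b\<in>A. \<exists>c\<in>A. c \<sqsubseteq>\<^bsub>L\<^esub> a \<and> c \<sqsubseteq>\<^bsub>L\<^esub> b) \<and>
    (\<forall>a\<in>carrier L. \<forall>b\<in>carrier L. \<forall>c\<in>A. is_lub L c {a, b} \<longrightarrow> a \<in> A \<or> b \<in> A)}"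

definition prime_spectrum :: "'a gorder \<Rightarrow> 'a set topology" where
  "prime_spectrum L = topology_generated_by ((\<lambda>a. {A\<in>prime_filters L. a \<in> A}) ` carrier L)"

definition up_closure :: "'a gorder \<Rightarrow> 'a set \<Rightarrow> 'a set" where
  "up_closure L X = {b\<in>carrier L. \<exists>a\<in>X. a \<sqsubseteq>\<^bsub>L\<^esub> b}"

definition spec_ob :: "'a rsg \<Rightarrow> 'a set tcat" where
  "spec_ob S =
    \<lparr> tc_arr = prime_spectrum (natural_order S),
      tc_obj = prime_spectrum (projection_order S),
      tc_unit = (\<lambda>F. up_closure (natural_order S) F),
      tc_dom = (\<lambda>A. up_closure (projection_order S) (rs_dom S ` A)),
      tc_cod = (\<lambda>A. up_closure (projection_order S) (rs_cod S ` A)),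
      tc_comp = (\<lambda>A B. up_closure (natural_order S) {rs_mult S a b | a b. a \<in> A \<and> b \<in> B}) \<rparr>"

text \<open>The inverse image of a prime filter under a morphism is in general not down-directed; it
  is a union of prime filters, and these are the values of the relation.\<close>

definition spec_ar :: "'a rsg \<Rightarrow> 'b rsg \<Rightarrow> ('a \<Rightarrow> 'b) \<Rightarrow> ('b set, 'a set) rel_map" where
  "spec_ar S T f =
    (let f0 = (\<lambda>F. {e\<in>rs_proj S. f e \<in> F}) in
      (\<lambda>A\<in>arrows (spec_ob T). {B\<in>arrows (spec_ob S). f ` B \<subseteq> A \<and>
          tc_dom (spec_ob S) B = f0 (tc_dom (spec_ob T) A) \<and>
          tc_cod (spec_ob S) B = f0 (tc_cod (spec_ob T) A)},
       \<lambda>F\<in>objects (spec_ob T). f0 F))"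

definition Spec :: "('a rsg, 'a \<Rightarrow> 'a, 'a set tcat, ('a set, 'a set) rel_map) fctr" where
  "Spec = \<lparr> on_ob = spec_ob, on_ar = spec_ar \<rparr>"

subsection \<open>From categories to semigroups: compact-open local bisections\<close>

definition compact_open_bisections :: "'c tcat \<Rightarrow> 'c set set" where
  "compact_open_bisections C =
    {B. compact_open (tc_arr C) B \<and> inj_on (tc_dom C) B \<and> inj_on (tc_cod C) B}"

definition bis_ob :: "'c tcat \<Rightarrow> 'c set rsg" where
  "bis_ob C =
    \<lparr> carrier = compact_open_bisections C,
      rs_mult = (\<lambda>A B. {tc_comp C a b | a b. a \<in> A \<and> b \<in> B \<and> tc_dom C a = tc_cod C b}),
      rs_proj = {tc_unit C ` U | U. compact_open (tc_obj C) U},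
      rs_dom = (\<lambda>B. tc_unit C ` tc_dom C ` B),
      rs_cod = (\<lambda>B. tc_unit C ` tc_cod C ` B) \<rparr>"

definition bis_ar :: "'c tcat \<Rightarrow> 'd tcat \<Rightarrow> ('c, 'd) rel_map \<Rightarrow> 'd set \<Rightarrow> 'c set" where
  "bis_ar C D f = (\<lambda>B\<in>compact_open_bisections D. {x\<in>arrows C. fst f x \<inter> B \<noteq> {}})"

definition Bis :: "('c tcat, ('c, 'c) rel_map, 'c set rsg, 'c set \<Rightarrow> 'c set) fctr" where
  "Bis = \<lparr> on_ob = bis_ob, on_ar = bis_ar \<rparr>"

subsection \<open>The inclusions of universes\<close>

definition tag :: "'a \<Rightarrow> 'a set set" where
  "tag x = {{x}}"

definition untag :: "'a set set \<Rightarrow> 'a" where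
  "untag X = the_elem (the_elem X)"

definition lift_topology :: "'a topology \<Rightarrow> 'a set set topology" where
  "lift_topology X = pullback_topology (tag ` topspace X) untag X"

definition DRS_lift ::
    "('a rsg, 'a \<Rightarrow> 'a, 'a set set rsg, 'a set set \<Rightarrow> 'a set set) fctr" where
  "DRS_lift =
    \<lparr> on_ob = (\<lambda>S.
        \<lparr> carrier = tag ` carrier S,
          rs_mult = (\<lambda>X Y. tag (rs_mult S (untag X) (untag Y))),
          rs_proj = tag ` rs_proj S,
          rs_dom = (\<lambda>X. tag (rs_dom S (untag X))),
          rs_cod = (\<lambda>X. tag (rs_cod S (untag X))) \<rparr>),
      on_ar = (\<lambda>S T f. \<lambda>X\<in>tag ` carrier S. tag (f (untag X))) \<rparr>"

definition ETC_lift ::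
    "('c tcat, ('c, 'c) rel_map, 'c set set tcat, ('c set set, 'c set set) rel_map) fctr" where
  "ETC_lift =
    \<lparr> on_ob = (\<lambda>C.
        \<lparr> tc_arr = lift_topology (tc_arr C),
          tc_obj = lift_topology (tc_obj C),
          tc_unit = (\<lambda>X. tag (tc_unit C (untag X))),
          tc_dom = (\<lambda>X. tag (tc_dom C (untag X))),
          tc_cod = (\<lambda>X. tag (tc_cod C (untag X))),
          tc_comp = (\<lambda>X Y. tag (tc_comp C (untag X) (untag Y))) \<rparr>),
      on_ar = (\<lambda>C D f.
        (\<lambda>X\<in>tag ` arrows C. tag ` fst f (untag X),
         \<lambda>X\<in>tag ` objects C. tag (snd f (untag X)))) \<rparr>"

end

theory Submission
  imports Defs
begin

text \<open>
  The duality is Stone duality between distributive lattices and spectral spaces, transported along the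
  domain map.  Let \<open>S\<close> be a distributive restriction semigroup with projections \<open>E\<close>.  A prime filter \<open>A\<close> of \<open>S\<close>
  is recovered from any one element \<open>a \<in> A\<close> and the prime filter \<open>F = \<lambda>(A)\<^sup>\<up>\<close> of \<open>E\<close> as \<open>A = (a F)\<^sup>\<up>\<close>, and every
  prime filter \<open>F\<close> containing \<open>\<lambda>(a)\<close> arises in this way (\<open>prime_filter_eq_translate\<close>, \<open>translate_prime\<close>).
  Hence the domain map is injective on the set \<open>X\<^sub>a\<close> of prime filters containing \<open>a\<close> and maps it onto the
  basic set of \<open>\<lambda>(a)\<close> in the spectral space of prime filters of \<open>E\<close>.  This makes the prime spectrum an
  etale category, with the \<open>X\<^sub>a\<close> as compact open bisections and \<open>X\<^sub>a X\<^sub>b = X\<^sub>a\<^sub>b\<close> (\<open>etale_category_spec\<close>,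
  \<open>set_comp_basic\<close>).  Statements about codomains are the statements about domains for the opposite
  semigroup.

  Every compact open bisection of the spectrum is a finite union of sets \<open>X\<^sub>a\<close>.  Injectivity of the domain
  and codomain maps on it makes the elements \<open>a\<close> compatible, so it is the set \<open>X\<^sub>c\<close> of their join \<open>c\<close>, and
  prime filters separate elements; this is the isomorphism of \<open>S\<close> with the bisections of its spectrum
  (\<open>basic_iso\<close>).  Conversely, the compact open bisections of a spectral etale category form a distributive
  restriction semigroup ordered by inclusion (\<open>drs_bis\<close>) and a basis of the arrow space.  Points of a
  spectral space are the prime filters of its compact open sets (\<open>spectral_space_prime_filter_point\<close>), and a
  prime filter of bisections is determined by one of its members and its domain, so the points of the
  spectrum are exactly the arrows (\<open>pt_iso\<close>).  Binary meets in \<open>S\<close> correspond to intersections of compact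
  open sets of arrows, and an identity to compactness of the object space.

  For a morphism \<open>f : S \<rightarrow> T\<close> the inverse image of a prime filter of \<open>T\<close> is a union of prime filters with one
  prescribed domain, which are the values of the dual relation.  The covering properties again express that
  a prime filter is determined by a single element and its domain.  Properness says that the values are
  nonempty (\<open>spec_ar_nonempty\<close>, \<open>proper_morphism_if_nonempty\<close>), weak preservation of meets that they have at
  most one element (\<open>spec_ar_single_valued\<close>).  In the other direction the inverse image of a bisection
  under a coherent relational covering morphism is a compact open bisection by uniqueness and existence of
  lifts (\<open>pre_cob\<close>, \<open>drs_morphism_bis\<close>).

  The inclusions of universes are isomorphisms of structures over different types, so fullness and
  faithfulness come from conjugating with them.
\<close>

section \<open>Restriction semigroups and their natural order\<close>

lemma order_simps [simp]:
  "carrier (natural_order S) = carrier S" "carrier (projection_order S) = rs_proj S"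
  "le (projection_order S) = le (natural_order S)"
  "eq (natural_order S) = (=)" "eq (projection_order S) = (=)"
  by (simp_all add: natural_order_def projection_order_def)

lemma le_natural_order:
  "a \<sqsubseteq>\<^bsub>natural_order S\<^esub> b \<longleftrightarrow>
    (\<exists>g\<in>rs_proj S. \<exists>f\<in>rs_proj S. a = rs_mult S g b \<and> a = rs_mult S b f)"
  by (simp add: natural_order_def)

lemma is_lub_pair_iff:
  assumes "a \<in> carrier L" "b \<in> carrier L"
  shows "is_lub L c {a, b} \<longleftrightarrow>
    c \<in> carrier L \<and> a \<sqsubseteq>\<^bsub>L\<^esub> c \<and> b \<sqsubseteq>\<^bsub>L\<^esub> c \<and>
    (\<forall>d\<in>carrier L. a \<sqsubseteq>\<^bsub>L\<^esub> d \<longrightarrow> b \<sqsubseteq>\<^bsub>L\<^esub> d \<longrightarrow> c \<sqsubseteq>\<^bsub>L\<^esub> d)"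
  using assms by (auto simp: least_def Upper_def)

lemma is_glb_pair_iff:
  assumes "a \<in> carrier L" "b \<in> carrier L"
  shows "is_glb L c {a, b} \<longleftrightarrow>
    c \<in> carrier L \<and> c \<sqsubseteq>\<^bsub>L\<^esub> a \<and> c \<sqsubseteq>\<^bsub>L\<^esub> b \<and>
    (\<forall>d\<in>carrier L. d \<sqsubseteq>\<^bsub>L\<^esub> a \<longrightarrow> d \<sqsubseteq>\<^bsub>L\<^esub> b \<longrightarrow> d \<sqsubseteq>\<^bsub>L\<^esub> c)"
  using assms by (auto simp: greatest_def Lower_def)

locale restriction_sg =
  fixes S :: "'a rsg"
  assumes restriction: "restriction_semigroup S"
begin

abbreviation mul (infixl "\<cdot>" 70) where "a \<cdot> b \<equiv> rs_mult S a b"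
abbreviation dm where "dm \<equiv> rs_dom S"
abbreviation cd where "cd \<equiv> rs_cod S"
abbreviation M where "M \<equiv> carrier S"
abbreviation E where "E \<equiv> rs_proj S"
abbreviation leq (infix "\<preceq>" 50) where "a \<preceq> b \<equiv> a \<sqsubseteq>\<^bsub>natural_order S\<^esub> b"

lemma ehresmann: "ehresmann_semigroup S"
  using restriction by (simp add: restriction_semigroup_def)

lemma mul_closed [simp]: "a \<in> M \<Longrightarrow> b \<in> M \<Longrightarrow> a \<cdot> b \<in> M"
  and mul_assoc: "a \<in> M \<Longrightarrow> b \<in> M \<Longrightarrow> c \<in> M \<Longrightarrow> a \<cdot> b \<cdot> c = a \<cdot> (b \<cdot> c)"
  and E_M [simp]: "e \<in> E \<Longrightarrow> e \<in> M"
  and E_nonempty: "E \<noteq> {}"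
  and E_idem [simp]: "e \<in> E \<Longrightarrow> e \<cdot> e = e"
  and E_mul [simp]: "e \<in> E \<Longrightarrow> f \<in> E \<Longrightarrow> e \<cdot> f \<in> E"
  and E_comm: "e \<in> E \<Longrightarrow> f \<in> E \<Longrightarrow> e \<cdot> f = f \<cdot> e"
  and dm_E [simp]: "a \<in> M \<Longrightarrow> dm a \<in> E"
  and cd_E [simp]: "a \<in> M \<Longrightarrow> cd a \<in> E"
  and dm_proj [simp]: "e \<in> E \<Longrightarrow> dm e = e"
  and cd_proj [simp]: "e \<in> E \<Longrightarrow> cd e = e"
  and mul_dm [simp]: "a \<in> M \<Longrightarrow> a \<cdot> dm a = a"
  and cd_mul [simp]: "a \<in> M \<Longrightarrow> cd a \<cdot> a = a"
  and dm_dm_mul: "a \<in> M \<Longrightarrow> b \<in> M \<Longrightarrow> dm (dm a \<cdot> b) = dm (a \<cdot> b)"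
  and cd_mul_cd: "a \<in> M \<Longrightarrow> b \<in> M \<Longrightarrow> cd (a \<cdot> cd b) = cd (a \<cdot> b)"
  using ehresmann by (auto simp: ehresmann_semigroup_def)

lemma proj_mul: "a \<in> M \<Longrightarrow> f \<in> E \<Longrightarrow> f \<cdot> a = a \<cdot> dm (f \<cdot> a)"
  and mul_proj: "a \<in> M \<Longrightarrow> f \<in> E \<Longrightarrow> a \<cdot> f = cd (a \<cdot> f) \<cdot> a"
  using restriction by (auto simp: restriction_semigroup_def)

lemma dm_mul_proj [simp]: "a \<in> M \<Longrightarrow> f \<in> E \<Longrightarrow> dm (a \<cdot> f) = dm a \<cdot> f"
  by (metis E_mul dm_E dm_dm_mul dm_proj E_M)

lemma cd_proj_mul [simp]: "a \<in> M \<Longrightarrow> f \<in> E \<Longrightarrow> cd (f \<cdot> a) = f \<cdot> cd a"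
  by (metis E_mul cd_E cd_mul_cd cd_proj E_M)

text \<open>If \<open>a = b f\<close> then \<open>\<lambda>(a) = \<lambda>(b) f\<close>, so \<open>f\<close> can be replaced by \<open>\<lambda>(a)\<close>; the restriction axiom then
  supplies the projection on the left.  Elements below a common bound are thus determined by their
  domains.\<close>

lemma le_iff_mul_dm: "b \<in> M \<Longrightarrow> a \<preceq> b \<longleftrightarrow> a \<in> M \<and> a = b \<cdot> dm a"
proof (safe)
  assume b: "b \<in> M" and le: "a \<preceq> b"
  obtain g f where gf: "g \<in> E" "f \<in> E" "a = g \<cdot> b" "a = b \<cdot> f"
    using le by (auto simp: le_natural_order)
  then show "a \<in> M" using b by simp
  show "a = b \<cdot> dm a"
    using gf b by (metis E_M dm_E dm_mul_proj mul_assoc mul_dm)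
next
  assume b: "b \<in> M" and a: "a \<in> M" "a = b \<cdot> dm a"
  then have "a = cd a \<cdot> b" by (metis dm_E mul_proj)
  then show "a \<preceq> b" unfolding le_natural_order using a b cd_E dm_E by blast
qed

end

text \<open>The opposite of a restriction semigroup reverses products and exchanges \<open>\<lambda>\<close> and \<open>\<rho>\<close> but
  has the same order and the same prime filters, so every statement about \<open>\<lambda>\<close> has a mirror
  image about \<open>\<rho>\<close>.\<close>

definition op_rsg :: "'a rsg \<Rightarrow> 'a rsg" where
  "op_rsg S = \<lparr> carrier = carrier S, rs_mult = (\<lambda>a b. rs_mult S b a), rs_proj = rs_proj S,
    rs_dom = rs_cod S, rs_cod = rs_dom S \<rparr>"

lemma op_rsg_simps [simp]:
  "carrier (op_rsg S) = carrier S" "rs_mult (op_rsg S) a b = rs_mult S b a"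
  "rs_proj (op_rsg S) = rs_proj S" "rs_dom (op_rsg S) = rs_cod S" "rs_cod (op_rsg S) = rs_dom S"
  by (simp_all add: op_rsg_def)

lemma natural_order_op [simp]: "natural_order (op_rsg S) = natural_order S"
  by (auto simp: natural_order_def fun_eq_iff)

lemma projection_order_op [simp]: "projection_order (op_rsg S) = projection_order S"
  by (simp add: projection_order_def)

lemma restriction_semigroup_op:
  assumes "restriction_semigroup S" shows "restriction_semigroup (op_rsg S)"
proof -
  interpret restriction_sg S by unfold_locales (rule assms)
  have "ehresmann_semigroup (op_rsg S)"
    unfolding ehresmann_semigroup_def op_rsg_simps
    using E_nonempty mul_assoc dm_dm_mul cd_mul_cd E_comm by (simp add: subset_iff)
  then show ?thesis
    unfolding restriction_semigroup_def op_rsg_simps using proj_mul mul_proj by blast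
qed

context restriction_sg
begin

lemma restriction_sg_op: "restriction_sg (op_rsg S)"
  by unfold_locales (rule restriction_semigroup_op[OF restriction])

lemma le_iff_cd_mul: "b \<in> M \<Longrightarrow> a \<preceq> b \<longleftrightarrow> a \<in> M \<and> a = cd a \<cdot> b"
  using restriction_sg.le_iff_mul_dm[OF restriction_sg_op, of b a] by simp

lemma le_M: "a \<preceq> b \<Longrightarrow> b \<in> M \<Longrightarrow> a \<in> M"
  by (simp add: le_iff_mul_dm)

lemma le_refl [simp]: "a \<in> M \<Longrightarrow> a \<preceq> a"
  by (simp add: le_iff_mul_dm)

lemma le_mul_proj [simp]: "a \<in> M \<Longrightarrow> f \<in> E \<Longrightarrow> a \<cdot> f \<preceq> a"
  unfolding le_natural_order by (metis cd_E mul_proj E_M mul_closed)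

lemma le_proj_mul [simp]: "a \<in> M \<Longrightarrow> f \<in> E \<Longrightarrow> f \<cdot> a \<preceq> a"
  using restriction_sg.le_mul_proj[OF restriction_sg_op, of a f] by simp

lemma le_proj_iff: "e \<in> E \<Longrightarrow> f \<in> E \<Longrightarrow> e \<preceq> f \<longleftrightarrow> e = f \<cdot> e"
  by (simp add: le_iff_mul_dm)

lemma le_antisym: assumes "a \<preceq> b" "b \<preceq> a" "b \<in> M" shows "a = b"
proof -
  have a: "a \<in> M" "a = b \<cdot> dm a" using assms(1,3) by (simp_all add: le_iff_mul_dm)
  have b: "b = a \<cdot> dm b" using assms(2) a(1) by (simp add: le_iff_mul_dm)
  have "dm a = dm b \<cdot> dm a" using arg_cong[OF a(2), of dm] a(1) assms(3) by simp
  moreover have "dm b = dm a \<cdot> dm b" using arg_cong[OF b, of dm] a(1) assms(3) by simp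
  ultimately have "dm a = dm b" using E_comm a(1) assms(3) by simp
  then show ?thesis using a(2) mul_dm[OF assms(3)] by simp
qed

text \<open>The middle factor of \<open>(b \<lambda>(a)) (d \<lambda>(c))\<close> moves to the right of \<open>d\<close> by the restriction axiom.\<close>

lemma mul_mono:
  assumes "a \<preceq> b" "c \<preceq> d" "b \<in> M" "d \<in> M" shows "a \<cdot> c \<preceq> b \<cdot> d"
proof -
  have a: "a \<in> M" "a = b \<cdot> dm a" and c: "c \<in> M" "c = d \<cdot> dm c"
    using assms by (simp_all add: le_iff_mul_dm)
  have "a \<cdot> c = (b \<cdot> dm a) \<cdot> (d \<cdot> dm c)" by (rule arg_cong2[OF a(2) c(2)])
  also have "\<dots> = b \<cdot> (dm a \<cdot> d) \<cdot> dm c" using assms a(1) c(1) by (simp add: mul_assoc)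
  also have "\<dots> = b \<cdot> (d \<cdot> dm (dm a \<cdot> d)) \<cdot> dm c"
    using assms a(1) by (simp flip: proj_mul)
  also have "\<dots> = (b \<cdot> d) \<cdot> (dm (dm a \<cdot> d) \<cdot> dm c)" using assms a(1) c(1) by (simp add: mul_assoc)
  finally show ?thesis using assms a(1) c(1) by simp
qed

lemma le_trans: assumes "a \<preceq> b" "b \<preceq> c" "c \<in> M" shows "a \<preceq> c"
proof -
  have b: "b \<in> M" "b = c \<cdot> dm b" and a: "a \<in> M" "a = b \<cdot> dm a"
    using assms le_M[OF assms(2,3)] by (simp_all add: le_iff_mul_dm)
  then have "a = c \<cdot> (dm b \<cdot> dm a)" using assms(3) by (metis E_M dm_E mul_assoc)
  then show ?thesis using assms a b by (metis E_mul dm_E le_mul_proj)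
qed

lemma dm_mono: "a \<preceq> b \<Longrightarrow> b \<in> M \<Longrightarrow> dm a \<preceq> dm b"
  by (metis dm_E dm_mul_proj le_iff_mul_dm le_mul_proj E_M)

lemma cd_mono: "a \<preceq> b \<Longrightarrow> b \<in> M \<Longrightarrow> cd a \<preceq> cd b"
  using restriction_sg.dm_mono[OF restriction_sg_op, of a b] by simp

lemma proj_le_mulI: "e \<in> E \<Longrightarrow> f \<in> E \<Longrightarrow> g \<in> E \<Longrightarrow> e \<preceq> f \<Longrightarrow> e \<preceq> g \<Longrightarrow> e \<preceq> f \<cdot> g"
  by (metis E_M E_idem mul_mono)

lemma dm_mul_le: "a \<in> M \<Longrightarrow> b \<in> M \<Longrightarrow> dm (a \<cdot> b) \<preceq> dm b"
  by (metis E_M dm_E dm_dm_mul dm_mono le_proj_mul)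

lemma below_compatible:
  assumes "a \<preceq> c" "b \<preceq> c" "c \<in> M" shows "compatible S a b"
proof -
  have a: "a \<in> M" "a = c \<cdot> dm a" "a = cd a \<cdot> c" and b: "b \<in> M" "b = c \<cdot> dm b" "b = cd b \<cdot> c"
    using assms le_iff_mul_dm le_iff_cd_mul by blast+
  have "a \<cdot> dm b = b \<cdot> dm a" using a b assms(3) by (metis E_M E_comm dm_E mul_assoc)
  moreover have "cd b \<cdot> a = cd a \<cdot> b" using a b assms(3) by (metis E_M E_comm cd_E mul_assoc)
  ultimately show ?thesis by (simp add: compatible_def)
qed

lemma projection_meet:
  assumes "e \<in> E" "f \<in> E" shows "e \<sqinter>\<^bsub>projection_order S\<^esub> f = e \<cdot> f"
proof -
  have *: "is_glb (projection_order S) x {e, f} \<longleftrightarrow> x = e \<cdot> f" for x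
  proof
    assume x: "is_glb (projection_order S) x {e, f}"
    then have "x \<in> E" "x \<preceq> e" "x \<preceq> f" "e \<cdot> f \<preceq> x"
      using assms by (auto simp: is_glb_pair_iff)
    then show "x = e \<cdot> f" using assms by (intro le_antisym proj_le_mulI) auto
  qed (use assms in \<open>auto simp: is_glb_pair_iff intro: proj_le_mulI\<close>)
  show ?thesis unfolding meet_def inf_def * by simp
qed

end

text \<open>The lattice and its distributivity are packed into one condition on joins, which also makes
  sense in the absence of a top element: multiplying with a projection and joining commute.\<close>

lemma distributive_restriction_semigroupI:
  assumes restriction: "restriction_semigroup S"
    and zero: "z \<in> rs_proj S" "\<And>a. a \<in> carrier S \<Longrightarrow> rs_mult S a z = z \<and> rs_mult S z a = z"
    and joins: "\<And>e f. e \<in> rs_proj S \<Longrightarrow> f \<in> rs_proj S \<Longrightarrow> \<exists>j\<in>rs_proj S.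
      e \<sqsubseteq>\<^bsub>natural_order S\<^esub> j \<and> f \<sqsubseteq>\<^bsub>natural_order S\<^esub> j \<and>
      (\<forall>g\<in>rs_proj S. \<forall>h\<in>rs_proj S. rs_mult S g e \<sqsubseteq>\<^bsub>natural_order S\<^esub> h \<longrightarrow>
        rs_mult S g f \<sqsubseteq>\<^bsub>natural_order S\<^esub> h \<longrightarrow> rs_mult S g j \<sqsubseteq>\<^bsub>natural_order S\<^esub> h)"
    and compatible_joins: "\<And>a b. a \<in> carrier S \<Longrightarrow> b \<in> carrier S \<Longrightarrow> compatible S a b \<Longrightarrow>
      \<exists>c. is_lub (natural_order S) c {a, b}"
  shows "distributive_restriction_semigroup S"
proof -
  interpret restriction_sg S by unfold_locales (rule restriction)
  let ?P = "projection_order S"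
  have le_trans': "a \<preceq> c" if "a \<in> E" "b \<in> E" "c \<in> E" "a \<preceq> b" "b \<preceq> c" for a b c
    using that le_trans E_M by blast
  have lub: "\<exists>j. is_lub ?P j {e, f} \<and> (\<forall>g\<in>E. \<forall>h\<in>E. g \<cdot> e \<preceq> h \<longrightarrow> g \<cdot> f \<preceq> h \<longrightarrow> g \<cdot> j \<preceq> h)"
    if ef: "e \<in> E" "f \<in> E" for e f
  proof -
    obtain j where j: "j \<in> E" "e \<preceq> j" "f \<preceq> j"
      "\<And>g h. g \<in> E \<Longrightarrow> h \<in> E \<Longrightarrow> g \<cdot> e \<preceq> h \<Longrightarrow> g \<cdot> f \<preceq> h \<Longrightarrow> g \<cdot> j \<preceq> h"
      using joins[OF ef] by blast
    \<comment> \<open>For \<open>g = j\<close> the condition says that \<open>j\<close> is a least upper bound.\<close>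
    have "j \<preceq> h" if "h \<in> E" "e \<preceq> h" "f \<preceq> h" for h
      using j(4)[of j h] j(1-3) that ef by (simp add: le_proj_iff E_comm)
    then have "is_lub ?P j {e, f}" using j ef by (auto simp: is_lub_pair_iff)
    then show ?thesis using j by blast
  qed
  have glb: "is_glb ?P (e \<cdot> f) {e, f}" if "e \<in> E" "f \<in> E" for e f
    using that by (auto simp: is_glb_pair_iff intro: proj_le_mulI)
  interpret P: lattice ?P
  proof unfold_locales
    fix x y assume "x \<in> carrier ?P" "y \<in> carrier ?P"
    then show "\<exists>s. is_lub ?P s {x, y}" "\<exists>s. is_glb ?P s {x, y}"
      using lub[of x y] glb[of x y] by (simp_all, blast+)
  qed (auto intro: le_antisym le_trans')
  have join: "is_lub ?P (e \<squnion>\<^bsub>?P\<^esub> f) {e, f}" if "e \<in> E" "f \<in> E" for e f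
    using that lub[OF that] unfolding join_def sup_def by (metis (mono_tags) someI_ex)
  have distr: "g \<cdot> (e \<squnion>\<^bsub>?P\<^esub> f) \<preceq> h"
    if efgh: "e \<in> E" "f \<in> E" "g \<in> E" "h \<in> E" "g \<cdot> e \<preceq> h" "g \<cdot> f \<preceq> h" for e f g h
  proof -
    obtain j where j: "is_lub ?P j {e, f}" "g \<cdot> j \<preceq> h" using lub[OF efgh(1,2)] efgh(3-) by blast
    then have "j = e \<squnion>\<^bsub>?P\<^esub> f" using join[of e f] efgh P.least_unique by blast
    then show ?thesis using j by simp
  qed
  have "distributive_lattice ?P"
    unfolding distributive_lattice_def
  proof (intro conjI ballI)
    fix x y w assume xyw: "x \<in> carrier ?P" "y \<in> carrier ?P" "w \<in> carrier ?P"
    have j: "y \<squnion>\<^bsub>?P\<^esub> w \<in> E" "(x \<cdot> y) \<squnion>\<^bsub>?P\<^esub> (x \<cdot> w) \<in> E"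
      using join[of y w] join[of "x \<cdot> y" "x \<cdot> w"] xyw by (auto simp: least_def)
    have u: "x \<cdot> y \<preceq> (x \<cdot> y) \<squnion>\<^bsub>?P\<^esub> (x \<cdot> w)" "x \<cdot> w \<preceq> (x \<cdot> y) \<squnion>\<^bsub>?P\<^esub> (x \<cdot> w)"
      "y \<preceq> y \<squnion>\<^bsub>?P\<^esub> w" "w \<preceq> y \<squnion>\<^bsub>?P\<^esub> w"
      using join[of y w] join[of "x \<cdot> y" "x \<cdot> w"] xyw by (auto simp: is_lub_pair_iff)
    have "x \<cdot> (y \<squnion>\<^bsub>?P\<^esub> w) \<preceq> (x \<cdot> y) \<squnion>\<^bsub>?P\<^esub> (x \<cdot> w)"
      using distr[of y w x] u xyw j by auto
    moreover have "(x \<cdot> y) \<squnion>\<^bsub>?P\<^esub> (x \<cdot> w) \<preceq> x \<cdot> (y \<squnion>\<^bsub>?P\<^esub> w)"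
      using join[of "x \<cdot> y" "x \<cdot> w"] xyw j u by (auto simp: is_lub_pair_iff mul_mono)
    ultimately show "x \<sqinter>\<^bsub>?P\<^esub> (y \<squnion>\<^bsub>?P\<^esub> w) = (x \<sqinter>\<^bsub>?P\<^esub> y) \<squnion>\<^bsub>?P\<^esub> (x \<sqinter>\<^bsub>?P\<^esub> w)"
      using xyw j by (simp add: projection_meet le_antisym)
  qed (rule P.lattice_axioms)
  moreover have zle: "z \<preceq> a" if "a \<in> M" for a
    using that zero by (simp add: le_iff_mul_dm)
  moreover have "least ?P z E" "least (natural_order S) z M"
    using zero(1) by (auto simp: least_def zle)
  ultimately show ?thesis
    using assms unfolding distributive_restriction_semigroup_def by blast
qed

section \<open>Joins in distributive restriction semigroups\<close>

locale drs = restriction_sg S for S :: "'a rsg" +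
  assumes distributive: "distributive_restriction_semigroup S"

lemma drsI: "distributive_restriction_semigroup S \<Longrightarrow> drs S"
  by unfold_locales (simp_all add: distributive_restriction_semigroup_def)

lemma drs_op:
  assumes "distributive_restriction_semigroup S" shows "drs (op_rsg S)"
proof (rule drsI)
  interpret drs S by (rule drsI[OF assms])
  have "compatible (op_rsg S) a b \<longleftrightarrow> compatible S a b" for a b
    by (auto simp: compatible_def)
  then show "distributive_restriction_semigroup (op_rsg S)"
    using assms restriction_semigroup_op[OF restriction]
    unfolding distributive_restriction_semigroup_def by (simp add: conj_commute)
qed

context drs
begin

abbreviation zr where "zr \<equiv> \<bottom>\<^bsub>projection_order S\<^esub>"
abbreviation jn (infixl "\<squnion>" 65) where "e \<squnion> f \<equiv> e \<squnion>\<^bsub>projection_order S\<^esub> f"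

lemma lattice_projections: "lattice (projection_order S)"
  using distributive
  by (simp add: distributive_restriction_semigroup_def distributive_lattice_def)

lemma zr_E [simp]: "zr \<in> E"
  and zr_mul [simp]: "a \<in> M \<Longrightarrow> zr \<cdot> a = zr" and mul_zr [simp]: "a \<in> M \<Longrightarrow> a \<cdot> zr = zr"
proof -
  interpret L: lattice "projection_order S" by (rule lattice_projections)
  obtain z where z: "least (projection_order S) z E" "\<And>a. a \<in> M \<Longrightarrow> a \<cdot> z = z \<and> z \<cdot> a = z"
    using distributive by (auto simp: distributive_restriction_semigroup_def)
  have "zr = z" unfolding bottom_def using z(1) L.least_unique
    by (metis order_simps(2) someI)
  then show "zr \<in> E" "a \<in> M \<Longrightarrow> zr \<cdot> a = zr" "a \<in> M \<Longrightarrow> a \<cdot> zr = zr"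
    using z by (auto simp: least_def)
qed

lemma zr_le [simp]: "a \<in> M \<Longrightarrow> zr \<preceq> a"
  by (simp add: le_iff_mul_dm)

lemma join_lub:
  assumes "e \<in> E" "f \<in> E" shows "is_lub (projection_order S) (e \<squnion> f) {e, f}"
proof -
  interpret L: lattice "projection_order S" by (rule lattice_projections)
  have "\<exists>s. is_lub (projection_order S) s {e, f}"
    using L.sup_of_two_exists[of e f] assms by simp
  then show ?thesis unfolding join_def sup_def by (rule someI_ex)
qed

lemma join_E [simp]: "e \<in> E \<Longrightarrow> f \<in> E \<Longrightarrow> e \<squnion> f \<in> E"
  and le_join1 [simp]: "e \<in> E \<Longrightarrow> f \<in> E \<Longrightarrow> e \<preceq> e \<squnion> f"
  and le_join2 [simp]: "e \<in> E \<Longrightarrow> f \<in> E \<Longrightarrow> f \<preceq> e \<squnion> f"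
  and join_le: "e \<in> E \<Longrightarrow> f \<in> E \<Longrightarrow> g \<in> E \<Longrightarrow> e \<preceq> g \<Longrightarrow> f \<preceq> g \<Longrightarrow> e \<squnion> f \<preceq> g"
  using join_lub[of e f] by (auto simp: is_lub_pair_iff)

lemma join_unique: "e \<in> E \<Longrightarrow> f \<in> E \<Longrightarrow> is_lub (projection_order S) g {e, f} \<Longrightarrow> g = e \<squnion> f"
  by (auto simp: is_lub_pair_iff intro!: le_antisym join_le)

lemma mul_join:
  assumes "e \<in> E" "f \<in> E" "g \<in> E" shows "g \<cdot> (e \<squnion> f) = g \<cdot> e \<squnion> g \<cdot> f"
  using distributive assms join_E[of e f]
  unfolding distributive_restriction_semigroup_def distributive_lattice_def
  by (auto simp: projection_meet)

lemma compatible_lub: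
  "a \<in> M \<Longrightarrow> b \<in> M \<Longrightarrow> compatible S a b \<Longrightarrow> \<exists>c. is_lub (natural_order S) c {a, b}"
  using distributive by (simp add: distributive_restriction_semigroup_def)

text \<open>For \<open>c = a \<or> b\<close> the restriction of \<open>c\<close> to \<open>\<lambda>(a) \<or> \<lambda>(b)\<close> is an upper bound of \<open>a\<close>
  and \<open>b\<close>, hence all of \<open>c\<close>.\<close>

lemma dm_lub:
  assumes "is_lub (natural_order S) c {a, b}" "a \<in> M" "b \<in> M"
  shows "dm c = dm a \<squnion> dm b"
proof -
  have c: "c \<in> M" "a \<preceq> c" "b \<preceq> c" and least: "\<And>d. d \<in> M \<Longrightarrow> a \<preceq> d \<Longrightarrow> b \<preceq> d \<Longrightarrow> c \<preceq> d"
    using assms by (auto simp: is_lub_pair_iff)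
  let ?j = "dm a \<squnion> dm b"
  have j: "?j \<in> E" using assms by simp
  have upper: "x \<preceq> c \<cdot> ?j" if "x \<preceq> c" "dm x \<preceq> ?j" "x \<in> M" for x
  proof -
    have "x = c \<cdot> dm x" using that c by (simp add: le_iff_mul_dm)
    then show ?thesis using mul_mono[OF le_refl[OF c(1)] that(2)] c j by simp
  qed
  have "c \<preceq> c \<cdot> ?j" using least[of "c \<cdot> ?j"] upper[of a] upper[of b] c assms j by simp
  then have "dm c \<preceq> dm c \<cdot> ?j" using dm_mono c j by fastforce
  moreover have "dm c \<cdot> ?j \<preceq> ?j" using c j by simp
  ultimately have "dm c \<preceq> ?j" using le_trans[of "dm c" "dm c \<cdot> ?j" ?j] j by simp
  moreover have "?j \<preceq> dm c" using c assms by (intro join_le dm_mono) auto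
  ultimately show ?thesis using j le_antisym[of "dm c" ?j] by simp
qed

text \<open>The elements \<open>a e\<close> and \<open>a f\<close> are compatible because both lie below \<open>a (e \<or> f)\<close>.  Their join lies below
  \<open>a (e \<or> f)\<close> too and, by distributivity, has the same domain, so it equals \<open>a (e \<or> f)\<close>.\<close>

lemma lub_mul_proj:
  assumes "a \<in> M" "e \<in> E" "f \<in> E"
  shows "is_lub (natural_order S) (a \<cdot> (e \<squnion> f)) {a \<cdot> e, a \<cdot> f}"
proof -
  have j: "a \<cdot> (e \<squnion> f) \<in> M" "a \<cdot> e \<in> M" "a \<cdot> f \<in> M" using assms by auto
  have up: "a \<cdot> e \<preceq> a \<cdot> (e \<squnion> f)" "a \<cdot> f \<preceq> a \<cdot> (e \<squnion> f)"
    using assms by (auto intro!: mul_mono)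
  obtain c where lub: "is_lub (natural_order S) c {a \<cdot> e, a \<cdot> f}"
    using compatible_lub[OF j(2,3)] below_compatible[OF up j(1)] by blast
  then have c: "c \<in> M" "c \<preceq> a \<cdot> (e \<squnion> f)" using j up by (auto simp: is_lub_pair_iff)
  have "dm c = dm a \<cdot> (e \<squnion> f)" using dm_lub[OF lub] assms j by (simp add: mul_join)
  then have "dm c = dm (a \<cdot> (e \<squnion> f))" using assms by simp
  then have "c = a \<cdot> (e \<squnion> f)"
    using c(2) j(1) le_iff_mul_dm[of "a \<cdot> (e \<squnion> f)" c] mul_dm[OF j(1)] by simp
  then show ?thesis using lub by simp
qed

end

section \<open>Prime filters\<close>

text \<open>The prime filter theorem for distributive lattices: a filter that is maximal among those
  that contain \<open>e\<close> and miss the ideal \<open>I\<close> is prime.\<close>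

lemma prime_filter_avoiding_ideal:
  fixes L (structure)
  assumes L: "distributive_lattice L" and e: "e \<in> carrier L" "e \<notin> I"
    and I: "I \<subseteq> carrier L" "I \<noteq> {}" "\<And>x y. x \<in> I \<Longrightarrow> y \<in> carrier L \<Longrightarrow> y \<sqsubseteq> x \<Longrightarrow> y \<in> I"
      "\<And>x y. x \<in> I \<Longrightarrow> y \<in> I \<Longrightarrow> x \<squnion> y \<in> I"
  shows "\<exists>F\<in>prime_filters L. e \<in> F \<and> F \<inter> I = {}"
proof -
  interpret lattice L using L by (simp add: distributive_lattice_def)
  have distr: "x \<sqinter> (y \<squnion> z) = (x \<sqinter> y) \<squnion> (x \<sqinter> z)"
    if "x \<in> carrier L" "y \<in> carrier L" "z \<in> carrier L" for x y z
    using L that by (simp add: distributive_lattice_def)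
  have mono: "x \<sqinter> a \<sqsubseteq> y \<sqinter> a"
    if "x \<sqsubseteq> y" "x \<in> carrier L" "y \<in> carrier L" "a \<in> carrier L" for x y a
    using that le_trans[of "x \<sqinter> a" x y] meet_left[of x a] meet_right[of x a]
    by (intro meet_le) auto
  define filt where "filt F \<longleftrightarrow> F \<subseteq> carrier L \<and>
    (\<forall>x\<in>F. \<forall>y\<in>carrier L. x \<sqsubseteq> y \<longrightarrow> y \<in> F) \<and> (\<forall>x\<in>F. \<forall>y\<in>F. x \<sqinter> y \<in> F)" for F
  define \<F> where "\<F> = {F. filt F \<and> e \<in> F \<and> F \<inter> I = {}}"
  have principal: "{y\<in>carrier L. e \<sqsubseteq> y} \<in> \<F>"
    using e I(3) by (auto simp: \<F>_def filt_def meet_le intro: le_trans)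
  have "\<exists>F\<in>\<F>. \<forall>X\<in>\<F>. F \<subseteq> X \<longrightarrow> X = F"
  proof (rule subset_Zorn_nonempty)
    fix \<C> assume ne: "\<C> \<noteq> {}" and chain: "subset.chain \<F> \<C>"
    have sub: "\<C> \<subseteq> \<F>" and lin: "\<And>A B. A \<in> \<C> \<Longrightarrow> B \<in> \<C> \<Longrightarrow> A \<subseteq> B \<or> B \<subseteq> A"
      using chain by (auto simp: subset.chain_def)
    have "x \<sqinter> y \<in> \<Union>\<C>" if xy: "x \<in> \<Union>\<C>" "y \<in> \<Union>\<C>" for x y
    proof -
      obtain A B where AB: "A \<in> \<C>" "x \<in> A" "B \<in> \<C>" "y \<in> B" using xy by blast
      then obtain D where "D \<in> \<C>" "x \<in> D" "y \<in> D" using lin by blast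
      moreover have "filt D" using \<open>D \<in> \<C>\<close> sub by (auto simp: \<F>_def)
      ultimately show ?thesis unfolding filt_def by blast
    qed
    moreover have mem: "filt A" "e \<in> A" "A \<inter> I = {}" if "A \<in> \<C>" for A
      using that sub by (auto simp: \<F>_def)
    moreover have "y \<in> \<Union>\<C>" if xy: "x \<in> \<Union>\<C>" "y \<in> carrier L" "x \<sqsubseteq> y" for x y
    proof -
      obtain A where "A \<in> \<C>" "x \<in> A" using xy by blast
      then have "y \<in> A" using mem(1)[of A] xy by (simp add: filt_def)
      then show ?thesis using \<open>A \<in> \<C>\<close> by blast
    qed
    moreover have "A \<subseteq> carrier L" if "A \<in> \<C>" for A using mem(1)[OF that] by (simp add: filt_def)
    ultimately have "filt (\<Union>\<C>)" by (simp add: filt_def Sup_le_iff)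
    moreover have "e \<in> \<Union>\<C>" using ne mem(2) by blast
    moreover have "\<Union>\<C> \<inter> I = {}" using mem(3) by blast
    ultimately show "\<Union>\<C> \<in> \<F>" by (simp add: \<F>_def)
  qed (use principal in blast)
  then obtain F where F: "F \<in> \<F>" and max: "\<And>X. X \<in> \<F> \<Longrightarrow> F \<subseteq> X \<Longrightarrow> X = F" by blast
  have FL: "F \<subseteq> carrier L" and up: "\<And>x y. x \<in> F \<Longrightarrow> y \<in> carrier L \<Longrightarrow> x \<sqsubseteq> y \<Longrightarrow> y \<in> F"
    and meet: "\<And>x y. x \<in> F \<Longrightarrow> y \<in> F \<Longrightarrow> x \<sqinter> y \<in> F" and eF: "e \<in> F" and FI: "F \<inter> I = {}"
    using F by (auto simp: \<F>_def filt_def)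
  have hit: "\<exists>x\<in>F. x \<sqinter> a \<in> I" if a: "a \<in> carrier L" "a \<notin> F" for a
  proof (rule ccontr)
    assume no: "\<not> ?thesis"
    define G where "G = {y\<in>carrier L. \<exists>x\<in>F. x \<sqinter> a \<sqsubseteq> y}"
    have "y \<sqinter> y' \<in> G" if y: "y \<in> G" "y' \<in> G" for y y'
    proof -
      obtain x x' where x: "x \<in> F" "x \<sqinter> a \<sqsubseteq> y" "x' \<in> F" "x' \<sqinter> a \<sqsubseteq> y'"
        using y by (auto simp: G_def)
      let ?m = "(x \<sqinter> x') \<sqinter> a"
      have c: "x \<in> carrier L" "x' \<in> carrier L" "y \<in> carrier L" "y' \<in> carrier L"
        using x y FL by (auto simp: G_def)
      have "?m \<sqsubseteq> x \<sqinter> a" "?m \<sqsubseteq> x' \<sqinter> a"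
        using mono[of "x \<sqinter> x'" x a] mono[of "x \<sqinter> x'" x' a] meet_left[of x x'] meet_right[of x x'] c a
        by auto
      then have "?m \<sqsubseteq> y" "?m \<sqsubseteq> y'"
        using le_trans[of ?m "x \<sqinter> a" y] le_trans[of ?m "x' \<sqinter> a" y'] x c a by auto
      then show ?thesis using c a x meet by (auto simp: G_def intro!: meet_le)
    qed
    moreover have "y \<in> G" if xy: "x \<in> G" "y \<in> carrier L" "x \<sqsubseteq> y" for x y
    proof -
      obtain w where w: "w \<in> F" "w \<sqinter> a \<sqsubseteq> x" "x \<in> carrier L" using xy by (auto simp: G_def)
      then have "w \<sqinter> a \<in> carrier L" using FL a by auto
      then have "w \<sqinter> a \<sqsubseteq> y" using le_trans w(2,3) xy(2,3) by blast
      then show ?thesis using w(1) xy(2) by (auto simp: G_def)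
    qed
    moreover have FG: "F \<subseteq> G"
    proof
      fix x assume "x \<in> F"
      then show "x \<in> G" using FL a meet_left[of x a] unfolding G_def by blast
    qed
    moreover have "G \<inter> I = {}"
    proof -
      have "x \<notin> I" if x: "x \<in> G" for x
      proof
        assume "x \<in> I"
        moreover obtain w where w: "w \<in> F" "w \<sqinter> a \<sqsubseteq> x" using x by (auto simp: G_def)
        moreover have "w \<sqinter> a \<in> carrier L" using w FL a by auto
        ultimately have "w \<sqinter> a \<in> I" using I(3) by blast
        then show False using no w(1) by blast
      qed
      then show ?thesis by blast
    qed
    moreover have "G \<subseteq> carrier L" by (auto simp: G_def)
    ultimately have "filt G" "e \<in> G" "G \<inter> I = {}" using eF unfolding filt_def by (simp, blast+)
    then have "G \<in> \<F>" by (simp add: \<F>_def)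
    then have "G = F" using max FG by blast
    moreover have "a \<in> G" using eF a e by (auto simp: G_def intro: meet_right)
    ultimately show False using a by simp
  qed
  have prime: "a \<in> F \<or> b \<in> F" if ab: "a \<in> carrier L" "b \<in> carrier L" "c \<in> F" "is_lub L c {a, b}" for a b c
  proof (rule ccontr)
    assume "\<not> ?thesis"
    then obtain x y where xy: "x \<in> F" "x \<sqinter> a \<in> I" "y \<in> F" "y \<sqinter> b \<in> I" using hit ab by blast
    let ?m = "x \<sqinter> y"
    have m: "?m \<in> F" "?m \<in> carrier L" "x \<in> carrier L" "y \<in> carrier L" using xy meet FL by auto
    have "?m \<sqinter> a \<sqsubseteq> x \<sqinter> a" "?m \<sqinter> b \<sqsubseteq> y \<sqinter> b"
      using mono[of ?m x a] mono[of ?m y b] meet_left[of x y] meet_right[of x y] m ab by auto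
    moreover have "?m \<sqinter> a \<in> carrier L" "?m \<sqinter> b \<in> carrier L" using m ab by auto
    ultimately have "?m \<sqinter> a \<in> I" "?m \<sqinter> b \<in> I" using xy(2,4) I(3) by blast+
    then have "?m \<sqinter> (a \<squnion> b) \<in> I" using I(4) m ab by (simp add: distr)
    moreover have "c = a \<squnion> b"
    proof -
      have "is_lub L (a \<squnion> b) {a, b}"
        using sup_of_two_exists[OF ab(1,2)] unfolding join_def sup_def by (rule someI_ex)
      then show ?thesis using ab(4) least_unique by blast
    qed
    ultimately show False using meet[OF m(1) ab(3)] FI by auto
  qed
  have "\<exists>z\<in>F. z \<sqsubseteq> x \<and> z \<sqsubseteq> y" if "x \<in> F" "y \<in> F" for x y
    using meet[OF that] meet_left[of x y] meet_right[of x y] that FL by blast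
  moreover have "F \<noteq> carrier L" using FI I(1,2) by blast
  ultimately have "F \<in> prime_filters L"
    using FL eF up prime unfolding prime_filters_def by blast
  then show ?thesis using eF FI by blast
qed

definition basic :: "'a gorder \<Rightarrow> 'a \<Rightarrow> 'a set set" where
  "basic L a = {A\<in>prime_filters L. a \<in> A}"

lemma mem_basic [simp]: "A \<in> basic L a \<longleftrightarrow> A \<in> prime_filters L \<and> a \<in> A"
  by (simp add: basic_def)

lemma prime_filterD:
  assumes "A \<in> prime_filters L"
  shows "A \<subseteq> carrier L" "A \<noteq> {}" "A \<noteq> carrier L"
    "\<And>a b. a \<in> A \<Longrightarrow> b \<in> carrier L \<Longrightarrow> a \<sqsubseteq>\<^bsub>L\<^esub> b \<Longrightarrow> b \<in> A"
    "\<And>a b. a \<in> A \<Longrightarrow> b \<in> A \<Longrightarrow> \<exists>c\<in>A. c \<sqsubseteq>\<^bsub>L\<^esub> a \<and> c \<sqsubseteq>\<^bsub>L\<^esub> b"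
    "\<And>a b c. a \<in> carrier L \<Longrightarrow> b \<in> carrier L \<Longrightarrow> c \<in> A \<Longrightarrow> is_lub L c {a, b} \<Longrightarrow> a \<in> A \<or> b \<in> A"
  using assms unfolding prime_filters_def by blast+

lemma spec_ob_simps [simp]:
  "tc_arr (spec_ob S) = prime_spectrum (natural_order S)"
  "tc_obj (spec_ob S) = prime_spectrum (projection_order S)"
  "tc_unit (spec_ob S) F = up_closure (natural_order S) F"
  by (simp_all add: spec_ob_def)

lemma spec_ob_op:
  "tc_dom (spec_ob (op_rsg S)) = tc_cod (spec_ob S)"
  "tc_cod (spec_ob (op_rsg S)) = tc_dom (spec_ob S)"
  "tc_comp (spec_ob (op_rsg S)) A B = tc_comp (spec_ob S) B A"
  by (auto simp: spec_ob_def intro!: arg_cong[of _ _ "up_closure (natural_order S)"])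

text \<open>The filter \<open>(a F)\<^sup>\<up>\<close>.  Every prime filter \<open>A\<close> of the semigroup has this form for each of
  its elements \<open>a\<close>, with \<open>F\<close> its domain.\<close>

definition translate :: "'a rsg \<Rightarrow> 'a \<Rightarrow> 'a set \<Rightarrow> 'a set" where
  "translate S a F = up_closure (natural_order S) (rs_mult S a ` F)"

context drs
begin

text \<open>The last letters \<open>S\<close> and \<open>E\<close> refer to the whole semigroup and to its projections: prime filters, basic sets
  and prime spectra come in both versions.\<close>

abbreviation PS where "PS \<equiv> prime_filters (natural_order S)"
abbreviation PE where "PE \<equiv> prime_filters (projection_order S)"
abbreviation Dm where "Dm \<equiv> tc_dom (spec_ob S)"
abbreviation Cd where "Cd \<equiv> tc_cod (spec_ob S)"
abbreviation un where "un \<equiv> tc_unit (spec_ob S)"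
abbreviation cmp where "cmp \<equiv> tc_comp (spec_ob S)"
abbreviation BS where "BS \<equiv> basic (natural_order S)"
abbreviation BE where "BE \<equiv> basic (projection_order S)"
abbreviation XS where "XS \<equiv> prime_spectrum (natural_order S)"
abbreviation XE where "XE \<equiv> prime_spectrum (projection_order S)"

lemma op: "drs (op_rsg S)" by (rule drs_op[OF distributive])

lemma mem_Dm: "e \<in> Dm A \<longleftrightarrow> e \<in> E \<and> (\<exists>a\<in>A. dm a \<preceq> e)"
  and mem_Cd: "e \<in> Cd A \<longleftrightarrow> e \<in> E \<and> (\<exists>a\<in>A. cd a \<preceq> e)"
  by (auto simp: spec_ob_def up_closure_def)

lemma mem_translate: "x \<in> translate S a F \<longleftrightarrow> x \<in> M \<and> (\<exists>f\<in>F. a \<cdot> f \<preceq> x)"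
  by (auto simp: translate_def up_closure_def)

lemma mem_comp: "x \<in> cmp A B \<longleftrightarrow> x \<in> M \<and> (\<exists>a\<in>A. \<exists>b\<in>B. a \<cdot> b \<preceq> x)"
  by (auto simp: spec_ob_def up_closure_def)

lemma PS_M: "A \<in> PS \<Longrightarrow> a \<in> A \<Longrightarrow> a \<in> M"
  and PE_E: "F \<in> PE \<Longrightarrow> e \<in> F \<Longrightarrow> e \<in> E"
  and PS_up: "A \<in> PS \<Longrightarrow> a \<in> A \<Longrightarrow> b \<in> M \<Longrightarrow> a \<preceq> b \<Longrightarrow> b \<in> A"
  and PE_up: "F \<in> PE \<Longrightarrow> e \<in> F \<Longrightarrow> f \<in> E \<Longrightarrow> e \<preceq> f \<Longrightarrow> f \<in> F"
  and PS_ex: "A \<in> PS \<Longrightarrow> \<exists>a. a \<in> A" and PE_ex: "F \<in> PE \<Longrightarrow> \<exists>e. e \<in> F"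
  using prime_filterD(1,2,4) by fastforce+

lemma PS_dir: assumes "A \<in> PS" "a \<in> A" "b \<in> A"
  obtains c where "c \<in> A" "c \<preceq> a" "c \<preceq> b"
  using prime_filterD(5)[OF assms] by auto

lemma PE_mul: assumes "F \<in> PE" "e \<in> F" "f \<in> F" shows "e \<cdot> f \<in> F"
proof -
  obtain g where "g \<in> F" "g \<preceq> e" "g \<preceq> f" using prime_filterD(5)[OF assms] by auto
  then show ?thesis using PE_up[OF assms(1), of g] PE_E[OF assms(1)] assms
    by (simp add: proj_le_mulI)
qed

lemma PE_mulD: assumes "F \<in> PE" "e \<cdot> f \<in> F" "e \<in> E" "f \<in> E" shows "e \<in> F" "f \<in> F"
  using PE_up[OF assms(1,2)] assms by auto

lemma zr_PS: assumes "A \<in> PS" shows "zr \<notin> A"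
proof
  assume "zr \<in> A"
  then have "M \<subseteq> A" using PS_up[OF assms] zr_le by blast
  then show False using prime_filterD(1,3)[OF assms] by auto
qed

lemma zr_PE: assumes "F \<in> PE" shows "zr \<notin> F"
proof
  assume "zr \<in> F"
  then have "E \<subseteq> F" using PE_up[OF assms] zr_le E_M by blast
  then show False using prime_filterD(1,3)[OF assms] by auto
qed

lemma PE_join: "F \<in> PE \<Longrightarrow> e \<squnion> f \<in> F \<Longrightarrow> e \<in> E \<Longrightarrow> f \<in> E \<Longrightarrow> e \<in> F \<or> f \<in> F"
  using prime_filterD(6)[of F "projection_order S" e f] join_lub by fastforce

lemma PS_I:
  assumes "A \<subseteq> M" "a \<in> A" "zr \<notin> A" "\<And>a b. a \<in> A \<Longrightarrow> b \<in> M \<Longrightarrow> a \<preceq> b \<Longrightarrow> b \<in> A"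
    "\<And>a b. a \<in> A \<Longrightarrow> b \<in> A \<Longrightarrow> \<exists>c\<in>A. c \<preceq> a \<and> c \<preceq> b"
    "\<And>a b c. a \<in> M \<Longrightarrow> b \<in> M \<Longrightarrow> c \<in> A \<Longrightarrow> is_lub (natural_order S) c {a, b} \<Longrightarrow> a \<in> A \<or> b \<in> A"
  shows "A \<in> PS"
proof -
  have "A \<noteq> M" using assms(3) E_M[OF zr_E] by blast
  then show ?thesis using assms unfolding prime_filters_def order_simps by blast
qed

lemma PE_I:
  assumes "F \<subseteq> E" "e \<in> F" "zr \<notin> F" "\<And>e f. e \<in> F \<Longrightarrow> f \<in> E \<Longrightarrow> e \<preceq> f \<Longrightarrow> f \<in> F"
    "\<And>e f. e \<in> F \<Longrightarrow> f \<in> F \<Longrightarrow> e \<cdot> f \<in> F"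
    "\<And>e f. e \<in> E \<Longrightarrow> f \<in> E \<Longrightarrow> e \<squnion> f \<in> F \<Longrightarrow> e \<in> F \<or> f \<in> F"
  shows "F \<in> PE"
proof -
  have "F \<noteq> E" using assms(3) zr_E by blast
  moreover have "\<exists>c\<in>F. c \<preceq> a \<and> c \<preceq> b" if "a \<in> F" "b \<in> F" for a b
    using assms(5)[OF that] assms(1) that by (meson E_M le_mul_proj le_proj_mul subsetD)
  moreover have "a \<in> F \<or> b \<in> F"
    if "a \<in> E" "b \<in> E" "c \<in> F" "is_lub (projection_order S) c {a, b}" for a b c
    using assms(6)[of a b] join_unique[of a b c] that by simp
  ultimately show ?thesis
    using assms(1,2,4) unfolding prime_filters_def order_simps by blast
qed

lemma Dm_I: "A \<in> PS \<Longrightarrow> a \<in> A \<Longrightarrow> dm a \<in> Dm A"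
  and Cd_I: "A \<in> PS \<Longrightarrow> a \<in> A \<Longrightarrow> cd a \<in> Cd A"
  unfolding mem_Dm mem_Cd using PS_M[of A a] by (auto intro!: bexI[of _ a])

text \<open>A witness \<open>b\<close> for \<open>f\<close> being in the domain of \<open>A\<close> need not be comparable with \<open>a\<close>, but a common lower
  bound \<open>c\<close> of the two is, and then \<open>c = a \<lambda>(c) \<le> a f\<close>.\<close>

lemma mul_Dm: assumes "A \<in> PS" "a \<in> A" "f \<in> Dm A" shows "a \<cdot> f \<in> A"
proof -
  obtain b where b: "b \<in> A" "dm b \<preceq> f" and f: "f \<in> E" using assms by (auto simp: mem_Dm)
  obtain c where c: "c \<in> A" "c \<preceq> a" "c \<preceq> b" using PS_dir assms b by blast
  have M: "a \<in> M" "b \<in> M" "c \<in> M" using assms b c PS_M by auto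
  have "dm c \<preceq> f" using le_trans[OF dm_mono[OF c(3)] b(2)] M f by simp
  moreover have "c = a \<cdot> dm c" using c M by (simp add: le_iff_mul_dm)
  ultimately have "c \<preceq> a \<cdot> f" using mul_mono[of a a "dm c" f] M f by simp
  then show ?thesis using PS_up[OF assms(1) c(1)] M f by simp
qed

lemma Cd_mul: "A \<in> PS \<Longrightarrow> a \<in> A \<Longrightarrow> f \<in> Cd A \<Longrightarrow> f \<cdot> a \<in> A"
  using drs.mul_Dm[OF op] by (simp add: spec_ob_op)

lemma mul_mem_Dm: "A \<in> PS \<Longrightarrow> a \<cdot> f \<in> A \<Longrightarrow> a \<in> M \<Longrightarrow> f \<in> E \<Longrightarrow> f \<in> Dm A"
  by (auto simp: mem_Dm intro!: bexI[of _ "a \<cdot> f"])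

lemma mul_mem_Cd: "A \<in> PS \<Longrightarrow> f \<cdot> a \<in> A \<Longrightarrow> a \<in> M \<Longrightarrow> f \<in> E \<Longrightarrow> f \<in> Cd A"
  by (auto simp: mem_Cd intro!: bexI[of _ "f \<cdot> a"])

lemma prime_filter_eq_translate:
  assumes "A \<in> PS" "a \<in> A" shows "A = translate S a (Dm A)"
proof (intro Set.set_eqI iffI)
  fix b assume b: "b \<in> A"
  obtain c where c: "c \<in> A" "c \<preceq> a" "c \<preceq> b" using PS_dir assms b by blast
  then have "a \<cdot> dm c \<preceq> b" using assms PS_M le_iff_mul_dm by metis
  then show "b \<in> translate S a (Dm A)" using assms b c PS_M Dm_I by (auto simp: mem_translate)
next
  fix b assume "b \<in> translate S a (Dm A)"
  then show "b \<in> A" using mul_Dm[OF assms] PS_up[OF assms(1)] by (auto simp: mem_translate)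
qed

lemma prime_filter_eqI_dm:
  "A \<in> PS \<Longrightarrow> B \<in> PS \<Longrightarrow> a \<in> A \<Longrightarrow> a \<in> B \<Longrightarrow> Dm A = Dm B \<Longrightarrow> A = B"
  using prime_filter_eq_translate by metis

lemma prime_filter_eqI_cd:
  "A \<in> PS \<Longrightarrow> B \<in> PS \<Longrightarrow> a \<in> A \<Longrightarrow> a \<in> B \<Longrightarrow> Cd A = Cd B \<Longrightarrow> A = B"
  using drs.prime_filter_eqI_dm[OF op] by (simp add: spec_ob_op)

text \<open>Membership of a projection \<open>e\<close> in the domain of \<open>A\<close> means \<open>a e \<in> A\<close> for a fixed \<open>a \<in> A\<close>.  As
  multiplication by \<open>a\<close> preserves joins of projections, primeness passes from \<open>A\<close> to its domain.\<close>

lemma Dm_prime: assumes A: "A \<in> PS" shows "Dm A \<in> PE"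
proof -
  obtain a where a: "a \<in> A" using PS_ex A by blast
  show ?thesis
  proof (rule PE_I)
    show "dm a \<in> Dm A" using A a by (rule Dm_I)
    show "zr \<notin> Dm A"
    proof
      assume "zr \<in> Dm A"
      then have "a \<cdot> zr \<in> A" using mul_Dm A a by blast
      then show False using zr_PS A a PS_M by auto
    qed
    show "f \<in> Dm A" if "e \<in> Dm A" "f \<in> E" "e \<preceq> f" for e f
      using that le_trans by (fastforce simp: mem_Dm)
    show "e \<cdot> f \<in> Dm A" if ef: "e \<in> Dm A" "f \<in> Dm A" for e f
    proof -
      have "a \<cdot> e \<cdot> f \<in> A" using mul_Dm A a ef by blast
      moreover have "e \<in> E" "f \<in> E" using ef by (auto simp: mem_Dm)
      ultimately show ?thesis using mul_mem_Dm[OF A, of a "e \<cdot> f"] PS_M[OF A a]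
        by (simp add: mul_assoc)
    qed
    show "e \<in> Dm A \<or> f \<in> Dm A" if ef: "e \<in> E" "f \<in> E" "e \<squnion> f \<in> Dm A" for e f
    proof -
      have "a \<cdot> (e \<squnion> f) \<in> A" using mul_Dm A a ef by blast
      then have "a \<cdot> e \<in> A \<or> a \<cdot> f \<in> A"
        using prime_filterD(6)[OF A _ _ _ lub_mul_proj[of a e f]] PS_M[OF A a] ef by simp
      then show ?thesis using mul_mem_Dm[OF A] PS_M[OF A a] ef by blast
    qed
  qed (auto simp: mem_Dm)
qed

lemma Cd_prime: "A \<in> PS \<Longrightarrow> Cd A \<in> PE"
  using drs.Dm_prime[OF op] by (simp add: spec_ob_op)

text \<open>If \<open>a f \<le> b \<or> c\<close> with \<open>f \<in> F\<close> then \<open>\<lambda>(a) f \<le> \<lambda>(b) \<or> \<lambda>(c)\<close>, so primeness of \<open>F\<close> puts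
  \<open>\<lambda>(b)\<close>, say, into \<open>F\<close>, and then \<open>a f \<lambda>(b)\<close> lies below \<open>b\<close>.\<close>

lemma translate_prime:
  assumes F: "F \<in> PE" and a: "a \<in> M" "dm a \<in> F"
  shows "translate S a F \<in> PS" "Dm (translate S a F) = F" "a \<in> translate S a F"
proof -
  let ?A = "translate S a F"
  show aA: "a \<in> ?A" using a by (auto simp: mem_translate intro!: bexI[of _ "dm a"])
  have dmF: "dm x \<in> F" if "x \<in> ?A" for x
  proof -
    obtain f where f: "f \<in> F" "a \<cdot> f \<preceq> x" "x \<in> M" using \<open>x \<in> ?A\<close> by (auto simp: mem_translate)
    have "dm (a \<cdot> f) \<preceq> dm x" using f dm_mono by blast
    moreover have "dm (a \<cdot> f) \<in> F" using PE_mul F f a PE_E by simp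
    ultimately show ?thesis using PE_up F f by simp
  qed
  have half: "b \<in> ?A" if x: "x \<in> ?A" "b \<preceq> x" "dm b \<in> F" for x b
  proof -
    obtain f where f: "f \<in> F" "a \<cdot> f \<preceq> x" "x \<in> M" using x by (auto simp: mem_translate)
    have b: "b \<in> M" "b = x \<cdot> dm b" using x f le_iff_mul_dm by blast+
    have fE: "f \<in> E" "dm a \<in> E" using F f a PE_E by auto
    have "a \<cdot> f \<cdot> dm b \<preceq> x \<cdot> dm b" using f b by (intro mul_mono) auto
    then have "a \<cdot> (f \<cdot> dm b) \<preceq> b" using b a fE by (simp add: mul_assoc)
    moreover have "f \<cdot> dm b \<in> F" using PE_mul F f x by blast
    ultimately show ?thesis using b by (auto simp: mem_translate)
  qed
  show AP: "?A \<in> PS"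
  proof (rule PS_I)
    show "?A \<subseteq> M" by (auto simp: mem_translate)
    show "a \<in> ?A" by (rule aA)
    show "zr \<notin> ?A" using dmF zr_PE[OF F] by fastforce
    show "y \<in> ?A" if "x \<in> ?A" "y \<in> M" "x \<preceq> y" for x y
      using that le_trans by (fastforce simp: mem_translate)
    show "\<exists>c\<in>?A. c \<preceq> x \<and> c \<preceq> y" if xy: "x \<in> ?A" "y \<in> ?A" for x y
    proof -
      obtain f g where fg: "f \<in> F" "a \<cdot> f \<preceq> x" "g \<in> F" "a \<cdot> g \<preceq> y" "x \<in> M" "y \<in> M"
        using xy by (auto simp: mem_translate)
      have E: "f \<in> E" "g \<in> E" using fg F PE_E by auto
      have "a \<cdot> (f \<cdot> g) \<preceq> a \<cdot> f" "a \<cdot> (f \<cdot> g) \<preceq> a \<cdot> g" using a E by (auto intro!: mul_mono)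
      then have "a \<cdot> (f \<cdot> g) \<preceq> x" "a \<cdot> (f \<cdot> g) \<preceq> y" using fg le_trans by blast+
      moreover have "a \<cdot> (f \<cdot> g) \<in> ?A"
        using PE_mul[OF F fg(1,3)] a E by (auto simp: mem_translate intro!: bexI[of _ "f \<cdot> g"])
      ultimately show ?thesis by blast
    qed
    show "b \<in> ?A \<or> c \<in> ?A"
      if bc: "b \<in> M" "c \<in> M" "x \<in> ?A" "is_lub (natural_order S) x {b, c}" for b c x
    proof -
      have "dm b \<squnion> dm c \<in> F" using dmF[OF bc(3)] dm_lub[OF bc(4,1,2)] by simp
      then have "dm b \<in> F \<or> dm c \<in> F" using PE_join F bc by simp
      moreover have "b \<preceq> x" "c \<preceq> x" using bc by (auto simp: is_lub_pair_iff)
      ultimately show ?thesis using half bc(3) by blast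
    qed
  qed
  show "Dm ?A = F"
  proof
    show "Dm ?A \<subseteq> F" using dmF PE_up[OF F] unfolding subset_iff mem_Dm by blast
    show "F \<subseteq> Dm ?A"
    proof
      fix f assume f: "f \<in> F"
      then have fE: "f \<in> E" using F PE_E by blast
      then have "a \<cdot> f \<in> ?A" using f a by (auto simp: mem_translate intro!: bexI[of _ f])
      then show "f \<in> Dm ?A" using mul_mem_Dm[OF AP] a fE by blast
    qed
  qed
qed

text \<open>The projections \<open>f\<close> with \<open>a f \<le> b\<close> form an ideal, which omits \<open>\<lambda>(a)\<close> unless \<open>a \<le> b\<close>.\<close>

lemma prime_filter_separation:
  assumes ab: "a \<in> M" "b \<in> M" "\<not> a \<preceq> b"
  shows "\<exists>A\<in>PS. a \<in> A \<and> b \<notin> A"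
proof -
  define I where "I = {f\<in>E. a \<cdot> f \<preceq> b}"
  have "\<exists>F\<in>PE. dm a \<in> F \<and> F \<inter> I = {}"
  proof (rule prime_filter_avoiding_ideal)
    show "distributive_lattice (projection_order S)"
      using distributive by (simp add: distributive_restriction_semigroup_def)
    show "dm a \<in> carrier (projection_order S)" "I \<subseteq> carrier (projection_order S)" "dm a \<notin> I"
      using ab by (auto simp: I_def)
    have "zr \<in> I" using ab by (simp add: I_def)
    then show "I \<noteq> {}" by blast
    show "g \<in> I" if fg: "f \<in> I" "g \<in> carrier (projection_order S)" "g \<sqsubseteq>\<^bsub>projection_order S\<^esub> f" for f g
    proof -
      have "a \<cdot> g \<preceq> a \<cdot> f" using fg ab by (auto simp: I_def intro!: mul_mono)
      then show ?thesis using fg ab le_trans[of "a \<cdot> g" "a \<cdot> f" b] by (auto simp: I_def)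
    qed
    show "f \<squnion> g \<in> I" if "f \<in> I" "g \<in> I" for f g
      using that lub_mul_proj[of a f g] ab by (auto simp: I_def is_lub_pair_iff)
  qed
  then obtain F where F: "F \<in> PE" "dm a \<in> F" "F \<inter> I = {}" by blast
  have "b \<notin> translate S a F" using F PE_E by (auto simp: mem_translate I_def)
  then show ?thesis using translate_prime[OF F(1) ab(1) F(2)] by blast
qed

lemma basic_mono_iff:
  assumes "a \<in> M" "b \<in> M"
  shows "BS a \<subseteq> BS b \<longleftrightarrow> a \<preceq> b"
proof
  assume "BS a \<subseteq> BS b"
  then show "a \<preceq> b" using prime_filter_separation[OF assms] by (auto simp: subset_iff)
next
  assume "a \<preceq> b"
  then show "BS a \<subseteq> BS b" using PS_up assms(2) by auto
qed

lemma basic_inj: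
  "a \<in> M \<Longrightarrow> b \<in> M \<Longrightarrow> BS a = BS b \<Longrightarrow> a = b"
  using basic_mono_iff le_antisym by (metis order_refl)

text \<open>Given \<open>a' b' \<le> x\<close>, replace \<open>a'\<close> by a common lower bound \<open>a e\<close> with \<open>a\<close>.  The projection \<open>e\<close> belongs to the
  domain of \<open>A\<close>, which is the codomain of \<open>B\<close>, so it can be absorbed into the second factor; hence the
  product is generated by any one pair \<open>(a, b)\<close>.\<close>

lemma prime_filter_comp:
  assumes A: "A \<in> PS" and B: "B \<in> PS" and AB: "Dm A = Cd B" and a: "a \<in> A" and b: "b \<in> B"
  shows "cmp A B = translate S (a \<cdot> b) (Dm B)" "dm (a \<cdot> b) \<in> Dm B"
proof -
  have M: "a \<in> M" "b \<in> M" using A B a b PS_M by auto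
  have "dm a \<in> Cd B" using Dm_I[OF A a] AB by simp
  then have "dm a \<cdot> b \<in> B" using Cd_mul B b by blast
  then show "dm (a \<cdot> b) \<in> Dm B" using Dm_I[OF B] M dm_dm_mul by metis
  show "cmp A B = translate S (a \<cdot> b) (Dm B)"
  proof (intro Set.set_eqI iffI)
    fix x assume "x \<in> translate S (a \<cdot> b) (Dm B)"
    then obtain f where f: "f \<in> Dm B" "a \<cdot> b \<cdot> f \<preceq> x" "x \<in> M" by (auto simp: mem_translate)
    have "f \<in> E" using f by (simp add: mem_Dm)
    then have "a \<cdot> (b \<cdot> f) \<preceq> x" using f M by (simp add: mul_assoc)
    then show "x \<in> cmp A B" using mul_Dm[OF B b f(1)] f(3) a unfolding mem_comp by blast
  next
    fix x assume "x \<in> cmp A B"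
    then obtain a' b' where ab': "a' \<in> A" "b' \<in> B" "a' \<cdot> b' \<preceq> x" "x \<in> M" by (auto simp: mem_comp)
    obtain a'' where a'': "a'' \<in> A" "a'' \<preceq> a'" "a'' \<preceq> a" using PS_dir A ab' a by blast
    have M': "a' \<in> M" "b' \<in> M" "a'' \<in> M" using A B ab' a'' PS_M by auto
    have "dm a'' \<in> Cd B" using Dm_I[OF A a''(1)] AB by simp
    then have "dm a'' \<cdot> b' \<in> B" using Cd_mul B ab' by blast
    then obtain c where c: "c \<in> B" "c \<preceq> dm a'' \<cdot> b'" "c \<preceq> b" using PS_dir B b by blast
    have cM: "c \<in> M" "c = b \<cdot> dm c" using c B PS_M M le_iff_mul_dm by blast+
    have "a \<cdot> c \<preceq> a \<cdot> (dm a'' \<cdot> b')" using c M M' by (intro mul_mono) auto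
    also have "a \<cdot> (dm a'' \<cdot> b') = a'' \<cdot> b'" using M M' a''(3) le_iff_mul_dm[of a a''] 
      by (simp flip: mul_assoc)
    finally have "a \<cdot> c \<preceq> a' \<cdot> b'"
      using mul_mono[of a'' a' b' b'] a'' M' le_trans[of "a \<cdot> c" "a'' \<cdot> b'" "a' \<cdot> b'"] by simp
    then have "a \<cdot> c \<preceq> x" using ab' le_trans by blast
    then have "a \<cdot> b \<cdot> dm c \<preceq> x" using cM M by (simp add: mul_assoc)
    then show "x \<in> translate S (a \<cdot> b) (Dm B)" using Dm_I[OF B c(1)] ab' by (auto simp: mem_translate)
  qed
qed

lemma comp_prime:
  assumes A: "A \<in> PS" and B: "B \<in> PS" and AB: "Dm A = Cd B"
  shows "cmp A B \<in> PS" "Dm (cmp A B) = Dm B"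
    "Cd (cmp A B) = Cd A"
    "\<And>a b. a \<in> A \<Longrightarrow> b \<in> B \<Longrightarrow> a \<cdot> b \<in> cmp A B"
proof -
  obtain a b where ab: "a \<in> A" "b \<in> B" using PS_ex A B by blast
  have M: "a \<cdot> b \<in> M" using ab A B PS_M by auto
  note c = prime_filter_comp[OF A B AB ab]
  show AB': "cmp A B \<in> PS" and "Dm (cmp A B) = Dm B"
    using translate_prime[OF Dm_prime[OF B] M c(2)] c(1) by auto
  show "\<And>a b. a \<in> A \<Longrightarrow> b \<in> B \<Longrightarrow> a \<cdot> b \<in> cmp A B"
    unfolding mem_comp using PS_M[OF A] PS_M[OF B] by (meson le_refl mul_closed)
  interpret O: drs "op_rsg S" by (rule op)
  have "O.Dm (tc_comp (spec_ob (op_rsg S)) B A) = O.Dm A"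
    using O.prime_filter_comp[of B A b a] O.translate_prime[of "O.Dm A" "a \<cdot> b"] O.Dm_prime[of A]
      A B AB ab M by (simp add: spec_ob_op)
  then show "Cd (cmp A B) = Cd A" by (simp add: spec_ob_op)
qed

lemma unit_prime:
  assumes F: "F \<in> PE"
  shows "un F \<in> PS" "Dm (un F) = F"
    "Cd (un F) = F"
proof -
  obtain e where e: "e \<in> F" "e \<in> E" using PE_ex PE_E F by blast
  have *: "un F = translate S e F"
  proof (intro Set.set_eqI iffI)
    fix x assume "x \<in> un F"
    then obtain f where f: "f \<in> F" "f \<preceq> x" "x \<in> M" by (auto simp: up_closure_def)
    then have "e \<cdot> f \<preceq> x" using e F PE_E le_trans[of "e \<cdot> f" f x] by auto
    then show "x \<in> translate S e F" using f by (auto simp: mem_translate)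
  next
    fix x assume "x \<in> translate S e F"
    then show "x \<in> un F"
      using PE_mul[OF F e(1)] by (auto simp: mem_translate up_closure_def)
  qed
  show "un F \<in> PS" "Dm (un F) = F"
    using translate_prime[OF F, of e] e * by auto
  have "\<exists>a\<in>un F. cd a \<preceq> x \<Longrightarrow> x \<in> E \<Longrightarrow> x \<in> F" for x
  proof -
    assume "\<exists>a\<in>un F. cd a \<preceq> x" "x \<in> E"
    then obtain a f where "f \<in> F" "f \<preceq> a" "a \<in> M" "cd a \<preceq> x" by (auto simp: up_closure_def)
    then have "f \<preceq> x" using cd_mono[of f a] F PE_E le_trans[of f "cd a" x] \<open>x \<in> E\<close> by simp
    then show "x \<in> F" using PE_up F \<open>f \<in> F\<close> \<open>x \<in> E\<close> by blast
  qed
  moreover have "x \<in> un F" if "x \<in> F" for x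
    using that PE_E[OF F that] by (auto simp: up_closure_def intro!: bexI[of _ x])
  ultimately show "Cd (un F) = F"
    unfolding Set.set_eq_iff mem_Cd using PE_E[OF F] cd_proj le_refl E_M by metis
qed

lemma prime_filter_with_projection:
  assumes A: "A \<in> PS" and e: "e \<in> A" "e \<in> E" shows "A = un (Dm A)" "e \<in> Dm A"
proof -
  show eD: "e \<in> Dm A" using Dm_I[OF A e(1)] e(2) by simp
  note u = unit_prime[OF Dm_prime[OF A]]
  have "e \<in> un (Dm A)" using eD e by (auto simp: up_closure_def intro!: bexI[of _ e])
  then show "A = un (Dm A)" using prime_filter_eqI_dm[OF A u(1) e(1)] u(2) by simp
qed

end

section \<open>Local homeomorphisms and spectral spaces\<close>

lemma homeomorphic_map_on_open_set:
  assumes f: "continuous_map X Y f" "open_map X Y f" and U: "openin X U" "inj_on f U"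
  shows "homeomorphic_map (subtopology X U) (subtopology Y (f ` U)) f"
proof (rule bijective_open_imp_homeomorphic_map)
  have UX: "U \<subseteq> topspace X" using U by (simp add: openin_subset)
  have fU: "openin Y (f ` U)" using f U by (simp add: open_map_def)
  show "continuous_map (subtopology X U) (subtopology Y (f ` U)) f"
    using f by (auto simp: continuous_map_in_subtopology continuous_map_from_subtopology)
  show "open_map (subtopology X U) (subtopology Y (f ` U)) f"
    using f U fU by (auto simp: open_map_def openin_open_subtopology)
  show "f ` topspace (subtopology X U) = topspace (subtopology Y (f ` U))"
    using UX openin_subset[OF fU] by (auto simp: Int_absorb1)
  show "inj_on f (topspace (subtopology X U))"
    using U UX by (simp add: Int_absorb1)
qed

text \<open>In this form being a local homeomorphism can be checked on a basis of open sets.\<close>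

lemma local_homeomorphism_iff:
  "local_homeomorphism X Y f \<longleftrightarrow> continuous_map X Y f \<and> open_map X Y f \<and>
    (\<forall>x\<in>topspace X. \<exists>U. openin X U \<and> x \<in> U \<and> inj_on f U)" (is "?l \<longleftrightarrow> ?r")
proof
  assume l: ?l
  have charts: "\<exists>U. openin X U \<and> x \<in> U \<and> openin Y (f ` U) \<and>
      homeomorphic_map (subtopology X U) (subtopology Y (f ` U)) f" if "x \<in> topspace X" for x
    using l that by (auto simp: local_homeomorphism_def)
  have "openin Y (f ` W)" if W: "openin X W" for W
  proof (subst openin_subopen, safe)
    fix x assume x: "x \<in> W"
    then obtain U where U: "openin X U" "x \<in> U" "openin Y (f ` U)"
      "homeomorphic_map (subtopology X U) (subtopology Y (f ` U)) f"
      using charts openin_subset[OF W] by blast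
    have "openin (subtopology X U) (W \<inter> U)" using W U by (simp add: openin_open_subtopology openin_Int)
    then have "openin (subtopology Y (f ` U)) (f ` (W \<inter> U))"
      using homeomorphic_imp_open_map[OF U(4)] by (simp add: open_map_def)
    then have "openin Y (f ` (W \<inter> U))" using U(3) by (simp add: openin_open_subtopology)
    then show "\<exists>T. openin Y T \<and> f x \<in> T \<and> T \<subseteq> f ` W" using x U(2) by blast
  qed
  moreover have "\<exists>U. openin X U \<and> x \<in> U \<and> inj_on f U" if x: "x \<in> topspace X" for x
  proof -
    obtain U where U: "openin X U" "x \<in> U" "homeomorphic_map (subtopology X U) (subtopology Y (f ` U)) f"
      using charts[OF x] by blast
    then have "inj_on f (topspace (subtopology X U))" by (blast intro: homeomorphic_imp_injective_map)
    then show ?thesis using U openin_subset[OF U(1)] by (auto simp: Int_absorb1)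
  qed
  ultimately show ?r using l by (auto simp: local_homeomorphism_def open_map_def)
next
  assume r: ?r
  then have f: "continuous_map X Y f" "open_map X Y f" by auto
  then show ?l unfolding local_homeomorphism_def
    using r homeomorphic_map_on_open_set[OF f] by (meson open_map_def)
qed

lemma compactin_image_iff:
  assumes f: "continuous_map X Y f" "open_map X Y f" and U: "openin X U" "inj_on f U" and "K \<subseteq> U"
  shows "compactin Y (f ` K) \<longleftrightarrow> compactin X K"
proof -
  have "K \<subseteq> topspace (subtopology X U)" using assms openin_subset[OF U(1)] by auto
  then have "compactin (subtopology Y (f ` U)) (f ` K) \<longleftrightarrow> compactin (subtopology X U) K"
    using homeomorphic_map_compactness[OF homeomorphic_map_on_open_set[OF f U]] by blast
  moreover have "f ` K \<subseteq> f ` U" using assms by blast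
  ultimately show ?thesis using \<open>K \<subseteq> U\<close> by (simp add: compactin_subtopology)
qed

lemma compact_open_Union:
  "finite \<F> \<Longrightarrow> (\<And>K. K \<in> \<F> \<Longrightarrow> compact_open X K) \<Longrightarrow> compact_open X (\<Union>\<F>)"
  by (auto simp: compact_open_def intro: compactin_Union)

lemma compact_open_empty [simp]: "compact_open X {}"
  by (simp add: compact_open_def)

lemma compact_open_Un: "compact_open X K \<Longrightarrow> compact_open X L \<Longrightarrow> compact_open X (K \<union> L)"
  by (auto simp: compact_open_def intro: compactin_Un)

lemma compact_open_subset: "compact_open X K \<Longrightarrow> K \<subseteq> topspace X"
  by (simp add: compact_open_def openin_subset)

lemma compactin_finite_basis_cover:
  assumes "compactin X K" "\<And>x. x \<in> K \<Longrightarrow> \<exists>B. openin X B \<and> P B \<and> x \<in> B"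
  shows "\<exists>\<F>. finite \<F> \<and> (\<forall>B\<in>\<F>. openin X B \<and> P B) \<and> K \<subseteq> \<Union>\<F>"
proof -
  have "K \<subseteq> \<Union>{B. openin X B \<and> P B}" using assms(2) by blast
  then have "\<exists>\<F>. finite \<F> \<and> \<F> \<subseteq> {B. openin X B \<and> P B} \<and> K \<subseteq> \<Union>\<F>"
    by (intro compactinD[OF assms(1)]) auto
  then show ?thesis by blast
qed

text \<open>The compact open sets are the finite unions of members of any basis of compact open sets, so a basis
  closed under intersection makes all of them closed under intersection.\<close>

lemma spectral_space_iff:
  "spectral_space X \<longleftrightarrow> sober_space X \<and>
    (\<forall>U x. openin X U \<and> x \<in> U \<longrightarrow> (\<exists>K. compact_open X K \<and> x \<in> K \<and> K \<subseteq> U)) \<and>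
    (\<forall>K L. compact_open X K \<and> compact_open X L \<longrightarrow> compact_open X (K \<inter> L))" (is "?l \<longleftrightarrow> ?r")
proof
  assume l: ?l
  then obtain \<B> where B: "\<And>B. B \<in> \<B> \<Longrightarrow> compact_open X B"
    "openin X = arbitrary union_of (\<lambda>B. B \<in> \<B>)"
    "\<And>\<F>. finite \<F> \<Longrightarrow> \<F> \<noteq> {} \<Longrightarrow> \<F> \<subseteq> \<B> \<Longrightarrow> \<Inter>\<F> \<in> \<B>"
    by (auto simp: spectral_space_def)
  have base: "\<exists>K\<in>\<B>. x \<in> K \<and> K \<subseteq> U" if "openin X U" "x \<in> U" for U x
    using B(2) that unfolding openin_topology_base_unique by blast
  have fin: "\<exists>\<F>. finite \<F> \<and> \<F> \<subseteq> \<B> \<and> K = \<Union>\<F>" if K: "compact_open X K" for K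
  proof -
    have "\<exists>B. openin X B \<and> (B \<in> \<B> \<and> B \<subseteq> K) \<and> x \<in> B" if "x \<in> K" for x
      using base[of K x] K that B(1) by (auto simp: compact_open_def)
    then obtain \<F> where "finite \<F>" "\<forall>B\<in>\<F>. openin X B \<and> B \<in> \<B> \<and> B \<subseteq> K" "K \<subseteq> \<Union>\<F>"
      using compactin_finite_basis_cover[of X K "\<lambda>B. B \<in> \<B> \<and> B \<subseteq> K"] K
      by (auto simp: compact_open_def)
    then show ?thesis by (intro exI[of _ \<F>]) auto
  qed
  have "compact_open X (K \<inter> L)" if KL: "compact_open X K" "compact_open X L" for K L
  proof -
    obtain \<F> \<G> where FG: "finite \<F>" "\<F> \<subseteq> \<B>" "K = \<Union>\<F>" "finite \<G>" "\<G> \<subseteq> \<B>" "L = \<Union>\<G>"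
      using fin[OF KL(1)] fin[OF KL(2)] by blast
    have "K \<inter> L = \<Union>((\<lambda>(A, B). A \<inter> B) ` (\<F> \<times> \<G>))" using FG by auto
    moreover have "compact_open X (A \<inter> B)" if "A \<in> \<F>" "B \<in> \<G>" for A B
      using B(3)[of "{A, B}"] FG that B(1) by auto
    ultimately show ?thesis using FG by (auto intro!: compact_open_Union)
  qed
  moreover have "\<exists>K. compact_open X K \<and> x \<in> K \<and> K \<subseteq> U" if "openin X U" "x \<in> U" for U x
    using base[OF that] B(1) by blast
  moreover have "sober_space X" using l by (simp add: spectral_space_def)
  ultimately show ?r by simp
next
  assume r: ?r
  have "openin X = arbitrary union_of (\<lambda>B. B \<in> Collect (compact_open X))"
    unfolding openin_topology_base_unique using r by (auto simp: compact_open_def)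
  moreover have "\<Inter>\<F> \<in> Collect (compact_open X)"
    if "finite \<F>" "\<F> \<noteq> {}" "\<F> \<subseteq> Collect (compact_open X)" for \<F>
    using that r by (induction rule: finite_ne_induct) auto
  ultimately show ?l unfolding spectral_space_def using r
    by (intro conjI exI[of _ "Collect (compact_open X)"]) auto
qed

lemma irreducible_closed_meets:
  assumes "irreducible_closed X Z" "openin X U" "openin X V" "U \<inter> Z \<noteq> {}" "V \<inter> Z \<noteq> {}"
  shows "U \<inter> V \<inter> Z \<noteq> {}"
proof
  assume "U \<inter> V \<inter> Z = {}"
  then have "Z = (Z - U) \<union> (Z - V)" by blast
  moreover have "closedin X (Z - U)" "closedin X (Z - V)"
    using assms by (auto simp: irreducible_closed_def closedin_diff)
  ultimately have "Z = Z - U \<or> Z = Z - V" using assms(1) unfolding irreducible_closed_def by blast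
  then show False using assms by blast
qed

lemma irreducible_closed_closure_of_singleton:
  assumes "x \<in> topspace X" shows "irreducible_closed X (X closure_of {x})"
  unfolding irreducible_closed_def
proof (intro conjI allI impI)
  have x: "x \<in> X closure_of {x}" using assms by (simp add: in_closure_of)
  then show "X closure_of {x} \<noteq> {}" by blast
  fix A B assume AB: "closedin X A \<and> closedin X B \<and> X closure_of {x} = A \<union> B"
  then have "x \<in> A \<or> x \<in> B" using x by blast
  then have "X closure_of {x} \<subseteq> A \<or> X closure_of {x} \<subseteq> B"
    using AB closure_of_minimal[of "{x}"] by (metis empty_subsetI insert_subset)
  then show "X closure_of {x} = A \<or> X closure_of {x} = B" using AB by blast
qed simp

lemma sober_space_T0:
  assumes "sober_space X" "x \<in> topspace X" "y \<in> topspace X"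
    "\<And>U. openin X U \<Longrightarrow> x \<in> U \<longleftrightarrow> y \<in> U"
  shows "x = y"
proof -
  have "X closure_of {x} = X closure_of {y}" using assms(4) by (auto simp: in_closure_of)
  then show ?thesis
    using assms irreducible_closed_closure_of_singleton[of x X] unfolding sober_space_def by blast
qed

text \<open>A prime filter \<open>P\<close> of compact open sets consists of the neighbourhoods of the generic
  point of the complement of all compact open sets outside \<open>P\<close>.\<close>

lemma spectral_space_prime_filter_point:
  assumes X: "spectral_space X"
    and P: "\<And>U. U \<in> P \<Longrightarrow> compact_open X U" "P \<noteq> {}" "{} \<notin> P"
      "\<And>U V. U \<in> P \<Longrightarrow> compact_open X V \<Longrightarrow> U \<subseteq> V \<Longrightarrow> V \<in> P"
      "\<And>U V. U \<in> P \<Longrightarrow> V \<in> P \<Longrightarrow> U \<inter> V \<in> P"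
      "\<And>U V. compact_open X U \<Longrightarrow> compact_open X V \<Longrightarrow> U \<union> V \<in> P \<Longrightarrow> U \<in> P \<or> V \<in> P"
  shows "\<exists>x\<in>topspace X. P = {U. compact_open X U \<and> x \<in> U}"
proof -
  define N where "N = {U. compact_open X U \<and> U \<notin> P}"
  define Z where "Z = topspace X - \<Union>N"
  have finN: "\<Union>\<F> \<in> N" if "finite \<F>" "\<F> \<subseteq> N" for \<F>
    using that
  proof (induction \<F> rule: finite_induct)
    case (insert U \<F>)
    then show ?case using P(6)[of U "\<Union>\<F>"] by (auto simp: N_def intro: compact_open_Un)
  qed (use P(3) in \<open>simp add: N_def\<close>)
  have meet: "U \<inter> Z \<noteq> {}" if U: "U \<in> P" for U
  proof
    assume "U \<inter> Z = {}"
    then have "\<exists>B. openin X B \<and> B \<in> N \<and> x \<in> B" if "x \<in> U" for x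
      using compact_open_subset[OF P(1)[OF U]] that by (auto simp: Z_def N_def compact_open_def)
    then obtain \<F> where F: "finite \<F>" "\<forall>B\<in>\<F>. openin X B \<and> B \<in> N" "U \<subseteq> \<Union>\<F>"
      using compactin_finite_basis_cover[of X U "\<lambda>B. B \<in> N"] P(1)[OF U]
      by (auto simp: compact_open_def)
    then have "\<Union>\<F> \<in> N" using finN[of \<F>] by blast
    then show False using P(4)[OF U] F(3) by (auto simp: N_def)
  qed
  have base: "\<exists>K. compact_open X K \<and> x \<in> K \<and> K \<subseteq> U" if "openin X U" "x \<in> U" for U x
    using X that by (simp add: spectral_space_iff)
  have "closedin X Z" unfolding Z_def by (rule closedin_diff) (auto simp: N_def compact_open_def)
  moreover have "Z = A \<or> Z = B" if AB: "closedin X A" "closedin X B" "Z = A \<union> B" for A B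
  proof (rule ccontr)
    assume "\<not> ?thesis"
    then obtain x y where xy: "x \<in> Z" "x \<notin> A" "y \<in> Z" "y \<notin> B" using AB by blast
    have "openin X (topspace X - A)" "openin X (topspace X - B)" using AB by auto
    moreover have "x \<in> topspace X - A" "y \<in> topspace X - B" using xy by (auto simp: Z_def)
    ultimately obtain K L where K: "compact_open X K" "x \<in> K" "K \<subseteq> topspace X - A"
      and L: "compact_open X L" "y \<in> L" "L \<subseteq> topspace X - B" using base by meson
    then have "K \<in> P" "L \<in> P" using xy by (auto simp: Z_def N_def)
    then have "K \<inter> L \<inter> Z \<noteq> {}" using meet P(5) by blast
    then show False using AB K L by blast
  qed
  moreover have "Z \<noteq> {}" using P(2) meet by blast
  ultimately have "irreducible_closed X Z" by (simp add: irreducible_closed_def)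
  then have "\<exists>!x. x \<in> topspace X \<and> Z = X closure_of {x}"
    using X by (simp add: spectral_space_def sober_space_def)
  then obtain x where x: "x \<in> topspace X" "Z = X closure_of {x}" by blast
  have "U \<in> P \<longleftrightarrow> x \<in> U" if U: "compact_open X U" for U
  proof
    assume "U \<in> P"
    then obtain z where "z \<in> U" "z \<in> Z" using meet by blast
    then show "x \<in> U" using U x by (auto simp: in_closure_of compact_open_def)
  next
    assume "x \<in> U"
    moreover have "x \<in> Z" using x by (simp add: in_closure_of)
    ultimately show "U \<in> P" using U by (auto simp: Z_def N_def)
  qed
  then show ?thesis using x P(1) by blast
qed

section \<open>The prime spectrum\<close>

lemma topspace_prime_spectrum [simp]: "topspace (prime_spectrum L) = prime_filters L"
proof -
  have "A \<in> (\<Union>a\<in>carrier L. {A \<in> prime_filters L. a \<in> A})" if A: "A \<in> prime_filters L" for A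
    using prime_filterD(1,2)[OF A] A by blast
  then show ?thesis by (auto simp: prime_spectrum_def)
qed

lemma openin_prime_spectrum:
  "openin (prime_spectrum L) U \<longleftrightarrow> U \<subseteq> prime_filters L \<and> (\<forall>A\<in>U. \<exists>a\<in>A. basic L a \<subseteq> U)"
  (is "?l \<longleftrightarrow> ?r")
proof
  assume l: ?l
  then have "generate_topology_on ((\<lambda>a. {A \<in> prime_filters L. a \<in> A}) ` carrier L) U"
    by (simp add: prime_spectrum_def openin_topology_generated_by_iff)
  then have "\<forall>A\<in>U. A \<in> prime_filters L \<longrightarrow> (\<exists>a\<in>A. basic L a \<subseteq> U)"
  proof induction
    case (Int U V)
    show ?case
    proof (intro ballI impI)
      fix A assume A: "A \<in> U \<inter> V" "A \<in> prime_filters L"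
      then have "\<exists>a\<in>A. basic L a \<subseteq> U" "\<exists>b\<in>A. basic L b \<subseteq> V" using Int by auto
      then obtain a b where ab: "a \<in> A" "b \<in> A" "basic L a \<subseteq> U" "basic L b \<subseteq> V" by blast
      then obtain c where c: "c \<in> A" "c \<sqsubseteq>\<^bsub>L\<^esub> a" "c \<sqsubseteq>\<^bsub>L\<^esub> b" using prime_filterD(5)[OF A(2) ab(1,2)] by blast
      have "a \<in> carrier L" "b \<in> carrier L" using ab prime_filterD(1)[OF A(2)] by blast+
      then have "basic L c \<subseteq> basic L a" "basic L c \<subseteq> basic L b"
        using c prime_filterD(4)[of _ L c] by (auto simp: subset_iff)
      then show "\<exists>a\<in>A. basic L a \<subseteq> U \<inter> V" using ab c by blast
    qed
  next
    case (UN K)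
    show ?case
    proof (intro ballI impI)
      fix A assume A: "A \<in> \<Union>K" "A \<in> prime_filters L"
      then obtain k where k: "k \<in> K" "A \<in> k" by blast
      then obtain a where "a \<in> A" "basic L a \<subseteq> k" using UN A(2) by blast
      then show "\<exists>a\<in>A. basic L a \<subseteq> \<Union>K" using k(1) by blast
    qed
  qed (auto simp: basic_def)
  moreover have "U \<subseteq> prime_filters L" using openin_subset[OF l] by simp
  ultimately show ?r by blast
next
  assume r: ?r
  show ?l
  proof (subst openin_subopen, intro ballI)
    fix A assume A: "A \<in> U"
    then obtain a where a: "a \<in> A" "basic L a \<subseteq> U" using r by blast
    moreover have "a \<in> carrier L" using a A r prime_filterD(1) by blast
    then have "openin (prime_spectrum L) (basic L a)"
      by (auto simp: prime_spectrum_def basic_def intro!: topology_generated_by_Basis)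
    ultimately show "\<exists>T. openin (prime_spectrum L) T \<and> A \<in> T \<and> T \<subseteq> U"
      using A r by (intro exI[of _ "basic L a"]) auto
  qed
qed

lemma openin_basic [simp]: "openin (prime_spectrum L) (basic L a)"
  by (auto simp: openin_prime_spectrum)

lemma closure_of_prime_filter:
  assumes "A \<in> prime_filters L"
  shows "B \<in> prime_spectrum L closure_of {A} \<longleftrightarrow> B \<in> prime_filters L \<and> B \<subseteq> A"
proof -
  have "A \<in> U" if "B \<subseteq> A" "openin (prime_spectrum L) U" "B \<in> U" for U
    using that assms by (fastforce simp: openin_prime_spectrum)
  moreover have "B \<subseteq> A" if "\<forall>U. B \<in> U \<and> openin (prime_spectrum L) U \<longrightarrow> A \<in> U" "B \<in> prime_filters L"
    using that(1)[rule_format, of "basic L _"] that(2) by auto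
  ultimately show ?thesis by (auto simp: in_closure_of)
qed

text \<open>The generic point of an irreducible closed set \<open>Z\<close> consists of the elements \<open>a\<close> whose basic sets meet
  \<open>Z\<close>.  It is down-directed because any two open sets that meet \<open>Z\<close> meet inside \<open>Z\<close>.  The least element
  lies in no prime filter and keeps it a proper subset.\<close>

lemma sober_prime_spectrum:
  assumes z: "z \<in> carrier L" "\<And>a. a \<in> carrier L \<Longrightarrow> z \<sqsubseteq>\<^bsub>L\<^esub> a"
  shows "sober_space (prime_spectrum L)"
  unfolding sober_space_def
proof (intro allI impI)
  fix Z assume Z: "irreducible_closed (prime_spectrum L) Z"
  then have clZ: "closedin (prime_spectrum L) Z" and Zne: "Z \<noteq> {}"
    by (auto simp: irreducible_closed_def)
  have ZP: "Z \<subseteq> prime_filters L" using closedin_subset[OF clZ] by simp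
  have zZ: "z \<notin> B" if "B \<in> prime_filters L" for B
    using prime_filterD(1,3,4)[OF that] z by blast
  define A where "A = {a\<in>carrier L. basic L a \<inter> Z \<noteq> {}}"
  have mem: "b \<in> A" if "B \<in> Z" "b \<in> B" for b B
    using that ZP prime_filterD(1) by (force simp: A_def)
  have "A \<subseteq> carrier L" by (auto simp: A_def)
  moreover have "A \<noteq> {}" using Zne ZP prime_filterD(2) mem by blast
  moreover have "z \<in> carrier L - A" using z(1) zZ by (auto simp: A_def)
  then have "A \<noteq> carrier L" by blast
  moreover have "b \<in> A" if "a \<in> A" "b \<in> carrier L" "a \<sqsubseteq>\<^bsub>L\<^esub> b" for a b
  proof -
    obtain B where "B \<in> Z" "a \<in> B" using \<open>a \<in> A\<close> by (auto simp: A_def)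
    then have "b \<in> B" using prime_filterD(4)[of B L a b] ZP that by blast
    then show ?thesis using mem \<open>B \<in> Z\<close> by blast
  qed
  moreover have "\<exists>c\<in>A. c \<sqsubseteq>\<^bsub>L\<^esub> a \<and> c \<sqsubseteq>\<^bsub>L\<^esub> b" if ab: "a \<in> A" "b \<in> A" for a b
  proof -
    have "basic L a \<inter> basic L b \<inter> Z \<noteq> {}"
      using ab by (intro irreducible_closed_meets[OF Z]) (auto simp: A_def)
    then obtain B where B: "B \<in> Z" "a \<in> B" "b \<in> B" by auto
    then obtain c where "c \<in> B" "c \<sqsubseteq>\<^bsub>L\<^esub> a" "c \<sqsubseteq>\<^bsub>L\<^esub> b"
      using prime_filterD(5)[of B L a b] ZP by blast
    then show ?thesis using mem B by blast
  qed
  moreover have "a \<in> A \<or> b \<in> A"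
    if abc: "a \<in> carrier L" "b \<in> carrier L" "c \<in> A" "is_lub L c {a, b}" for a b c
  proof -
    obtain B where B: "B \<in> Z" "c \<in> B" using abc by (auto simp: A_def)
    then have "a \<in> B \<or> b \<in> B" using prime_filterD(6)[of B L a b c] ZP abc by blast
    then show ?thesis using mem B by blast
  qed
  ultimately have AP: "A \<in> prime_filters L" unfolding prime_filters_def by blast
  have inZ: "B \<in> Z" if B: "B \<in> prime_filters L" "B \<subseteq> A" for B
  proof (rule ccontr)
    assume "B \<notin> Z"
    then have "B \<in> prime_filters L - Z" using B by blast
    moreover have "openin (prime_spectrum L) (prime_filters L - Z)"
      using clZ by (simp add: closedin_def)
    ultimately obtain b where "b \<in> B" "basic L b \<subseteq> prime_filters L - Z"
      unfolding openin_prime_spectrum by blast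
    then show False using B by (auto simp: A_def)
  qed
  then have ZA: "Z = prime_spectrum L closure_of {A}"
  proof (intro Set.set_eqI iffI)
    fix B assume B: "B \<in> Z"
    then have "B \<subseteq> A" using mem by blast
    then show "B \<in> prime_spectrum L closure_of {A}" using closure_of_prime_filter[OF AP] ZP B by auto
  qed (simp add: closure_of_prime_filter[OF AP] inZ)
  show "\<exists>!x. x \<in> topspace (prime_spectrum L) \<and> Z = prime_spectrum L closure_of {x}"
  proof (intro ex1I[of _ A])
    fix B assume B: "B \<in> topspace (prime_spectrum L) \<and> Z = prime_spectrum L closure_of {B}"
    then have BP: "B \<in> prime_filters L" by simp
    have "B \<in> Z" using B closure_of_prime_filter[OF BP, of B] BP by simp
    moreover have "A \<in> Z" using inZ[OF AP] by blast
    ultimately have "B \<subseteq> A" "A \<subseteq> B"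
      using ZA B closure_of_prime_filter[OF AP, of B] closure_of_prime_filter[OF BP, of A] by simp_all
    then show "B = A" by blast
  qed (use AP ZA in simp)
qed

section \<open>Etale categories in terms of products of open sets\<close>

definition set_comp :: "'c tcat \<Rightarrow> 'c set \<Rightarrow> 'c set \<Rightarrow> 'c set" where
  "set_comp C A B = {tc_comp C a b | a b. a \<in> A \<and> b \<in> B \<and> tc_dom C a = tc_cod C b}"

text \<open>The sets \<open>A \<times> B\<close> with \<open>A\<close> and \<open>B\<close> open, cut down to composable pairs, form a basis.  Continuity and
  openness of the composition can thus be expressed by the products \<open>A B\<close> of open sets of arrows.\<close>

lemma openin_composable_space:
  "openin (composable_space C) S \<longleftrightarrow> S \<subseteq> composable C \<and>
    (\<forall>a b. (a, b) \<in> S \<longrightarrow> (\<exists>A B. openin (tc_arr C) A \<and> openin (tc_arr C) B \<and> a \<in> A \<and> b \<in> B \<and>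
      (A \<times> B) \<inter> composable C \<subseteq> S))" (is "?l \<longleftrightarrow> ?r")
proof
  assume ?l
  then obtain T where T: "openin (prod_topology (tc_arr C) (tc_arr C)) T" "S = T \<inter> composable C"
    by (auto simp: composable_space_def openin_subtopology)
  show ?r
  proof (intro conjI allI impI)
    fix a b assume "(a, b) \<in> S"
    then obtain A B where "openin (tc_arr C) A" "openin (tc_arr C) B" "a \<in> A" "b \<in> B" "A \<times> B \<subseteq> T"
      using T(1)[unfolded openin_prod_topology_alt, rule_format, of a b] T(2) by blast
    then show "\<exists>A B. openin (tc_arr C) A \<and> openin (tc_arr C) B \<and> a \<in> A \<and> b \<in> B \<and>
      (A \<times> B) \<inter> composable C \<subseteq> S" using T(2) by blast
  qed (use T in auto)
next
  assume r: ?r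
  define T where "T = \<Union>{A \<times> B | A B. openin (tc_arr C) A \<and> openin (tc_arr C) B \<and>
    (A \<times> B) \<inter> composable C \<subseteq> S}"
  have "openin (prod_topology (tc_arr C) (tc_arr C)) T"
    unfolding T_def by (rule openin_Union) (auto simp: openin_prod_Times_iff)
  moreover have "S = T \<inter> composable C"
  proof
    show "S \<subseteq> T \<inter> composable C"
    proof
      fix x assume x: "x \<in> S"
      obtain a b where ab: "x = (a, b)" by (cases x)
      then obtain A B where "openin (tc_arr C) A" "openin (tc_arr C) B" "a \<in> A" "b \<in> B"
        "(A \<times> B) \<inter> composable C \<subseteq> S" using r x by blast
      then have "x \<in> T" using ab by (auto simp: T_def)
      then show "x \<in> T \<inter> composable C" using r x by blast
    qed
  qed (auto simp: T_def)
  ultimately show ?l by (auto simp: composable_space_def openin_subtopology)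
qed

lemma topspace_composable_space [simp]: "topspace (composable_space C) = composable C"
  by (auto simp: composable_space_def composable_def)

lemma continuous_composition_iff:
  "continuous_map (composable_space C) (tc_arr C) (\<lambda>(a, b). tc_comp C a b) \<longleftrightarrow>
    (\<forall>a b. (a, b) \<in> composable C \<longrightarrow> tc_comp C a b \<in> arrows C) \<and>
    (\<forall>W a b. openin (tc_arr C) W \<longrightarrow> (a, b) \<in> composable C \<longrightarrow> tc_comp C a b \<in> W \<longrightarrow>
      (\<exists>A B. openin (tc_arr C) A \<and> openin (tc_arr C) B \<and> a \<in> A \<and> b \<in> B \<and> set_comp C A B \<subseteq> W))"
proof -
  have sub: "(A \<times> B) \<inter> composable C \<subseteq> {x \<in> composable C. (case x of (a, b) \<Rightarrow> tc_comp C a b) \<in> W} \<longleftrightarrow>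
      set_comp C A B \<subseteq> W" if "openin (tc_arr C) A" "openin (tc_arr C) B" for A B W
    using openin_subset[OF that(1)] openin_subset[OF that(2)]
    by (fastforce simp: set_comp_def composable_def)
  have ex: "(\<exists>A B. openin (tc_arr C) A \<and> openin (tc_arr C) B \<and> a \<in> A \<and> b \<in> B \<and>
      (A \<times> B) \<inter> composable C \<subseteq> {x \<in> composable C. (case x of (a, b) \<Rightarrow> tc_comp C a b) \<in> W}) \<longleftrightarrow>
    (\<exists>A B. openin (tc_arr C) A \<and> openin (tc_arr C) B \<and> a \<in> A \<and> b \<in> B \<and> set_comp C A B \<subseteq> W)"
    for a b W
    by (intro ex_cong1 conj_cong refl) (rule sub)
  show ?thesis
    unfolding continuous_map_def topspace_composable_space openin_composable_space ex Pi_iff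
    by (simp only: split_paired_All mem_Collect_eq prod.case Ball_def) blast
qed

lemma open_composition_iff:
  "open_map (composable_space C) (tc_arr C) (\<lambda>(a, b). tc_comp C a b) \<longleftrightarrow>
    (\<forall>A B. openin (tc_arr C) A \<longrightarrow> openin (tc_arr C) B \<longrightarrow> openin (tc_arr C) (set_comp C A B))"
  (is "?l \<longleftrightarrow> ?r")
proof
  assume l: ?l
  show ?r
  proof (intro allI impI)
    fix A B assume AB: "openin (tc_arr C) A" "openin (tc_arr C) B"
    have "openin (composable_space C) ((A \<times> B) \<inter> composable C)"
      using AB by (auto simp: openin_composable_space)
    then have "openin (tc_arr C) ((\<lambda>(a, b). tc_comp C a b) ` ((A \<times> B) \<inter> composable C))"
      using l by (simp add: open_map_def)
    also have "(\<lambda>(a, b). tc_comp C a b) ` ((A \<times> B) \<inter> composable C) = set_comp C A B"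
      using AB[THEN openin_subset] by (fastforce simp: set_comp_def composable_def)
    finally show "openin (tc_arr C) (set_comp C A B)" .
  qed
next
  assume r: ?r
  show ?l unfolding open_map_def
  proof (intro allI impI)
    fix S assume S: "openin (composable_space C) S"
    show "openin (tc_arr C) ((\<lambda>(a, b). tc_comp C a b) ` S)"
    proof (subst openin_subopen, intro ballI)
      fix x assume "x \<in> (\<lambda>(a, b). tc_comp C a b) ` S"
      then obtain a b where ab: "(a, b) \<in> S" "x = tc_comp C a b" by auto
      then obtain A B where AB: "openin (tc_arr C) A" "openin (tc_arr C) B" "a \<in> A" "b \<in> B"
        "(A \<times> B) \<inter> composable C \<subseteq> S" using S unfolding openin_composable_space by blast
      have "set_comp C A B \<subseteq> (\<lambda>(a, b). tc_comp C a b) ` S"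
        using AB(5) AB(1,2)[THEN openin_subset] by (fastforce simp: set_comp_def composable_def)
      moreover have "x \<in> set_comp C A B"
        using ab AB S by (auto simp: set_comp_def openin_composable_space composable_def)
      ultimately show "\<exists>T. openin (tc_arr C) T \<and> x \<in> T \<and> T \<subseteq> (\<lambda>(a, b). tc_comp C a b) ` S"
        using r AB by blast
    qed
  qed
qed

lemma etale_category_iff:
  "etale_category C \<longleftrightarrow>
    local_homeomorphism (tc_arr C) (tc_obj C) (tc_dom C) \<and>
    local_homeomorphism (tc_arr C) (tc_obj C) (tc_cod C) \<and>
    continuous_map (tc_obj C) (tc_arr C) (tc_unit C) \<and>
    open_map (tc_obj C) (tc_arr C) (tc_unit C) \<and>
    (\<forall>p\<in>objects C. tc_dom C (tc_unit C p) = p \<and> tc_cod C (tc_unit C p) = p) \<and>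
    (\<forall>a b. (a, b) \<in> composable C \<longrightarrow> tc_comp C a b \<in> arrows C \<and>
        tc_dom C (tc_comp C a b) = tc_dom C b \<and> tc_cod C (tc_comp C a b) = tc_cod C a) \<and>
    (\<forall>a\<in>arrows C. tc_comp C a (tc_unit C (tc_dom C a)) = a \<and>
        tc_comp C (tc_unit C (tc_cod C a)) a = a) \<and>
    (\<forall>a b c. (a, b) \<in> composable C \<and> (b, c) \<in> composable C \<longrightarrow>
        tc_comp C (tc_comp C a b) c = tc_comp C a (tc_comp C b c)) \<and>
    (\<forall>W a b. openin (tc_arr C) W \<longrightarrow> (a, b) \<in> composable C \<longrightarrow> tc_comp C a b \<in> W \<longrightarrow>
      (\<exists>A B. openin (tc_arr C) A \<and> openin (tc_arr C) B \<and> a \<in> A \<and> b \<in> B \<and> set_comp C A B \<subseteq> W)) \<and>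
    (\<forall>A B. openin (tc_arr C) A \<longrightarrow> openin (tc_arr C) B \<longrightarrow> openin (tc_arr C) (set_comp C A B))"
  (is "?l \<longleftrightarrow> ?d \<and> ?c \<and> ?uc \<and> ?uo \<and> ?du \<and> ?cl \<and> ?un \<and> ?as \<and> ?cont \<and> ?open")
proof -
  have "continuous_map (tc_arr C) (tc_obj C) (tc_dom C)" if ?d
    using that by (simp add: local_homeomorphism_def)
  moreover have "continuous_map (tc_arr C) (tc_obj C) (tc_cod C)" if ?c
    using that by (simp add: local_homeomorphism_def)
  ultimately show ?thesis
    unfolding etale_category_def topological_category_def continuous_composition_iff
      open_composition_iff by (auto split: prod.splits)
qed

section \<open>The prime spectrum of a distributive restriction semigroup is an etale category\<close>

lemma openin_prime_spectrumE:
  assumes "openin (prime_spectrum L) U" "A \<in> U"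
  obtains a where "A \<in> prime_filters L" "a \<in> A" "basic L a \<subseteq> U"
proof -
  have "U \<subseteq> prime_filters L" "\<exists>a\<in>A. basic L a \<subseteq> U"
    using assms by (auto simp: openin_prime_spectrum)
  then show thesis using that assms(2) by blast
qed

context drs
begin

text \<open>On the filters containing \<open>a\<close> the domain map is inverse to \<open>F \<mapsto> (a F)\<^sup>\<up>\<close>, and it maps them onto the basic
  set of \<open>\<lambda>(a)\<close>.\<close>

lemma Dm_local_homeomorphism:
  "local_homeomorphism (XS) (XE) Dm"
  unfolding local_homeomorphism_iff topspace_prime_spectrum
proof (intro conjI ballI)
  show "continuous_map (XS) (XE) Dm"
    unfolding continuous_map_def topspace_prime_spectrum
  proof (intro conjI allI impI)
    fix U assume U: "openin (XE) U"
    show "openin (XS) {A \<in> PS. Dm A \<in> U}"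
      unfolding openin_prime_spectrum
    proof (intro conjI ballI)
      fix A assume A: "A \<in> {A \<in> PS. Dm A \<in> U}"
      then obtain e where e: "e \<in> Dm A" "BE e \<subseteq> U"
        using U by (auto simp: openin_prime_spectrum)
      then obtain a where a: "a \<in> A" "dm a \<preceq> e" "e \<in> E" by (auto simp: mem_Dm)
      have "e \<in> Dm B" if "a \<in> B" for B using that a by (auto simp: mem_Dm)
      then have "BS a \<subseteq> {A \<in> PS. Dm A \<in> U}"
        using e Dm_prime by (auto simp: subset_iff)
      then show "\<exists>a\<in>A. BS a \<subseteq> {A \<in> PS. Dm A \<in> U}" using a by blast
    qed auto
  qed (use Dm_prime in auto)
  show "open_map (XS) (XE) Dm"
    unfolding open_map_def
  proof (intro allI impI)
    fix U assume U: "openin (XS) U"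
    show "openin (XE) (Dm ` U)"
      unfolding openin_prime_spectrum
    proof (intro conjI ballI)
      show "Dm ` U \<subseteq> PE" using U Dm_prime by (auto simp: openin_prime_spectrum)
      fix F assume "F \<in> Dm ` U"
      then obtain A where A: "A \<in> U" "F = Dm A" by blast
      have AP: "A \<in> PS" using U A by (auto simp: openin_prime_spectrum)
      obtain a where a: "a \<in> A" "BS a \<subseteq> U"
        using U A by (auto simp: openin_prime_spectrum)
      have "G \<in> Dm ` U" if G: "G \<in> PE" "dm a \<in> G" for G
        using translate_prime[OF G(1) PS_M[OF AP a(1)] G(2)] a(2) by (auto simp: image_iff subset_iff)
      then have "BE (dm a) \<subseteq> Dm ` U" by auto
      then show "\<exists>e\<in>F. BE e \<subseteq> Dm ` U" using Dm_I[OF AP a(1)] A by blast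
    qed
  qed
  fix A assume A: "A \<in> PS"
  then obtain a where a: "a \<in> A" using PS_ex by blast
  have "inj_on Dm (BS a)"
    by (rule inj_onI, rule prime_filter_eqI_dm[where a = a]) auto
  then show "\<exists>U. openin (XS) U \<and> A \<in> U \<and> inj_on Dm U"
    using A a by (intro exI[of _ "BS a"]) auto
qed

lemma Cd_local_homeomorphism:
  "local_homeomorphism (XS) (XE) Cd"
  using drs.Dm_local_homeomorphism[OF op] by (simp add: spec_ob_op)

lemma mem_unit: "x \<in> un F \<longleftrightarrow> x \<in> M \<and> (\<exists>e\<in>F. e \<preceq> x)"
  by (auto simp: up_closure_def)

lemma mem_unitI: "e \<in> F \<Longrightarrow> e \<in> M \<Longrightarrow> e \<in> un F"
  unfolding mem_unit by (auto intro!: bexI[of _ e])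

lemma unit_continuous:
  "continuous_map (XE) (XS) (un)"
  unfolding continuous_map_def topspace_prime_spectrum
proof (intro conjI allI impI)
  fix U assume U: "openin (XS) U"
  show "openin (XE) {F \<in> PE. un F \<in> U}"
    unfolding openin_prime_spectrum
  proof (intro conjI ballI)
    fix F assume F: "F \<in> {F \<in> PE. un F \<in> U}"
    then have "un F \<in> U" by blast
    then obtain a where a: "a \<in> un F" "BS a \<subseteq> U"
      using openin_prime_spectrumE[OF U] by blast
    then obtain e where e: "e \<in> F" "e \<preceq> a" "a \<in> M" by (auto simp: mem_unit simp del: spec_ob_simps)
    then have "a \<in> un G" if "e \<in> G" for G
      using that by (auto simp: mem_unit simp del: spec_ob_simps)
    then have "BE e \<subseteq> {F \<in> PE. un F \<in> U}"
      using a unit_prime by (auto simp: subset_iff simp del: spec_ob_simps)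
    then show "\<exists>e\<in>F. BE e \<subseteq> {F \<in> PE. un F \<in> U}"
      using e by blast
  qed auto
qed (use unit_prime in \<open>auto simp del: spec_ob_simps\<close>)

lemma unit_image_basic:
  assumes "e \<in> E"
  shows "un ` BE e = BS e"
proof
  show "un ` BE e \<subseteq> BS e"
    using unit_prime assms mem_unitI by (auto simp del: spec_ob_simps)
  show "BS e \<subseteq> un ` BE e"
  proof
    fix A assume A: "A \<in> BS e"
    then have "Dm A \<in> BE e" "A = un (Dm A)"
      using prime_filter_with_projection[OF _ _ assms, of A] Dm_prime by simp_all
    then show "A \<in> un ` BE e" by (rule rev_image_eqI)
  qed
qed

lemma unit_open:
  "open_map (XE) (XS) (un)"
  unfolding open_map_def
proof (intro allI impI)
  fix U assume U: "openin (XE) U"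
  show "openin (XS) (un ` U)"
    unfolding openin_prime_spectrum
  proof (intro conjI ballI)
    show "un ` U \<subseteq> PS"
      using U unit_prime by (auto simp: openin_prime_spectrum simp del: spec_ob_simps)
    fix A assume "A \<in> un ` U"
    then obtain F where F: "F \<in> U" "A = un F" by blast
    obtain e where FP: "F \<in> PE" and e: "e \<in> F" "BE e \<subseteq> U"
      using openin_prime_spectrumE[OF U F(1)] .
    have eE: "e \<in> E" using FP e PE_E by blast
    then have "e \<in> A" unfolding F(2) by (intro mem_unitI e(1)) simp
    moreover have "BS e \<subseteq> un ` U"
      unfolding unit_image_basic[OF eE, symmetric] using e(2) by (rule image_mono)
    ultimately show "\<exists>a\<in>A. BS a \<subseteq> un ` U" by (rule bexI[rotated])
  qed
qed

text \<open>The domain of \<open>D\<close> has to be the domain of the second factor and so determines it.  This factor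
  contains \<open>b \<lambda>(a b) = \<lambda>(a) b\<close>, therefore its codomain contains \<open>\<lambda>(a)\<close> and determines the first factor.\<close>

lemma prime_filter_factor:
  assumes D: "D \<in> PS" "a \<cdot> b \<in> D" and ab: "a \<in> M" "b \<in> M"
  shows "\<exists>A\<in>PS. \<exists>B\<in>PS. a \<in> A \<and> b \<in> B \<and> Dm A = Cd B \<and> D = cmp A B"
proof -
  let ?F = "Dm D"
  have F: "?F \<in> PE" by (rule Dm_prime[OF D(1)])
  have dab: "dm (a \<cdot> b) \<in> ?F" using Dm_I[OF D] .
  then have db: "dm b \<in> ?F" using PE_up[OF F] dm_mul_le ab by simp
  let ?B = "translate S b ?F"
  note B = translate_prime[OF F ab(2) db]
  have "b \<cdot> dm (a \<cdot> b) = dm a \<cdot> b"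
    using proj_mul[of b "dm a"] ab by (simp add: dm_dm_mul)
  then have "dm a \<cdot> b \<in> ?B" using mul_Dm[OF B(1,3), of "dm (a \<cdot> b)"] B(2) dab by simp
  then have da: "dm a \<in> Cd ?B" using mul_mem_Cd[OF B(1)] ab by simp
  let ?A = "translate S a (Cd ?B)"
  note A = translate_prime[OF Cd_prime[OF B(1)] ab(1) da]
  note AB = comp_prime[OF A(1) B(1) A(2)]
  have "D = cmp ?A ?B"
    using prime_filter_eqI_dm[OF D(1) AB(1) D(2) AB(4)[OF A(3) B(3)]] AB(2) B(2) by simp
  then show ?thesis using A B by blast
qed

lemma set_comp_basic:
  assumes "a \<in> M" "b \<in> M"
  shows "set_comp (spec_ob S) (BS a) (BS b) =
    BS (a \<cdot> b)"
proof
  show "set_comp (spec_ob S) (BS a) (BS b) \<subseteq>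
      BS (a \<cdot> b)"
    using comp_prime by (auto simp: set_comp_def)
  show "BS (a \<cdot> b) \<subseteq>
      set_comp (spec_ob S) (BS a) (BS b)"
    using prime_filter_factor[OF _ _ assms] unfolding set_comp_def by fastforce
qed

lemma mem_composable_spec:
  "(A, B) \<in> composable (spec_ob S) \<longleftrightarrow> A \<in> PS \<and> B \<in> PS \<and> Dm A = Cd B"
  by (auto simp: composable_def)

lemma spec_assoc:
  assumes A: "A \<in> PS" and B: "B \<in> PS" and C: "C \<in> PS" and AB: "Dm A = Cd B" and BC: "Dm B = Cd C"
  shows "cmp (cmp A B) C = cmp A (cmp B C)"
proof -
  obtain a b c where abc: "a \<in> A" "b \<in> B" "c \<in> C"
    using PS_ex[OF A] PS_ex[OF B] PS_ex[OF C] by blast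
  note AB' = comp_prime[OF A B AB] and BC' = comp_prime[OF B C BC]
  note l = comp_prime[OF AB'(1) C] and r = comp_prime[OF A BC'(1)]
  have "a \<cdot> b \<cdot> c = a \<cdot> (b \<cdot> c)" using abc A B C PS_M mul_assoc by blast
  then show ?thesis
    using prime_filter_eqI_dm[of "cmp (cmp A B) C" _ "a \<cdot> b \<cdot> c"]
      l(1,2) l(4)[of "a \<cdot> b" c] r(1,2) r(4)[of a "b \<cdot> c"] AB' BC' abc AB BC by simp
qed

lemma spec_unit_laws:
  assumes A: "A \<in> PS"
  shows "cmp A (un (Dm A)) = A"
    "cmp (un (Cd A)) A = A"
proof -
  obtain a where a: "a \<in> A" using PS_ex A by blast
  have aM: "a \<in> M" using A a PS_M by blast
  note u = unit_prime[OF Dm_prime[OF A]] and v = unit_prime[OF Cd_prime[OF A]]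
  have "dm a \<in> un (Dm A)" "cd a \<in> un (Cd A)"
    unfolding mem_unit using Dm_I[OF A a] Cd_I[OF A a] aM by (auto intro: bexI[of _ "dm a"] bexI[of _ "cd a"])
  moreover note Au = comp_prime[OF A u(1)] and vA = comp_prime[OF v(1) A]
  ultimately show "cmp A (un (Dm A)) = A"
    "cmp (un (Cd A)) A = A"
    using prime_filter_eqI_dm[OF _ A, of _ a] prime_filter_eqI_cd[OF _ A, of _ a] u v a aM
      Au(4)[of a "dm a"] vA(4)[of "cd a" a]
    by (simp_all del: spec_ob_simps)
qed

theorem etale_category_spec: "etale_category (spec_ob S)"
  unfolding etale_category_iff spec_ob_simps(1,2) topspace_prime_spectrum mem_composable_spec
proof (intro conjI)
  show "\<forall>W A B. openin (XS) W \<longrightarrow>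
      A \<in> PS \<and> B \<in> PS \<and> Dm A = Cd B \<longrightarrow> cmp A B \<in> W \<longrightarrow>
      (\<exists>U V. openin (XS) U \<and> openin (XS) V \<and>
        A \<in> U \<and> B \<in> V \<and> set_comp (spec_ob S) U V \<subseteq> W)"
  proof (intro allI impI, elim conjE)
    fix W A B assume W: "openin (XS) W" "cmp A B \<in> W"
      and AB: "A \<in> PS" "B \<in> PS" "Dm A = Cd B"
    obtain x where x: "x \<in> cmp A B" "BS x \<subseteq> W"
      using openin_prime_spectrumE[OF W] by blast
    obtain a b where ab: "a \<in> A" "b \<in> B" "a \<cdot> b \<preceq> x" "x \<in> M" using x by (auto simp: mem_comp)
    have M: "a \<in> M" "b \<in> M" using ab AB PS_M by auto
    have "BS (a \<cdot> b) \<subseteq> W" using basic_mono_iff[of "a \<cdot> b" x] M ab x by auto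
    then show "\<exists>U V. openin (XS) U \<and> openin (XS) V \<and>
        A \<in> U \<and> B \<in> V \<and> set_comp (spec_ob S) U V \<subseteq> W"
      using ab AB M set_comp_basic[OF M]
      by (intro exI[of _ "BS a"] exI[of _ "BS b"]) auto
  qed
  show "\<forall>U V. openin (XS) U \<longrightarrow> openin (XS) V \<longrightarrow>
      openin (XS) (set_comp (spec_ob S) U V)"
  proof (intro allI impI)
    fix U V assume UV: "openin (XS) U" "openin (XS) V"
    show "openin (XS) (set_comp (spec_ob S) U V)"
      unfolding openin_prime_spectrum
    proof (intro conjI ballI)
      show "set_comp (spec_ob S) U V \<subseteq> PS"
        using UV[THEN openin_subset] comp_prime(1) by (auto simp: set_comp_def)
      fix D assume "D \<in> set_comp (spec_ob S) U V"
      then obtain A B where AB: "A \<in> U" "B \<in> V" "Dm A = Cd B" "D = cmp A B"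
        by (auto simp: set_comp_def)
      obtain a where a: "A \<in> PS" "a \<in> A" "BS a \<subseteq> U"
        using openin_prime_spectrumE[OF UV(1) AB(1)] .
      obtain b where b: "B \<in> PS" "b \<in> B" "BS b \<subseteq> V"
        using openin_prime_spectrumE[OF UV(2) AB(2)] .
      have "set_comp (spec_ob S) (BS a) (BS b) \<subseteq> set_comp (spec_ob S) U V"
        using a(3) b(3) unfolding set_comp_def by blast
      then have "BS (a \<cdot> b) \<subseteq> set_comp (spec_ob S) U V"
        using set_comp_basic[of a b] a b PS_M by simp
      then show "\<exists>x\<in>D. BS x \<subseteq> set_comp (spec_ob S) U V"
        using comp_prime(4)[OF a(1) b(1) AB(3) a(2) b(2)] AB(4) by blast
    qed
  qed
qed (use Dm_local_homeomorphism Cd_local_homeomorphism unit_continuous unit_open unit_prime comp_prime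
    spec_unit_laws spec_assoc in \<open>auto simp del: spec_ob_simps\<close>)

lemma basic_join:
  assumes "e \<in> E" "f \<in> E"
  shows "BE (e \<squnion> f) = BE e \<union> BE f"
proof
  show "BE (e \<squnion> f) \<subseteq> BE e \<union> BE f"
  proof
    fix F assume "F \<in> BE (e \<squnion> f)"
    then show "F \<in> BE e \<union> BE f"
      using PE_join[OF _ _ assms, of F] by simp
  qed
  show "BE e \<union> BE f \<subseteq> BE (e \<squnion> f)"
    using PE_up[OF _ _ join_E[OF assms]] le_join1[OF assms] le_join2[OF assms] by auto
qed

text \<open>For a cover of the basic set of \<open>e\<close>, the projections whose basic sets have finite subcovers form
  an ideal; if \<open>e\<close> were not in it, a prime filter containing \<open>e\<close> and avoiding the ideal would not be
  covered.\<close>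

lemma compactin_basic_projection:
  assumes e: "e \<in> E" shows "compactin (XE) (BE e)"
  unfolding compactin_def
proof (intro conjI allI impI)
  fix \<U> assume "(\<forall>U\<in>\<U>. openin (XE) U) \<and>
    BE e \<subseteq> \<Union>\<U>"
  then have op: "\<And>U. U \<in> \<U> \<Longrightarrow> openin (XE) U"
    and cover: "BE e \<subseteq> \<Union>\<U>" by auto
  define I where "I = {f\<in>E. \<exists>\<V>. finite \<V> \<and> \<V> \<subseteq> \<U> \<and> BE f \<subseteq> \<Union>\<V>}"
  have "e \<in> I"
  proof (rule ccontr)
    assume eI: "e \<notin> I"
    have "\<exists>F\<in>PE. e \<in> F \<and> F \<inter> I = {}"
    proof (rule prime_filter_avoiding_ideal)
      show "distributive_lattice (projection_order S)"
        using distributive by (simp add: distributive_restriction_semigroup_def)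
      show "e \<in> carrier (projection_order S)" "I \<subseteq> carrier (projection_order S)" "e \<notin> I"
        using e eI by (auto simp: I_def)
      have "BE zr \<subseteq> \<Union>{}" using zr_PE by auto
      then have "zr \<in> I" unfolding I_def by (auto intro!: exI[of _ "{}"])
      then show "I \<noteq> {}" by blast
      show "g \<in> I" if "f \<in> I" "g \<in> carrier (projection_order S)" "g \<sqsubseteq>\<^bsub>projection_order S\<^esub> f" for f g
      proof -
        have "BE g \<subseteq> BE f"
          using that PE_up by (auto simp: I_def)
        then show ?thesis using that unfolding I_def by fastforce
      qed
      show "f \<squnion> g \<in> I" if "f \<in> I" "g \<in> I" for f g
      proof -
        obtain \<V> \<W> where "finite \<V>" "\<V> \<subseteq> \<U>" "BE f \<subseteq> \<Union>\<V>"
          "finite \<W>" "\<W> \<subseteq> \<U>" "BE g \<subseteq> \<Union>\<W>" and fg: "f \<in> E" "g \<in> E"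
          using \<open>f \<in> I\<close> \<open>g \<in> I\<close> unfolding I_def by blast
        moreover have "BE (f \<squnion> g) \<subseteq>
            BE f \<union> BE g"
          using basic_join[OF fg] by simp
        ultimately have "finite (\<V> \<union> \<W>)" "\<V> \<union> \<W> \<subseteq> \<U>"
          "BE (f \<squnion> g) \<subseteq> \<Union>(\<V> \<union> \<W>)" by blast+
        then show ?thesis unfolding I_def using fg join_E by blast
      qed
    qed
    then obtain F where F: "F \<in> PE" "e \<in> F" "F \<inter> I = {}" by blast
    then obtain U where U: "U \<in> \<U>" "F \<in> U" using cover by auto
    then have "openin (XE) U" using op by blast
    then obtain f where f: "f \<in> F" "BE f \<subseteq> U"
      using openin_prime_spectrumE U(2) by blast
    have "f \<in> I" unfolding I_def using f U PE_E[OF F(1)] by (auto intro!: exI[of _ "{U}"])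
    then show False using F f by blast
  qed
  then show "\<exists>\<F>. finite \<F> \<and> \<F> \<subseteq> \<U> \<and> BE e \<subseteq> \<Union>\<F>"
    unfolding I_def by blast
qed auto

lemma basic_mul_projection:
  assumes "e \<in> E" "f \<in> E"
  shows "BE (e \<cdot> f) = BE e \<inter> BE f"
proof (intro Set.set_eqI iffI)
  fix F assume F: "F \<in> BE (e \<cdot> f)"
  then have "e \<in> F" "f \<in> F" using PE_mulD[of F e f] assms by auto
  then show "F \<in> BE e \<inter> BE f" using F by simp
next
  fix F assume "F \<in> BE e \<inter> BE f"
  then show "F \<in> BE (e \<cdot> f)" using PE_mul[of F e f] by simp
qed

lemma compact_open_objects_iff:
  "compact_open (XE) U \<longleftrightarrow> (\<exists>e\<in>E. U = BE e)"
proof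
  assume U: "compact_open (XE) U"
  have "\<exists>B. openin (XE) B \<and>
      (\<exists>e\<in>E. B = BE e \<and> B \<subseteq> U) \<and> F \<in> B" if F: "F \<in> U" for F
  proof -
    have "openin (XE) U" using U by (simp add: compact_open_def)
    then obtain e where "F \<in> PE" "e \<in> F" "BE e \<subseteq> U"
      using openin_prime_spectrumE F by blast
    then show ?thesis using PE_E by (intro exI[of _ "BE e"]) auto
  qed
  then obtain \<F> where F: "finite \<F>" "U \<subseteq> \<Union>\<F>"
    "\<forall>B\<in>\<F>. openin (XE) B \<and> (\<exists>e\<in>E. B = BE e \<and> B \<subseteq> U)"
    using compactin_finite_basis_cover[of _ U "\<lambda>B. \<exists>e\<in>E. B = BE e \<and> B \<subseteq> U"] U
    unfolding compact_open_def by metis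
  have "\<exists>e\<in>E. \<Union>\<F> = BE e" using F(1,3)
  proof (induction \<F> rule: finite_induct)
    case empty
    have "BE zr = {}" using zr_PE by auto
    then show ?case using zr_E by auto
  next
    case (insert B \<F>)
    then obtain e f where "e \<in> E" "f \<in> E" "\<Union>\<F> = BE e" "B = BE f"
      by (metis insertCI)
    then show ?case using basic_join[of f e] by (intro bexI[of _ "f \<squnion> e"]) auto
  qed
  moreover have "\<Union>\<F> = U" using F by blast
  ultimately show "\<exists>e\<in>E. U = BE e" by blast
next
  assume "\<exists>e\<in>E. U = BE e"
  then show "compact_open (XE) U"
    using compactin_basic_projection by (auto simp: compact_open_def)
qed

lemma spectral_objects: "spectral_space (XE)"
  unfolding spectral_space_iff
proof (intro conjI allI impI)
  show "sober_space (XE)"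
    by (rule sober_prime_spectrum[of zr]) simp_all
  fix U F assume UF: "openin (XE) U \<and> F \<in> U"
  then obtain e where "F \<in> PE" "e \<in> F" "BE e \<subseteq> U"
    using openin_prime_spectrumE by blast
  then show "\<exists>K. compact_open (XE) K \<and> F \<in> K \<and> K \<subseteq> U"
    unfolding compact_open_objects_iff using PE_E by (intro exI[of _ "BE e"]) auto
next
  fix K L assume "compact_open (XE) K \<and> compact_open (XE) L"
  then show "compact_open (XE) (K \<inter> L)"
    unfolding compact_open_objects_iff using basic_mul_projection E_mul by metis
qed

lemma Dm_image_basic:
  assumes "a \<in> M" shows "Dm ` BS a = BE (dm a)"
proof
  show "Dm ` BS a \<subseteq> BE (dm a)"
    using Dm_prime Dm_I by auto
  show "BE (dm a) \<subseteq> Dm ` BS a"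
  proof
    fix F assume "F \<in> BE (dm a)"
    then show "F \<in> Dm ` BS a"
      using translate_prime[OF _ assms, of F] by (intro rev_image_eqI[of "translate S a F"]) auto
  qed
qed

lemma Dm_inj_basic: "inj_on Dm (BS a)"
  by (rule inj_onI, rule prime_filter_eqI_dm[where a = a]) auto

lemma Cd_inj_basic: "inj_on Cd (BS a)"
  by (rule inj_onI, rule prime_filter_eqI_cd[where a = a]) auto

text \<open>The basic set of \<open>a\<close> is homeomorphic to that of the projection \<open>\<lambda>(a)\<close>.\<close>

lemma compact_open_basic:
  assumes "a \<in> M" shows "compact_open (XS) (BS a)"
  using compactin_image_iff[of "XS" "XE" Dm
      "BS a" "BS a"] Dm_local_homeomorphism
    Dm_inj_basic Dm_image_basic[OF assms] compactin_basic_projection[of "dm a"] assms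
  by (simp add: local_homeomorphism_iff compact_open_def)

lemma spectral_arrows:
  assumes "has_meets S" shows "spectral_space (XS)"
proof -
  let ?X = "XS"
  have base: "\<exists>a\<in>M. A \<in> BS a \<and> BS a \<subseteq> U"
    if "openin ?X U" "A \<in> U" for U A
    using openin_prime_spectrumE[OF that] PS_M by (metis mem_basic)
  have meet: "\<exists>c\<in>M. BS a \<inter> BS b = BS c"
    if ab: "a \<in> M" "b \<in> M" for a b
  proof -
    obtain c where c: "is_glb (natural_order S) c {a, b}" using assms ab by (auto simp: has_meets_def)
    then have c: "c \<in> M" "c \<preceq> a" "c \<preceq> b" "\<And>d. d \<in> M \<Longrightarrow> d \<preceq> a \<Longrightarrow> d \<preceq> b \<Longrightarrow> d \<preceq> c"
      using ab by (auto simp: is_glb_pair_iff)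
    have "A \<in> BS c" if A: "A \<in> PS" "a \<in> A" "b \<in> A" for A
    proof -
      obtain d where d: "d \<in> A" "d \<preceq> a" "d \<preceq> b" using PS_dir A by blast
      then show ?thesis using PS_up[OF A(1) d(1), of c] c A PS_M by auto
    qed
    then have "BS a \<inter> BS b = BS c"
      using c ab PS_up by auto
    then show ?thesis using c by blast
  qed
  have fin: "\<exists>\<F>. finite \<F> \<and> \<F> \<subseteq> M \<and> K = \<Union>(BS ` \<F>)" if K: "compact_open ?X K" for K
  proof -
    have "\<exists>B. openin ?X B \<and> (\<exists>a\<in>M. B = BS a \<and> B \<subseteq> K) \<and> A \<in> B" if "A \<in> K" for A
      using base[of K A] K that openin_basic unfolding compact_open_def by metis
    then obtain \<F> where F: "finite \<F>" "\<forall>B\<in>\<F>. openin ?X B \<and> (\<exists>a\<in>M. B = BS a \<and> B \<subseteq> K)" "K \<subseteq> \<Union>\<F>"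
      using compactin_finite_basis_cover[of ?X K "\<lambda>B. \<exists>a\<in>M. B = BS a \<and> B \<subseteq> K"] K
      unfolding compact_open_def by metis
    then obtain g where g: "\<And>B. B \<in> \<F> \<Longrightarrow> g B \<in> M \<and> B = BS (g B) \<and> B \<subseteq> K" by metis
    then show ?thesis using F(1,3) by (intro exI[of _ "g ` \<F>"]) fastforce
  qed
  show ?thesis unfolding spectral_space_iff
  proof (intro conjI allI impI)
    show "sober_space ?X" by (rule sober_prime_spectrum[of zr]) simp_all
    show "\<exists>K. compact_open ?X K \<and> A \<in> K \<and> K \<subseteq> U" if "openin ?X U \<and> A \<in> U" for U A
      using base[of U A] that compact_open_basic by blast
    fix K L assume "compact_open ?X K \<and> compact_open ?X L"
    then obtain \<F> \<G> where FG: "finite \<F>" "\<F> \<subseteq> M" "K = \<Union>(BS ` \<F>)"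
      "finite \<G>" "\<G> \<subseteq> M" "L = \<Union>(BS ` \<G>)" using fin by meson
    have "K \<inter> L = \<Union>((\<lambda>(a, b). BS a \<inter> BS b) ` (\<F> \<times> \<G>))"
      using FG by auto
    moreover have "compact_open ?X (BS a \<inter> BS b)"
      if "a \<in> \<F>" "b \<in> \<G>" for a b
      using meet[of a b] that FG compact_open_basic by (metis subsetD)
    ultimately show "compact_open ?X (K \<inter> L)" using FG by (auto intro!: compact_open_Union)
  qed
qed

lemma compact_objects:
  assumes "has_identity S" shows "compact_space (XE)"
proof -
  obtain i where i: "i \<in> M" "\<And>a. a \<in> M \<Longrightarrow> i \<cdot> a = a \<and> a \<cdot> i = a"
    using assms by (auto simp: has_identity_def)
  have "i = dm i" using i(2)[of "dm i"] mul_dm[OF i(1)] i(1) by simp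
  then have iE: "i \<in> E" using dm_E i(1) by metis
  have "PE = BE i"
  proof (intro Set.set_eqI iffI)
    fix F assume F: "F \<in> PE"
    then obtain e where "e \<in> F" "e \<in> E" using PE_ex PE_E by blast
    then show "F \<in> BE i"
      using PE_up[OF F, of e i] iE i(2)[of e] F by (simp add: le_proj_iff)
  qed simp
  then show ?thesis using compactin_basic_projection[OF iE] by (simp add: compact_space_def)
qed

end

lemma etc_object_spec:
  assumes "drs_object v S" shows "etc_object v (spec_ob S)"
proof -
  interpret drs S by (rule drsI) (use assms in \<open>cases v; simp\<close>)
  show ?thesis using assms etale_category_spec spectral_objects spectral_arrows compact_objects
    by (cases v) (auto simp: spectral_category_def strongly_spectral_category_def)
qed

section \<open>Compact open bisections\<close>

text \<open>Open subspaces of spectral spaces are spectral.  Applied to the unit map, this shows that the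
  object space of a strongly spectral etale category is spectral.\<close>

lemma spectral_space_open_embedding:
  assumes f: "continuous_map X Y f" "open_map X Y f" "inj_on f (topspace X)" and Y: "spectral_space Y"
  shows "spectral_space X"
proof -
  have inj: "x = y" if "f x = f y" "x \<in> topspace X" "y \<in> topspace X" for x y
    using f(3) that by (simp add: inj_on_def)
  have fX: "f x \<in> topspace Y" if "x \<in> topspace X" for x
    using f(1) that by (auto simp: continuous_map_def)
  have pre: "openin X {x\<in>topspace X. f x \<in> U}" if "openin Y U" for U
    using f(1) that by (simp add: continuous_map_def)
  have im: "openin Y (f ` U)" if "openin X U" for U
    using f(2) that by (simp add: open_map_def)
  have co: "compact_open X K \<longleftrightarrow> K \<subseteq> topspace X \<and> compact_open Y (f ` K)" for K
  proof
    assume "compact_open X K"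
    then show "K \<subseteq> topspace X \<and> compact_open Y (f ` K)"
      using im image_compactin[OF _ f(1)] openin_subset[of X K] by (auto simp: compact_open_def)
  next
    assume K: "K \<subseteq> topspace X \<and> compact_open Y (f ` K)"
    then have "{x\<in>topspace X. f x \<in> f ` K} = K" using inj by blast
    then have "openin X K" using pre[of "f ` K"] K by (simp add: compact_open_def)
    moreover have "compactin X K"
      using compactin_image_iff[OF f(1,2) openin_topspace f(3), of K] K by (simp add: compact_open_def)
    ultimately show "compact_open X K" by (simp add: compact_open_def)
  qed
  have cl: "f z \<in> Y closure_of (f ` Z) \<longleftrightarrow> z \<in> X closure_of Z"
    if z: "z \<in> topspace X" and Z: "Z \<subseteq> topspace X" for z Z
  proof
    assume l: "f z \<in> Y closure_of (f ` Z)"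
    have "\<exists>y\<in>Z. y \<in> V" if V: "z \<in> V" "openin X V" for V
    proof -
      obtain y where "y \<in> Z" "f y \<in> f ` V" using l V im[OF V(2)] by (auto simp: in_closure_of)
      then show ?thesis using inj Z openin_subset[OF V(2)] by blast
    qed
    then show "z \<in> X closure_of Z" using z by (auto simp: in_closure_of)
  next
    assume l: "z \<in> X closure_of Z"
    have "\<exists>y\<in>Z. f y \<in> V" if V: "f z \<in> V" "openin Y V" for V
    proof -
      have "z \<in> {x\<in>topspace X. f x \<in> V}" using z V(1) by simp
      then obtain y where "y \<in> Z" "y \<in> {x\<in>topspace X. f x \<in> V}"
        using l pre[OF V(2)] unfolding in_closure_of by meson
      then show ?thesis by blast
    qed
    then show "f z \<in> Y closure_of (f ` Z)" using fX[OF z] by (auto simp: in_closure_of)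
  qed
  have sober: "sober_space X" unfolding sober_space_def
  proof (intro allI impI)
    fix Z assume Z: "irreducible_closed X Z"
    then have Zc: "closedin X Z" and Zne: "Z \<noteq> {}" by (auto simp: irreducible_closed_def)
    have ZX: "Z \<subseteq> topspace X" by (rule closedin_subset[OF Zc])
    let ?W = "Y closure_of (f ` Z)"
    have fZ: "f ` Z \<subseteq> topspace Y" using ZX fX by blast
    then have sub: "f ` Z \<subseteq> ?W" by (rule closure_of_subset)
    have "irreducible_closed Y ?W" unfolding irreducible_closed_def
    proof (intro conjI allI impI)
      show "?W \<noteq> {}" using sub Zne by blast
      fix A B assume AB: "closedin Y A \<and> closedin Y B \<and> ?W = A \<union> B"
      have c: "closedin X {x\<in>Z. f x \<in> D}" if "closedin Y D" for D
      proof -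
        have "closedin X {x\<in>topspace X. f x \<in> D}" using f(1) that closedin_continuous_map_preimage by blast
        then have "closedin X (Z \<inter> {x\<in>topspace X. f x \<in> D})" using Zc by blast
        moreover have "Z \<inter> {x\<in>topspace X. f x \<in> D} = {x\<in>Z. f x \<in> D}" using ZX by blast
        ultimately show ?thesis by simp
      qed
      have "Z = {x\<in>Z. f x \<in> A} \<union> {x\<in>Z. f x \<in> B}" using sub AB by blast
      then have "Z = {x\<in>Z. f x \<in> A} \<or> Z = {x\<in>Z. f x \<in> B}"
        using Z c AB unfolding irreducible_closed_def by meson
      then have "f ` Z \<subseteq> A \<or> f ` Z \<subseteq> B" by blast
      then have "?W \<subseteq> A \<or> ?W \<subseteq> B" using closure_of_minimal AB by metis
      then show "?W = A \<or> ?W = B" using AB by blast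
    qed simp
    then obtain y where y: "y \<in> topspace Y" "?W = Y closure_of {y}"
      using Y by (auto simp: spectral_space_def sober_space_def)
    obtain z where z: "z \<in> Z" using Zne by blast
    then have "f z \<in> Y closure_of {y}" using sub y by blast
    then have "y \<in> f ` topspace X"
      using im[OF openin_topspace] z ZX by (auto simp: in_closure_of)
    then obtain x where x: "x \<in> topspace X" "y = f x" by blast
    have mem: "z \<in> Z \<longleftrightarrow> z \<in> X closure_of {x}" if "z \<in> topspace X" for z
      using cl[OF that ZX] cl[OF that, of "{x}"] y x Zc by (simp add: closure_of_closedin)
    moreover have "X closure_of {x} \<subseteq> topspace X" by (rule closure_of_subset_topspace)
    ultimately have Zx: "Z = X closure_of {x}" using ZX by blast
    show "\<exists>!x. x \<in> topspace X \<and> Z = X closure_of {x}"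
    proof (intro ex1I[of _ x])
      fix x' assume x': "x' \<in> topspace X \<and> Z = X closure_of {x'}"
      have mutual: "x \<in> X closure_of {x'}" "x' \<in> X closure_of {x}"
      proof -
        have "x \<in> X closure_of {x}" "x' \<in> X closure_of {x'}" using x x' by (auto simp: in_closure_of)
        then show "x \<in> X closure_of {x'}" "x' \<in> X closure_of {x}" using x' Zx by simp_all
      qed
      have "x \<in> T \<longleftrightarrow> x' \<in> T" if "openin X T" for T
        using mutual that by (auto simp: in_closure_of)
      then have "f x \<in> U \<longleftrightarrow> f x' \<in> U" if "openin Y U" for U
        using pre[OF that] x x' by (metis (no_types, lifting) mem_Collect_eq)
      then have "f x = f x'" using sober_space_T0[of Y "f x" "f x'"] Y fX x x' 
        by (simp add: spectral_space_def)
      then show "x' = x" using inj x x' by metis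
    qed (use x Zx in simp)
  qed
  show ?thesis unfolding spectral_space_iff
  proof (intro conjI allI impI sober)
    fix U x assume U: "openin X U \<and> x \<in> U"
    then obtain K where K: "compact_open Y K" "f x \<in> K" "K \<subseteq> f ` U"
      using Y im[of U] unfolding spectral_space_iff by blast
    have UX: "U \<subseteq> topspace X" using U openin_subset by blast
    have "f ` {y\<in>U. f y \<in> K} = K" using K by blast
    then have "compact_open X {y\<in>U. f y \<in> K}" using co K UX by auto
    then show "\<exists>K. compact_open X K \<and> x \<in> K \<and> K \<subseteq> U" using U K by blast
  next
    fix K L assume KL: "compact_open X K \<and> compact_open X L"
    have "f ` (K \<inter> L) = f ` K \<inter> f ` L"
      using inj KL co by (intro inj_on_image_Int[OF f(3)]) auto
    then show "compact_open X (K \<inter> L)" using KL co Y unfolding spectral_space_iff by auto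
  qed
qed

lemma strongly_spectral_imp_spectral:
  assumes "strongly_spectral_category C" shows "spectral_category C"
proof -
  have C: "etale_category C" "spectral_space (tc_arr C)"
    using assms by (auto simp: strongly_spectral_category_def)
  have u: "continuous_map (tc_obj C) (tc_arr C) (tc_unit C)" "open_map (tc_obj C) (tc_arr C) (tc_unit C)"
    "\<forall>p\<in>objects C. tc_dom C (tc_unit C p) = p"
    using C(1) by (simp_all add: etale_category_iff)
  have "inj_on (tc_unit C) (objects C)" by (rule inj_on_inverseI[of _ "tc_dom C"]) (use u(3) in blast)
  then have "spectral_space (tc_obj C)" using spectral_space_open_embedding u(1,2) C(2) by metis
  then show ?thesis using C by (simp add: spectral_category_def)
qed

locale spectral_etale =
  fixes C :: "'c tcat"
  assumes spectral: "spectral_category C"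
begin

abbreviation X1 where "X1 \<equiv> tc_arr C"
abbreviation X0 where "X0 \<equiv> tc_obj C"
abbreviation d where "d \<equiv> tc_dom C"
abbreviation r where "r \<equiv> tc_cod C"
abbreviation u where "u \<equiv> tc_unit C"
abbreviation cob where "cob \<equiv> compact_open_bisections C"
abbreviation le_bis (infix "\<unlhd>" 50) where "A \<unlhd> B \<equiv> A \<sqsubseteq>\<^bsub>natural_order (bis_ob C)\<^esub> B"

lemma etale: "etale_category C" and spectral_obj: "spectral_space X0"
  using spectral by (auto simp: spectral_category_def)

lemmas etale_facts = etale[unfolded etale_category_iff]

lemma d_cont: "continuous_map X1 X0 d" and d_open: "open_map X1 X0 d"
  and d_locally_inj: "\<And>x. x \<in> arrows C \<Longrightarrow> \<exists>U. openin X1 U \<and> x \<in> U \<and> inj_on d U"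
  and r_cont: "continuous_map X1 X0 r" and r_open: "open_map X1 X0 r"
  and r_locally_inj: "\<And>x. x \<in> arrows C \<Longrightarrow> \<exists>U. openin X1 U \<and> x \<in> U \<and> inj_on r U"
  using etale_facts by (auto simp: local_homeomorphism_iff)

lemma u_cont: "continuous_map X0 X1 u" and u_open: "open_map X0 X1 u"
  and d_u [simp]: "p \<in> objects C \<Longrightarrow> d (u p) = p" and r_u [simp]: "p \<in> objects C \<Longrightarrow> r (u p) = p"
  using etale_facts by auto

lemma d_obj [simp]: "x \<in> arrows C \<Longrightarrow> d x \<in> objects C"
  and r_obj [simp]: "x \<in> arrows C \<Longrightarrow> r x \<in> objects C"
  and u_arr [simp]: "p \<in> objects C \<Longrightarrow> u p \<in> arrows C"
  using d_cont r_cont u_cont by (auto simp: continuous_map_def)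

lemma comp_arr: "(a, b) \<in> composable C \<Longrightarrow> tc_comp C a b \<in> arrows C"
  and d_comp: "(a, b) \<in> composable C \<Longrightarrow> d (tc_comp C a b) = d b"
  and r_comp: "(a, b) \<in> composable C \<Longrightarrow> r (tc_comp C a b) = r a"
  using etale_facts by auto

lemma comp_u [simp]: "a \<in> arrows C \<Longrightarrow> tc_comp C a (u (d a)) = a"
  and u_comp [simp]: "a \<in> arrows C \<Longrightarrow> tc_comp C (u (r a)) a = a"
  using etale_facts by auto

lemma comp_assoc: "(a, b) \<in> composable C \<Longrightarrow> (b, c) \<in> composable C \<Longrightarrow>
    tc_comp C (tc_comp C a b) c = tc_comp C a (tc_comp C b c)"
  using etale_facts by simp

lemma composableI [intro]: "a \<in> arrows C \<Longrightarrow> b \<in> arrows C \<Longrightarrow> d a = r b \<Longrightarrow> (a, b) \<in> composable C"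
  by (simp add: composable_def)

lemma set_comp_open: "openin X1 A \<Longrightarrow> openin X1 B \<Longrightarrow> openin X1 (set_comp C A B)"
  using etale_facts by simp

lemma compact_open_Int: "compact_open X0 U \<Longrightarrow> compact_open X0 V \<Longrightarrow> compact_open X0 (U \<inter> V)"
  using spectral_obj unfolding spectral_space_iff by blast

lemma compact_open_basis: "openin X0 U \<Longrightarrow> p \<in> U \<Longrightarrow> \<exists>K. compact_open X0 K \<and> p \<in> K \<and> K \<subseteq> U"
  using spectral_obj unfolding spectral_space_iff by blast

lemma objects_T0:
  assumes "p \<in> objects C" "q \<in> objects C" "\<And>U. compact_open X0 U \<Longrightarrow> p \<in> U \<longleftrightarrow> q \<in> U"
  shows "p = q"
proof (rule sober_space_T0[of X0])
  show "sober_space X0" using spectral_obj by (simp add: spectral_space_def)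
  fix U assume U: "openin X0 U"
  show "p \<in> U \<longleftrightarrow> q \<in> U"
    using compact_open_basis[OF U, of p] compact_open_basis[OF U, of q] assms(3) by blast
qed (use assms in auto)

text \<open>A bisection is homeomorphic to its domain, so its compactness is visible in the object space.\<close>

lemma mem_cob:
  "B \<in> cob \<longleftrightarrow> openin X1 B \<and> inj_on d B \<and> inj_on r B \<and> compactin X0 (d ` B)"
  using compactin_image_iff[OF d_cont d_open, of B B]
  by (auto simp: compact_open_bisections_def compact_open_def)

lemma cob_arrows: "B \<in> cob \<Longrightarrow> x \<in> B \<Longrightarrow> x \<in> arrows C"
  using openin_subset by (auto simp: mem_cob)

lemma cob_compact_open: "B \<in> cob \<Longrightarrow> compact_open X1 B"
  and cob_d: "B \<in> cob \<Longrightarrow> compact_open X0 (d ` B)"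
  and cob_r: "B \<in> cob \<Longrightarrow> compact_open X0 (r ` B)"
  using d_open r_open image_compactin[OF _ d_cont, of B] image_compactin[OF _ r_cont, of B]
  by (auto simp: compact_open_bisections_def compact_open_def open_map_def)

lemma cob_inj_d: "B \<in> cob \<Longrightarrow> x \<in> B \<Longrightarrow> y \<in> B \<Longrightarrow> d x = d y \<Longrightarrow> x = y"
  and cob_inj_r: "B \<in> cob \<Longrightarrow> x \<in> B \<Longrightarrow> y \<in> B \<Longrightarrow> r x = r y \<Longrightarrow> x = y"
  by (auto simp: mem_cob inj_on_def)

lemma cob_subset: "compact_open X1 A \<Longrightarrow> A \<subseteq> B \<Longrightarrow> B \<in> cob \<Longrightarrow> A \<in> cob"
  by (auto simp: compact_open_bisections_def intro: inj_on_subset)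

text \<open>Around \<open>x\<close> there is a neighbourhood on which both the domain and the codomain map are injective; restricting
  it to a compact open set of domains makes it compact.\<close>

lemma cob_basis:
  assumes "openin X1 W" "x \<in> W" shows "\<exists>B\<in>cob. x \<in> B \<and> B \<subseteq> W"
proof -
  have x: "x \<in> arrows C" using assms openin_subset by blast
  obtain U V where U: "openin X1 U" "x \<in> U" "inj_on d U" and V: "openin X1 V" "x \<in> V" "inj_on r V"
    using d_locally_inj[OF x] r_locally_inj[OF x] by blast
  let ?N = "W \<inter> U \<inter> V"
  have N: "openin X1 ?N" "x \<in> ?N" using assms U V by (auto intro!: openin_Int)
  then have "openin X0 (d ` ?N)" using d_open by (simp add: open_map_def)
  then obtain K where K: "compact_open X0 K" "d x \<in> K" "K \<subseteq> d ` ?N"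
    using compact_open_basis N by blast
  let ?B = "?N \<inter> {y\<in>arrows C. d y \<in> K}"
  have "openin X1 {y\<in>arrows C. d y \<in> K}"
    using d_cont K(1) by (simp add: continuous_map_def compact_open_def)
  then have "openin X1 ?B" using N by blast
  moreover have "d ` ?B = K"
  proof (intro Set.set_eqI iffI)
    fix p assume p: "p \<in> K"
    then obtain y where "y \<in> ?N" "p = d y" using K(3) by blast
    then show "p \<in> d ` ?B" using openin_subset[OF N(1)] p by blast
  qed blast
  moreover have "inj_on d ?B" "inj_on r ?B" using U V by (auto simp: inj_on_def)
  ultimately have "?B \<in> cob" using K(1) by (simp add: mem_cob compact_open_def)
  moreover have "x \<in> ?B" "?B \<subseteq> W" using N x K(2) by auto
  ultimately show ?thesis by (intro bexI[of _ ?B] conjI)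
qed

lemma unit_cob: "compact_open X0 U \<Longrightarrow> u ` U \<in> cob"
proof -
  assume U: "compact_open X0 U"
  have UX: "\<And>p. p \<in> U \<Longrightarrow> p \<in> objects C" using compact_open_subset[OF U] by blast
  have "openin X1 (u ` U)" using u_open U by (simp add: open_map_def compact_open_def)
  moreover have "d ` u ` U = U" using UX by (force simp: image_iff)
  moreover have "inj_on d (u ` U)" "inj_on r (u ` U)" using UX by (auto simp: inj_on_def)
  ultimately show ?thesis using U by (simp add: mem_cob compact_open_def)
qed

lemma d_unit_image [simp]: "U \<subseteq> objects C \<Longrightarrow> d ` u ` U = U"
  and r_unit_image [simp]: "U \<subseteq> objects C \<Longrightarrow> r ` u ` U = U"
  by (force simp: image_iff)+

lemma set_comp_unit: "A \<subseteq> arrows C \<Longrightarrow> U \<subseteq> objects C \<Longrightarrow> set_comp C A (u ` U) = {a\<in>A. d a \<in> U}"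
  unfolding set_comp_def by (force simp: subset_iff)

lemma unit_set_comp: "A \<subseteq> arrows C \<Longrightarrow> U \<subseteq> objects C \<Longrightarrow> set_comp C (u ` U) A = {a\<in>A. r a \<in> U}"
  unfolding set_comp_def by (force simp: subset_iff)

text \<open>The domain of \<open>A B\<close> equals that of the part of \<open>B\<close> with codomains in the domain of \<open>A\<close>.  This part is compact
  because its set of codomains is an intersection of two compact open sets of objects.\<close>

lemma set_comp_cob:
  assumes A: "A \<in> cob" and B: "B \<in> cob" shows "set_comp C A B \<in> cob"
proof -
  have comp: "(a, b) \<in> composable C" if "a \<in> A" "b \<in> B" "d a = r b" for a b
    using that cob_arrows[OF A] cob_arrows[OF B] by (intro composableI) auto
  have "openin X1 (set_comp C A B)" using A B set_comp_open by (simp add: mem_cob)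
  moreover have "inj_on d (set_comp C A B)"
  proof (rule inj_onI)
    fix x y assume "x \<in> set_comp C A B" "y \<in> set_comp C A B" and dxy: "d x = d y"
    then obtain a b a' b' where ab: "x = tc_comp C a b" "a \<in> A" "b \<in> B" "d a = r b"
      "y = tc_comp C a' b'" "a' \<in> A" "b' \<in> B" "d a' = r b'" unfolding set_comp_def by blast
    have "d b = d b'" using dxy ab(1,5) d_comp[OF comp[OF ab(2,3,4)]] d_comp[OF comp[OF ab(6,7,8)]] by simp
    then have "b = b'" using cob_inj_d[OF B ab(3,7)] by blast
    then have "a = a'" using ab(2,4,6,8) cob_inj_d[OF A] by metis
    then show "x = y" using ab(1,5) \<open>b = b'\<close> by simp
  qed
  moreover have "inj_on r (set_comp C A B)"
  proof (rule inj_onI)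
    fix x y assume "x \<in> set_comp C A B" "y \<in> set_comp C A B" and rxy: "r x = r y"
    then obtain a b a' b' where ab: "x = tc_comp C a b" "a \<in> A" "b \<in> B" "d a = r b"
      "y = tc_comp C a' b'" "a' \<in> A" "b' \<in> B" "d a' = r b'" unfolding set_comp_def by blast
    have "r a = r a'" using rxy ab(1,5) r_comp[OF comp[OF ab(2,3,4)]] r_comp[OF comp[OF ab(6,7,8)]] by simp
    then have "a = a'" using cob_inj_r[OF A ab(2,6)] by blast
    then have "b = b'" using ab(3,4,7,8) cob_inj_r[OF B] by metis
    then show "x = y" using ab(1,5) \<open>a = a'\<close> by simp
  qed
  moreover have "compactin X0 (d ` set_comp C A B)"
  proof -
    let ?B = "{b\<in>B. r b \<in> d ` A}"
    have "r ` ?B = r ` B \<inter> d ` A" by blast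
    then have "compact_open X0 (r ` ?B)" using compact_open_Int cob_r[OF B] cob_d[OF A] by simp
    then have "compactin X1 ?B"
      using compactin_image_iff[OF r_cont r_open, of B ?B] B by (auto simp: mem_cob compact_open_def)
    moreover have "d ` set_comp C A B = d ` ?B"
    proof (intro Set.set_eqI iffI)
      fix p assume "p \<in> d ` set_comp C A B"
      then obtain a b where ab: "a \<in> A" "b \<in> B" "d a = r b" "p = d (tc_comp C a b)"
        unfolding set_comp_def by blast
      then have "p = d b" "b \<in> ?B" using comp d_comp by (auto simp: image_iff) metis
      then show "p \<in> d ` ?B" by blast
    next
      fix p assume "p \<in> d ` ?B"
      then obtain a b where ab: "a \<in> A" "b \<in> B" "d a = r b" "p = d b" by force
      then have "p = d (tc_comp C a b)" using comp d_comp by simp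
      then show "p \<in> d ` set_comp C A B" using ab unfolding set_comp_def by blast
    qed
    ultimately show ?thesis using image_compactin[OF _ d_cont] by simp
  qed
  ultimately show ?thesis by (simp add: mem_cob)
qed

lemma d_set_comp:
  assumes "A \<subseteq> arrows C" "B \<subseteq> arrows C" shows "d ` set_comp C A B = {d b | b. b \<in> B \<and> r b \<in> d ` A}"
proof (intro Set.set_eqI iffI)
  fix p assume "p \<in> d ` set_comp C A B"
  then obtain a b where ab: "a \<in> A" "b \<in> B" "d a = r b" "p = d (tc_comp C a b)"
    unfolding set_comp_def by blast
  then have "p = d b" using assms by (auto intro!: d_comp)
  then show "p \<in> {d b | b. b \<in> B \<and> r b \<in> d ` A}" using ab(1-3) by (auto intro!: exI[of _ b] rev_image_eqI[of a])
next
  fix p assume "p \<in> {d b | b. b \<in> B \<and> r b \<in> d ` A}"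
  then obtain a b where ab: "a \<in> A" "b \<in> B" "d a = r b" "p = d b" by force
  then have "p = d (tc_comp C a b)" using assms by (auto intro!: d_comp[symmetric])
  then show "p \<in> d ` set_comp C A B" using ab unfolding set_comp_def by blast
qed

lemma r_set_comp:
  assumes "A \<subseteq> arrows C" "B \<subseteq> arrows C" shows "r ` set_comp C A B = {r a | a. a \<in> A \<and> d a \<in> r ` B}"
proof (intro Set.set_eqI iffI)
  fix p assume "p \<in> r ` set_comp C A B"
  then obtain a b where ab: "a \<in> A" "b \<in> B" "d a = r b" "p = r (tc_comp C a b)"
    unfolding set_comp_def by blast
  then have "p = r a" using assms by (auto intro!: r_comp)
  then show "p \<in> {r a | a. a \<in> A \<and> d a \<in> r ` B}" using ab(1-3) by (auto intro!: exI[of _ a] rev_image_eqI[of b])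
next
  fix p assume "p \<in> {r a | a. a \<in> A \<and> d a \<in> r ` B}"
  then obtain a b where ab: "a \<in> A" "b \<in> B" "d a = r b" "p = r a" by force
  then have "p = r (tc_comp C a b)" using assms by (auto intro!: r_comp[symmetric])
  then show "p \<in> r ` set_comp C A B" using ab unfolding set_comp_def by blast
qed

lemma set_comp_assoc:
  assumes "A \<subseteq> arrows C" "B \<subseteq> arrows C" "D \<subseteq> arrows C"
  shows "set_comp C (set_comp C A B) D = set_comp C A (set_comp C B D)"
proof (intro Set.set_eqI iffI)
  fix x assume "x \<in> set_comp C (set_comp C A B) D"
  then obtain a b c where abc: "a \<in> A" "b \<in> B" "d a = r b" "c \<in> D" "d (tc_comp C a b) = r c"
    "x = tc_comp C (tc_comp C a b) c" unfolding set_comp_def by blast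
  have ab: "(a, b) \<in> composable C" using abc assms by blast
  then have bc: "(b, c) \<in> composable C" using abc assms d_comp[OF ab] by auto
  have "x = tc_comp C a (tc_comp C b c)" "d a = r (tc_comp C b c)" "d b = r c"
    using abc ab bc comp_assoc d_comp r_comp by auto
  then show "x \<in> set_comp C A (set_comp C B D)" using abc unfolding set_comp_def by blast
next
  fix x assume "x \<in> set_comp C A (set_comp C B D)"
  then obtain a b c where abc: "a \<in> A" "b \<in> B" "d b = r c" "c \<in> D" "d a = r (tc_comp C b c)"
    "x = tc_comp C a (tc_comp C b c)" unfolding set_comp_def by blast
  have bc: "(b, c) \<in> composable C" using abc assms by blast
  then have ab: "(a, b) \<in> composable C" using abc assms r_comp[OF bc] by auto
  have "x = tc_comp C (tc_comp C a b) c" "d (tc_comp C a b) = r c" "d a = r b"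
    using abc ab bc comp_assoc d_comp r_comp by auto
  then show "x \<in> set_comp C (set_comp C A B) D" using abc unfolding set_comp_def by blast
qed

end

lemma bis_ob_simps [simp]:
  "carrier (bis_ob C) = compact_open_bisections C"
  "rs_mult (bis_ob C) A B = set_comp C A B"
  "rs_dom (bis_ob C) A = tc_unit C ` tc_dom C ` A"
  "rs_cod (bis_ob C) A = tc_unit C ` tc_cod C ` A"
  by (simp_all add: bis_ob_def set_comp_def)

lemma mem_proj_bis: "e \<in> rs_proj (bis_ob C) \<longleftrightarrow> (\<exists>U. compact_open (tc_obj C) U \<and> e = tc_unit C ` U)"
  by (auto simp: bis_ob_def)

context spectral_etale
begin

lemma cob_subset_arrows: "B \<in> cob \<Longrightarrow> B \<subseteq> arrows C"
  using cob_arrows by blast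

lemma unit_Int: "U \<subseteq> objects C \<Longrightarrow> V \<subseteq> objects C \<Longrightarrow> set_comp C (u ` U) (u ` V) = u ` (U \<inter> V)"
  by (subst set_comp_unit) (auto simp: subset_iff)

lemma restriction_semigroup_bis: "restriction_semigroup (bis_ob C)"
proof -
  have "ehresmann_semigroup (bis_ob C)"
    unfolding ehresmann_semigroup_def bis_ob_simps
  proof (intro conjI ballI)
    show "rs_proj (bis_ob C) \<subseteq> cob" by (auto simp: mem_proj_bis unit_cob)
    show "rs_proj (bis_ob C) \<noteq> {}" using mem_proj_bis[of "u ` {}" C] compact_open_empty by blast
    fix A B assume A: "A \<in> cob" and B: "B \<in> cob"
    note A' = cob_subset_arrows[OF A] and B' = cob_subset_arrows[OF B]
    have dA: "d ` A \<subseteq> objects C" and rB: "r ` B \<subseteq> objects C" and rA: "r ` A \<subseteq> objects C"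
      using A' B' by auto
    have 1: "set_comp C (u ` d ` A) B = {b\<in>B. r b \<in> d ` A}" using unit_set_comp[OF B' dA] .
    show "u ` d ` set_comp C (u ` d ` A) B = u ` d ` set_comp C A B"
      unfolding d_set_comp[OF A' B'] 1 by (rule arg_cong[of _ _ "image u"]) blast
    have 2: "set_comp C A (u ` r ` B) = {a\<in>A. d a \<in> r ` B}" using set_comp_unit[OF A' rB] .
    show "u ` r ` set_comp C A (u ` r ` B) = u ` r ` set_comp C A B"
      unfolding r_set_comp[OF A' B'] 2 by (rule arg_cong[of _ _ "image u"]) blast
    show "set_comp C A B \<in> cob" using A B by (rule set_comp_cob)
    show "set_comp C (set_comp C A B) D = set_comp C A (set_comp C B D)" if "D \<in> cob" for D
      using set_comp_assoc[OF A' B' cob_subset_arrows[OF that]] .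
    show "u ` d ` A \<in> rs_proj (bis_ob C)" "u ` r ` A \<in> rs_proj (bis_ob C)"
      unfolding mem_proj_bis using cob_d[OF A] cob_r[OF A] by blast+
    show "set_comp C A (u ` d ` A) = A" "set_comp C (u ` r ` A) A = A"
      using set_comp_unit[OF A' dA] unit_set_comp[OF A' rA] by auto
  next
    fix e f assume "e \<in> rs_proj (bis_ob C)" "f \<in> rs_proj (bis_ob C)"
    then obtain U V where UV: "compact_open X0 U" "e = u ` U" "compact_open X0 V" "f = u ` V"
      by (auto simp: mem_proj_bis)
    note UX = compact_open_subset[OF UV(1)] compact_open_subset[OF UV(3)]
    show "set_comp C e e = e" using UV unit_Int UX by simp
    show "u ` d ` e = e" "u ` r ` e = e" using UV UX by simp_all
    show "set_comp C e f = set_comp C f e" using UV UX by (simp add: unit_Int Int_commute)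
    show "set_comp C e f \<in> rs_proj (bis_ob C)"
      unfolding mem_proj_bis UV(2,4) unit_Int[OF UX] using compact_open_Int[OF UV(1,3)] by blast
  qed
  moreover have "set_comp C f A = set_comp C A (u ` d ` set_comp C f A) \<and>
      set_comp C A f = set_comp C (u ` r ` set_comp C A f) A"
    if A: "A \<in> cob" and f: "f \<in> rs_proj (bis_ob C)" for A f
  proof -
    obtain U where U: "compact_open X0 U" "f = u ` U" using f by (auto simp: mem_proj_bis)
    note UX = compact_open_subset[OF U(1)] and A' = cob_subset_arrows[OF A]
    have "d ` {a\<in>A. r a \<in> U} \<subseteq> objects C" "r ` {a\<in>A. d a \<in> U} \<subseteq> objects C" using A' by auto
    then have "set_comp C A (u ` d ` {a\<in>A. r a \<in> U}) = {a\<in>A. d a \<in> d ` {a\<in>A. r a \<in> U}}"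
      "set_comp C (u ` r ` {a\<in>A. d a \<in> U}) A = {a\<in>A. r a \<in> r ` {a\<in>A. d a \<in> U}}"
      using set_comp_unit[OF A'] unit_set_comp[OF A'] by auto
    moreover have "{a\<in>A. d a \<in> d ` {a\<in>A. r a \<in> U}} = {a\<in>A. r a \<in> U}"
      "{a\<in>A. r a \<in> r ` {a\<in>A. d a \<in> U}} = {a\<in>A. d a \<in> U}"
      using cob_inj_d[OF A] cob_inj_r[OF A] by blast+
    ultimately show ?thesis using U set_comp_unit[OF A' UX] unit_set_comp[OF A' UX] by simp
  qed
  ultimately show ?thesis by (simp add: restriction_semigroup_def)
qed

interpretation B: restriction_sg "bis_ob C"
  by unfold_locales (rule restriction_semigroup_bis)

text \<open>The product of \<open>B\<close> with the projection on the domain of \<open>A\<close> is the part of \<open>B\<close> over that domain.\<close>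

lemma le_bis_iff:
  assumes A: "A \<in> cob" and B: "B \<in> cob"
  shows "A \<unlhd> B \<longleftrightarrow> A \<subseteq> B"
proof -
  have dA: "d ` A \<subseteq> objects C" using cob_subset_arrows[OF A] by auto
  have "A \<unlhd> B \<longleftrightarrow> A = {b\<in>B. d b \<in> d ` A}"
    using B.le_iff_mul_dm[of B A] A B set_comp_unit[OF cob_subset_arrows[OF B] dA] by simp
  also have "\<dots> \<longleftrightarrow> A \<subseteq> B" using cob_inj_d[OF B] by blast
  finally show ?thesis .
qed

text \<open>Compatibility of bisections says that arrows of \<open>A\<close> and \<open>B\<close> with equal domains or equal codomains are equal,
  which is injectivity on the union.\<close>

lemma compatible_Un:
  assumes A: "A \<in> cob" and B: "B \<in> cob" and c: "compatible (bis_ob C) A B" shows "A \<union> B \<in> cob"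
proof -
  note A' = cob_subset_arrows[OF A] and B' = cob_subset_arrows[OF B]
  have o: "d ` A \<subseteq> objects C" "d ` B \<subseteq> objects C" "r ` A \<subseteq> objects C" "r ` B \<subseteq> objects C"
    using A' B' by auto
  have eq: "{a\<in>A. d a \<in> d ` B} = {b\<in>B. d b \<in> d ` A}" "{a\<in>A. r a \<in> r ` B} = {b\<in>B. r b \<in> r ` A}"
    using c set_comp_unit[OF A' o(2)] set_comp_unit[OF B' o(1)] unit_set_comp[OF A' o(4)]
      unit_set_comp[OF B' o(3)] by (simp_all add: compatible_def)
  have cross: "a = b" if "a \<in> A" "b \<in> B" "d a = d b \<or> r a = r b" for a b
  proof -
    have "a \<in> B"
    proof (cases "d a = d b")
      case True
      then have "a \<in> {a\<in>A. d a \<in> d ` B}" using that by blast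
      then show ?thesis unfolding eq(1) by blast
    next
      case False
      then have "a \<in> {a\<in>A. r a \<in> r ` B}" using that by blast
      then show ?thesis unfolding eq(2) by blast
    qed
    then show ?thesis using that cob_inj_d[OF B] cob_inj_r[OF B] by blast
  qed
  have "inj_on d (A \<union> B)" "inj_on r (A \<union> B)"
    using cross cob_inj_d[OF A] cob_inj_d[OF B] cob_inj_r[OF A] cob_inj_r[OF B]
    unfolding inj_on_def by (metis UnE)+
  then show ?thesis
    using compact_open_Un[OF cob_compact_open[OF A] cob_compact_open[OF B]]
    by (simp add: compact_open_bisections_def)
qed

lemma is_lub_bis:
  assumes A: "A \<in> cob" and B: "B \<in> cob"
  shows "is_lub (natural_order (bis_ob C)) D {A, B} \<longleftrightarrow> D \<in> cob \<and> D = A \<union> B"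
proof -
  have iff: "is_lub (natural_order (bis_ob C)) D {A, B} \<longleftrightarrow>
      D \<in> cob \<and> A \<subseteq> D \<and> B \<subseteq> D \<and> (\<forall>F\<in>cob. A \<subseteq> F \<longrightarrow> B \<subseteq> F \<longrightarrow> D \<subseteq> F)"
    using A B by (subst is_lub_pair_iff) (simp_all add: le_bis_iff cong: conj_cong)
  show ?thesis
  proof
    assume "is_lub (natural_order (bis_ob C)) D {A, B}"
    then have D: "D \<in> cob" "A \<subseteq> D" "B \<subseteq> D" "\<forall>F\<in>cob. A \<subseteq> F \<longrightarrow> B \<subseteq> F \<longrightarrow> D \<subseteq> F"
      unfolding iff by auto
    have "A \<union> B \<in> cob"
      using cob_subset[OF compact_open_Un[OF cob_compact_open[OF A] cob_compact_open[OF B]] _ D(1)] D(2,3)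
      by simp
    then have "D \<subseteq> A \<union> B" using D(4) by simp
    then show "D \<in> cob \<and> D = A \<union> B" using D by auto
  next
    assume "D \<in> cob \<and> D = A \<union> B"
    then have D: "D \<in> cob" "D = A \<union> B" by blast+
    show "is_lub (natural_order (bis_ob C)) D {A, B}" unfolding iff using D(1) unfolding D(2) by simp
  qed
qed

theorem drs_bis: "distributive_restriction_semigroup (bis_ob C)"
proof (rule distributive_restriction_semigroupI[OF restriction_semigroup_bis, of "{}"])
  show "{} \<in> rs_proj (bis_ob C)" using mem_proj_bis[of "{}" C] compact_open_empty by auto
  show "rs_mult (bis_ob C) a {} = {} \<and> rs_mult (bis_ob C) {} a = {}" for a
    by (simp add: set_comp_def)
next
  fix a b assume "a \<in> carrier (bis_ob C)" "b \<in> carrier (bis_ob C)" "compatible (bis_ob C) a b"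
  then show "\<exists>c. is_lub (natural_order (bis_ob C)) c {a, b}"
    using is_lub_bis[of a b] compatible_Un[of a b] by auto
next
  fix e f assume "e \<in> rs_proj (bis_ob C)" "f \<in> rs_proj (bis_ob C)"
  then obtain U V where UV: "compact_open X0 U" "e = u ` U" "compact_open X0 V" "f = u ` V"
    by (auto simp: mem_proj_bis)
  note UX = compact_open_subset[OF UV(1)] compact_open_subset[OF UV(3)]
  have j: "compact_open X0 (U \<union> V)" using compact_open_Un UV by blast
  have dist: "set_comp C g (u ` (U \<union> V)) \<unlhd> h"
    if gh: "g \<in> rs_proj (bis_ob C)" "h \<in> rs_proj (bis_ob C)"
      "set_comp C g e \<unlhd> h" "set_comp C g f \<unlhd> h"
    for g h
  proof -
    have gc: "g \<in> cob" "h \<in> cob" using gh by (auto simp: mem_proj_bis unit_cob)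
    note gX = cob_subset_arrows[OF gc(1)]
    have "set_comp C g e \<in> cob" "set_comp C g f \<in> cob" "set_comp C g (u ` (U \<union> V)) \<in> cob"
      using set_comp_cob gc(1) unit_cob UV j by simp_all
    then show ?thesis
      using gh(3,4) gc UV UX set_comp_unit[OF gX, of U] set_comp_unit[OF gX, of V]
        set_comp_unit[OF gX, of "U \<union> V"] by (auto simp: le_bis_iff)
  qed
  have "u ` (U \<union> V) \<in> rs_proj (bis_ob C)" using mem_proj_bis j by blast
  moreover have "e \<unlhd> u ` (U \<union> V)"
    "f \<unlhd> u ` (U \<union> V)"
    using UV unit_cob j by (auto simp: le_bis_iff)
  ultimately show "\<exists>j\<in>rs_proj (bis_ob C). e \<unlhd> j \<and>
      f \<unlhd> j \<and> (\<forall>g\<in>rs_proj (bis_ob C). \<forall>h\<in>rs_proj (bis_ob C).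
        rs_mult (bis_ob C) g e \<unlhd> h \<longrightarrow>
        rs_mult (bis_ob C) g f \<unlhd> h \<longrightarrow>
        rs_mult (bis_ob C) g j \<unlhd> h)"
    using dist by (intro bexI[of _ "u ` (U \<union> V)"]) auto
qed

lemma has_meets_bis:
  assumes "spectral_space X1" shows "has_meets (bis_ob C)"
  unfolding has_meets_def bis_ob_simps
proof (intro ballI)
  fix A B assume AB: "A \<in> cob" "B \<in> cob"
  then have "compact_open X1 (A \<inter> B)"
    using assms cob_compact_open unfolding spectral_space_iff by blast
  then have "A \<inter> B \<in> cob" using cob_subset[of "A \<inter> B" A] AB by blast
  then have "is_glb (natural_order (bis_ob C)) (A \<inter> B) {A, B}"
    using AB by (subst is_glb_pair_iff) (auto simp: le_bis_iff)
  then show "\<exists>D. is_glb (natural_order (bis_ob C)) D {A, B}" by blast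
qed

lemma has_identity_bis:
  assumes "compact_space X0" shows "has_identity (bis_ob C)"
  unfolding has_identity_def bis_ob_simps
proof (intro bexI ballI)
  show "u ` objects C \<in> cob"
    using unit_cob[of "objects C"] assms by (simp add: compact_open_def compact_space_def)
  fix A assume "A \<in> cob"
  then show "set_comp C (u ` objects C) A = A \<and> set_comp C A (u ` objects C) = A"
    using set_comp_unit[OF cob_subset_arrows, of A "objects C"]
      unit_set_comp[OF cob_subset_arrows, of A "objects C"] cob_arrows by auto
qed

end

lemma etc_object_spectral: "etc_object v C \<Longrightarrow> spectral_category C"
  using strongly_spectral_imp_spectral by (cases v) auto

lemma drs_object_bis:
  assumes "etc_object v C" shows "drs_object v (bis_ob C)"
proof -
  interpret spectral_etale C by unfold_locales (rule etc_object_spectral[OF assms])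
  show ?thesis using assms drs_bis has_meets_bis has_identity_bis
    by (cases v) (auto simp: strongly_spectral_category_def)
qed

section \<open>Points of an etale category as prime filters of bisections\<close>

definition pt :: "'c tcat \<Rightarrow> 'c \<Rightarrow> 'c set set" where
  "pt C x = {B \<in> compact_open_bisections C. x \<in> B}"

definition pt0 :: "'c tcat \<Rightarrow> 'c \<Rightarrow> 'c set set" where
  "pt0 C p = {tc_unit C ` U | U. compact_open (tc_obj C) U \<and> p \<in> U}"

sublocale spectral_etale \<subseteq> B: drs "bis_ob C"
  by (rule drsI[OF drs_bis])

context spectral_etale
begin

lemma mem_pt [simp]: "B \<in> pt C x \<longleftrightarrow> B \<in> cob \<and> x \<in> B"
  by (simp add: pt_def)

lemma mem_pt0: "e \<in> pt0 C p \<longleftrightarrow> (\<exists>U. compact_open X0 U \<and> p \<in> U \<and> e = u ` U)"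
  by (auto simp: pt0_def)

lemma proj_bisE:
  assumes "e \<in> rs_proj (bis_ob C)" obtains U where "compact_open X0 U" "e = u ` U"
  using assms by (auto simp: mem_proj_bis)

lemma unit_image_inj:
  assumes "compact_open X0 U" "compact_open X0 V" "u ` U = u ` V" shows "U = V"
  using d_unit_image[OF compact_open_subset[OF assms(1)]] d_unit_image[OF compact_open_subset[OF assms(2)]]
  unfolding assms(3) by (rule trans[OF sym])

lemma unit_image_mem_pt0:
  assumes "compact_open X0 U" shows "u ` U \<in> pt0 C p \<longleftrightarrow> p \<in> U"
proof
  assume "u ` U \<in> pt0 C p"
  then obtain V where "compact_open X0 V" "p \<in> V" "u ` U = u ` V" unfolding mem_pt0 by blast
  then show "p \<in> U" using unit_image_inj[OF assms] by simp
next
  assume "p \<in> U"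
  then show "u ` U \<in> pt0 C p" unfolding mem_pt0 using assms by blast
qed

lemma zr_bis: "B.zr = {}"
  using B.zr_mul[of "{}"] by (simp add: set_comp_def mem_cob)

lemma le_unit_image:
  assumes "compact_open X0 U" "compact_open X0 V"
  shows "u ` U \<unlhd> u ` V \<longleftrightarrow> U \<subseteq> V"
proof -
  have "u ` U \<subseteq> u ` V \<longleftrightarrow> U \<subseteq> V"
    using d_unit_image[OF compact_open_subset[OF assms(1)]] d_unit_image[OF compact_open_subset[OF assms(2)]]
    by (metis image_mono)
  then show ?thesis using le_bis_iff unit_cob assms by simp
qed

lemma bis_join:
  assumes "compact_open X0 U" "compact_open X0 V"
  shows "u ` U \<squnion>\<^bsub>projection_order (bis_ob C)\<^esub> u ` V = u ` (U \<union> V)"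
proof -
  have UV: "compact_open X0 (U \<union> V)" using compact_open_Un assms by blast
  have E: "u ` U \<in> rs_proj (bis_ob C)" "u ` V \<in> rs_proj (bis_ob C)" "u ` (U \<union> V) \<in> rs_proj (bis_ob C)"
    using assms UV mem_proj_bis by blast+
  have "is_lub (projection_order (bis_ob C)) (u ` (U \<union> V)) {u ` U, u ` V}"
  proof (subst is_lub_pair_iff, goal_cases)
    case 3
    have "u ` (U \<union> V) \<unlhd> h"
      if h: "h \<in> rs_proj (bis_ob C)" "u ` U \<unlhd> h"
        "u ` V \<unlhd> h" for h
    proof -
      obtain W where W: "compact_open X0 W" "h = u ` W" using h(1) by (rule proj_bisE)
      have "U \<subseteq> W" "V \<subseteq> W"
        using h(2,3) le_unit_image[OF assms(1) W(1)] le_unit_image[OF assms(2) W(1)] W(2) by simp_all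
      then show ?thesis using le_unit_image[OF UV W(1)] W(2) by simp
    qed
    then have "\<forall>h\<in>carrier (projection_order (bis_ob C)).
        u ` U \<sqsubseteq>\<^bsub>projection_order (bis_ob C)\<^esub> h \<longrightarrow> u ` V \<sqsubseteq>\<^bsub>projection_order (bis_ob C)\<^esub> h \<longrightarrow>
        u ` (U \<union> V) \<sqsubseteq>\<^bsub>projection_order (bis_ob C)\<^esub> h" by simp
    moreover have "u ` U \<unlhd> u ` (U \<union> V)"
      "u ` V \<unlhd> u ` (U \<union> V)"
      using le_unit_image[OF assms(1) UV] le_unit_image[OF assms(2) UV] by simp_all
    ultimately show ?case using E(3) by simp
  next
    case 1
    then show ?case using E(1) by simp
  next
    case 2
    then show ?case using E(2) by simp
  qed
  then show ?thesis using B.join_unique[OF E(1,2)] by simp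
qed

lemma pt_prime:
  assumes x: "x \<in> arrows C" shows "pt C x \<in> B.PS"
proof -
  obtain A where A: "A \<in> cob" "x \<in> A" using cob_basis[OF openin_topspace x] by blast
  show ?thesis
  proof (rule B.PS_I)
    show "A \<in> pt C x" using A by simp
    show "D \<in> pt C x" if "B \<in> pt C x" "D \<in> carrier (bis_ob C)" "B \<unlhd> D" for B D
      using that le_bis_iff[of B D] by auto
    show "\<exists>D\<in>pt C x. D \<unlhd> B \<and> D \<unlhd> B'"
      if B: "B \<in> pt C x" "B' \<in> pt C x" for B B'
    proof -
      have "openin X1 (B \<inter> B')" "x \<in> B \<inter> B'" using B by (auto simp: mem_cob)
      then obtain D where D: "D \<in> cob" "x \<in> D" "D \<subseteq> B \<inter> B'" using cob_basis by blast
      then show ?thesis using le_bis_iff[OF D(1), of B] le_bis_iff[OF D(1), of B'] B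
        by (intro bexI[of _ D]) auto
    qed
    show "A \<in> pt C x \<or> B \<in> pt C x"
      if "A \<in> carrier (bis_ob C)" "B \<in> carrier (bis_ob C)" "D \<in> pt C x"
        "is_lub (natural_order (bis_ob C)) D {A, B}" for A B D
      using that is_lub_bis[of A B D] by auto
  qed (auto simp: zr_bis)
qed

lemma pt0_prime:
  assumes p: "p \<in> objects C" shows "pt0 C p \<in> B.PE"
proof -
  obtain K where K: "compact_open X0 K" "p \<in> K" using compact_open_basis[OF openin_topspace p] by blast
  show ?thesis
  proof (rule B.PE_I)
    show "pt0 C p \<subseteq> rs_proj (bis_ob C)" by (auto simp: mem_pt0 mem_proj_bis)
    show "u ` K \<in> pt0 C p" using K by (simp add: unit_image_mem_pt0)
    show "B.zr \<notin> pt0 C p" by (auto simp: zr_bis mem_pt0)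
    show "f \<in> pt0 C p" if ef: "e \<in> pt0 C p" "f \<in> rs_proj (bis_ob C)" "e \<unlhd> f" for e f
    proof -
      obtain U where U: "compact_open X0 U" "p \<in> U" "e = u ` U" using ef(1) unfolding mem_pt0 by blast
      obtain V where V: "compact_open X0 V" "f = u ` V" using ef(2) by (rule proj_bisE)
      then have "p \<in> V" using ef(3) le_unit_image[OF U(1) V(1)] U by auto
      then show ?thesis using V unit_image_mem_pt0 by simp
    qed
    show "rs_mult (bis_ob C) e f \<in> pt0 C p" if ef: "e \<in> pt0 C p" "f \<in> pt0 C p" for e f
    proof -
      obtain U V where UV: "compact_open X0 U" "p \<in> U" "e = u ` U" "compact_open X0 V" "p \<in> V" "f = u ` V"
        using ef unfolding mem_pt0 by blast
      then have "rs_mult (bis_ob C) e f = u ` (U \<inter> V)" 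
        using unit_Int[OF compact_open_subset[OF UV(1)] compact_open_subset[OF UV(4)]] by simp
      then show ?thesis using UV compact_open_Int[OF UV(1,4)] by (simp add: unit_image_mem_pt0)
    qed
    show "e \<in> pt0 C p \<or> f \<in> pt0 C p"
      if ef: "e \<in> rs_proj (bis_ob C)" "f \<in> rs_proj (bis_ob C)"
        "e \<squnion>\<^bsub>projection_order (bis_ob C)\<^esub> f \<in> pt0 C p" for e f
    proof -
      obtain U V where UV: "compact_open X0 U" "e = u ` U" "compact_open X0 V" "f = u ` V"
        using proj_bisE[OF ef(1)] proj_bisE[OF ef(2)] by metis
      then have "p \<in> U \<union> V"
        using ef(3) bis_join[OF UV(1,3)] unit_image_mem_pt0[OF compact_open_Un[OF UV(1,3)]] by simp
      then show ?thesis using UV by (auto simp: unit_image_mem_pt0)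
    qed
  qed
qed

lemma Dm_pt:
  assumes x: "x \<in> arrows C" shows "B.Dm (pt C x) = pt0 C (d x)" "B.Cd (pt C x) = pt0 C (r x)"
proof -
  have le: "u ` U \<unlhd> e \<longleftrightarrow> (\<exists>V. compact_open X0 V \<and> e = u ` V \<and> U \<subseteq> V)"
    if "compact_open X0 U" "e \<in> rs_proj (bis_ob C)" for U e
    using that le_unit_image[OF that(1)] by (auto simp: mem_proj_bis)
  have pre: "\<exists>B\<in>cob. x \<in> B \<and> f ` B \<subseteq> U"
    if f: "continuous_map X1 X0 f" "compact_open X0 U" "f x \<in> U" for f U
  proof -
    have "openin X1 {y\<in>arrows C. f y \<in> U}" using f by (simp add: continuous_map_def compact_open_def)
    moreover have "x \<in> {y\<in>arrows C. f y \<in> U}" using x f(3) by simp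
    ultimately obtain B where "B \<in> cob" "x \<in> B" "B \<subseteq> {y\<in>arrows C. f y \<in> U}"
      using cob_basis by blast
    then show ?thesis by blast
  qed
  have 1: "e \<in> B.Dm (pt C x) \<longleftrightarrow> e \<in> pt0 C (d x)" for e
  proof
    assume "e \<in> B.Dm (pt C x)"
    then obtain B where B: "B \<in> cob" "x \<in> B" "u ` d ` B \<unlhd> e"
      "e \<in> rs_proj (bis_ob C)" by (auto simp: B.mem_Dm)
    then show "e \<in> pt0 C (d x)" using le[OF cob_d[OF B(1)] B(4)] unfolding mem_pt0 by blast
  next
    assume "e \<in> pt0 C (d x)"
    then obtain U where U: "compact_open X0 U" "d x \<in> U" "e = u ` U" unfolding mem_pt0 by blast
    then obtain B where B: "B \<in> cob" "x \<in> B" "d ` B \<subseteq> U" using pre[OF d_cont] by blast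
    then show "e \<in> B.Dm (pt C x)" unfolding B.mem_Dm
      using U le_unit_image[OF cob_d[OF B(1)] U(1)] mem_proj_bis by (auto intro!: bexI[of _ B])
  qed
  have 2: "e \<in> B.Cd (pt C x) \<longleftrightarrow> e \<in> pt0 C (r x)" for e
  proof
    assume "e \<in> B.Cd (pt C x)"
    then obtain B where B: "B \<in> cob" "x \<in> B" "u ` r ` B \<unlhd> e"
      "e \<in> rs_proj (bis_ob C)" by (auto simp: B.mem_Cd)
    then show "e \<in> pt0 C (r x)" using le[OF cob_r[OF B(1)] B(4)] unfolding mem_pt0 by blast
  next
    assume "e \<in> pt0 C (r x)"
    then obtain U where U: "compact_open X0 U" "r x \<in> U" "e = u ` U" unfolding mem_pt0 by blast
    then obtain B where B: "B \<in> cob" "x \<in> B" "r ` B \<subseteq> U" using pre[OF r_cont] by blast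
    then show "e \<in> B.Cd (pt C x)" unfolding B.mem_Cd
      using U le_unit_image[OF cob_r[OF B(1)] U(1)] mem_proj_bis by (auto intro!: bexI[of _ B])
  qed
  show "B.Dm (pt C x) = pt0 C (d x)" "B.Cd (pt C x) = pt0 C (r x)"
    using 1 2 by (simp_all add: Set.set_eq_iff)
qed

lemma pt0_inj: assumes "p \<in> objects C" "q \<in> objects C" "pt0 C p = pt0 C q" shows "p = q"
  using objects_T0[OF assms(1,2)] unit_image_mem_pt0 assms(3) by metis

lemma pt_inj: assumes "x \<in> arrows C" "y \<in> arrows C" "pt C x = pt C y" shows "x = y"
proof -
  have "d x = d y" using pt0_inj[of "d x" "d y"] Dm_pt[OF assms(1)] Dm_pt[OF assms(2)] assms by simp
  moreover obtain A where A: "A \<in> cob" "x \<in> A" using cob_basis[OF openin_topspace assms(1)] by blast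
  moreover have "y \<in> A" using A assms(3) mem_pt by metis
  ultimately show ?thesis using cob_inj_d by metis
qed

lemma pt0_surj: assumes F: "F \<in> B.PE" obtains p where "p \<in> objects C" "F = pt0 C p"
proof -
  define P where "P = {U. compact_open X0 U \<and> u ` U \<in> F}"
  have FE: "\<And>e. e \<in> F \<Longrightarrow> \<exists>U. U \<in> P \<and> e = u ` U"
    using B.PE_E[OF F] by (fastforce simp: P_def mem_proj_bis)
  have PE: "u ` U \<in> rs_proj (bis_ob C)" if "compact_open X0 U" for U using that mem_proj_bis by blast
  have "\<exists>p\<in>objects C. P = {U. compact_open X0 U \<and> p \<in> U}"
  proof (rule spectral_space_prime_filter_point[OF spectral_obj])
    show "P \<noteq> {}" using B.PE_ex[OF F] FE by blast
    show "{} \<notin> P" using B.zr_PE[OF F] by (simp add: P_def zr_bis)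
    show "V \<in> P" if "U \<in> P" "compact_open X0 V" "U \<subseteq> V" for U V
      using that B.PE_up[OF F, of "u ` U" "u ` V"] PE by (auto simp: P_def le_unit_image)
    show "U \<inter> V \<in> P" if "U \<in> P" "V \<in> P" for U V
      using that B.PE_mul[OF F, of "u ` U" "u ` V"] unit_Int[OF compact_open_subset compact_open_subset]
        compact_open_Int by (auto simp: P_def)
    show "U \<in> P \<or> V \<in> P" if "compact_open X0 U" "compact_open X0 V" "U \<union> V \<in> P" for U V
      using that B.PE_join[OF F, of "u ` U" "u ` V"] bis_join[of U V] PE by (simp add: P_def)
  qed (simp add: P_def)
  then obtain p where p: "p \<in> objects C" "P = {U. compact_open X0 U \<and> p \<in> U}" by blast
  have "e \<in> F \<longleftrightarrow> e \<in> pt0 C p" for e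
  proof
    assume "e \<in> F"
    then obtain U where "U \<in> P" "e = u ` U" using FE by blast
    then show "e \<in> pt0 C p" unfolding mem_pt0 using p(2) by blast
  next
    assume "e \<in> pt0 C p"
    then obtain U where "compact_open X0 U" "p \<in> U" "e = u ` U" unfolding mem_pt0 by blast
    then have "U \<in> P" using p(2) by simp
    then show "e \<in> F" using \<open>e = u ` U\<close> by (simp add: P_def)
  qed
  then have "F = pt0 C p" by (simp add: Set.set_eq_iff)
  then show thesis using p(1) that by blast
qed

text \<open>The domain of a prime filter \<open>P\<close> of bisections is a point \<open>p\<close> of the object space.  Any member \<open>A\<close> of \<open>P\<close> has
  exactly one arrow \<open>x\<close> over \<open>p\<close>, and \<open>P\<close> agrees with the filter of \<open>x\<close> since both contain \<open>A\<close> and have the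
  same domain.\<close>

lemma pt_surj: assumes P: "P \<in> B.PS" obtains x where "x \<in> arrows C" "P = pt C x"
proof -
  obtain A where A: "A \<in> P" using B.PS_ex[OF P] by blast
  have Ac: "A \<in> cob" using B.PS_M[OF P A] by simp
  obtain p where p: "p \<in> objects C" "B.Dm P = pt0 C p" using pt0_surj[OF B.Dm_prime[OF P]] .
  have "u ` d ` A \<in> pt0 C p" using B.Dm_I[OF P A] p(2) by simp
  then have "p \<in> d ` A" using unit_image_mem_pt0[OF cob_d[OF Ac]] by simp
  then obtain x where x: "x \<in> A" "p = d x" by blast
  have xC: "x \<in> arrows C" using cob_arrows Ac x by blast
  have "P = pt C x"
    using B.prime_filter_eqI_dm[OF P pt_prime[OF xC] A] x Ac p(2) Dm_pt(1)[OF xC] by simp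
  then show thesis using xC that by blast
qed

lemma unit_pt0: assumes "p \<in> objects C" shows "tc_unit (spec_ob (bis_ob C)) (pt0 C p) = pt C (u p)"
proof -
  have up: "u p \<in> arrows C" using assms by simp
  note v = B.unit_prime[OF pt0_prime[OF assms]]
  obtain K where K: "compact_open X0 K" "p \<in> K" using compact_open_basis[OF openin_topspace assms] by blast
  have "u ` K \<in> pt0 C p" using K by (simp add: unit_image_mem_pt0)
  then have 1: "u ` K \<in> tc_unit (spec_ob (bis_ob C)) (pt0 C p)"
    using B.mem_unitI unit_cob[OF K(1)] by simp
  have 2: "u ` K \<in> pt C (u p)" using K unit_cob by simp
  show ?thesis
    using B.prime_filter_eqI_dm[OF v(1) pt_prime[OF up] 1 2] v(2) Dm_pt(1)[OF up] assms by simp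
qed

text \<open>Both sides are prime filters with the same domain and with a common element, hence equal.\<close>

lemma comp_pt:
  assumes ab: "(a, b) \<in> composable C"
  shows "tc_comp (spec_ob (bis_ob C)) (pt C a) (pt C b) = pt C (tc_comp C a b)"
proof -
  have a: "a \<in> arrows C" and b: "b \<in> arrows C" and dr: "d a = r b" using ab by (auto simp: composable_def)
  have "B.Dm (pt C a) = B.Cd (pt C b)" using Dm_pt a b dr by simp
  note c = B.comp_prime[OF pt_prime[OF a] pt_prime[OF b] this]
  obtain A B where AB: "A \<in> cob" "a \<in> A" "B \<in> cob" "b \<in> B"
    using cob_basis[OF openin_topspace a] cob_basis[OF openin_topspace b] by blast
  have 1: "set_comp C A B \<in> tc_comp (spec_ob (bis_ob C)) (pt C a) (pt C b)" using c(4)[of A B] AB by simp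
  have "tc_comp C a b \<in> set_comp C A B" using AB dr unfolding set_comp_def by blast
  then have 2: "set_comp C A B \<in> pt C (tc_comp C a b)" using set_comp_cob AB by simp
  show ?thesis
    using B.prime_filter_eqI_dm[OF c(1) pt_prime[OF comp_arr[OF ab]] 1 2] c(2) Dm_pt(1)[OF b]
      Dm_pt(1)[OF comp_arr[OF ab]] d_comp[OF ab] by simp
qed

lemma pt_image:
  assumes "B \<in> cob" shows "pt C ` B = basic (natural_order (bis_ob C)) B"
proof (intro Set.set_eqI iffI)
  fix P assume "P \<in> pt C ` B"
  then obtain x where "x \<in> B" "P = pt C x" by blast
  then show "P \<in> basic (natural_order (bis_ob C)) B" using assms pt_prime[of x] cob_arrows by simp
next
  fix P assume P: "P \<in> basic (natural_order (bis_ob C)) B"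
  then obtain x where x: "x \<in> arrows C" "P = pt C x" using pt_surj[of P] by auto
  then have "x \<in> B" using P by simp
  then show "P \<in> pt C ` B" using x(2) by blast
qed

lemma pt0_image:
  assumes "compact_open X0 U" shows "pt0 C ` U = basic (projection_order (bis_ob C)) (u ` U)"
proof (intro Set.set_eqI iffI)
  fix P assume "P \<in> pt0 C ` U"
  then obtain p where "p \<in> U" "P = pt0 C p" by blast
  then show "P \<in> basic (projection_order (bis_ob C)) (u ` U)"
    using assms pt0_prime[of p] compact_open_subset[OF assms] unit_image_mem_pt0[OF assms] by auto
next
  fix P assume P: "P \<in> basic (projection_order (bis_ob C)) (u ` U)"
  then obtain p where x: "p \<in> objects C" "P = pt0 C p" using pt0_surj[of P] by auto
  then have "p \<in> U" using P unit_image_mem_pt0[OF assms] by simp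
  then show "P \<in> pt0 C ` U" using x(2) by blast
qed

end

lemma homeomorphic_map_basis:
  assumes bij: "bij_betw f (topspace X) (topspace Y)"
    and X: "\<And>U x. openin X U \<Longrightarrow> x \<in> U \<Longrightarrow> \<exists>B\<in>\<B>. x \<in> B \<and> B \<subseteq> U"
    and Y: "\<And>V y. openin Y V \<Longrightarrow> y \<in> V \<Longrightarrow> \<exists>B\<in>\<B>. y \<in> f ` B \<and> f ` B \<subseteq> V"
    and open1: "\<And>B. B \<in> \<B> \<Longrightarrow> openin X B" and open2: "\<And>B. B \<in> \<B> \<Longrightarrow> openin Y (f ` B)"
  shows "homeomorphic_map X Y f"
proof (rule bijective_open_imp_homeomorphic_map)
  have im: "f ` topspace X = topspace Y" and inj: "inj_on f (topspace X)"
    using bij by (auto simp: bij_betw_def)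
  show "f ` topspace X = topspace Y" "inj_on f (topspace X)" by fact+
  show "continuous_map X Y f"
    unfolding continuous_map_def
  proof (intro conjI allI impI)
    show "f \<in> topspace X \<rightarrow> topspace Y" using im by blast
    fix V assume V: "openin Y V"
    show "openin X {x\<in>topspace X. f x \<in> V}"
    proof (subst openin_subopen, intro ballI)
      fix x assume x: "x \<in> {x\<in>topspace X. f x \<in> V}"
      then obtain B where B: "B \<in> \<B>" "f x \<in> f ` B" "f ` B \<subseteq> V" using Y[OF V, of "f x"] by blast
      have BX: "B \<subseteq> topspace X" using open1[OF B(1)] openin_subset by blast
      have "x \<in> B" using B(2) x BX inj by (auto simp: inj_on_def)
      then show "\<exists>T. openin X T \<and> x \<in> T \<and> T \<subseteq> {x\<in>topspace X. f x \<in> V}"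
        using open1[OF B(1)] B(3) BX by blast
    qed
  qed
  show "open_map X Y f" unfolding open_map_def
  proof (intro allI impI)
    fix U assume U: "openin X U"
    show "openin Y (f ` U)"
    proof (subst openin_subopen, intro ballI)
      fix y assume "y \<in> f ` U"
      then obtain x where x: "x \<in> U" "y = f x" by blast
      then obtain B where B: "B \<in> \<B>" "x \<in> B" "B \<subseteq> U" using X[OF U] by blast
      then show "\<exists>T. openin Y T \<and> y \<in> T \<and> T \<subseteq> f ` U" using open2[OF B(1)] x by blast
    qed
  qed
qed

context spectral_etale
begin

lemma homeomorphic_pt: "homeomorphic_map X1 (prime_spectrum (natural_order (bis_ob C))) (pt C)"
proof (rule homeomorphic_map_basis[of _ _ _ cob])
  show "bij_betw (pt C) (arrows C) (topspace (prime_spectrum (natural_order (bis_ob C))))"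
    unfolding bij_betw_def topspace_prime_spectrum
  proof
    show "inj_on (pt C) (arrows C)" using pt_inj by (rule inj_onI)
    show "pt C ` arrows C = B.PS" using pt_prime pt_surj by (metis (no_types, lifting) image_iff subsetI subset_antisym image_subsetI)
  qed
  show "\<exists>B\<in>cob. x \<in> B \<and> B \<subseteq> U" if "openin X1 U" "x \<in> U" for U x using cob_basis that by blast
  show "\<exists>B\<in>cob. P \<in> pt C ` B \<and> pt C ` B \<subseteq> V"
    if V: "openin (prime_spectrum (natural_order (bis_ob C))) V" "P \<in> V" for V P
  proof -
    obtain B where B: "P \<in> B.PS" "B \<in> P" "basic (natural_order (bis_ob C)) B \<subseteq> V"
      using openin_prime_spectrumE[OF V] .
    then have "B \<in> cob" using B.PS_M by fastforce
    then show ?thesis using pt_image[of B] B by (intro bexI[of _ B]) auto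
  qed
qed (auto simp: mem_cob pt_image)

lemma homeomorphic_pt0: "homeomorphic_map X0 (prime_spectrum (projection_order (bis_ob C))) (pt0 C)"
proof (rule homeomorphic_map_basis[of _ _ _ "Collect (compact_open X0)"])
  show "bij_betw (pt0 C) (objects C) (topspace (prime_spectrum (projection_order (bis_ob C))))"
    unfolding bij_betw_def topspace_prime_spectrum
  proof
    show "inj_on (pt0 C) (objects C)" using pt0_inj by (rule inj_onI)
    show "pt0 C ` objects C = B.PE" using pt0_prime pt0_surj by (metis (no_types, lifting) image_iff subsetI subset_antisym image_subsetI)
  qed
  show "\<exists>B\<in>Collect (compact_open X0). x \<in> B \<and> B \<subseteq> U" if "openin X0 U" "x \<in> U" for U x
    using compact_open_basis that by blast
  show "\<exists>B\<in>Collect (compact_open X0). P \<in> pt0 C ` B \<and> pt0 C ` B \<subseteq> V"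
    if V: "openin (prime_spectrum (projection_order (bis_ob C))) V" "P \<in> V" for V P
  proof -
    obtain e where e: "P \<in> B.PE" "e \<in> P" "basic (projection_order (bis_ob C)) e \<subseteq> V"
      using openin_prime_spectrumE[OF V] .
    have "e \<in> rs_proj (bis_ob C)" using B.PE_E e by blast
    then obtain U where "compact_open X0 U" "e = u ` U" by (rule proj_bisE)
    then show ?thesis using pt0_image[of U] e by (intro bexI[of _ U]) auto
  qed
qed (auto simp: compact_open_def pt0_image)

end

section \<open>Morphisms of distributive restriction semigroups\<close>

lemma proper_morphismI:
  assumes "\<And>t. t \<in> carrier T \<Longrightarrow> \<exists>X. finite X \<and> X \<noteq> {} \<and> X \<subseteq> carrier T \<and>
    (\<forall>x\<in>X. \<exists>s\<in>carrier S. x \<sqsubseteq>\<^bsub>natural_order T\<^esub> f s) \<and> is_lub (natural_order T) t X"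
  shows "proper_morphism S T f"
  unfolding proper_morphism_def
proof
  fix t assume "t \<in> carrier T"
  from assms[OF this]
  obtain X where X: "finite X" "X \<noteq> {}" "X \<subseteq> carrier T" "is_lub (natural_order T) t X"
    and XP: "\<forall>x\<in>X. \<exists>s\<in>carrier S. x \<sqsubseteq>\<^bsub>natural_order T\<^esub> f s"
    by (elim exE conjE) (rule that)
  obtain ts where ts: "bij_betw ts {1..card X} X" using ex_bij_betw_nat_finite_1[OF X(1)] by blast
  have im: "ts ` {1..card X} = X" using ts by (simp add: bij_betw_def)
  have "\<exists>ss. \<forall>i\<in>{1..card X}. ss i \<in> carrier S \<and> ts i \<sqsubseteq>\<^bsub>natural_order T\<^esub> f (ss i)"
    using XP im by (intro bchoice) blast
  then obtain ss where ss: "\<forall>i\<in>{1..card X}. ss i \<in> carrier S \<and> ts i \<sqsubseteq>\<^bsub>natural_order T\<^esub> f (ss i)" by blast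
  have "card X \<ge> 1" using X by (simp add: Suc_leI card_gt_0_iff)
  moreover have "\<forall>i\<in>{1..card X}. ts i \<in> carrier T \<and> ss i \<in> carrier S \<and> ts i \<sqsubseteq>\<^bsub>natural_order T\<^esub> f (ss i)"
    using ss X(3) im by blast
  ultimately show "\<exists>n\<ge>1. \<exists>(ts :: nat \<Rightarrow> _) (ss :: nat \<Rightarrow> _). (\<forall>i\<in>{1..n}. ts i \<in> carrier T \<and> ss i \<in> carrier S \<and> ts i \<sqsubseteq>\<^bsub>natural_order T\<^esub> f (ss i)) \<and>
      is_lub (natural_order T) t (ts ` {1..n})"
    using X(4) im by (intro exI[of _ "card X"] conjI exI[of _ ts] exI[of _ ss]) simp_all
qed

lemma (in drs) PS_elem: assumes "A \<in> PS" obtains a where "a \<in> A" "a \<in> M"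
  using PS_ex[OF assms] PS_M[OF assms] by blast

locale drs_hom = S: drs S + T: drs T for S :: "'a rsg" and T :: "'b rsg" +
  fixes f :: "'a \<Rightarrow> 'b"
  assumes morphism: "drs_morphism S T f"
begin

abbreviation leS (infix "\<preceq>\<^sub>S" 50) where "a \<preceq>\<^sub>S b \<equiv> a \<sqsubseteq>\<^bsub>natural_order S\<^esub> b"
abbreviation leT (infix "\<preceq>\<^sub>T" 50) where "a \<preceq>\<^sub>T b \<equiv> a \<sqsubseteq>\<^bsub>natural_order T\<^esub> b"

lemma f_ext: "f \<in> carrier S \<rightarrow>\<^sub>E carrier T"
  and f_M [simp]: "a \<in> S.M \<Longrightarrow> f a \<in> T.M"
  and f_mul [simp]: "a \<in> S.M \<Longrightarrow> b \<in> S.M \<Longrightarrow> f (rs_mult S a b) = rs_mult T (f a) (f b)"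
  and f_dm [simp]: "a \<in> S.M \<Longrightarrow> f (rs_dom S a) = rs_dom T (f a)"
  and f_cd [simp]: "a \<in> S.M \<Longrightarrow> f (rs_cod S a) = rs_cod T (f a)"
  and f_zr [simp]: "f S.zr = T.zr"
  and f_join [simp]: "e \<in> S.E \<Longrightarrow> e' \<in> S.E \<Longrightarrow>
    f (e \<squnion>\<^bsub>projection_order S\<^esub> e') = f e \<squnion>\<^bsub>projection_order T\<^esub> f e'"
  and f_cofinal: "t \<in> T.E \<Longrightarrow> \<exists>b\<in>S.E. t \<preceq>\<^sub>T f b"
  using morphism by (auto simp: drs_morphism_def PiE_iff)

lemma f_E [simp]: "e \<in> S.E \<Longrightarrow> f e \<in> T.E"
  using f_dm[of e] by (metis S.E_M S.dm_proj T.dm_E f_M)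

lemma f_mono: assumes "a \<preceq>\<^sub>S b" "b \<in> S.M" shows "f a \<preceq>\<^sub>T f b"
proof -
  have a: "a \<in> S.M" "a = rs_mult S b (rs_dom S a)" using S.le_iff_mul_dm assms by blast+
  have "f a = rs_mult T (f b) (rs_dom T (f a))" using arg_cong[OF a(2), of f] a(1) assms(2) by simp
  then show ?thesis using T.le_iff_mul_dm a(1) assms(2) f_M by blast
qed

end

lemma drs_homI: "drs S \<Longrightarrow> drs T \<Longrightarrow> drs_morphism S T f \<Longrightarrow> drs_hom S T f"
  by (simp add: drs_hom_def drs_hom_axioms_def)

lemma drs_morphismI:
  assumes S: "drs S" and T: "drs T" and f: "f \<in> carrier S \<rightarrow>\<^sub>E carrier T"
    "\<And>a b. a \<in> carrier S \<Longrightarrow> b \<in> carrier S \<Longrightarrow> f (rs_mult S a b) = rs_mult T (f a) (f b)"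
    "\<And>a. a \<in> carrier S \<Longrightarrow> f (rs_dom S a) = rs_dom T (f a)"
    "\<And>a. a \<in> carrier S \<Longrightarrow> f (rs_cod S a) = rs_cod T (f a)"
    "f \<bottom>\<^bsub>projection_order S\<^esub> = \<bottom>\<^bsub>projection_order T\<^esub>"
    "\<And>e e'. e \<in> rs_proj S \<Longrightarrow> e' \<in> rs_proj S \<Longrightarrow>
      f (e \<squnion>\<^bsub>projection_order S\<^esub> e') = f e \<squnion>\<^bsub>projection_order T\<^esub> f e'"
    "\<And>a. a \<in> rs_proj T \<Longrightarrow> \<exists>b\<in>rs_proj S. a \<sqsubseteq>\<^bsub>natural_order T\<^esub> f b"
  shows "drs_morphism S T f"
proof -
  interpret S: drs S by fact
  interpret T: drs T by fact
  have fM: "f a \<in> carrier T" if "a \<in> carrier S" for a using f(1) that by auto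
  have fE: "f e \<in> rs_proj T" if "e \<in> rs_proj S" for e
    using f(3)[of e] T.dm_E[OF fM[of e]] that by simp
  show ?thesis unfolding drs_morphism_def
    using f fE by (auto simp: S.projection_meet T.projection_meet)
qed

lemma drs_morphism_id: assumes "drs S" shows "drs_morphism S S (restrict id (carrier S))"
proof (rule drs_morphismI[OF assms assms])
  interpret drs S by fact
  show "\<exists>b\<in>rs_proj S. a \<sqsubseteq>\<^bsub>natural_order S\<^esub> restrict id (carrier S) b" if "a \<in> rs_proj S" for a
    using that by (intro bexI[of _ a]) auto
qed (use drs.zr_E[OF assms] restriction_sg.E_M[of S] restriction_sg.mul_closed[of S]
      drs.axioms(1)[OF assms] restriction_sg.dm_E[of S] restriction_sg.cd_E[of S] drs.join_E[OF assms] in auto)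

lemma drs_morphism_compose:
  assumes "drs_hom S T f" "drs_hom T U g" shows "drs_morphism S U (compose (carrier S) g f)"
proof -
  interpret f: drs_hom S T f by fact
  interpret g: drs_hom T U g by fact
  show ?thesis
  proof (rule drs_morphismI[OF f.S.drs_axioms g.T.drs_axioms])
    show "compose (carrier S) g f \<in> carrier S \<rightarrow>\<^sub>E carrier U"
      by (auto simp: compose_def)
    fix a assume a: "a \<in> rs_proj U"
    obtain b where b: "b \<in> rs_proj T" "a \<sqsubseteq>\<^bsub>natural_order U\<^esub> g b" using g.f_cofinal[OF a] by blast
    obtain c where c: "c \<in> rs_proj S" "b \<sqsubseteq>\<^bsub>natural_order T\<^esub> f c" using f.f_cofinal[OF b(1)] by blast
    have "a \<sqsubseteq>\<^bsub>natural_order U\<^esub> g (f c)"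
      using g.T.le_trans[OF b(2) g.f_mono[OF c(2)]] c(1) by simp
    then show "\<exists>c\<in>rs_proj S. a \<sqsubseteq>\<^bsub>natural_order U\<^esub> compose (carrier S) g f c"
      using c(1) by (auto simp: compose_def)
  qed (simp_all add: compose_def)
qed

lemma weakly_meet_preserving_compose:
  assumes "drs_hom S T f" "drs_hom T U g" "weakly_meet_preserving S T f" "weakly_meet_preserving T U g"
  shows "weakly_meet_preserving S U (compose (carrier S) g f)"
  unfolding weakly_meet_preserving_def
proof (intro ballI impI)
  interpret f: drs_hom S T f by fact
  interpret g: drs_hom T U g by fact
  fix t a b assume t: "t \<in> carrier U" and ab: "a \<in> carrier S" "b \<in> carrier S"
    and "t \<sqsubseteq>\<^bsub>natural_order U\<^esub> compose (carrier S) g f a \<and> t \<sqsubseteq>\<^bsub>natural_order U\<^esub> compose (carrier S) g f b"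
  then have "t \<sqsubseteq>\<^bsub>natural_order U\<^esub> g (f a)" "t \<sqsubseteq>\<^bsub>natural_order U\<^esub> g (f b)" by (auto simp: compose_def)
  then obtain c where c: "c \<in> carrier T" "c \<sqsubseteq>\<^bsub>natural_order T\<^esub> f a" "c \<sqsubseteq>\<^bsub>natural_order T\<^esub> f b"
    "t \<sqsubseteq>\<^bsub>natural_order U\<^esub> g c" using assms(4) t ab f.f_M unfolding weakly_meet_preserving_def by metis
  then obtain c' where c': "c' \<in> carrier S" "c' \<sqsubseteq>\<^bsub>natural_order S\<^esub> a" "c' \<sqsubseteq>\<^bsub>natural_order S\<^esub> b"
    "c \<sqsubseteq>\<^bsub>natural_order T\<^esub> f c'" using assms(3) ab unfolding weakly_meet_preserving_def by metis
  have "t \<sqsubseteq>\<^bsub>natural_order U\<^esub> g (f c')"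
    using g.T.le_trans[OF c(4) g.f_mono[OF c'(4)]] c'(1) by simp
  then show "\<exists>c\<in>carrier S. c \<sqsubseteq>\<^bsub>natural_order S\<^esub> a \<and> c \<sqsubseteq>\<^bsub>natural_order S\<^esub> b \<and>
      t \<sqsubseteq>\<^bsub>natural_order U\<^esub> compose (carrier S) g f c" using c' by (auto simp: compose_def)
qed

section \<open>Relational covering morphisms of prime spectra\<close>

context drs
begin

text \<open>Let \<open>e\<close> be the join of the domains of the members of \<open>X\<close>.  Then \<open>t e\<close> is an upper bound of \<open>X\<close>, so
  \<open>t e \<in> A\<close> and \<open>e\<close> is in the domain of \<open>A\<close>; by primeness there the domain of some \<open>x \<in> X\<close> is, too, and
  \<open>x = t \<lambda>(x)\<close>.\<close>

lemma prime_filter_finite_lub: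
  assumes A: "A \<in> PS" "t \<in> A" and X: "finite X" "X \<subseteq> M" "is_lub (natural_order S) t X"
  shows "\<exists>x\<in>X. x \<in> A"
proof -
  have "\<exists>e\<in>E. (\<forall>x\<in>X. dm x \<preceq> e) \<and> (\<forall>F\<in>PE. e \<in> F \<longrightarrow> (\<exists>x\<in>X. dm x \<in> F))" using X(1,2)
  proof (induction X rule: finite_induct)
    case empty
    then show ?case using zr_PE zr_E by blast
  next
    case (insert x X)
    then obtain e where e: "e \<in> E" "\<forall>x\<in>X. dm x \<preceq> e" "\<forall>F\<in>PE. e \<in> F \<longrightarrow> (\<exists>x\<in>X. dm x \<in> F)" by auto
    have dx: "dm x \<in> E" using insert by simp
    have "dm y \<preceq> dm x \<squnion> e" if "y \<in> insert x X" for y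
    proof (cases "y = x")
      case False
      then show ?thesis
        using that e(1,2) dx le_trans[of "dm y" e "dm x \<squnion> e"] le_join2[OF dx e(1)] by auto
    qed (use dx e in simp)
    moreover have "\<exists>y\<in>insert x X. dm y \<in> F" if "F \<in> PE" "dm x \<squnion> e \<in> F" for F
      using PE_join[OF that dx e(1)] e(3) that(1) by auto
    ultimately show ?case using dx e(1) join_E by blast
  qed
  then obtain e where e: "e \<in> E" "\<And>x. x \<in> X \<Longrightarrow> dm x \<preceq> e"
    "\<And>F. F \<in> PE \<Longrightarrow> e \<in> F \<Longrightarrow> \<exists>x\<in>X. dm x \<in> F" by blast
  have t: "t \<in> M" "\<And>x. x \<in> X \<Longrightarrow> x \<preceq> t" and least: "\<And>y. y \<in> M \<Longrightarrow> (\<And>x. x \<in> X \<Longrightarrow> x \<preceq> y) \<Longrightarrow> t \<preceq> y"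
    using X(2,3) by (auto simp: least_def Upper_def)
  have xt: "x = t \<cdot> dm x" if "x \<in> X" for x using t that le_iff_mul_dm by blast
  have "x \<preceq> t \<cdot> e" if "x \<in> X" for x
    using mul_mono[OF le_refl[OF t(1)] e(2)[OF that]] xt[OF that] t(1) e(1) by simp
  then have "t \<preceq> t \<cdot> e" using least[of "t \<cdot> e"] t(1) e(1) by simp
  then have "t \<cdot> e \<in> A" using PS_up[OF A, of "t \<cdot> e"] t(1) e(1) by simp
  then have "e \<in> Dm A" using mul_mem_Dm[OF A(1)] t(1) e(1) by blast
  then obtain x where x: "x \<in> X" "dm x \<in> Dm A" using e(3)[OF Dm_prime[OF A(1)]] by blast
  then have "x \<in> A" using mul_Dm[OF A x(2)] xt[OF x(1)] by simp
  then show ?thesis using x(1) by blast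
qed

end

context drs_hom
begin

definition pull :: "'b set \<Rightarrow> 'a set" where
  "pull F = {e\<in>rs_proj S. f e \<in> F}"

lemma mem_pull [simp]: "e \<in> pull F \<longleftrightarrow> e \<in> rs_proj S \<and> f e \<in> F"
  by (simp add: pull_def)

lemma pull_prime: assumes F: "F \<in> T.PE" shows "pull F \<in> S.PE"
proof -
  obtain t where t: "t \<in> F" "t \<in> T.E" using T.PE_ex[OF F] T.PE_E[OF F] by blast
  obtain e where e: "e \<in> S.E" "t \<preceq>\<^sub>T f e" using f_cofinal[OF t(2)] by blast
  show ?thesis
  proof (rule S.PE_I)
    show "e \<in> pull F" using T.PE_up[OF F t(1)] e by simp
    show "S.zr \<notin> pull F" using T.zr_PE[OF F] by simp
    show "e' \<in> pull F" if "e \<in> pull F" "e' \<in> rs_proj S" "e \<preceq>\<^sub>S e'" for e e'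
      using that T.PE_up[OF F, of "f e" "f e'"] f_mono[of e e'] by simp
    show "rs_mult S e e' \<in> pull F" if "e \<in> pull F" "e' \<in> pull F" for e e'
      using that T.PE_mul[OF F] by simp
    show "e \<in> pull F \<or> e' \<in> pull F"
      if "e \<in> rs_proj S" "e' \<in> rs_proj S" "e \<squnion>\<^bsub>projection_order S\<^esub> e' \<in> pull F" for e e'
      using that T.PE_join[OF F, of "f e" "f e'"] by simp
  qed auto
qed

text \<open>For \<open>b \<in> B\<close> and a projection \<open>g\<close> with \<open>f(g)\<close> in the codomain of \<open>A\<close>, the element \<open>f(g b)\<close> is in \<open>A\<close>; hence
  \<open>\<lambda>(g b)\<close> is in the domain of \<open>B\<close>, and \<open>g b = b \<lambda>(g b) \<in> B\<close>.  So membership in the dual relation is decided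
  by domains alone.\<close>

lemma Cd_eq_pull:
  assumes A: "A \<in> T.PS" and B: "B \<in> S.PS" and fB: "f ` B \<subseteq> A" and D: "S.Dm B = pull (T.Dm A)"
  shows "S.Cd B = pull (T.Cd A)"
proof (intro Set.set_eqI iffI)
  obtain b where b: "b \<in> B" "b \<in> S.M" using S.PS_ex[OF B] S.PS_M[OF B] by blast
  then have fb: "f b \<in> A" using fB by blast
  fix g
  {
    assume "g \<in> S.Cd B"
    then obtain c where c: "c \<in> B" "rs_cod S c \<preceq>\<^sub>S g" "g \<in> S.E" by (auto simp: S.mem_Cd)
    then have "f c \<in> A" "c \<in> S.M" using fB S.PS_M[OF B] by blast+
    then have "f (rs_cod S c) \<in> T.Cd A" using T.Cd_I[OF A] by simp
    then have "f g \<in> T.Cd A" using T.PE_up[OF T.Cd_prime[OF A], of "f (rs_cod S c)" "f g"] f_mono[OF c(2)] c(3)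
      by simp
    then show "g \<in> pull (T.Cd A)" using c(3) by simp
  next
    assume "g \<in> pull (T.Cd A)"
    then have g: "g \<in> S.E" "f g \<in> T.Cd A" by auto
    have "rs_mult T (f g) (f b) \<in> A" using T.Cd_mul[OF A fb g(2)] .
    then have "rs_dom T (f (rs_mult S g b)) \<in> T.Dm A" using T.Dm_I[OF A] g b by simp
    then have "rs_dom S (rs_mult S g b) \<in> S.Dm B" using D g b by simp
    then have "rs_mult S b (rs_dom S (rs_mult S g b)) \<in> B" using S.mul_Dm[OF B b(1)] by blast
    then have "rs_mult S g b \<in> B" using S.proj_mul[of b g] g b by simp
    then show "g \<in> S.Cd B" using S.mul_mem_Cd[OF B] g b by blast
  }
qed

lemma mem_spec_ar:
  assumes A: "A \<in> T.PS"
  shows "B \<in> fst (spec_ar S T f) A \<longleftrightarrow> B \<in> S.PS \<and> f ` B \<subseteq> A \<and> S.Dm B = pull (T.Dm A)"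
  using Cd_eq_pull[OF A, of B] A by (auto simp: spec_ar_def Let_def pull_def)

lemma spec_ar_Cd:
  assumes "A \<in> T.PS" "B \<in> fst (spec_ar S T f) A" shows "S.Cd B = pull (T.Cd A)"
  using assms Cd_eq_pull mem_spec_ar by blast

lemma snd_spec_ar [simp]: "F \<in> T.PE \<Longrightarrow> snd (spec_ar S T f) F = pull F"
  by (simp add: spec_ar_def Let_def pull_def)

text \<open>Any \<open>s\<close> that is mapped into \<open>A\<close> lies in a prime filter related to \<open>A\<close>.  Thus the inverse image of \<open>A\<close> is the
  union of the values of the relation at \<open>A\<close>.\<close>

lemma translate_spec_ar:
  assumes A: "A \<in> T.PS" and s: "s \<in> S.M" "f s \<in> A"
  shows "translate S s (pull (T.Dm A)) \<in> fst (spec_ar S T f) A" "s \<in> translate S s (pull (T.Dm A))"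
proof -
  have "rs_dom S s \<in> pull (T.Dm A)" using T.Dm_I[OF A s(2)] s(1) by simp
  note B = S.translate_prime[OF pull_prime[OF T.Dm_prime[OF A]] s(1) this]
  show "s \<in> translate S s (pull (T.Dm A))" by (rule B(3))
  have "f c \<in> A" if c: "c \<in> translate S s (pull (T.Dm A))" for c
  proof -
    obtain e where e: "e \<in> S.E" "f e \<in> T.Dm A" "rs_mult S s e \<preceq>\<^sub>S c" "c \<in> S.M"
      using c by (auto simp: S.mem_translate)
    have "rs_mult T (f s) (f e) \<in> A" using T.mul_Dm[OF A s(2) e(2)] .
    then show ?thesis using T.PS_up[OF A, of "rs_mult T (f s) (f e)" "f c"] f_mono[OF e(3,4)] e s by simp
  qed
  then show "translate S s (pull (T.Dm A)) \<in> fst (spec_ar S T f) A"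
    unfolding mem_spec_ar[OF A] using B by blast
qed

lemma spec_ar_meets_basic:
  assumes "s \<in> S.M"
  shows "{A \<in> T.PS. fst (spec_ar S T f) A \<inter> S.BS s \<noteq> {}} = T.BS (f s)"
proof (intro Set.set_eqI iffI)
  fix A assume "A \<in> {A \<in> T.PS. fst (spec_ar S T f) A \<inter> S.BS s \<noteq> {}}"
  then obtain B where A: "A \<in> T.PS" and B: "B \<in> fst (spec_ar S T f) A" "s \<in> B" by auto
  then have "f s \<in> A" using mem_spec_ar[OF A] by blast
  then show "A \<in> T.BS (f s)" using A by simp
next
  fix A assume "A \<in> T.BS (f s)"
  then have A: "A \<in> T.PS" "f s \<in> A" by auto
  note B = translate_spec_ar[OF A(1) assms A(2)]
  then have "translate S s (pull (T.Dm A)) \<in> fst (spec_ar S T f) A \<inter> S.BS s"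
    using mem_spec_ar[OF A(1)] by simp
  then show "A \<in> {A \<in> T.PS. fst (spec_ar S T f) A \<inter> S.BS s \<noteq> {}}" using A by blast
qed

lemma pull_basic: "e \<in> S.E \<Longrightarrow>
    {F\<in>T.PE. pull F \<in> S.BE e} = T.BE (f e)"
  using pull_prime by auto

text \<open>The covering property: a prime filter \<open>B\<close> over the inverse image of \<open>F\<close> is related to the filter with domain
  \<open>F\<close> that the image of any element of \<open>B\<close> generates.\<close>

lemma spec_ar_lift:
  assumes F: "F \<in> T.PE" and B: "B \<in> S.PS" "S.Dm B = pull F"
  shows "\<exists>A\<in>T.PS. T.Dm A = F \<and> B \<in> fst (spec_ar S T f) A"
proof -
  obtain b where b: "b \<in> B" "b \<in> S.M" using S.PS_ex[OF B(1)] S.PS_M[OF B(1)] by blast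
  have "rs_dom S b \<in> pull F" using S.Dm_I[OF B(1) b(1)] B(2) by simp
  then have db: "rs_dom T (f b) \<in> F" using b by simp
  note A = T.translate_prime[OF F f_M[OF b(2)] db]
  have D: "S.Dm B = pull (T.Dm (translate T (f b) F))" using B(2) A(2) by simp
  have "translate S b (pull (T.Dm (translate T (f b) F))) = B"
    using S.prime_filter_eq_translate[OF B(1) b(1)] D by simp
  then have "B \<in> fst (spec_ar S T f) (translate T (f b) F)"
    using translate_spec_ar(1)[OF A(1) b(2) A(3)] by simp
  then show ?thesis using A by blast
qed

end

lemma (in drs_hom) drs_hom_op: "drs_hom (op_rsg S) (op_rsg T) f"
proof (rule drs_homI[OF S.op T.op], rule drs_morphismI[OF S.op T.op])
qed (use f_ext f_cofinal in simp_all)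

context drs_hom
begin

lemma spec_ar_op:
  "fst (spec_ar (op_rsg S) (op_rsg T) f) A = fst (spec_ar S T f) A"
  by (simp add: spec_ar_def Let_def spec_ob_op conj_ac restrict_def)

lemma spec_ar_lift_Cd:
  assumes F: "F \<in> T.PE" and B: "B \<in> S.PS" "S.Cd B = pull F"
  shows "\<exists>A\<in>T.PS. T.Cd A = F \<and> B \<in> fst (spec_ar S T f) A"
proof -
  interpret O: drs_hom "op_rsg S" "op_rsg T" f by (rule drs_hom_op)
  have "O.pull F = pull F" by (simp add: O.pull_def pull_def)
  then show ?thesis using O.spec_ar_lift[of F B] assms spec_ar_op by (simp add: spec_ob_op)
qed

lemma relational_covering_morphism_spec:
  "relational_covering_morphism (spec_ob T) (spec_ob S) (spec_ar S T f)"
proof -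
  let ?f1 = "fst (spec_ar S T f)" and ?f0 = "snd (spec_ar S T f)"
  have 1: "?f1 \<in> T.PS \<rightarrow>\<^sub>E Pow S.PS"
    by (auto simp: spec_ar_def Let_def)
  have 2: "?f0 \<in> T.PE \<rightarrow>\<^sub>E S.PE"
    using pull_prime by (auto simp: spec_ar_def Let_def pull_def)
  have 3: "continuous_map (T.XE) (S.XE) ?f0"
    unfolding continuous_map_def topspace_prime_spectrum
  proof (intro conjI allI impI)
    fix U assume U: "openin (S.XE) U"
    show "openin (T.XE) {F \<in> T.PE. ?f0 F \<in> U}"
      unfolding openin_prime_spectrum
    proof (intro conjI ballI)
      fix F assume F: "F \<in> {F \<in> T.PE. ?f0 F \<in> U}"
      then have F': "F \<in> T.PE" "pull F \<in> U" by auto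
      obtain e where e: "e \<in> pull F" "S.BE e \<subseteq> U"
        using openin_prime_spectrumE[OF U F'(2)] by blast
      have "G \<in> {F \<in> T.PE. ?f0 F \<in> U}" if G: "G \<in> T.BE (f e)" for G
      proof -
        have "pull G \<in> S.BE e" using pull_prime[of G] G e(1) by simp
        then have "pull G \<in> U" using e(2) by blast
        then show ?thesis using G by simp
      qed
      then show "\<exists>a\<in>F. T.BE a \<subseteq> {F \<in> T.PE. ?f0 F \<in> U}"
        using e(1) by (intro bexI[of _ "f e"] subsetI) simp_all
    qed auto
  qed (use 2 in auto)
  have 4: "S.Dm B = ?f0 (T.Dm A) \<and> S.Cd B = ?f0 (T.Cd A)" if "A \<in> T.PS" "B \<in> ?f1 A" for A B
    using that mem_spec_ar[OF that(1)] spec_ar_Cd[OF that] T.Dm_prime T.Cd_prime by simp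
  have 5: "S.cmp B B' \<in> ?f1 (T.cmp A A')"
    if A: "A \<in> T.PS" "A' \<in> T.PS" "T.Dm A = T.Cd A'" and B: "B \<in> ?f1 A" "B' \<in> ?f1 A'"
      and BB: "S.Dm B = S.Cd B'" for A A' B B'
  proof -
    note B' = B(1)[unfolded mem_spec_ar[OF A(1)]] B(2)[unfolded mem_spec_ar[OF A(2)]]
    note AA = T.comp_prime[OF A]
    have P: "B \<in> S.PS" "B' \<in> S.PS" using B' by auto
    note BB' = S.comp_prime[OF P BB]
    have "f c \<in> T.cmp A A'" if c: "c \<in> S.cmp B B'" for c
    proof -
      obtain b b' where b: "b \<in> B" "b' \<in> B'" "rs_mult S b b' \<preceq>\<^sub>S c" "c \<in> S.M"
        using c by (auto simp: S.mem_comp)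
      have M: "b \<in> S.M" "b' \<in> S.M" using S.PS_M P b by blast+
      have "rs_mult T (f b) (f b') \<in> T.cmp A A'" using AA(4)[of "f b" "f b'"] B' b by blast
      then show ?thesis using T.PS_up[OF AA(1), of "rs_mult T (f b) (f b')" "f c"] f_mono[OF b(3,4)] b M by simp
    qed
    then show ?thesis unfolding mem_spec_ar[OF AA(1)] using BB' B' AA(2) by auto
  qed
  have 6: "A = A'" if A: "A \<in> T.PS" "A' \<in> T.PS" "T.Dm A = T.Dm A' \<or> T.Cd A = T.Cd A'"
    and ne: "?f1 A \<inter> ?f1 A' \<noteq> {}" for A A'
  proof -
    obtain B where B: "B \<in> ?f1 A" "B \<in> ?f1 A'" using ne by blast
    note B' = B(1)[unfolded mem_spec_ar[OF A(1)]] B(2)[unfolded mem_spec_ar[OF A(2)]]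
    have BP: "B \<in> S.PS" using B' by blast
    obtain b where "b \<in> B" using S.PS_elem[OF BP] .
    then have "f b \<in> A" "f b \<in> A'" using B' by blast+
    then show ?thesis using A T.prime_filter_eqI_dm T.prime_filter_eqI_cd by blast
  qed
  have 7: "(S.Dm B = ?f0 F \<longrightarrow> (\<exists>A\<in>T.PS. T.Dm A = F \<and> B \<in> ?f1 A)) \<and>
      (S.Cd B = ?f0 F \<longrightarrow> (\<exists>A\<in>T.PS. T.Cd A = F \<and> B \<in> ?f1 A))" if "F \<in> T.PE" "B \<in> S.PS" for F B
    using spec_ar_lift[OF that] spec_ar_lift_Cd[OF that] that by simp
  have 8: "openin (T.XS) {A \<in> T.PS. ?f1 A \<inter> U \<noteq> {}}"
    if U: "openin (S.XS) U" for U
    unfolding openin_prime_spectrum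
  proof (intro conjI ballI)
    fix A assume "A \<in> {A \<in> T.PS. ?f1 A \<inter> U \<noteq> {}}"
    then obtain B where A: "A \<in> T.PS" and B: "B \<in> ?f1 A" "B \<in> U" by blast
    obtain b where b: "B \<in> S.PS" "b \<in> B" "S.BS b \<subseteq> U" using openin_prime_spectrumE[OF U B(2)] .
    have bM: "b \<in> S.M" using S.PS_M b by blast
    have "f b \<in> A" using mem_spec_ar[OF A] B(1) b(2) by blast
    moreover have "T.BS (f b) \<subseteq> {A \<in> T.PS. ?f1 A \<inter> U \<noteq> {}}"
      unfolding spec_ar_meets_basic[OF bM, symmetric] using b(3) by blast
    ultimately show "\<exists>a\<in>A. T.BS a \<subseteq> {A \<in> T.PS. ?f1 A \<inter> U \<noteq> {}}" by (rule bexI[rotated])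
  qed auto
  have 9: "S.un (?f0 F) \<in> ?f1 (T.un F)" if F: "F \<in> T.PE" for F
  proof -
    note uF = T.unit_prime[OF F] and upF = S.unit_prime[OF pull_prime[OF F]]
    have "f c \<in> T.un F" if c: "c \<in> S.un (pull F)" for c
    proof -
      obtain e where e: "e \<in> S.E" "f e \<in> F" "e \<preceq>\<^sub>S c" "c \<in> S.M"
        using c unfolding S.mem_unit by auto
      then show ?thesis unfolding T.mem_unit using f_mono[OF e(3,4)] by auto
    qed
    then have "S.un (pull F) \<in> ?f1 (T.un F)"
      unfolding mem_spec_ar[OF uF(1)] using upF uF by (intro conjI subsetI) (auto simp del: spec_ob_simps)
    then show ?thesis using F by simp
  qed
  show ?thesis
    unfolding relational_covering_morphism_def split_beta spec_ob_simps(1,2) topspace_prime_spectrum composable_def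
    using 1 2 3 4 5 6 7 8 9 by (intro conjI ballI allI impI; simp del: spec_ob_simps)
qed

lemma coherent_spec: "coherent (spec_ob T) (spec_ob S) (spec_ar S T f)"
  unfolding coherent_def spec_ob_simps topspace_prime_spectrum
proof (intro allI impI)
  fix U assume "compact_open (S.XE) U"
  then obtain e where e: "e \<in> S.E" "U = S.BE e" using S.compact_open_objects_iff by blast
  have "{F \<in> T.PE. snd (spec_ar S T f) F \<in> U} = {F \<in> T.PE. pull F \<in> U}" by auto
  then show "compact_open (T.XE) {F \<in> T.PE. snd (spec_ar S T f) F \<in> U}"
    unfolding T.compact_open_objects_iff e(2) pull_basic[OF e(1)] using f_E[OF e(1)] by auto
qed

text \<open>If \<open>t \<in> A\<close> is a join of elements below images, primeness puts one of these elements and so an image \<open>f(s)\<close>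
  into \<open>A\<close>, and \<open>s\<close> generates a prime filter related to \<open>A\<close>.\<close>

lemma spec_ar_nonempty:
  assumes p: "proper_morphism S T f" and A: "A \<in> T.PS" shows "fst (spec_ar S T f) A \<noteq> {}"
proof -
  obtain t where t: "t \<in> A" "t \<in> T.M" using T.PS_ex[OF A] T.PS_M[OF A] by blast
  obtain n ts ss where ts: "\<forall>i\<in>{1..n::nat}. ts i \<in> T.M \<and> ss i \<in> S.M \<and> ts i \<preceq>\<^sub>T f (ss i)"
    "is_lub (natural_order T) t (ts ` {1..n})" using p t(2) unfolding proper_morphism_def by metis
  have "\<exists>x\<in>ts ` {1..n}. x \<in> A"
    using ts by (intro T.prime_filter_finite_lub[OF A t(1)]) auto
  then obtain i where i: "i \<in> {1..n}" "ts i \<in> A" by blast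
  then have "f (ss i) \<in> A" using T.PS_up[OF A i(2)] ts(1) by simp
  then show ?thesis using translate_spec_ar(1)[OF A, of "ss i"] ts(1) i(1) by blast
qed

text \<open>Around each prime filter in the basic set of \<open>t\<close> there is the basic set of some \<open>t' \<le> t\<close> that lies below an
  image; by compactness finitely many of these cover, and \<open>t\<close> is then their join because the order is
  inclusion of basic sets.\<close>

lemma proper_morphism_if_nonempty:
  assumes ne: "\<And>A. A \<in> T.PS \<Longrightarrow> fst (spec_ar S T f) A \<noteq> {}" shows "proper_morphism S T f"
proof (rule proper_morphismI)
  fix t assume t: "t \<in> T.M"
  let ?P = "\<lambda>t'. t' \<in> T.M \<and> t' \<preceq>\<^sub>T t \<and> (\<exists>s\<in>S.M. t' \<preceq>\<^sub>T f s)"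
  have "\<exists>B. openin (T.XS) B \<and> (\<exists>t'. B = T.BS t' \<and> ?P t') \<and> A \<in> B"
    if A: "A \<in> T.BS t" for A
  proof -
    have A': "A \<in> T.PS" "t \<in> A" using A by auto
    obtain B where B: "B \<in> fst (spec_ar S T f) A" using ne[OF A'(1)] by blast
    note B' = B[unfolded mem_spec_ar[OF A'(1)]]
    then have BP: "B \<in> S.PS" by blast
    obtain s where s: "s \<in> B" "s \<in> S.M" using S.PS_elem[OF BP] .
    have "f s \<in> A" using B' s by blast
    then obtain t' where t': "t' \<in> A" "t' \<preceq>\<^sub>T t" "t' \<preceq>\<^sub>T f s"
      using T.PS_dir[OF A'] by blast
    then have "?P t'" using s(2) T.PS_M[OF A'(1)] by blast
    then show ?thesis using t'(1) A'(1) openin_basic by (intro exI[of _ "T.BS t'"]) auto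
  qed
  then obtain \<F> where F: "finite \<F>" "T.BS t \<subseteq> \<Union>\<F>"
    "\<forall>B\<in>\<F>. \<exists>t'. B = T.BS t' \<and> ?P t'"
    using compactin_finite_basis_cover[of "T.XS" "T.BS t"
        "\<lambda>B. \<exists>t'. B = T.BS t' \<and> ?P t'"] T.compact_open_basic[OF t]
    unfolding compact_open_def by metis
  then obtain g where g: "\<And>B. B \<in> \<F> \<Longrightarrow> B = T.BS (g B) \<and> ?P (g B)" by metis
  \<comment> \<open>Zero is included because the family in the definition of properness has at least one member.\<close>
  define X where "X = insert T.zr (g ` \<F>)"
  have X: "finite X" "X \<noteq> {}" using F(1) by (auto simp: X_def)
  have XP: "?P x" if "x \<in> X" for x
  proof (cases "x = T.zr")
    case True
    then show ?thesis unfolding True using t by (intro conjI bexI[of _ S.zr]) simp_all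
  next
    case False
    then show ?thesis using that g unfolding X_def by blast
  qed
  have lub: "is_lub (natural_order T) t X"
  proof (rule least_UpperI)
    fix y assume y: "y \<in> Upper (natural_order T) X"
    then have yM: "y \<in> T.M" using Upper_closed[of "natural_order T" X] by auto
    have "A \<in> T.BS y" if A: "A \<in> T.BS t" for A
    proof -
      obtain B where B: "B \<in> \<F>" "A \<in> B" using F(2) A by blast
      then have gA: "g B \<in> A" "A \<in> T.PS" using g[OF B(1)] A mem_basic by metis+
      have "g B \<preceq>\<^sub>T y"
        using y g[OF B(1)] B(1) by (auto simp: Upper_def X_def)
      then show ?thesis using T.PS_up[OF gA(2,1) yM] gA by simp
    qed
    then show "t \<preceq>\<^sub>T y" using T.basic_mono_iff[OF t yM] by blast
  qed (use XP t in auto)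
  show "\<exists>X. finite X \<and> X \<noteq> {} \<and> X \<subseteq> T.M \<and> (\<forall>x\<in>X. \<exists>s\<in>S.M. x \<preceq>\<^sub>T f s) \<and>
      is_lub (natural_order T) t X" using X XP lub by blast
qed

text \<open>If \<open>B\<close> and \<open>B'\<close> are both related to \<open>A\<close>, weak preservation of meets gives a common lower bound \<open>c\<close> of some \<open>b \<in> B\<close>
  and \<open>b' \<in> B'\<close> that is still mapped into \<open>A\<close>.  Its domain lies in the common domain of \<open>B\<close> and \<open>B'\<close>, so \<open>c\<close> is in
  both.\<close>

lemma spec_ar_single_valued:
  assumes w: "weakly_meet_preserving S T f" and A: "A \<in> T.PS"
    and B: "B \<in> fst (spec_ar S T f) A" "B' \<in> fst (spec_ar S T f) A"
  shows "B = B'"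
proof -
  note P = B(1)[unfolded mem_spec_ar[OF A]] B(2)[unfolded mem_spec_ar[OF A]]
  have BP: "B \<in> S.PS" "B' \<in> S.PS" using P by blast+
  obtain b b' where b: "b \<in> B" "b' \<in> B'" "b \<in> S.M" "b' \<in> S.M"
    using S.PS_elem[OF BP(1)] S.PS_elem[OF BP(2)] by metis
  have "f b \<in> A" "f b' \<in> A" using P b by blast+
  then obtain t where t: "t \<in> A" "t \<preceq>\<^sub>T f b" "t \<preceq>\<^sub>T f b'" using T.PS_dir[OF A] by blast
  then obtain c where c: "c \<in> S.M" "c \<preceq>\<^sub>S b" "c \<preceq>\<^sub>S b'" "t \<preceq>\<^sub>T f c"
    using w b T.PS_M[OF A] unfolding weakly_meet_preserving_def by metis
  have "f c \<in> A" using T.PS_up[OF A t(1)] c by simp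
  then have "rs_dom T (f c) \<in> T.Dm A" using T.Dm_I[OF A] by blast
  then have dc: "rs_dom S c \<in> pull (T.Dm A)" using c(1) by simp
  have "c = rs_mult S b (rs_dom S c)" "c = rs_mult S b' (rs_dom S c)" using S.le_iff_mul_dm c b by blast+
  then have "c \<in> B" "c \<in> B'" using S.mul_Dm[of B b "rs_dom S c"] S.mul_Dm[of B' b' "rs_dom S c"] dc P b by auto
  then show ?thesis using S.prime_filter_eqI_dm[of B B' c] P by simp
qed

end

lemma etc_morphism_of_type_spec:
  assumes "drs S" "drs T" "drs_morphism_of_type k S T f"
  shows "etc_morphism_of_type k (spec_ob T) (spec_ob S) (spec_ar S T f)"
proof -
  interpret drs_hom S T f using assms by (simp add: drs_homI drs_morphism_of_type_def)
  show ?thesis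
    using assms(3) relational_covering_morphism_spec coherent_spec spec_ar_nonempty spec_ar_single_valued
    unfolding etc_morphism_of_type_def drs_morphism_of_type_def
    by (simp del: spec_ob_simps(3))
qed

lemma spec_ar_id:
  assumes "drs S"
  shows "spec_ar S S (restrict id (carrier S)) =
    (\<lambda>A\<in>prime_filters (natural_order S). {A}, \<lambda>F\<in>prime_filters (projection_order S). F)"
proof -
  interpret drs S by fact
  interpret i: drs_hom S S "restrict id (carrier S)" using drs_morphism_id[OF assms] by (intro drs_homI assms)
  have pull: "i.pull F = F" if "F \<in> PE" for F
    using PE_E[OF that] by (auto simp: i.pull_def)
  have "fst (spec_ar S S (restrict id (carrier S))) A = {A}" if A: "A \<in> PS" for A
  proof (intro Set.set_eqI iffI)
    fix B assume "B \<in> fst (spec_ar S S (restrict id (carrier S))) A"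
    then have B: "B \<in> PS" "restrict id (carrier S) ` B \<subseteq> A" "Dm B = Dm A"
      unfolding i.mem_spec_ar[OF A] using pull[OF Dm_prime[OF A]] by auto
    obtain b where b: "b \<in> B" "b \<in> M" using PS_ex[OF B(1)] PS_M[OF B(1)] by blast
    then have "restrict id (carrier S) b \<in> A" using B(2) by blast
    then have "b \<in> A" using b by simp
    then show "B \<in> {A}" using prime_filter_eqI_dm[OF B(1) A b(1)] B(3) by simp
  next
    fix B assume "B \<in> {A}"
    moreover have "restrict id (carrier S) ` A \<subseteq> A" using PS_M[OF A] by auto
    ultimately show "B \<in> fst (spec_ar S S (restrict id (carrier S))) A"
      unfolding i.mem_spec_ar[OF A] using A pull[OF Dm_prime[OF A]] by simp
  qed
  then have "fst (spec_ar S S (restrict id (carrier S))) = (\<lambda>A\<in>PS. {A})"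
    by (intro extensionalityI[of _ PS]) (auto simp: spec_ar_def Let_def)
  moreover have "snd (spec_ar S S (restrict id (carrier S))) = (\<lambda>F\<in>PE. F)"
    using pull by (intro extensionalityI[of _ PE]) (auto simp: spec_ar_def Let_def i.pull_def)
  ultimately show ?thesis by (metis prod.collapse)
qed

text \<open>Given \<open>D\<close> related to \<open>A\<close> by the composite, the intermediate prime filter is generated by the image of any
  one element of \<open>D\<close>.\<close>

lemma spec_ar_compose:
  assumes "drs_hom S T f" "drs_hom T U g"
  shows "spec_ar S U (compose (carrier S) g f) =
    (\<lambda>A\<in>prime_filters (natural_order U). \<Union>B\<in>fst (spec_ar T U g) A. fst (spec_ar S T f) B,
     \<lambda>F\<in>prime_filters (projection_order U). snd (spec_ar S T f) (snd (spec_ar T U g) F))"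
proof -
  interpret f: drs_hom S T f by fact
  interpret g: drs_hom T U g by fact
  interpret h: drs_hom S U "compose (carrier S) g f"
    using drs_morphism_compose[OF assms] by (intro drs_homI f.S.drs_axioms g.T.drs_axioms)
  have h: "compose (carrier S) g f a = g (f a)" if "a \<in> carrier S" for a using that by (simp add: compose_def)
  have pull: "h.pull F = f.pull (g.pull F)" for F
    by (auto simp: h.pull_def f.pull_def g.pull_def h)
  have "fst (spec_ar S U (compose (carrier S) g f)) A = (\<Union>B\<in>fst (spec_ar T U g) A. fst (spec_ar S T f) B)"
    if A: "A \<in> g.T.PS" for A
  proof (intro Set.set_eqI iffI)
    fix D assume "D \<in> fst (spec_ar S U (compose (carrier S) g f)) A"
    then have D: "D \<in> f.S.PS" "compose (carrier S) g f ` D \<subseteq> A" "f.S.Dm D = f.pull (g.pull (g.T.Dm A))"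
      unfolding h.mem_spec_ar[OF A] pull by auto
    obtain s where s: "s \<in> D" "s \<in> f.S.M" using f.S.PS_ex[OF D(1)] f.S.PS_M[OF D(1)] by blast
    then have "compose (carrier S) g f s \<in> A" using D(2) by blast
    then have gfs: "g (f s) \<in> A" using h s(2) by simp
    let ?B = "translate T (f s) (g.pull (g.T.Dm A))"
    note B = g.translate_spec_ar[OF A f.f_M[OF s(2)] gfs]
    note B' = B(1)[unfolded g.mem_spec_ar[OF A]]
    have BP: "?B \<in> f.T.PS" using B' by blast
    have "f.pull (f.T.Dm ?B) = f.S.Dm D" using B' D(3) by simp
    then have "translate S s (f.pull (f.T.Dm ?B)) = D"
      using f.S.prime_filter_eq_translate[OF D(1) s(1)] by simp
    then have "D \<in> fst (spec_ar S T f) ?B" using f.translate_spec_ar(1)[OF BP s(2) B(2)] by simp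
    then show "D \<in> (\<Union>B\<in>fst (spec_ar T U g) A. fst (spec_ar S T f) B)" using B(1) by blast
  next
    fix D assume "D \<in> (\<Union>B\<in>fst (spec_ar T U g) A. fst (spec_ar S T f) B)"
    then obtain B where B: "B \<in> fst (spec_ar T U g) A" "D \<in> fst (spec_ar S T f) B" by blast
    note B' = B(1)[unfolded g.mem_spec_ar[OF A]]
    then have "B \<in> f.T.PS" by blast
    note D = B(2)[unfolded f.mem_spec_ar[OF this]]
    have "compose (carrier S) g f c \<in> A" if "c \<in> D" for c
    proof -
      have "c \<in> f.S.M" using D f.S.PS_M that by blast
      moreover have "g (f c) \<in> A" using D B' that by blast
      ultimately show ?thesis using h by simp
    qed
    then show "D \<in> fst (spec_ar S U (compose (carrier S) g f)) A"
      unfolding h.mem_spec_ar[OF A] pull using D B' by auto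
  qed
  then have "fst (spec_ar S U (compose (carrier S) g f)) =
      (\<lambda>A\<in>g.T.PS. \<Union>B\<in>fst (spec_ar T U g) A. fst (spec_ar S T f) B)"
    by (intro extensionalityI[of _ g.T.PS]) (auto simp: spec_ar_def Let_def)
  moreover have "snd (spec_ar S U (compose (carrier S) g f)) =
      (\<lambda>F\<in>g.T.PE. snd (spec_ar S T f) (snd (spec_ar T U g) F))"
  proof (rule extensionalityI[of _ g.T.PE])
    fix F assume F: "F \<in> g.T.PE"
    show "snd (spec_ar S U (compose (carrier S) g f)) F = (\<lambda>F\<in>g.T.PE. snd (spec_ar S T f) (snd (spec_ar T U g) F)) F"
      using F g.pull_prime[OF F] pull[of F] by simp
  qed (auto simp: spec_ar_def Let_def)
  ultimately show ?thesis by (metis prod.collapse)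
qed

text \<open>A value of the composite relation is reached through a value of each factor, so properness passes to
  composites.\<close>

lemma proper_morphism_compose:
  assumes f: "drs_hom S T f" "proper_morphism S T f" and g: "drs_hom T U g" "proper_morphism T U g"
  shows "proper_morphism S U (compose (carrier S) g f)"
proof -
  interpret f: drs_hom S T f by fact
  interpret g: drs_hom T U g by fact
  interpret h: drs_hom S U "compose (carrier S) g f"
    using drs_morphism_compose[OF f(1) g(1)] by (intro drs_homI f.S.drs_axioms g.T.drs_axioms)
  show ?thesis
  proof (rule h.proper_morphism_if_nonempty)
    fix A assume A: "A \<in> g.T.PS"
    obtain B where B: "B \<in> fst (spec_ar T U g) A" using g.spec_ar_nonempty[OF g(2) A] by blast
    then have "B \<in> f.T.PS" unfolding g.mem_spec_ar[OF A] by blast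
    then have "fst (spec_ar S T f) B \<noteq> {}" by (rule f.spec_ar_nonempty[OF f(2)])
    then show "fst (spec_ar S U (compose (carrier S) g f)) A \<noteq> {}"
      unfolding spec_ar_compose[OF f(1) g(1)] using A B by auto
  qed
qed

lemma drs_morphism_of_type_compose:
  assumes "drs S" "drs T" "drs U" "drs_morphism_of_type k S T f" "drs_morphism_of_type k T U g"
  shows "drs_morphism_of_type k S U (compose (carrier S) g f)"
proof -
  have "drs_hom S T f" "drs_hom T U g" using assms by (simp_all add: drs_homI drs_morphism_of_type_def)
  then show ?thesis
    using assms(4,5) drs_morphism_compose proper_morphism_compose weakly_meet_preserving_compose
    unfolding drs_morphism_of_type_def by blast
qed

section \<open>Relational covering morphisms\<close>

lemma relational_covering_morphismD:
  assumes "relational_covering_morphism C D f"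
  shows "fst f \<in> arrows C \<rightarrow>\<^sub>E Pow (arrows D)" "snd f \<in> objects C \<rightarrow>\<^sub>E objects D"
    "continuous_map (tc_obj C) (tc_obj D) (snd f)"
    "\<And>a b. a \<in> arrows C \<Longrightarrow> b \<in> fst f a \<Longrightarrow> tc_dom D b = snd f (tc_dom C a)"
    "\<And>a b. a \<in> arrows C \<Longrightarrow> b \<in> fst f a \<Longrightarrow> tc_cod D b = snd f (tc_cod C a)"
    "\<And>a b s t. (a, b) \<in> composable C \<Longrightarrow> (s, t) \<in> composable D \<Longrightarrow> s \<in> fst f a \<Longrightarrow> t \<in> fst f b \<Longrightarrow>
      tc_comp D s t \<in> fst f (tc_comp C a b)"
    "\<And>a b s. a \<in> arrows C \<Longrightarrow> b \<in> arrows C \<Longrightarrow> tc_dom C a = tc_dom C b \<Longrightarrow> s \<in> fst f a \<Longrightarrow> s \<in> fst f b \<Longrightarrow> a = b"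
    "\<And>a b s. a \<in> arrows C \<Longrightarrow> b \<in> arrows C \<Longrightarrow> tc_cod C a = tc_cod C b \<Longrightarrow> s \<in> fst f a \<Longrightarrow> s \<in> fst f b \<Longrightarrow> a = b"
    "\<And>q s. q \<in> objects C \<Longrightarrow> s \<in> arrows D \<Longrightarrow> tc_dom D s = snd f q \<Longrightarrow>
      \<exists>t\<in>arrows C. tc_dom C t = q \<and> s \<in> fst f t"
    "\<And>q s. q \<in> objects C \<Longrightarrow> s \<in> arrows D \<Longrightarrow> tc_cod D s = snd f q \<Longrightarrow>
      \<exists>t\<in>arrows C. tc_cod C t = q \<and> s \<in> fst f t"
    "\<And>A. openin (tc_arr D) A \<Longrightarrow> openin (tc_arr C) {x\<in>arrows C. fst f x \<inter> A \<noteq> {}}"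
    "\<And>t. t \<in> objects C \<Longrightarrow> tc_unit D (snd f t) \<in> fst f (tc_unit C t)"
proof -
  obtain f1 f0 where f: "f = (f1, f0)" by (cases f)
  note A = assms[unfolded f relational_covering_morphism_def prod.case]
  show "fst f \<in> arrows C \<rightarrow>\<^sub>E Pow (arrows D)" "snd f \<in> objects C \<rightarrow>\<^sub>E objects D"
    "continuous_map (tc_obj C) (tc_obj D) (snd f)"
    using A by (simp_all add: f)
  show "tc_dom D b = snd f (tc_dom C a)" "tc_cod D b = snd f (tc_cod C a)"
    if "a \<in> arrows C" "b \<in> fst f a" for a b
    using A that by (simp_all add: f)
  show "tc_comp D s t \<in> fst f (tc_comp C a b)"
    if "(a, b) \<in> composable C" "(s, t) \<in> composable D" "s \<in> fst f a" "t \<in> fst f b" for a b s t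
  proof -
    have "\<forall>(a, b)\<in>composable C. \<forall>(s, t)\<in>composable D. s \<in> f1 a \<and> t \<in> f1 b \<longrightarrow> tc_comp D s t \<in> f1 (tc_comp C a b)"
      using A by (elim conjE)
    then show ?thesis using that unfolding f by auto
  qed
  have inj: "\<forall>a\<in>arrows C. \<forall>b\<in>arrows C. (tc_dom C a = tc_dom C b \<or> tc_cod C a = tc_cod C b) \<and>
      f1 a \<inter> f1 b \<noteq> {} \<longrightarrow> a = b" using A by (elim conjE)
  show "a = b" if "a \<in> arrows C" "b \<in> arrows C" "tc_dom C a = tc_dom C b" "s \<in> fst f a" "s \<in> fst f b" for a b s
    using inj that unfolding f by auto
  show "a = b" if "a \<in> arrows C" "b \<in> arrows C" "tc_cod C a = tc_cod C b" "s \<in> fst f a" "s \<in> fst f b" for a b s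
    using inj that unfolding f by auto
  show "\<exists>t\<in>arrows C. tc_dom C t = q \<and> s \<in> fst f t"
    if "q \<in> objects C" "s \<in> arrows D" "tc_dom D s = snd f q" for q s using A that by (simp add: f)
  show "\<exists>t\<in>arrows C. tc_cod C t = q \<and> s \<in> fst f t"
    if "q \<in> objects C" "s \<in> arrows D" "tc_cod D s = snd f q" for q s using A that by (simp add: f)
  show "openin (tc_arr C) {x\<in>arrows C. fst f x \<inter> A \<noteq> {}}" if "openin (tc_arr D) A" for A
    using A that by (simp add: f)
  show "tc_unit D (snd f t) \<in> fst f (tc_unit C t)" if "t \<in> objects C" for t using A that by (simp add: f)
qed

lemma relational_covering_morphismI:
  assumes "f1 \<in> arrows C \<rightarrow>\<^sub>E Pow (arrows D)" "f0 \<in> objects C \<rightarrow>\<^sub>E objects D"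
    "continuous_map (tc_obj C) (tc_obj D) f0"
    "\<And>a b. a \<in> arrows C \<Longrightarrow> b \<in> f1 a \<Longrightarrow> tc_dom D b = f0 (tc_dom C a)"
    "\<And>a b. a \<in> arrows C \<Longrightarrow> b \<in> f1 a \<Longrightarrow> tc_cod D b = f0 (tc_cod C a)"
    "\<And>a b s t. (a, b) \<in> composable C \<Longrightarrow> (s, t) \<in> composable D \<Longrightarrow> s \<in> f1 a \<Longrightarrow> t \<in> f1 b \<Longrightarrow>
      tc_comp D s t \<in> f1 (tc_comp C a b)"
    "\<And>a b s. a \<in> arrows C \<Longrightarrow> b \<in> arrows C \<Longrightarrow> tc_dom C a = tc_dom C b \<or> tc_cod C a = tc_cod C b \<Longrightarrow>
      s \<in> f1 a \<Longrightarrow> s \<in> f1 b \<Longrightarrow> a = b"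
    "\<And>q s. q \<in> objects C \<Longrightarrow> s \<in> arrows D \<Longrightarrow> tc_dom D s = f0 q \<Longrightarrow>
      \<exists>t\<in>arrows C. tc_dom C t = q \<and> s \<in> f1 t"
    "\<And>q s. q \<in> objects C \<Longrightarrow> s \<in> arrows D \<Longrightarrow> tc_cod D s = f0 q \<Longrightarrow>
      \<exists>t\<in>arrows C. tc_cod C t = q \<and> s \<in> f1 t"
    "\<And>A. openin (tc_arr D) A \<Longrightarrow> openin (tc_arr C) {x\<in>arrows C. f1 x \<inter> A \<noteq> {}}"
    "\<And>t. t \<in> objects C \<Longrightarrow> tc_unit D (f0 t) \<in> f1 (tc_unit C t)"
  shows "relational_covering_morphism C D (f1, f0)"
proof -
  have "a = b" if "a \<in> arrows C" "b \<in> arrows C" "tc_dom C a = tc_dom C b \<or> tc_cod C a = tc_cod C b"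
    "f1 a \<inter> f1 b \<noteq> {}" for a b using assms(7)[OF that(1-3)] that(4) by blast
  then show ?thesis
    unfolding relational_covering_morphism_def prod.case
    using assms(1-6,8-) by (intro conjI ballI allI impI) (auto split: prod.splits)
qed

locale rel_hom = C: spectral_etale C + D: spectral_etale D for C :: "'c tcat" and D :: "'d tcat" +
  fixes f :: "('c, 'd) rel_map"
  assumes relational: "relational_covering_morphism C D f" and coherent: "coherent C D f"
begin

abbreviation f1 where "f1 \<equiv> fst f"
abbreviation f0 where "f0 \<equiv> snd f"

lemmas rcm = relational_covering_morphismD[OF relational]

lemma f1_arr: "a \<in> arrows C \<Longrightarrow> s \<in> f1 a \<Longrightarrow> s \<in> arrows D"
  and f0_obj [simp]: "p \<in> objects C \<Longrightarrow> f0 p \<in> objects D"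
  using rcm(1,2) by auto

definition pre :: "'d set \<Rightarrow> 'c set" where
  "pre B = {x\<in>arrows C. f1 x \<inter> B \<noteq> {}}"

definition pre0 :: "'d set \<Rightarrow> 'c set" where
  "pre0 U = {p\<in>objects C. f0 p \<in> U}"

lemma preE: assumes "x \<in> pre B" obtains b where "x \<in> arrows C" "b \<in> f1 x" "b \<in> B"
  using assms by (auto simp: pre_def)

lemma preI: "x \<in> arrows C \<Longrightarrow> b \<in> f1 x \<Longrightarrow> b \<in> B \<Longrightarrow> x \<in> pre B"
  by (auto simp: pre_def)

lemma pre_mono: "A \<subseteq> B \<Longrightarrow> pre A \<subseteq> pre B"
  by (auto simp: pre_def)

lemma d_pre: assumes "B \<subseteq> arrows D" shows "C.d ` pre B = pre0 (D.d ` B)"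
proof (intro Set.set_eqI iffI)
  fix p assume "p \<in> C.d ` pre B"
  then obtain x b where x: "x \<in> arrows C" "b \<in> f1 x" "b \<in> B" "p = C.d x" by (auto elim!: preE)
  then have "f0 p = D.d b" using rcm(4) by simp
  then show "p \<in> pre0 (D.d ` B)" using x by (auto simp: pre0_def)
next
  fix p assume "p \<in> pre0 (D.d ` B)"
  then obtain b where b: "p \<in> objects C" "b \<in> B" "D.d b = f0 p" by (auto simp: pre0_def)
  then obtain x where "x \<in> arrows C" "C.d x = p" "b \<in> f1 x" using rcm(9) assms by blast
  then show "p \<in> C.d ` pre B" using preI b by blast
qed

lemma r_pre: assumes "B \<subseteq> arrows D" shows "C.r ` pre B = pre0 (D.r ` B)"
proof (intro Set.set_eqI iffI)
  fix p assume "p \<in> C.r ` pre B"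
  then obtain x b where x: "x \<in> arrows C" "b \<in> f1 x" "b \<in> B" "p = C.r x" by (auto elim!: preE)
  then have "f0 p = D.r b" using rcm(5) by simp
  then show "p \<in> pre0 (D.r ` B)" using x by (auto simp: pre0_def)
next
  fix p assume "p \<in> pre0 (D.r ` B)"
  then obtain b where b: "p \<in> objects C" "b \<in> B" "D.r b = f0 p" by (auto simp: pre0_def)
  then obtain x where "x \<in> arrows C" "C.r x = p" "b \<in> f1 x" using rcm(10) assms by blast
  then show "p \<in> C.r ` pre B" using preI b by blast
qed

lemma compact_open_pre0: "compact_open D.X0 U \<Longrightarrow> compact_open C.X0 (pre0 U)"
  using coherent by (simp add: coherent_def pre0_def)

text \<open>Arrows with equal domains that are related to arrows of one bisection are related to the same arrow, as
  the domains of these agree, and hence are equal.  The set of domains is compact by coherence.\<close>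

lemma pre_cob: assumes B: "B \<in> D.cob" shows "pre B \<in> C.cob"
proof -
  have "openin C.X1 (pre B)" unfolding pre_def using rcm(11) B by (simp add: D.mem_cob)
  moreover have "inj_on C.d (pre B)"
  proof (rule inj_onI)
    fix x y assume "x \<in> pre B" "y \<in> pre B" and dxy: "C.d x = C.d y"
    then obtain a b where ab: "x \<in> arrows C" "a \<in> f1 x" "a \<in> B" "y \<in> arrows C" "b \<in> f1 y" "b \<in> B"
      by (auto elim!: preE)
    have "D.d a = D.d b" using rcm(4)[OF ab(1,2)] rcm(4)[OF ab(4,5)] dxy by simp
    then have "a = b" using D.cob_inj_d[OF B] ab by blast
    then show "x = y" using rcm(7)[OF ab(1,4) dxy] ab by blast
  qed
  moreover have "inj_on C.r (pre B)"
  proof (rule inj_onI)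
    fix x y assume "x \<in> pre B" "y \<in> pre B" and rxy: "C.r x = C.r y"
    then obtain a b where ab: "x \<in> arrows C" "a \<in> f1 x" "a \<in> B" "y \<in> arrows C" "b \<in> f1 y" "b \<in> B"
      by (auto elim!: preE)
    have "D.r a = D.r b" using rcm(5)[OF ab(1,2)] rcm(5)[OF ab(4,5)] rxy by simp
    then have "a = b" using D.cob_inj_r[OF B] ab by blast
    then show "x = y" using rcm(8)[OF ab(1,4) rxy] ab by blast
  qed
  moreover have "compactin C.X0 (C.d ` pre B)"
    using compact_open_pre0[OF D.cob_d[OF B]] d_pre[OF D.cob_subset_arrows[OF B]] by (simp add: compact_open_def)
  ultimately show ?thesis by (simp add: C.mem_cob)
qed

text \<open>An arrow related to a unit \<open>u q\<close> shares its domain \<open>p\<close> with \<open>u p\<close>, which is related to \<open>u q\<close> as well; by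
  uniqueness of lifts it is \<open>u p\<close>.\<close>

lemma pre_unit: assumes U: "U \<subseteq> objects D" shows "pre (D.u ` U) = C.u ` pre0 U"
proof (intro Set.set_eqI iffI)
  fix x assume "x \<in> pre (D.u ` U)"
  then obtain q where x: "x \<in> arrows C" "D.u q \<in> f1 x" "q \<in> U" by (auto elim!: preE)
  have dx: "C.d x \<in> objects C" "C.u (C.d x) \<in> arrows C" using x(1) by simp_all
  have q: "f0 (C.d x) = q" using rcm(4)[OF x(1,2)] x(3) U by (simp add: subset_iff)
  then have "D.u q \<in> f1 (C.u (C.d x))" using rcm(12)[OF dx(1)] by simp
  then have "x = C.u (C.d x)" using rcm(7)[OF x(1) dx(2) _ x(2)] dx(1) by simp
  moreover have "C.d x \<in> pre0 U" using dx q x(3) by (simp add: pre0_def)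
  ultimately show "x \<in> C.u ` pre0 U" by blast
next
  fix x assume "x \<in> C.u ` pre0 U"
  then obtain p where p: "p \<in> objects C" "f0 p \<in> U" "x = C.u p" by (auto simp: pre0_def)
  show "x \<in> pre (D.u ` U)" using preI[of x "D.u (f0 p)"] rcm(12)[OF p(1)] p by simp
qed

text \<open>An arrow \<open>x\<close> related to \<open>a b\<close> is recovered by lifting \<open>a\<close> from the codomain of \<open>x\<close> and then \<open>b\<close> from the domain
  of this lift: the composite of the lifts is also related to \<open>a b\<close> and has the codomain of \<open>x\<close>.\<close>

lemma pre_set_comp:
  assumes A: "A \<subseteq> arrows D" and B: "B \<subseteq> arrows D"
  shows "pre (set_comp D A B) = set_comp C (pre A) (pre B)"
proof (intro Set.set_eqI iffI)
  fix x assume "x \<in> pre (set_comp D A B)"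
  then obtain a b where x: "x \<in> arrows C" and ab: "a \<in> A" "b \<in> B" "D.d a = D.r b" "tc_comp D a b \<in> f1 x"
    by (auto elim!: preE simp: set_comp_def)
  have comp: "(a, b) \<in> composable D" using A B ab by auto
  have "D.r a = f0 (C.r x)" using rcm(5)[OF x ab(4)] D.r_comp[OF comp] by simp
  then obtain t where t: "t \<in> arrows C" "C.r t = C.r x" "a \<in> f1 t"
    using rcm(10)[of "C.r x" a] x A ab by auto
  have "D.r b = f0 (C.d t)" using rcm(4)[OF t(1,3)] ab by simp
  then obtain t' where t': "t' \<in> arrows C" "C.r t' = C.d t" "b \<in> f1 t'"
    using rcm(10)[of "C.d t" b] t B ab by auto
  have comp': "(t, t') \<in> composable C" using t t' by auto
  have "tc_comp D a b \<in> f1 (tc_comp C t t')" using rcm(6)[OF comp' comp t(3) t'(3)] .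
  then have "x = tc_comp C t t'"
    using rcm(8)[OF x C.comp_arr[OF comp'] _ ab(4)] C.r_comp[OF comp'] t(2) by simp
  moreover have "t \<in> pre A" "t' \<in> pre B" using preI t t' ab by blast+
  ultimately show "x \<in> set_comp C (pre A) (pre B)" using t'(2) unfolding set_comp_def by force
next
  fix x assume "x \<in> set_comp C (pre A) (pre B)"
  then obtain t t' where x: "x = tc_comp C t t'" "t \<in> pre A" "t' \<in> pre B" "C.d t = C.r t'"
    unfolding set_comp_def by blast
  obtain a b where ab: "t \<in> arrows C" "a \<in> f1 t" "a \<in> A" "t' \<in> arrows C" "b \<in> f1 t'" "b \<in> B"
    using x by (auto elim!: preE)
  have comp': "(t, t') \<in> composable C" using ab x by auto
  have dr: "D.d a = D.r b" using rcm(4)[OF ab(1,2)] rcm(5)[OF ab(4,5)] x(4) by simp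
  then have comp: "(a, b) \<in> composable D" using ab A B by auto
  have "tc_comp D a b \<in> f1 x" using rcm(6)[OF comp' comp ab(2,5)] x by simp
  moreover have "tc_comp D a b \<in> set_comp D A B" using ab dr unfolding set_comp_def by blast
  ultimately show "x \<in> pre (set_comp D A B)" using preI C.comp_arr[OF comp'] x(1) by blast
qed

lemma bis_ar_eq: "B \<in> D.cob \<Longrightarrow> bis_ar C D f B = pre B"
  by (simp add: bis_ar_def pre_def)

lemma unit_pre: "compact_open D.X0 U \<Longrightarrow> bis_ar C D f (D.u ` U) = C.u ` pre0 U"
  using bis_ar_eq[OF D.unit_cob] pre_unit[OF compact_open_subset] by simp

lemma drs_morphism_bis: "drs_morphism (bis_ob D) (bis_ob C) (bis_ar C D f)"
proof (rule drs_morphismI[OF D.B.drs_axioms C.B.drs_axioms])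
  show "bis_ar C D f \<in> carrier (bis_ob D) \<rightarrow>\<^sub>E carrier (bis_ob C)"
    using pre_cob by (auto simp: bis_ar_def pre_def)
  fix A B assume "A \<in> carrier (bis_ob D)" "B \<in> carrier (bis_ob D)"
  then have AB: "A \<in> D.cob" "B \<in> D.cob" by simp_all
  show "bis_ar C D f (rs_mult (bis_ob D) A B) = rs_mult (bis_ob C) (bis_ar C D f A) (bis_ar C D f B)"
    using AB D.set_comp_cob[OF AB] pre_set_comp[OF D.cob_subset_arrows D.cob_subset_arrows, OF AB]
    by (simp add: bis_ar_eq)
next
  fix B assume "B \<in> carrier (bis_ob D)"
  then have B: "B \<in> D.cob" by simp
  show "bis_ar C D f (rs_dom (bis_ob D) B) = rs_dom (bis_ob C) (bis_ar C D f B)"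
    using unit_pre[OF D.cob_d[OF B]] d_pre[OF D.cob_subset_arrows[OF B]] bis_ar_eq[OF B] by simp
  show "bis_ar C D f (rs_cod (bis_ob D) B) = rs_cod (bis_ob C) (bis_ar C D f B)"
    using unit_pre[OF D.cob_r[OF B]] r_pre[OF D.cob_subset_arrows[OF B]] bis_ar_eq[OF B] by simp
next
  show "bis_ar C D f D.B.zr = C.B.zr"
    using unit_pre[of "{}"] by (simp add: D.zr_bis C.zr_bis pre0_def)
next
  fix e e' assume "e \<in> rs_proj (bis_ob D)" "e' \<in> rs_proj (bis_ob D)"
  then obtain U V where U: "compact_open D.X0 U" "e = D.u ` U" and V: "compact_open D.X0 V" "e' = D.u ` V"
    using D.proj_bisE by metis
  have "pre0 (U \<union> V) = pre0 U \<union> pre0 V" by (auto simp: pre0_def)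
  then show "bis_ar C D f (e \<squnion>\<^bsub>projection_order (bis_ob D)\<^esub> e') =
      bis_ar C D f e \<squnion>\<^bsub>projection_order (bis_ob C)\<^esub> bis_ar C D f e'"
    using D.bis_join[OF U(1) V(1)] C.bis_join[OF compact_open_pre0[OF U(1)] compact_open_pre0[OF V(1)]]
      unit_pre[OF U(1)] unit_pre[OF V(1)] unit_pre[OF compact_open_Un[OF U(1) V(1)]] U V by simp
next
  fix e assume "e \<in> rs_proj (bis_ob C)"
  then obtain U where U: "compact_open C.X0 U" "e = C.u ` U" by (rule C.proj_bisE)
  have "compactin D.X0 (f0 ` U)" using image_compactin[OF _ rcm(3)] U(1) by (simp add: compact_open_def)
  moreover have "\<exists>V. openin D.X0 V \<and> compact_open D.X0 V \<and> q \<in> V" if "q \<in> f0 ` U" for q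
  proof -
    have "q \<in> objects D" using that compact_open_subset[OF U(1)] by auto
    then show ?thesis using D.compact_open_basis[OF openin_topspace, of q] by (auto simp: compact_open_def)
  qed
  ultimately obtain \<F> where F: "finite \<F>" "\<forall>V\<in>\<F>. openin D.X0 V \<and> compact_open D.X0 V" "f0 ` U \<subseteq> \<Union>\<F>"
    using compactin_finite_basis_cover[of D.X0 "f0 ` U" "compact_open D.X0"] by blast
  have V: "compact_open D.X0 (\<Union>\<F>)" using F by (intro compact_open_Union) auto
  have "U \<subseteq> pre0 (\<Union>\<F>)" using F(3) compact_open_subset[OF U(1)] by (auto simp: pre0_def)
  then have "e \<sqsubseteq>\<^bsub>natural_order (bis_ob C)\<^esub> bis_ar C D f (D.u ` \<Union>\<F>)"
    unfolding unit_pre[OF V] U(2) using C.le_unit_image[OF U(1) compact_open_pre0[OF V]] by blast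
  then show "\<exists>b\<in>rs_proj (bis_ob D). e \<sqsubseteq>\<^bsub>natural_order (bis_ob C)\<^esub> bis_ar C D f b"
    using V mem_proj_bis by blast
qed

text \<open>The bisection is covered by smaller ones, each inside an inverse image.  The empty bisection is added to
  the finite subcover because the family in the definition of properness has at least one member.\<close>

lemma proper_bis:
  assumes ne: "\<And>x. x \<in> arrows C \<Longrightarrow> f1 x \<noteq> {}" shows "proper_morphism (bis_ob D) (bis_ob C) (bis_ar C D f)"
proof (rule proper_morphismI)
  fix B assume "B \<in> carrier (bis_ob C)"
  then have B: "B \<in> C.cob" by simp
  let ?P = "\<lambda>A. A \<in> C.cob \<and> A \<subseteq> B \<and> (\<exists>A'\<in>D.cob. A \<subseteq> pre A')"
  have "\<exists>A. openin C.X1 A \<and> ?P A \<and> x \<in> A" if x: "x \<in> B" for x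
  proof -
    have xC: "x \<in> arrows C" using C.cob_arrows B x by blast
    obtain y where y: "y \<in> f1 x" using ne[OF xC] by blast
    obtain A' where A': "A' \<in> D.cob" "y \<in> A'"
      using D.cob_basis[OF openin_topspace f1_arr[OF xC y]] by blast
    have "openin C.X1 (B \<inter> pre A')" "x \<in> B \<inter> pre A'"
      using B pre_cob[OF A'(1)] x preI[OF xC y A'(2)] by (auto simp: C.mem_cob)
    then obtain A where "A \<in> C.cob" "x \<in> A" "A \<subseteq> B \<inter> pre A'" using C.cob_basis by blast
    then show ?thesis using A'(1) C.mem_cob by blast
  qed
  then obtain \<F> where F: "finite \<F>" "\<forall>A\<in>\<F>. openin C.X1 A \<and> ?P A" "B \<subseteq> \<Union>\<F>"
    using compactin_finite_basis_cover[of C.X1 B ?P] C.cob_compact_open[OF B] by (auto simp: compact_open_def)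
  let ?X = "insert {} \<F>"
  have empty: "{} \<in> C.cob" "{} \<in> D.cob" by (auto simp: C.mem_cob D.mem_cob)
  have X: "\<forall>A\<in>?X. A \<in> C.cob \<and> A \<subseteq> B \<and> (\<exists>A'\<in>D.cob. A \<subseteq> pre A')" using F(2) empty by blast
  have "is_lub (natural_order (bis_ob C)) B ?X"
  proof (rule least_UpperI)
    show "A \<sqsubseteq>\<^bsub>natural_order (bis_ob C)\<^esub> B" if "A \<in> ?X" for A
    proof -
      have "A \<in> C.cob" "A \<subseteq> B" using X that by blast+
      then show ?thesis using C.le_bis_iff[of A B] B by blast
    qed
    fix Y assume Y: "Y \<in> Upper (natural_order (bis_ob C)) ?X"
    then have Yc: "Y \<in> C.cob" using Upper_closed[of "natural_order (bis_ob C)" ?X] by auto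
    have "A \<subseteq> Y" if "A \<in> ?X" for A
    proof -
      have A: "A \<in> C.cob" using X that by blast
      then have "A \<sqsubseteq>\<^bsub>natural_order (bis_ob C)\<^esub> Y" using Y that by (auto simp: Upper_def)
      then show ?thesis using C.le_bis_iff[OF A Yc] by blast
    qed
    then have "B \<subseteq> Y" using F(3) by blast
    then show "B \<sqsubseteq>\<^bsub>natural_order (bis_ob C)\<^esub> Y" using C.le_bis_iff[OF B Yc] by blast
  qed (use X B in auto)
  moreover have "\<exists>s\<in>carrier (bis_ob D). A \<sqsubseteq>\<^bsub>natural_order (bis_ob C)\<^esub> bis_ar C D f s" if "A \<in> ?X" for A
  proof -
    obtain A' where A': "A \<in> C.cob" "A' \<in> D.cob" "A \<subseteq> pre A'" using X \<open>A \<in> ?X\<close> by blast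
    then have "A \<sqsubseteq>\<^bsub>natural_order (bis_ob C)\<^esub> bis_ar C D f A'"
      using C.le_bis_iff[OF A'(1) pre_cob[OF A'(2)]] bis_ar_eq[OF A'(2)] by simp
    then show ?thesis using A'(2) by auto
  qed
  moreover have "?X \<subseteq> carrier (bis_ob C)" using X by auto
  ultimately show "\<exists>X. finite X \<and> X \<noteq> {} \<and> X \<subseteq> carrier (bis_ob C) \<and>
      (\<forall>x\<in>X. \<exists>s\<in>carrier (bis_ob D). x \<sqsubseteq>\<^bsub>natural_order (bis_ob C)\<^esub> bis_ar C D f s) \<and>
      is_lub (natural_order (bis_ob C)) B X"
    using F(1) by (intro exI[of _ ?X] conjI ballI) simp_all
qed

text \<open>When values are single, a point of two inverse images is related to an arrow in \<open>A \<inter> A'\<close>.  This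
  intersection need not be compact, but finitely many bisections inside it suffice to cover the compact
  \<open>B\<close>.\<close>

lemma weakly_meet_preserving_bis:
  assumes single: "\<And>x y z. x \<in> arrows C \<Longrightarrow> y \<in> f1 x \<Longrightarrow> z \<in> f1 x \<Longrightarrow> y = z"
  shows "weakly_meet_preserving (bis_ob D) (bis_ob C) (bis_ar C D f)"
  unfolding weakly_meet_preserving_def bis_ob_simps
proof (intro ballI impI)
  fix B A A' assume B: "B \<in> C.cob" and A: "A \<in> D.cob" "A' \<in> D.cob"
    and "B \<sqsubseteq>\<^bsub>natural_order (bis_ob C)\<^esub> bis_ar C D f A \<and> B \<sqsubseteq>\<^bsub>natural_order (bis_ob C)\<^esub> bis_ar C D f A'"
  then have BA: "B \<subseteq> pre A" "B \<subseteq> pre A'"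
    using C.le_bis_iff[OF B pre_cob] bis_ar_eq by auto
  let ?P = "\<lambda>W. \<exists>K\<in>D.cob. K \<subseteq> A \<inter> A' \<and> W = pre K"
  have "\<exists>W. openin C.X1 W \<and> ?P W \<and> x \<in> W" if x: "x \<in> B" for x
  proof -
    obtain y z where y: "x \<in> arrows C" "y \<in> f1 x" "y \<in> A" and z: "z \<in> f1 x" "z \<in> A'"
      using BA[THEN subsetD, OF x] by (auto simp: pre_def)
    then have "y = z" using single by blast
    have "openin D.X1 (A \<inter> A')" using A by (auto simp: D.mem_cob)
    then obtain K where K: "K \<in> D.cob" "y \<in> K" "K \<subseteq> A \<inter> A'"
      using D.cob_basis[of "A \<inter> A'" y] y z \<open>y = z\<close> by blast
    have "openin C.X1 (pre K)" using pre_cob[OF K(1)] by (simp add: C.mem_cob)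
    then show ?thesis using K preI[OF y(1,2) K(2)] by blast
  qed
  then obtain \<F> where F: "finite \<F>" "\<forall>W\<in>\<F>. openin C.X1 W \<and> ?P W" "B \<subseteq> \<Union>\<F>"
    using compactin_finite_basis_cover[of C.X1 B ?P] C.cob_compact_open[OF B] by (auto simp: compact_open_def)
  then obtain k where k: "\<And>W. W \<in> \<F> \<Longrightarrow> k W \<in> D.cob \<and> k W \<subseteq> A \<inter> A' \<and> W = pre (k W)" by metis
  let ?K = "\<Union>(k ` \<F>)"
  have sub: "?K \<subseteq> A" "?K \<subseteq> A'" using k by blast+
  have "compact_open D.X1 ?K" using k F(1) D.cob_compact_open by (intro compact_open_Union) auto
  then have K: "?K \<in> D.cob" using D.cob_subset sub(1) A(1) by blast
  have "W \<subseteq> pre ?K" if "W \<in> \<F>" for W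
  proof -
    have "pre (k W) \<subseteq> pre ?K" using that by (intro pre_mono) blast
    then show ?thesis using k[OF that] by blast
  qed
  then have "B \<subseteq> pre ?K" using F(3) by blast
  then have "B \<sqsubseteq>\<^bsub>natural_order (bis_ob C)\<^esub> bis_ar C D f ?K"
    using C.le_bis_iff[OF B pre_cob[OF K]] bis_ar_eq[OF K] by simp
  moreover have "?K \<sqsubseteq>\<^bsub>natural_order (bis_ob D)\<^esub> A" "?K \<sqsubseteq>\<^bsub>natural_order (bis_ob D)\<^esub> A'"
    using D.le_bis_iff[OF K A(1)] D.le_bis_iff[OF K A(2)] sub by blast+
  ultimately show "\<exists>K\<in>D.cob. K \<sqsubseteq>\<^bsub>natural_order (bis_ob D)\<^esub> A \<and> K \<sqsubseteq>\<^bsub>natural_order (bis_ob D)\<^esub> A' \<and>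
      B \<sqsubseteq>\<^bsub>natural_order (bis_ob C)\<^esub> bis_ar C D f K" using K by blast
qed

end

lemma rel_homI: "spectral_category C \<Longrightarrow> spectral_category D \<Longrightarrow> relational_covering_morphism C D f \<Longrightarrow>
    coherent C D f \<Longrightarrow> rel_hom C D f"
  by (simp add: rel_hom_def rel_hom_axioms_def spectral_etale_def)

lemma etc_morphism_of_typeD:
  assumes "etc_morphism_of_type k C D f"
  shows "relational_covering_morphism C D f" "coherent C D f"
    "\<And>c. k \<in> {2, 4} \<Longrightarrow> c \<in> arrows C \<Longrightarrow> fst f c \<noteq> {}"
    "\<And>c x y. k \<in> {3, 4} \<Longrightarrow> c \<in> arrows C \<Longrightarrow> x \<in> fst f c \<Longrightarrow> y \<in> fst f c \<Longrightarrow> x = y"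
proof -
  note A = assms[unfolded etc_morphism_of_type_def]
  show "relational_covering_morphism C D f" using A by (elim conjE)
  show "coherent C D f" using A by (elim conjE)
  have n: "k \<in> {2, 4} \<longrightarrow> (\<forall>c\<in>arrows C. fst f c \<noteq> {})" using A by (elim conjE)
  have s: "k \<in> {3, 4} \<longrightarrow> (\<forall>c\<in>arrows C. \<forall>x\<in>fst f c. \<forall>y\<in>fst f c. x = y)"
    using A by (elim conjE)
  show "fst f c \<noteq> {}" if "k \<in> {2, 4}" "c \<in> arrows C" for c using n that by blast
  show "x = y" if "k \<in> {3, 4}" "c \<in> arrows C" "x \<in> fst f c" "y \<in> fst f c" for c x y using s that by blast
qed

lemma drs_morphism_of_type_bis:
  assumes "spectral_category C" "spectral_category D" "etc_morphism_of_type k C D f"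
  shows "drs_morphism_of_type k (bis_ob D) (bis_ob C) (bis_ar C D f)"
proof -
  interpret rel_hom C D f using assms by (simp add: rel_homI etc_morphism_of_type_def)
  show ?thesis
    unfolding drs_morphism_of_type_def
  proof (intro conjI impI drs_morphism_bis)
    show "proper_morphism (bis_ob D) (bis_ob C) (bis_ar C D f)" if "k \<in> {2, 4}"
      using etc_morphism_of_typeD(3)[OF assms(3) that] by (rule proper_bis)
    show "weakly_meet_preserving (bis_ob D) (bis_ob C) (bis_ar C D f)" if "k \<in> {3, 4}"
      using etc_morphism_of_typeD(4)[OF assms(3) that] by (rule weakly_meet_preserving_bis)
  qed
qed

definition id_rel :: "'c tcat \<Rightarrow> ('c, 'c) rel_map" where
  "id_rel C = (\<lambda>a\<in>arrows C. {a}, \<lambda>p\<in>objects C. p)"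

definition comp_rel :: "'c tcat \<Rightarrow> ('d, 'e) rel_map \<Rightarrow> ('c, 'd) rel_map \<Rightarrow> ('c, 'e) rel_map" where
  "comp_rel C g f = (\<lambda>a\<in>arrows C. \<Union>b\<in>fst f a. fst g b, \<lambda>p\<in>objects C. snd g (snd f p))"

lemma bis_ar_id: "spectral_category C \<Longrightarrow> bis_ar C C (id_rel C) = restrict id (carrier (bis_ob C))"
proof -
  assume "spectral_category C"
  then interpret spectral_etale C by unfold_locales
  show ?thesis
  proof (rule extensionalityI[of _ cob])
    fix B assume B: "B \<in> cob"
    have "{x \<in> arrows C. fst (id_rel C) x \<inter> B \<noteq> {}} = B"
      using cob_subset_arrows[OF B] by (auto simp: id_rel_def)
    then show "bis_ar C C (id_rel C) B = restrict id (carrier (bis_ob C)) B"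
      using B by (simp add: bis_ar_def)
  qed (auto simp: bis_ar_def)
qed

lemma bis_ar_comp:
  assumes "rel_hom C D f" "rel_hom D B g"
  shows "bis_ar C B (comp_rel C g f) = compose (carrier (bis_ob B)) (bis_ar C D f) (bis_ar D B g)"
proof -
  interpret f: rel_hom C D f by fact
  interpret g: rel_hom D B g by fact
  show ?thesis
  proof (rule extensionalityI[of _ g.D.cob])
    fix A assume A: "A \<in> g.D.cob"
    have "{x \<in> arrows C. fst (comp_rel C g f) x \<inter> A \<noteq> {}} = f.pre (g.pre A)"
      using f.f1_arr by (auto simp: comp_rel_def f.pre_def g.pre_def)
    then show "bis_ar C B (comp_rel C g f) A = compose (carrier (bis_ob B)) (bis_ar C D f) (bis_ar D B g) A"
    proof -
      have "bis_ar C B (comp_rel C g f) A = {x \<in> arrows C. fst (comp_rel C g f) x \<inter> A \<noteq> {}}"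
        using A by (simp add: bis_ar_def)
      also note \<open>\<dots> = f.pre (g.pre A)\<close>
      finally show ?thesis
        using A g.bis_ar_eq[OF A] f.bis_ar_eq[OF g.pre_cob[OF A]] by (simp add: compose_def)
    qed
  qed (auto simp: bis_ar_def compose_def)
qed

lemma etc_morphism_of_type_id:
  assumes "spectral_category C" shows "etc_morphism_of_type k C C (id_rel C)"
proof -
  interpret spectral_etale C by unfold_locales fact
  have "relational_covering_morphism C C (\<lambda>a\<in>arrows C. {a}, \<lambda>p\<in>objects C. p)"
  proof (rule relational_covering_morphismI)
    show "continuous_map X0 X0 (\<lambda>p\<in>objects C. p)"
      by (rule continuous_map_eq[of X0 X0 "\<lambda>p. p"]) auto
    show "openin X1 {x \<in> arrows C. (\<lambda>a\<in>arrows C. {a}) x \<inter> A \<noteq> {}}" if "openin X1 A" for A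
    proof -
      have "{x \<in> arrows C. (\<lambda>a\<in>arrows C. {a}) x \<inter> A \<noteq> {}} = A" using openin_subset[OF that] by auto
      then show ?thesis using that by simp
    qed
  qed (auto simp: composable_def comp_arr)
  moreover have "coherent C C (\<lambda>a\<in>arrows C. {a}, \<lambda>p\<in>objects C. p)"
  proof -
    have "{p \<in> objects C. (\<lambda>p\<in>objects C. p) p \<in> U} = U" if "compact_open X0 U" for U
      using compact_open_subset[OF that] by auto
    then show ?thesis by (simp add: coherent_def)
  qed
  ultimately show ?thesis by (auto simp: etc_morphism_of_type_def id_rel_def)
qed

text \<open>An element common to two values of the composite relation passes through intermediate arrows with equal
  domains or equal codomains; these coincide because \<open>g\<close> is a covering, and then \<open>f\<close> applies.\<close>

lemma etc_morphism_of_type_comp: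
  assumes f: "etc_morphism_of_type k C D f" and g: "etc_morphism_of_type k D B g"
    and cat: "topological_category C"
  shows "etc_morphism_of_type k C B (comp_rel C g f)"
proof -
  note F = relational_covering_morphismD[OF etc_morphism_of_typeD(1)[OF f]]
    and G = relational_covering_morphismD[OF etc_morphism_of_typeD(1)[OF g]]
    and fn = etc_morphism_of_typeD(3)[OF f] and gn = etc_morphism_of_typeD(3)[OF g]
    and fs = etc_morphism_of_typeD(4)[OF f] and gs = etc_morphism_of_typeD(4)[OF g]
  have f1: "s \<in> arrows D" if "a \<in> arrows C" "s \<in> fst f a" for a s using F(1) that by auto
  have f0: "snd f p \<in> objects D" if "p \<in> objects C" for p using F(2) that by auto
  have c: "tc_comp C a b \<in> arrows C" if "(a, b) \<in> composable C" for a b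
  proof -
    have "continuous_map (composable_space C) (tc_arr C) (\<lambda>(a, b). tc_comp C a b)"
      using cat by (simp add: topological_category_def)
    then show ?thesis using that by (simp add: continuous_composition_iff)
  qed
  have dr: "tc_dom C a \<in> objects C" "tc_cod C a \<in> objects C" if "a \<in> arrows C" for a
    using cat that by (auto simp: topological_category_def continuous_map_def)
  have un: "tc_unit C p \<in> arrows C" if "p \<in> objects C" for p
    using cat that by (auto simp: topological_category_def continuous_map_def)
  have "relational_covering_morphism C B
      (\<lambda>a\<in>arrows C. \<Union>b\<in>fst f a. fst g b, \<lambda>p\<in>objects C. snd g (snd f p))"
  proof (rule relational_covering_morphismI)
    show "(\<lambda>a\<in>arrows C. \<Union>b\<in>fst f a. fst g b) \<in> arrows C \<rightarrow>\<^sub>E Pow (arrows B)"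
      using f1 G(1) by fastforce
    show "(\<lambda>p\<in>objects C. snd g (snd f p)) \<in> objects C \<rightarrow>\<^sub>E objects B"
      using f0 G(2) by auto
    show "continuous_map (tc_obj C) (tc_obj B) (\<lambda>p\<in>objects C. snd g (snd f p))"
      using continuous_map_compose[OF F(3) G(3)] by (rule continuous_map_eq) simp
  next
    fix a b assume a: "a \<in> arrows C" and "b \<in> (\<lambda>a\<in>arrows C. \<Union>b\<in>fst f a. fst g b) a"
    then obtain s where s: "s \<in> fst f a" "b \<in> fst g s" by auto
    show "tc_dom B b = (\<lambda>p\<in>objects C. snd g (snd f p)) (tc_dom C a)"
      "tc_cod B b = (\<lambda>p\<in>objects C. snd g (snd f p)) (tc_cod C a)"
      using G(4,5)[OF f1[OF a s(1)] s(2)] F(4,5)[OF a s(1)] dr[OF a] by simp_all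
  next
    fix a b s t assume ab: "(a, b) \<in> composable C" and st: "(s, t) \<in> composable B"
      and "s \<in> (\<lambda>a\<in>arrows C. \<Union>b\<in>fst f a. fst g b) a" "t \<in> (\<lambda>a\<in>arrows C. \<Union>b\<in>fst f a. fst g b) b"
    moreover have ab': "a \<in> arrows C" "b \<in> arrows C" "tc_dom C a = tc_cod C b" using ab by (auto simp: composable_def)
    ultimately obtain s' t' where s: "s' \<in> fst f a" "s \<in> fst g s'" "t' \<in> fst f b" "t \<in> fst g t'" by auto
    have st': "(s', t') \<in> composable D"
      using F(4)[OF ab'(1) s(1)] F(5)[OF ab'(2) s(3)] ab'(3) f1 s ab' by (auto simp: composable_def)
    have "tc_comp D s' t' \<in> fst f (tc_comp C a b)" using F(6)[OF ab st' s(1,3)] .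
    moreover have "tc_comp B s t \<in> fst g (tc_comp D s' t')" using G(6)[OF st' st s(2,4)] .
    ultimately show "tc_comp B s t \<in> (\<lambda>a\<in>arrows C. \<Union>b\<in>fst f a. fst g b) (tc_comp C a b)"
      using c[OF ab] by auto
  next
    fix a b s assume ab: "a \<in> arrows C" "b \<in> arrows C" and e: "tc_dom C a = tc_dom C b \<or> tc_cod C a = tc_cod C b"
      and "s \<in> (\<lambda>a\<in>arrows C. \<Union>b\<in>fst f a. fst g b) a" "s \<in> (\<lambda>a\<in>arrows C. \<Union>b\<in>fst f a. fst g b) b"
    then obtain s' t' where s: "s' \<in> fst f a" "s \<in> fst g s'" "t' \<in> fst f b" "s \<in> fst g t'" by auto
    have "s' = t'"
      using e F(4)[OF ab(1) s(1)] F(4)[OF ab(2) s(3)] F(5)[OF ab(1) s(1)] F(5)[OF ab(2) s(3)]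
        G(7,8)[OF f1[OF ab(1) s(1)] f1[OF ab(2) s(3)] _ s(2,4)] by auto
    then show "a = b" using e F(7,8)[OF ab _ s(1)] s(3) by auto
  next
    fix q s assume q: "q \<in> objects C" and s: "s \<in> arrows B"
    {
      assume "tc_dom B s = (\<lambda>p\<in>objects C. snd g (snd f p)) q"
      then obtain t where t: "t \<in> arrows D" "tc_dom D t = snd f q" "s \<in> fst g t" using G(9)[OF f0[OF q] s] q by auto
      then obtain t' where "t' \<in> arrows C" "tc_dom C t' = q" "t \<in> fst f t'" using F(9)[OF q] by blast
      then show "\<exists>t\<in>arrows C. tc_dom C t = q \<and> s \<in> (\<lambda>a\<in>arrows C. \<Union>b\<in>fst f a. fst g b) t"
        using t by (intro bexI[of _ t']) auto
    next
      assume "tc_cod B s = (\<lambda>p\<in>objects C. snd g (snd f p)) q"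
      then obtain t where t: "t \<in> arrows D" "tc_cod D t = snd f q" "s \<in> fst g t" using G(10)[OF f0[OF q] s] q by auto
      then obtain t' where "t' \<in> arrows C" "tc_cod C t' = q" "t \<in> fst f t'" using F(10)[OF q] by blast
      then show "\<exists>t\<in>arrows C. tc_cod C t = q \<and> s \<in> (\<lambda>a\<in>arrows C. \<Union>b\<in>fst f a. fst g b) t"
        using t by (intro bexI[of _ t']) auto
    }
  next
    fix A assume "openin (tc_arr B) A"
    then have "openin (tc_arr C) {x\<in>arrows C. fst f x \<inter> {y\<in>arrows D. fst g y \<inter> A \<noteq> {}} \<noteq> {}}"
      using F(11) G(11) by blast
    also have "{x\<in>arrows C. fst f x \<inter> {y\<in>arrows D. fst g y \<inter> A \<noteq> {}} \<noteq> {}} =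
        {x \<in> arrows C. (\<lambda>a\<in>arrows C. \<Union>b\<in>fst f a. fst g b) x \<inter> A \<noteq> {}}" using f1 by auto
    finally show "openin (tc_arr C) {x \<in> arrows C. (\<lambda>a\<in>arrows C. \<Union>b\<in>fst f a. fst g b) x \<inter> A \<noteq> {}}" .
  next
    fix p assume p: "p \<in> objects C"
    show "tc_unit B ((\<lambda>p\<in>objects C. snd g (snd f p)) p) \<in> (\<lambda>a\<in>arrows C. \<Union>b\<in>fst f a. fst g b) (tc_unit C p)"
      using F(12)[OF p] G(12)[OF f0[OF p]] p un[OF p] by auto
  qed
  moreover have "coherent C B (\<lambda>a\<in>arrows C. \<Union>b\<in>fst f a. fst g b, \<lambda>p\<in>objects C. snd g (snd f p))"
    unfolding coherent_def
  proof (intro allI impI)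
    fix U assume U: "compact_open (tc_obj B) U"
    have eq: "{p \<in> objects C. snd (\<lambda>a\<in>arrows C. \<Union>b\<in>fst f a. fst g b, \<lambda>p\<in>objects C. snd g (snd f p)) p \<in> U} =
        {p \<in> objects C. snd f p \<in> {q\<in>objects D. snd g q \<in> U}}" using f0 by auto
    show "compact_open (tc_obj C) {p \<in> objects C. snd (\<lambda>a\<in>arrows C. \<Union>b\<in>fst f a. fst g b, \<lambda>p\<in>objects C. snd g (snd f p)) p \<in> U}"
    proof -
      have "compact_open (tc_obj D) {q\<in>objects D. snd g q \<in> U}"
        using etc_morphism_of_typeD(2)[OF g] U by (simp add: coherent_def)
      then have "compact_open (tc_obj C) {p \<in> objects C. snd f p \<in> {q\<in>objects D. snd g q \<in> U}}"
        by (rule etc_morphism_of_typeD(2)[OF f, unfolded coherent_def, rule_format])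
      then show ?thesis
        unfolding eq .
    qed
  qed
  moreover have "(\<Union>b\<in>fst f a. fst g b) \<noteq> {}" if ka: "k \<in> {2, 4}" "a \<in> arrows C" for a
  proof -
    obtain b where b: "b \<in> fst f a" using fn[OF ka] by blast
    then have "fst g b \<noteq> {}" using gn[OF ka(1)] f1[OF ka(2)] by blast
    then show ?thesis using b by blast
  qed
  moreover have "x = y" if ka: "k \<in> {3, 4}" "a \<in> arrows C" "x \<in> (\<Union>b\<in>fst f a. fst g b)" "y \<in> (\<Union>b\<in>fst f a. fst g b)" for a x y
  proof -
    obtain b b' where b: "b \<in> fst f a" "x \<in> fst g b" "b' \<in> fst f a" "y \<in> fst g b'" using ka(3,4) by blast
    then have "b = b'" using fs[OF ka(1,2)] by blast
    then show ?thesis using gs[OF ka(1) f1[OF ka(2) b(1)]] b by blast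
  qed
  ultimately show ?thesis unfolding etc_morphism_of_type_def comp_rel_def
    by (intro conjI impI ballI) (simp_all del: insert_iff)
qed

section \<open>Isomorphisms and the representation by bisections\<close>

text \<open>Source and target may have different carrier types, as they do for the inclusions of universes and for
  the representations; such an isomorphism carries the whole structure and all types of morphisms along.\<close>

definition drs_iso :: "'a rsg \<Rightarrow> 'b rsg \<Rightarrow> ('a \<Rightarrow> 'b) \<Rightarrow> bool" where
  "drs_iso S T \<phi> \<longleftrightarrow> bij_betw \<phi> (carrier S) (carrier T) \<and> \<phi> ` rs_proj S = rs_proj T \<and>
    (\<forall>a\<in>carrier S. \<forall>b\<in>carrier S. \<phi> (rs_mult S a b) = rs_mult T (\<phi> a) (\<phi> b)) \<and>
    (\<forall>a\<in>carrier S. \<phi> (rs_dom S a) = rs_dom T (\<phi> a) \<and> \<phi> (rs_cod S a) = rs_cod T (\<phi> a))"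

locale drs_iso_loc = drs S for S :: "'a rsg" +
  fixes T :: "'b rsg" and \<phi> :: "'a \<Rightarrow> 'b"
  assumes iso: "drs_iso S T \<phi>"
begin

lemma carrier_T: "carrier T = \<phi> ` M" and proj_T: "rs_proj T = \<phi> ` E" and inj: "inj_on \<phi> M"
  and mult_T: "a \<in> M \<Longrightarrow> b \<in> M \<Longrightarrow> rs_mult T (\<phi> a) (\<phi> b) = \<phi> (a \<cdot> b)"
  and dom_T: "a \<in> M \<Longrightarrow> rs_dom T (\<phi> a) = \<phi> (dm a)"
  and cod_T: "a \<in> M \<Longrightarrow> rs_cod T (\<phi> a) = \<phi> (cd a)"
  using iso by (auto simp: drs_iso_def bij_betw_def)

lemma inj_iff: "a \<in> M \<Longrightarrow> b \<in> M \<Longrightarrow> \<phi> a = \<phi> b \<longleftrightarrow> a = b"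
  using inj by (auto simp: inj_on_def)

lemmas transport = mult_T dom_T cod_T inj_iff

lemma restriction_semigroup_T: "restriction_semigroup T"
proof -
  have comm: "rs_mult T (\<phi> e) (\<phi> f) = rs_mult T (\<phi> f) (\<phi> e)" if "e \<in> E" "f \<in> E" for e f
    using E_comm[OF that] that by (simp add: mult_T)
  have "ehresmann_semigroup T"
    unfolding ehresmann_semigroup_def carrier_T proj_T ball_simps
  proof (intro conjI ballI)
    fix a b assume ab: "a \<in> M" "b \<in> M"
    show "rs_mult T (\<phi> a) (\<phi> b) \<in> \<phi> ` M" using ab by (simp add: mult_T)
    show "rs_mult T (rs_mult T (\<phi> a) (\<phi> b)) (\<phi> c) = rs_mult T (\<phi> a) (rs_mult T (\<phi> b) (\<phi> c))"
      if "c \<in> M" for c using mul_assoc[OF ab that] ab that by (simp add: mult_T)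
    show "rs_dom T (\<phi> a) \<in> \<phi> ` E" "rs_cod T (\<phi> a) \<in> \<phi> ` E"
      "rs_mult T (\<phi> a) (rs_dom T (\<phi> a)) = \<phi> a" "rs_mult T (rs_cod T (\<phi> a)) (\<phi> a) = \<phi> a"
      using ab by (simp_all add: mult_T dom_T cod_T)
    show "rs_dom T (rs_mult T (rs_dom T (\<phi> a)) (\<phi> b)) = rs_dom T (rs_mult T (\<phi> a) (\<phi> b))"
      using dm_dm_mul[OF ab] ab by (simp add: mult_T dom_T)
    show "rs_cod T (rs_mult T (\<phi> a) (rs_cod T (\<phi> b))) = rs_cod T (rs_mult T (\<phi> a) (\<phi> b))"
      using cd_mul_cd[OF ab] ab by (simp add: mult_T cod_T)
  next
    fix e f assume ef: "e \<in> E" "f \<in> E"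
    show "rs_mult T (\<phi> e) (\<phi> e) = \<phi> e" "rs_mult T (\<phi> e) (\<phi> f) \<in> \<phi> ` E"
      "rs_dom T (\<phi> e) = \<phi> e" "rs_cod T (\<phi> e) = \<phi> e"
      using ef by (simp_all add: mult_T dom_T cod_T)
    show "rs_mult T (\<phi> e) (\<phi> f) = rs_mult T (\<phi> f) (\<phi> e)" using comm[OF ef] .
  qed (use E_nonempty in auto)
  moreover have "rs_mult T (\<phi> f) (\<phi> a) = rs_mult T (\<phi> a) (rs_dom T (rs_mult T (\<phi> f) (\<phi> a)))"
    if "a \<in> M" "f \<in> E" for a f
  proof -
    have "rs_mult T (\<phi> f) (\<phi> a) = \<phi> (f \<cdot> a)" using that by (simp add: mult_T)
    also have "\<dots> = \<phi> (a \<cdot> dm (f \<cdot> a))" by (rule arg_cong[OF proj_mul[OF that]])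
    also have "\<dots> = rs_mult T (\<phi> a) (rs_dom T (rs_mult T (\<phi> f) (\<phi> a)))"
      using that by (simp add: mult_T dom_T)
    finally show ?thesis .
  qed
  moreover have "rs_mult T (\<phi> a) (\<phi> f) = rs_mult T (rs_cod T (rs_mult T (\<phi> a) (\<phi> f))) (\<phi> a)"
    if "a \<in> M" "f \<in> E" for a f
  proof -
    have "rs_mult T (\<phi> a) (\<phi> f) = \<phi> (a \<cdot> f)" using that by (simp add: mult_T)
    also have "\<dots> = \<phi> (cd (a \<cdot> f) \<cdot> a)" by (rule arg_cong[OF mul_proj[OF that]])
    also have "\<dots> = rs_mult T (rs_cod T (rs_mult T (\<phi> a) (\<phi> f))) (\<phi> a)"
      using that by (simp add: mult_T cod_T)
    finally show ?thesis .
  qed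
  ultimately show ?thesis
    unfolding restriction_semigroup_def carrier_T proj_T ball_simps by (intro conjI ballI)
qed

lemma le_T: "a \<in> M \<Longrightarrow> b \<in> M \<Longrightarrow> \<phi> a \<sqsubseteq>\<^bsub>natural_order T\<^esub> \<phi> b \<longleftrightarrow> a \<preceq> b"
  unfolding le_natural_order proj_T by (simp add: transport)

lemma lub_T:
  "a \<in> M \<Longrightarrow> b \<in> M \<Longrightarrow> c \<in> M \<Longrightarrow> is_lub (natural_order T) (\<phi> c) {\<phi> a, \<phi> b} \<longleftrightarrow> is_lub (natural_order S) c {a, b}"
  by (subst (1 2) is_lub_pair_iff) (auto simp: carrier_T le_T inj_iff)

lemma glb_T:
  "a \<in> M \<Longrightarrow> b \<in> M \<Longrightarrow> c \<in> M \<Longrightarrow> is_glb (natural_order T) (\<phi> c) {\<phi> a, \<phi> b} \<longleftrightarrow> is_glb (natural_order S) c {a, b}"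
  by (subst (1 2) is_glb_pair_iff) (auto simp: carrier_T le_T inj_iff)

lemma drs_T: "distributive_restriction_semigroup T"
proof (rule distributive_restriction_semigroupI[OF restriction_semigroup_T, of "\<phi> zr"])
  show "\<phi> zr \<in> rs_proj T" by (simp add: proj_T)
  show "rs_mult T a (\<phi> zr) = \<phi> zr \<and> rs_mult T (\<phi> zr) a = \<phi> zr" if "a \<in> carrier T" for a
    using that by (auto simp: carrier_T mult_T)
  fix e' f' assume "e' \<in> rs_proj T" "f' \<in> rs_proj T"
  then obtain e f where ef: "e \<in> E" "f \<in> E" "e' = \<phi> e" "f' = \<phi> f" by (auto simp: proj_T)
  have "g \<cdot> (e \<squnion> f) \<preceq> h" if "g \<in> E" "h \<in> E" "g \<cdot> e \<preceq> h" "g \<cdot> f \<preceq> h" for g h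
    using that ef by (simp add: mul_join join_le)
  then have "\<forall>g\<in>rs_proj T. \<forall>h\<in>rs_proj T. rs_mult T g e' \<sqsubseteq>\<^bsub>natural_order T\<^esub> h \<longrightarrow>
        rs_mult T g f' \<sqsubseteq>\<^bsub>natural_order T\<^esub> h \<longrightarrow> rs_mult T g (\<phi> (e \<squnion> f)) \<sqsubseteq>\<^bsub>natural_order T\<^esub> h"
    using ef by (simp add: proj_T mult_T le_T)
  then show "\<exists>j\<in>rs_proj T. e' \<sqsubseteq>\<^bsub>natural_order T\<^esub> j \<and> f' \<sqsubseteq>\<^bsub>natural_order T\<^esub> j \<and>
      (\<forall>g\<in>rs_proj T. \<forall>h\<in>rs_proj T. rs_mult T g e' \<sqsubseteq>\<^bsub>natural_order T\<^esub> h \<longrightarrow>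
        rs_mult T g f' \<sqsubseteq>\<^bsub>natural_order T\<^esub> h \<longrightarrow> rs_mult T g j \<sqsubseteq>\<^bsub>natural_order T\<^esub> h)"
    using ef by (intro bexI[of _ "\<phi> (e \<squnion> f)"]) (auto simp: proj_T le_T)
next
  fix a' b' assume ab': "a' \<in> carrier T" "b' \<in> carrier T" "compatible T a' b'"
  then obtain a b where ab: "a \<in> M" "b \<in> M" "a' = \<phi> a" "b' = \<phi> b" by (auto simp: carrier_T)
  have "compatible S a b" using ab'(3) ab by (simp add: compatible_def transport)
  then obtain c where c: "is_lub (natural_order S) c {a, b}" using compatible_lub ab by blast
  then have "c \<in> M" using ab by (simp add: is_lub_pair_iff)
  then show "\<exists>c. is_lub (natural_order T) c {a', b'}" using c lub_T ab by blast
qed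

lemma drs_object_T: assumes "drs_object v S" shows "drs_object v T"
proof -
  have "has_meets T" if hm: "has_meets S"
    unfolding has_meets_def carrier_T
  proof (intro ballI)
    fix a' b' assume "a' \<in> \<phi> ` M" "b' \<in> \<phi> ` M"
    then obtain a b where ab: "a \<in> M" "b \<in> M" "a' = \<phi> a" "b' = \<phi> b" by blast
    then obtain c where c: "is_glb (natural_order S) c {a, b}" using hm unfolding has_meets_def by blast
    then have "c \<in> M" using ab by (simp add: is_glb_pair_iff)
    then show "\<exists>c. is_glb (natural_order T) c {a', b'}" using c glb_T ab by blast
  qed
  moreover have "has_identity T" if "has_identity S"
  proof -
    obtain i where "i \<in> M" "\<forall>a\<in>M. i \<cdot> a = a \<and> a \<cdot> i = a" using \<open>has_identity S\<close> by (auto simp: has_identity_def)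
    then show ?thesis unfolding has_identity_def carrier_T by (intro bexI[of _ "\<phi> i"]) (auto simp: mult_T)
  qed
  ultimately show ?thesis using assms drs_T by (cases v) auto
qed

lemma morphism_T: "drs_morphism_of_type k S T (restrict \<phi> M)"
proof -
  interpret T: drs T by (rule drsI[OF drs_T])
  have \<phi>M: "\<phi> a \<in> carrier T" if "a \<in> M" for a using that carrier_T by blast
  have "drs_morphism S T (restrict \<phi> M)"
  proof (rule drs_morphismI[OF drs_axioms T.drs_axioms])
    have "\<phi> zr = rs_mult T T.zr (\<phi> zr)"
    proof -
      obtain z where "z \<in> E" "T.zr = \<phi> z" using T.zr_E unfolding proj_T by blast
      then show ?thesis by (simp add: mult_T)
    qed
    then show "restrict \<phi> M zr = T.zr" using T.zr_mul[OF \<phi>M[of zr]] by simp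
    fix e f assume ef: "e \<in> rs_proj S" "f \<in> rs_proj S"
    have "is_lub (projection_order T) (\<phi> (e \<squnion> f)) {\<phi> e, \<phi> f}"
      using ef by (subst is_lub_pair_iff) (auto simp: proj_T le_T join_le)
    then show "restrict \<phi> M (e \<squnion> f) = restrict \<phi> M e \<squnion>\<^bsub>projection_order T\<^esub> restrict \<phi> M f"
      using T.join_unique[of "\<phi> e" "\<phi> f"] ef by (simp add: proj_T)
  next
    fix a' assume "a' \<in> rs_proj T"
    then obtain a where a: "a \<in> E" "a' = \<phi> a" unfolding proj_T by blast
    then show "\<exists>b\<in>rs_proj S. a' \<sqsubseteq>\<^bsub>natural_order T\<^esub> restrict \<phi> M b"
      by (intro bexI[of _ a]) (simp_all add: le_T)
  qed (use \<phi>M in \<open>auto simp: transport\<close>)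
  moreover have "proper_morphism S T (restrict \<phi> M)"
  proof (rule proper_morphismI)
    fix t' assume t': "t' \<in> carrier T"
    then obtain t where t: "t \<in> M" "t' = \<phi> t" using carrier_T by blast
    have "is_lub (natural_order T) t' {t'}" using t' by (auto simp: least_def Upper_def)
    moreover have "\<exists>s\<in>carrier S. t' \<sqsubseteq>\<^bsub>natural_order T\<^esub> restrict \<phi> M s"
      using t by (intro bexI[of _ t]) (simp_all add: le_T)
    ultimately show "\<exists>X. finite X \<and> X \<noteq> {} \<and> X \<subseteq> carrier T \<and>
        (\<forall>x\<in>X. \<exists>s\<in>carrier S. x \<sqsubseteq>\<^bsub>natural_order T\<^esub> restrict \<phi> M s) \<and> is_lub (natural_order T) t' X"
      using t' by (intro exI[of _ "{t'}"]) simp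
  qed
  moreover have "weakly_meet_preserving S T (restrict \<phi> M)"
    unfolding weakly_meet_preserving_def carrier_T
  proof (intro ballI impI)
    fix t' a b assume "t' \<in> \<phi> ` M" and ab: "a \<in> M" "b \<in> M"
      and le: "t' \<sqsubseteq>\<^bsub>natural_order T\<^esub> restrict \<phi> M a \<and> t' \<sqsubseteq>\<^bsub>natural_order T\<^esub> restrict \<phi> M b"
    then obtain t where t: "t \<in> M" "t' = \<phi> t" by blast
    then show "\<exists>c\<in>M. c \<preceq> a \<and> c \<preceq> b \<and> t' \<sqsubseteq>\<^bsub>natural_order T\<^esub> restrict \<phi> M c"
      using le ab by (intro bexI[of _ t]) (simp_all add: le_T)
  qed
  ultimately show ?thesis by (simp add: drs_morphism_of_type_def)
qed

lemma inverse:
  obtains \<psi> where "drs_iso T S \<psi>" "\<And>a. a \<in> M \<Longrightarrow> \<psi> (\<phi> a) = a" "\<And>b. b \<in> carrier T \<Longrightarrow> \<phi> (\<psi> b) = b"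
proof
  let ?\<psi> = "inv_into M \<phi>"
  show l: "?\<psi> (\<phi> a) = a" if "a \<in> M" for a using inv_into_f_f[OF inj that] .
  show "\<phi> (?\<psi> b) = b" if "b \<in> carrier T" for b using that f_inv_into_f unfolding carrier_T by metis
  show "drs_iso T S ?\<psi>" unfolding drs_iso_def
  proof (intro conjI)
    show "bij_betw ?\<psi> (carrier T) (carrier S)" using iso bij_betw_inv_into by (auto simp: drs_iso_def)
    show "?\<psi> ` rs_proj T = rs_proj S" unfolding proj_T image_image using l by force
  qed (auto simp: carrier_T transport l)
qed

end

lemma drs_iso_locI: "drs S \<Longrightarrow> drs_iso S T \<phi> \<Longrightarrow> drs_iso_loc S T \<phi>"
  by (simp add: drs_iso_loc_def drs_iso_loc_axioms_def)

lemma drs_iso_comp: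
  assumes "drs_iso S T \<phi>" "drs_iso T U \<psi>" shows "drs_iso S U (\<lambda>x. \<psi> (\<phi> x))"
proof -
  have \<phi>: "\<phi> a \<in> carrier T" if "a \<in> carrier S" for a
    using assms(1) that by (auto simp: drs_iso_def bij_betw_def)
  have "bij_betw (\<lambda>x. \<psi> (\<phi> x)) (carrier S) (carrier U)"
    using assms bij_betw_trans[of \<phi> "carrier S" "carrier T" \<psi> "carrier U"] by (simp add: drs_iso_def comp_def)
  moreover have "(\<lambda>x. \<psi> (\<phi> x)) ` rs_proj S = rs_proj U"
    using assms by (auto simp: drs_iso_def simp flip: image_image)
  ultimately show ?thesis using assms \<phi> by (simp add: drs_iso_def)
qed

lemma is_iso_drs:
  assumes S: "drs_object v S" and T: "drs_object v T" and iso: "drs_iso S T \<phi>"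
  shows "is_iso (DRS v k) S T (restrict \<phi> (carrier S))"
proof -
  have d: "drs S" "drs T" using S T by (cases v; simp add: drsI)+
  interpret drs_iso_loc S T \<phi> using drs_iso_locI[OF d(1) iso] .
  obtain \<psi> where \<psi>: "drs_iso T S \<psi>" "\<And>a. a \<in> M \<Longrightarrow> \<psi> (\<phi> a) = a" "\<And>b. b \<in> carrier T \<Longrightarrow> \<phi> (\<psi> b) = b"
    by (rule inverse) blast
  interpret I: drs_iso_loc T S \<psi> using drs_iso_locI[OF d(2) \<psi>(1)] .
  have "compose M (restrict \<psi> (carrier T)) (restrict \<phi> M) = restrict id M"
  proof (rule extensionalityI[of _ M])
    fix a assume a: "a \<in> M"
    then have "\<phi> a \<in> carrier T" using carrier_T by blast
    then show "compose M (restrict \<psi> (carrier T)) (restrict \<phi> M) a = restrict id M a"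
      using \<psi>(2)[OF a] a by (simp add: compose_def)
  qed (simp_all add: compose_extensional)
  moreover have "compose (carrier T) (restrict \<phi> M) (restrict \<psi> (carrier T)) = restrict id (carrier T)"
  proof (rule extensionalityI[of _ "carrier T"])
    fix b assume b: "b \<in> carrier T"
    then have "\<psi> b \<in> M" using I.carrier_T by blast
    then show "compose (carrier T) (restrict \<phi> M) (restrict \<psi> (carrier T)) b = restrict id (carrier T) b"
      using \<psi>(3)[OF b] b by (simp add: compose_def)
  qed (simp_all add: compose_extensional)
  ultimately show ?thesis
    using morphism_T[of k] I.morphism_T[of k] unfolding is_iso_def
    by (intro conjI bexI[of _ "restrict \<psi> (carrier T)"]) (simp_all add: DRS_def)
qed

text \<open>Two basic sets inside one bisection come from compatible elements: by injectivity of the domain map both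
  \<open>a \<lambda>(b)\<close> and \<open>b \<lambda>(a)\<close> have the intersection of the two sets as their basic set, and dually for codomains.\<close>

context drs
begin

lemma basic_mul_dm:
  assumes ab: "a \<in> M" "b \<in> M"
  shows "BS (a \<cdot> dm b) =
    {A\<in>BS a. Dm A \<in> Dm ` BS b}"
proof (intro Set.set_eqI iffI)
  fix A assume "A \<in> BS (a \<cdot> dm b)"
  then have A: "A \<in> PS" "a \<cdot> dm b \<in> A" by auto
  have "a \<in> A" using PS_up[OF A] ab by simp
  moreover have "dm b \<in> Dm A" using mul_mem_Dm[OF A] ab by simp
  ultimately show "A \<in> {A\<in>BS a. Dm A \<in> Dm ` BS b}"
    unfolding Dm_image_basic[OF ab(2)] using A Dm_prime by simp
next
  fix A assume "A \<in> {A\<in>BS a. Dm A \<in> Dm ` BS b}"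
  then have A: "A \<in> PS" "a \<in> A" "dm b \<in> Dm A" unfolding Dm_image_basic[OF ab(2)] by simp_all
  then show "A \<in> BS (a \<cdot> dm b)" using mul_Dm[OF A] by simp
qed

lemma basic_Int_of_inj:
  assumes ab: "a \<in> M" "b \<in> M" and B: "BS a \<subseteq> B" "BS b \<subseteq> B" "inj_on Dm B"
  shows "BS (a \<cdot> dm b) = BS a \<inter> BS b"
  unfolding basic_mul_dm[OF ab]
proof (intro Set.set_eqI iffI)
  fix A assume A: "A \<in> {A\<in>BS a. Dm A \<in> Dm ` BS b}"
  then obtain A' where A': "A' \<in> BS b" "Dm A = Dm A'" by blast
  then have "A = A'" using inj_onD[OF B(3) A'(2)] A A'(1) B(1,2) by blast
  then show "A \<in> BS a \<inter> BS b" using A A' by simp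
next
  fix A assume "A \<in> BS a \<inter> BS b"
  then show "A \<in> {A\<in>BS a. Dm A \<in> Dm ` BS b}" by blast
qed

lemma compatible_of_bisection:
  assumes ab: "a \<in> M" "b \<in> M" and B: "BS a \<subseteq> B" "BS b \<subseteq> B"
    and inj: "inj_on Dm B" "inj_on Cd B"
  shows "compatible S a b"
proof -
  interpret O: drs "op_rsg S" by (rule op)
  have "a \<cdot> dm b = b \<cdot> dm a"
  proof (rule basic_inj)
    show "BS (a \<cdot> dm b) = BS (b \<cdot> dm a)"
      unfolding basic_Int_of_inj[OF ab B inj(1)] basic_Int_of_inj[OF ab(2,1) B(2,1) inj(1)] by (rule Int_commute)
  qed (use ab in simp_all)
  moreover have "cd b \<cdot> a = cd a \<cdot> b"
  proof (rule basic_inj)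
    show "BS (cd b \<cdot> a) = BS (cd a \<cdot> b)"
      using O.basic_Int_of_inj[of a b B] O.basic_Int_of_inj[of b a B] ab B inj
      by (simp add: spec_ob_op Int_commute)
  qed (use ab in simp_all)
  ultimately show ?thesis by (simp add: compatible_def)
qed

lemma basic_lub:
  assumes ab: "a \<in> M" "b \<in> M" "is_lub (natural_order S) c {a, b}"
  shows "BS c = BS a \<union> BS b"
proof -
  have c: "c \<in> M" "a \<preceq> c" "b \<preceq> c" using ab by (auto simp: is_lub_pair_iff)
  show ?thesis
  proof
    show "BS c \<subseteq> BS a \<union> BS b"
    proof
      fix A assume "A \<in> BS c"
      then show "A \<in> BS a \<union> BS b"
        using prime_filterD(6)[of A "natural_order S" a b c] ab by simp
    qed
    show "BS a \<union> BS b \<subseteq> BS c"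
      using basic_mono_iff[of a c] basic_mono_iff[of b c] ab c by simp
  qed
qed

lemma bisection_is_basic:
  assumes "B \<in> compact_open_bisections (spec_ob S)" shows "\<exists>a\<in>M. B = BS a"
proof -
  let ?X = "XS"
  have B: "openin ?X B" "compactin ?X B" "inj_on Dm B" "inj_on Cd B"
    using assms by (auto simp: compact_open_bisections_def compact_open_def)
  let ?P = "\<lambda>W. \<exists>a\<in>M. W = BS a \<and> W \<subseteq> B"
  have "\<exists>W. openin ?X W \<and> ?P W \<and> A \<in> W" if AB: "A \<in> B" for A
  proof -
    obtain a where a: "A \<in> PS" "a \<in> A" "BS a \<subseteq> B" using openin_prime_spectrumE[OF B(1) AB] .
    have "a \<in> M" using PS_M[OF a(1,2)] .
    then show ?thesis using a by (intro exI[of _ "BS a"] conjI bexI[of _ a]) simp_all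
  qed
  then obtain \<F> where F: "finite \<F>" "\<forall>W\<in>\<F>. openin ?X W \<and> ?P W" "B \<subseteq> \<Union>\<F>"
    using compactin_finite_basis_cover[OF B(2), of ?P] by auto
  have "\<exists>a\<in>M. \<Union>\<F> = BS a" using F(1,2)
  proof (induction \<F> rule: finite_induct)
    case empty
    have "BS zr = {}" using zr_PS by auto
    then show ?case using E_M[OF zr_E] by auto
  next
    case (insert W \<F>)
    then obtain a where a: "a \<in> M" "\<Union>\<F> = BS a" by auto
    obtain b where b: "b \<in> M" "W = BS b" "W \<subseteq> B" using insert.prems by auto
    have aB: "BS a \<subseteq> B" using insert.prems a(2) by blast
    have bB: "BS b \<subseteq> B" using b by simp
    obtain c where c: "is_lub (natural_order S) c {b, a}"
      using compatible_lub[OF b(1) a(1) compatible_of_bisection[OF b(1) a(1) bB aB B(3,4)]] by blast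
    then have "c \<in> M" using a b by (auto simp: is_lub_pair_iff)
    then show ?case using basic_lub[OF b(1) a(1) c] a b by (intro bexI[of _ c]) auto
  qed
  moreover have "\<Union>\<F> = B" using F by blast
  ultimately show ?thesis by blast
qed

theorem basic_iso: "drs_iso S (bis_ob (spec_ob S)) (BS)"
proof -
  have 1: "BS a \<in> compact_open_bisections (spec_ob S)" if "a \<in> M" for a
    using that compact_open_basic Dm_inj_basic Cd_inj_basic by (simp add: compact_open_bisections_def)
  have "bij_betw (BS) (carrier S) (carrier (bis_ob (spec_ob S)))"
    unfolding bij_betw_def bis_ob_simps
  proof
    show "inj_on (BS) M" using basic_inj by (rule inj_onI)
    show "BS ` M = compact_open_bisections (spec_ob S)"
      using 1 bisection_is_basic by blast
  qed
  moreover have "BS ` rs_proj S = rs_proj (bis_ob (spec_ob S))"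
  proof (intro Set.set_eqI iffI)
    fix W assume "W \<in> BS ` rs_proj S"
    then obtain e where e: "e \<in> E" "W = BS e" by blast
    then show "W \<in> rs_proj (bis_ob (spec_ob S))"
      unfolding mem_proj_bis e(2) unit_image_basic[OF e(1), symmetric] spec_ob_simps(1,2)
      using compact_open_objects_iff by blast
  next
    fix W assume "W \<in> rs_proj (bis_ob (spec_ob S))"
    then obtain U where U: "compact_open (XE) U" "W = un ` U"
      unfolding mem_proj_bis spec_ob_simps(1,2) by blast
    then obtain e where e: "e \<in> E" "U = BE e" using compact_open_objects_iff by blast
    then show "W \<in> BS ` rs_proj S" using unit_image_basic[OF e(1)] U(2) by simp
  qed
  moreover have "BS (dm a) = un ` Dm ` BS a" if "a \<in> M" for a
    using unit_image_basic[of "dm a"] Dm_image_basic[OF that] that by simp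
  moreover have "BS (cd a) = un ` Cd ` BS a" if "a \<in> M" for a
  proof -
    have "Cd ` BS a = BE (cd a)"
      using drs.Dm_image_basic[OF op, of a] that by (simp add: spec_ob_op)
    then show ?thesis using unit_image_basic[of "cd a"] that by simp
  qed
  ultimately show ?thesis using set_comp_basic by (simp add: drs_iso_def del: spec_ob_simps(3))
qed

end

section \<open>Isomorphisms of etale categories\<close>

definition etc_iso :: "'c tcat \<Rightarrow> 'd tcat \<Rightarrow> ('c \<Rightarrow> 'd) \<Rightarrow> ('c \<Rightarrow> 'd) \<Rightarrow> bool" where
  "etc_iso C D \<phi>1 \<phi>0 \<longleftrightarrow>
    homeomorphic_map (tc_arr C) (tc_arr D) \<phi>1 \<and> homeomorphic_map (tc_obj C) (tc_obj D) \<phi>0 \<and>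
    (\<forall>a\<in>arrows C. tc_dom D (\<phi>1 a) = \<phi>0 (tc_dom C a) \<and> tc_cod D (\<phi>1 a) = \<phi>0 (tc_cod C a)) \<and>
    (\<forall>p\<in>objects C. tc_unit D (\<phi>0 p) = \<phi>1 (tc_unit C p)) \<and>
    (\<forall>(a, b)\<in>composable C. tc_comp D (\<phi>1 a) (\<phi>1 b) = \<phi>1 (tc_comp C a b))"

definition rel_of :: "'c tcat \<Rightarrow> ('c \<Rightarrow> 'd) \<Rightarrow> ('c \<Rightarrow> 'd) \<Rightarrow> ('c, 'd) rel_map" where
  "rel_of C \<phi>1 \<phi>0 = (\<lambda>a\<in>arrows C. {\<phi>1 a}, \<lambda>p\<in>objects C. \<phi>0 p)"

lemma local_homeomorphism_conjugate:
  assumes f: "local_homeomorphism X Y f" and \<phi>: "homeomorphic_map X X' \<phi>" "homeomorphic_map Y Y' \<psi>"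
    and g: "\<And>x. x \<in> topspace X \<Longrightarrow> g (\<phi> x) = \<psi> (f x)"
  shows "local_homeomorphism X' Y' g"
proof -
  obtain \<phi>' where "homeomorphic_maps X X' \<phi> \<phi>'" using \<phi>(1) homeomorphic_map_maps by blast
  then have \<phi>': "homeomorphic_map X' X \<phi>'" "\<And>x. x \<in> topspace X' \<Longrightarrow> \<phi> (\<phi>' x) = x"
    using homeomorphic_maps_map by (auto simp: homeomorphic_maps_def)
  have \<phi>'X: "\<phi>' x \<in> topspace X" if "x \<in> topspace X'" for x
    using homeomorphic_imp_surjective_map[OF \<phi>'(1)] that by blast
  have eq: "(\<psi> \<circ> f \<circ> \<phi>') x = g x" if "x \<in> topspace X'" for x
    using g[OF \<phi>'X[OF that]] \<phi>'(2)[OF that] by simp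
  have "continuous_map X' Y' (\<psi> \<circ> f \<circ> \<phi>')"
    using f homeomorphic_imp_continuous_map[OF \<phi>'(1)] homeomorphic_imp_continuous_map[OF \<phi>(2)]
    by (auto simp: local_homeomorphism_iff comp_assoc intro: continuous_map_compose)
  then have "continuous_map X' Y' g" using eq by (rule continuous_map_eq)
  moreover have "open_map X' Y' (\<psi> \<circ> f \<circ> \<phi>')"
    using f homeomorphic_imp_open_map[OF \<phi>'(1)] homeomorphic_imp_open_map[OF \<phi>(2)]
    by (auto simp: local_homeomorphism_iff intro!: open_map_compose)
  then have "open_map X' Y' g" using eq by (rule open_map_eq)
  moreover have "\<exists>U. openin X' U \<and> x \<in> U \<and> inj_on g U" if x: "x \<in> topspace X'" for x
  proof -
    obtain U where U: "openin X U" "\<phi>' x \<in> U" "inj_on f U"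
      using f \<phi>'X[OF x] unfolding local_homeomorphism_iff by blast
    have UX: "U \<subseteq> topspace X" by (rule openin_subset[OF U(1)])
    have fY: "f y \<in> topspace Y" if "y \<in> U" for y
      using f that UX by (auto simp: local_homeomorphism_iff continuous_map_def)
    have "openin X' (\<phi> ` U)" using homeomorphic_imp_open_map[OF \<phi>(1)] U(1) by (simp add: open_map_def)
    moreover have "x \<in> \<phi> ` U" using U(2) \<phi>'(2)[OF x] by force
    moreover have "inj_on g (\<phi> ` U)"
    proof (rule inj_onI)
      fix a b assume "a \<in> \<phi> ` U" "b \<in> \<phi> ` U" and gab: "g a = g b"
      then obtain y z where yz: "y \<in> U" "z \<in> U" "a = \<phi> y" "b = \<phi> z" by blast
      then have "\<psi> (f y) = \<psi> (f z)" using gab g UX by (metis subsetD)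
      then have "f y = f z"
        using homeomorphic_imp_injective_map[OF \<phi>(2)] fY yz by (auto simp: inj_on_def)
      then show "a = b" using U(3) yz by (auto simp: inj_on_def)
    qed
    ultimately show ?thesis by blast
  qed
  ultimately show ?thesis by (simp add: local_homeomorphism_iff)
qed

lemma spectral_space_homeomorphic:
  assumes "homeomorphic_map X Y \<phi>" "spectral_space X" shows "spectral_space Y"
proof -
  obtain \<psi> where "homeomorphic_maps X Y \<phi> \<psi>" using assms(1) homeomorphic_map_maps by blast
  then have "homeomorphic_map Y X \<psi>" using homeomorphic_maps_map by blast
  then show ?thesis
    using spectral_space_open_embedding[of Y X \<psi>] assms(2) homeomorphic_imp_continuous_map
      homeomorphic_imp_open_map homeomorphic_imp_injective_map by blast
qed

locale etc_iso_loc =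
  fixes C :: "'c tcat" and D :: "'d tcat" and \<phi>1 \<phi>0 :: "'c \<Rightarrow> 'd"
  assumes cat: "etale_category C" and iso: "etc_iso C D \<phi>1 \<phi>0"
begin

lemma h1: "homeomorphic_map (tc_arr C) (tc_arr D) \<phi>1" and h0: "homeomorphic_map (tc_obj C) (tc_obj D) \<phi>0"
  and dom_D: "a \<in> arrows C \<Longrightarrow> tc_dom D (\<phi>1 a) = \<phi>0 (tc_dom C a)"
  and cod_D: "a \<in> arrows C \<Longrightarrow> tc_cod D (\<phi>1 a) = \<phi>0 (tc_cod C a)"
  and unit_D: "p \<in> objects C \<Longrightarrow> tc_unit D (\<phi>0 p) = \<phi>1 (tc_unit C p)"
  and comp_D: "(a, b) \<in> composable C \<Longrightarrow> tc_comp D (\<phi>1 a) (\<phi>1 b) = \<phi>1 (tc_comp C a b)"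
  using iso by (auto simp: etc_iso_def)

lemma arrows_D: "arrows D = \<phi>1 ` arrows C" and objects_D: "objects D = \<phi>0 ` objects C"
  using homeomorphic_imp_surjective_map[OF h1] homeomorphic_imp_surjective_map[OF h0] by simp_all

lemma inj1: "a \<in> arrows C \<Longrightarrow> b \<in> arrows C \<Longrightarrow> \<phi>1 a = \<phi>1 b \<longleftrightarrow> a = b"
  and inj0: "p \<in> objects C \<Longrightarrow> q \<in> objects C \<Longrightarrow> \<phi>0 p = \<phi>0 q \<longleftrightarrow> p = q"
  using homeomorphic_imp_injective_map[OF h1] homeomorphic_imp_injective_map[OF h0] by (auto simp: inj_on_def)

lemmas cat_facts = cat[unfolded etale_category_iff]

lemma dom_C [simp]: "a \<in> arrows C \<Longrightarrow> tc_dom C a \<in> objects C"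
  and cod_C [simp]: "a \<in> arrows C \<Longrightarrow> tc_cod C a \<in> objects C"
  and unit_C [simp]: "p \<in> objects C \<Longrightarrow> tc_unit C p \<in> arrows C"
  using cat_facts by (auto simp: local_homeomorphism_iff continuous_map_def)

lemma comp_C: "(a, b) \<in> composable C \<Longrightarrow> tc_comp C a b \<in> arrows C \<and>
    tc_dom C (tc_comp C a b) = tc_dom C b \<and> tc_cod C (tc_comp C a b) = tc_cod C a"
  using cat_facts by simp

lemma open1: "openin (tc_arr D) W \<longleftrightarrow> (\<exists>U. openin (tc_arr C) U \<and> W = \<phi>1 ` U)"
proof
  assume W: "openin (tc_arr D) W"
  let ?U = "{x\<in>arrows C. \<phi>1 x \<in> W}"
  have "openin (tc_arr C) ?U"
    using homeomorphic_imp_continuous_map[OF h1] W by (simp add: continuous_map_def)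
  moreover have "W = \<phi>1 ` ?U" using openin_subset[OF W] unfolding arrows_D by blast
  ultimately show "\<exists>U. openin (tc_arr C) U \<and> W = \<phi>1 ` U" by blast
next
  assume "\<exists>U. openin (tc_arr C) U \<and> W = \<phi>1 ` U"
  then show "openin (tc_arr D) W" using homeomorphic_imp_open_map[OF h1] by (auto simp: open_map_def)
qed

lemma composable_D: "a \<in> arrows C \<Longrightarrow> b \<in> arrows C \<Longrightarrow> (\<phi>1 a, \<phi>1 b) \<in> composable D \<longleftrightarrow> (a, b) \<in> composable C"
  by (auto simp: composable_def arrows_D dom_D cod_D inj0)

lemma composable_DE:
  assumes "(x, y) \<in> composable D" obtains a b where "x = \<phi>1 a" "y = \<phi>1 b" "(a, b) \<in> composable C"
proof -
  have "x \<in> arrows D" "y \<in> arrows D" using assms by (auto simp: composable_def)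
  then obtain a b where "a \<in> arrows C" "b \<in> arrows C" "x = \<phi>1 a" "y = \<phi>1 b" unfolding arrows_D by blast
  then show thesis using that assms composable_D by blast
qed

lemma composable_arrows: "(a, b) \<in> composable C \<Longrightarrow> a \<in> arrows C \<and> b \<in> arrows C"
  by (simp add: composable_def)

lemma set_comp_D:
  assumes "A \<subseteq> arrows C" "B \<subseteq> arrows C" shows "set_comp D (\<phi>1 ` A) (\<phi>1 ` B) = \<phi>1 ` set_comp C A B"
proof (intro Set.set_eqI iffI)
  fix x assume "x \<in> set_comp D (\<phi>1 ` A) (\<phi>1 ` B)"
  then obtain a b where ab: "a \<in> A" "b \<in> B" "tc_dom D (\<phi>1 a) = tc_cod D (\<phi>1 b)" "x = tc_comp D (\<phi>1 a) (\<phi>1 b)"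
    unfolding set_comp_def by blast
  have M: "a \<in> arrows C" "b \<in> arrows C" using ab assms by auto
  then have dr: "tc_dom C a = tc_cod C b" using ab(3) by (simp add: dom_D cod_D inj0)
  then have "(a, b) \<in> composable C" using M by (simp add: composable_def)
  then have "x = \<phi>1 (tc_comp C a b)" using ab(4) comp_D by simp
  then show "x \<in> \<phi>1 ` set_comp C A B" using ab dr unfolding set_comp_def by blast
next
  fix x assume "x \<in> \<phi>1 ` set_comp C A B"
  then obtain a b where ab: "a \<in> A" "b \<in> B" "tc_dom C a = tc_cod C b" "x = \<phi>1 (tc_comp C a b)"
    unfolding set_comp_def by blast
  have M: "a \<in> arrows C" "b \<in> arrows C" using ab assms by auto
  then have "tc_dom D (\<phi>1 a) = tc_cod D (\<phi>1 b)" "(a, b) \<in> composable C"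
    using ab(3) by (simp_all add: dom_D cod_D composable_def)
  then show "x \<in> set_comp D (\<phi>1 ` A) (\<phi>1 ` B)" using ab comp_D unfolding set_comp_def by force
qed

lemma etale_D: "etale_category D"
  unfolding etale_category_iff
proof (intro conjI)
  show "local_homeomorphism (tc_arr D) (tc_obj D) (tc_dom D)"
    by (rule local_homeomorphism_conjugate[OF _ h1 h0]) (use cat_facts dom_D in auto)
  show "local_homeomorphism (tc_arr D) (tc_obj D) (tc_cod D)"
    by (rule local_homeomorphism_conjugate[OF _ h1 h0]) (use cat_facts cod_D in auto)
  obtain \<psi> where "homeomorphic_maps (tc_obj C) (tc_obj D) \<phi>0 \<psi>" using h0 homeomorphic_map_maps by blast
  then have \<psi>: "homeomorphic_map (tc_obj D) (tc_obj C) \<psi>" "\<And>p. p \<in> objects D \<Longrightarrow> \<phi>0 (\<psi> p) = p"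
    using homeomorphic_maps_map by (auto simp: homeomorphic_maps_def)
  have \<psi>C: "\<psi> p \<in> objects C" if "p \<in> objects D" for p
    using homeomorphic_imp_surjective_map[OF \<psi>(1)] that by blast
  have eq: "(\<phi>1 \<circ> tc_unit C \<circ> \<psi>) p = tc_unit D p" if "p \<in> objects D" for p
    using unit_D[OF \<psi>C[OF that]] \<psi>(2)[OF that] by simp
  have "continuous_map (tc_obj D) (tc_arr D) (\<phi>1 \<circ> tc_unit C \<circ> \<psi>)"
    using cat_facts homeomorphic_imp_continuous_map[OF \<psi>(1)] homeomorphic_imp_continuous_map[OF h1]
    by (auto intro!: continuous_map_compose)
  then show "continuous_map (tc_obj D) (tc_arr D) (tc_unit D)" using eq by (rule continuous_map_eq)
  have "open_map (tc_obj D) (tc_arr D) (\<phi>1 \<circ> tc_unit C \<circ> \<psi>)"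
    using cat_facts homeomorphic_imp_open_map[OF \<psi>(1)] homeomorphic_imp_open_map[OF h1]
    by (auto intro!: open_map_compose)
  then show "open_map (tc_obj D) (tc_arr D) (tc_unit D)" using eq by (rule open_map_eq)
  show "\<forall>p\<in>objects D. tc_dom D (tc_unit D p) = p \<and> tc_cod D (tc_unit D p) = p"
    unfolding objects_D using cat_facts by (simp add: unit_D dom_D cod_D)
  show "\<forall>x y. (x, y) \<in> composable D \<longrightarrow> tc_comp D x y \<in> arrows D \<and>
      tc_dom D (tc_comp D x y) = tc_dom D y \<and> tc_cod D (tc_comp D x y) = tc_cod D x"
  proof (intro allI impI)
    fix x y assume "(x, y) \<in> composable D"
    then obtain a b where ab: "x = \<phi>1 a" "y = \<phi>1 b" "(a, b) \<in> composable C" by (rule composable_DE)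
    then show "tc_comp D x y \<in> arrows D \<and> tc_dom D (tc_comp D x y) = tc_dom D y \<and> tc_cod D (tc_comp D x y) = tc_cod D x"
      using comp_C[OF ab(3)] composable_arrows[OF ab(3)] by (simp add: comp_D arrows_D dom_D cod_D)
  qed
  have comp_unit: "(a, tc_unit C (tc_dom C a)) \<in> composable C" "(tc_unit C (tc_cod C a), a) \<in> composable C"
    if "a \<in> arrows C" for a using that cat_facts by (auto simp: composable_def)
  show "\<forall>a\<in>arrows D. tc_comp D a (tc_unit D (tc_dom D a)) = a \<and> tc_comp D (tc_unit D (tc_cod D a)) a = a"
    unfolding arrows_D using cat_facts comp_unit by (simp add: dom_D cod_D unit_D comp_D)
  show "\<forall>x y z. (x, y) \<in> composable D \<and> (y, z) \<in> composable D \<longrightarrow>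
      tc_comp D (tc_comp D x y) z = tc_comp D x (tc_comp D y z)"
  proof (intro allI impI, elim conjE)
    fix x y z assume xy: "(x, y) \<in> composable D" and yz: "(y, z) \<in> composable D"
    obtain a b where ab: "x = \<phi>1 a" "y = \<phi>1 b" "(a, b) \<in> composable C" using xy by (rule composable_DE)
    obtain b' c where bc: "y = \<phi>1 b'" "z = \<phi>1 c" "(b', c) \<in> composable C" using yz by (rule composable_DE)
    have "b' = b" using ab bc composable_arrows inj1 by metis
    then have bc': "(b, c) \<in> composable C" using bc by simp
    have "(tc_comp C a b, c) \<in> composable C" "(a, tc_comp C b c) \<in> composable C"
      using comp_C[OF ab(3)] comp_C[OF bc'] ab(3) bc' by (auto simp: composable_def)
    then show "tc_comp D (tc_comp D x y) z = tc_comp D x (tc_comp D y z)"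
      using ab bc bc' cat_facts by (simp add: comp_D)
  qed
  show "\<forall>W x y. openin (tc_arr D) W \<longrightarrow> (x, y) \<in> composable D \<longrightarrow> tc_comp D x y \<in> W \<longrightarrow>
      (\<exists>A B. openin (tc_arr D) A \<and> openin (tc_arr D) B \<and> x \<in> A \<and> y \<in> B \<and> set_comp D A B \<subseteq> W)"
  proof (intro allI impI)
    fix W x y assume "openin (tc_arr D) W" and xy: "(x, y) \<in> composable D" and xyW: "tc_comp D x y \<in> W"
    then obtain U where U: "openin (tc_arr C) U" "W = \<phi>1 ` U" using open1 by blast
    obtain a b where ab: "x = \<phi>1 a" "y = \<phi>1 b" "(a, b) \<in> composable C" using xy by (rule composable_DE)
    have "\<phi>1 (tc_comp C a b) \<in> \<phi>1 ` U" using xyW ab U comp_D by simp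
    then obtain z where z: "z \<in> U" "\<phi>1 (tc_comp C a b) = \<phi>1 z" by blast
    then have "tc_comp C a b = z"
      using inj1[of "tc_comp C a b" z] comp_C[OF ab(3)] openin_subset[OF U(1)] by blast
    then have "tc_comp C a b \<in> U" using z(1) by simp
    then obtain A B where AB: "openin (tc_arr C) A" "openin (tc_arr C) B" "a \<in> A" "b \<in> B" "set_comp C A B \<subseteq> U"
    proof -
      have "\<forall>W a b. openin (tc_arr C) W \<longrightarrow> (a, b) \<in> composable C \<longrightarrow> tc_comp C a b \<in> W \<longrightarrow>
        (\<exists>A B. openin (tc_arr C) A \<and> openin (tc_arr C) B \<and> a \<in> A \<and> b \<in> B \<and> set_comp C A B \<subseteq> W)"
        using cat_facts by (elim conjE)
      from this[rule_format, OF U(1) ab(3) \<open>tc_comp C a b \<in> U\<close>] show thesis using that by blast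
    qed
    have "set_comp D (\<phi>1 ` A) (\<phi>1 ` B) \<subseteq> W"
      unfolding set_comp_D[OF openin_subset[OF AB(1)] openin_subset[OF AB(2)]] U(2) using AB(5) by (rule image_mono)
    then show "\<exists>A B. openin (tc_arr D) A \<and> openin (tc_arr D) B \<and> x \<in> A \<and> y \<in> B \<and> set_comp D A B \<subseteq> W"
      using AB ab open1 by (intro exI[of _ "\<phi>1 ` A"] exI[of _ "\<phi>1 ` B"]) auto
  qed
  show "\<forall>A B. openin (tc_arr D) A \<longrightarrow> openin (tc_arr D) B \<longrightarrow> openin (tc_arr D) (set_comp D A B)"
  proof (intro allI impI)
    fix A B assume "openin (tc_arr D) A" "openin (tc_arr D) B"
    then obtain U V where UV: "openin (tc_arr C) U" "A = \<phi>1 ` U" "openin (tc_arr C) V" "B = \<phi>1 ` V"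
      using open1 by metis
    then have "openin (tc_arr C) (set_comp C U V)" using cat_facts by simp
    moreover have "set_comp D A B = \<phi>1 ` set_comp C U V"
      using UV set_comp_D[OF openin_subset[OF UV(1)] openin_subset[OF UV(3)]] by simp
    ultimately show "openin (tc_arr D) (set_comp D A B)" using open1 by blast
  qed
qed

lemma etc_object_D: assumes "etc_object v C" shows "etc_object v D"
proof -
  have "compact_space (tc_obj D)" if "compact_space (tc_obj C)"
    using that homeomorphic_map_compactness[OF h0, of "objects C"] objects_D by (simp add: compact_space_def)
  then show ?thesis
    using assms etale_D spectral_space_homeomorphic[OF h0] spectral_space_homeomorphic[OF h1]
    by (cases v) (auto simp: spectral_category_def strongly_spectral_category_def)
qed

lemma etc_morphism_rel_of: "etc_morphism_of_type k C D (rel_of C \<phi>1 \<phi>0)"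
proof -
  have "relational_covering_morphism C D (\<lambda>a\<in>arrows C. {\<phi>1 a}, \<lambda>p\<in>objects C. \<phi>0 p)"
  proof (rule relational_covering_morphismI)
    show "continuous_map (tc_obj C) (tc_obj D) (\<lambda>p\<in>objects C. \<phi>0 p)"
      using homeomorphic_imp_continuous_map[OF h0] by (rule continuous_map_eq) simp
    show "\<exists>t\<in>arrows C. tc_dom C t = q \<and> s \<in> (\<lambda>a\<in>arrows C. {\<phi>1 a}) t"
      if "q \<in> objects C" "s \<in> arrows D" "tc_dom D s = (\<lambda>p\<in>objects C. \<phi>0 p) q" for q s
      using that unfolding arrows_D by (auto simp: dom_D inj0)
    show "\<exists>t\<in>arrows C. tc_cod C t = q \<and> s \<in> (\<lambda>a\<in>arrows C. {\<phi>1 a}) t"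
      if "q \<in> objects C" "s \<in> arrows D" "tc_cod D s = (\<lambda>p\<in>objects C. \<phi>0 p) q" for q s
      using that unfolding arrows_D by (auto simp: cod_D inj0)
    show "openin (tc_arr C) {x \<in> arrows C. (\<lambda>a\<in>arrows C. {\<phi>1 a}) x \<inter> A \<noteq> {}}" if "openin (tc_arr D) A" for A
    proof -
      have "{x \<in> arrows C. (\<lambda>a\<in>arrows C. {\<phi>1 a}) x \<inter> A \<noteq> {}} = {x \<in> arrows C. \<phi>1 x \<in> A}" by auto
      then show ?thesis using homeomorphic_imp_continuous_map[OF h1] that by (simp add: continuous_map_def)
    qed
    show "tc_comp D s t \<in> (\<lambda>a\<in>arrows C. {\<phi>1 a}) (tc_comp C a b)"
      if "(a, b) \<in> composable C" "s \<in> (\<lambda>a\<in>arrows C. {\<phi>1 a}) a" "t \<in> (\<lambda>a\<in>arrows C. {\<phi>1 a}) b" for a b s t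
      using that composable_arrows[OF that(1)] comp_C[OF that(1)] comp_D[OF that(1)] by simp
  qed (auto simp: arrows_D objects_D dom_D cod_D unit_D inj1)
  moreover have "coherent C D (\<lambda>a\<in>arrows C. {\<phi>1 a}, \<lambda>p\<in>objects C. \<phi>0 p)"
    unfolding coherent_def
  proof (intro allI impI)
    fix U assume U: "compact_open (tc_obj D) U"
    let ?V = "{p\<in>objects C. \<phi>0 p \<in> U}"
    have "\<phi>0 ` ?V = U" using compact_open_subset[OF U] unfolding objects_D by blast
    then have "compact_open (tc_obj C) ?V"
      using U homeomorphic_imp_continuous_map[OF h0] homeomorphic_map_compactness[OF h0, of ?V]
      by (simp add: compact_open_def continuous_map_def)
    moreover have "{p \<in> objects C. snd (\<lambda>a\<in>arrows C. {\<phi>1 a}, \<lambda>p\<in>objects C. \<phi>0 p) p \<in> U} = ?V" by auto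
    ultimately show "compact_open (tc_obj C) {p \<in> objects C. snd (\<lambda>a\<in>arrows C. {\<phi>1 a}, \<lambda>p\<in>objects C. \<phi>0 p) p \<in> U}"
      by simp
  qed
  ultimately show ?thesis by (auto simp: etc_morphism_of_type_def rel_of_def)
qed

lemma inverse:
  obtains \<psi>1 \<psi>0 where "etc_iso D C \<psi>1 \<psi>0"
    "\<And>a. a \<in> arrows C \<Longrightarrow> \<psi>1 (\<phi>1 a) = a" "\<And>b. b \<in> arrows D \<Longrightarrow> \<phi>1 (\<psi>1 b) = b"
    "\<And>p. p \<in> objects C \<Longrightarrow> \<psi>0 (\<phi>0 p) = p" "\<And>q. q \<in> objects D \<Longrightarrow> \<phi>0 (\<psi>0 q) = q"
proof -
  obtain \<psi>1 where m1: "homeomorphic_maps (tc_arr C) (tc_arr D) \<phi>1 \<psi>1" using h1 homeomorphic_map_maps by blast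
  obtain \<psi>0 where m0: "homeomorphic_maps (tc_obj C) (tc_obj D) \<phi>0 \<psi>0" using h0 homeomorphic_map_maps by blast
  have p1: "\<And>a. a \<in> arrows C \<Longrightarrow> \<psi>1 (\<phi>1 a) = a" "\<And>b. b \<in> arrows D \<Longrightarrow> \<phi>1 (\<psi>1 b) = b"
    and p0: "\<And>p. p \<in> objects C \<Longrightarrow> \<psi>0 (\<phi>0 p) = p" "\<And>q. q \<in> objects D \<Longrightarrow> \<phi>0 (\<psi>0 q) = q"
    using m1 m0 by (auto simp: homeomorphic_maps_def)
  have "etc_iso D C \<psi>1 \<psi>0" unfolding etc_iso_def
  proof (intro conjI)
    show "homeomorphic_map (tc_arr D) (tc_arr C) \<psi>1" "homeomorphic_map (tc_obj D) (tc_obj C) \<psi>0"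
      using m1 m0 homeomorphic_maps_map by blast+
    show "\<forall>(x, y)\<in>composable D. tc_comp C (\<psi>1 x) (\<psi>1 y) = \<psi>1 (tc_comp D x y)"
    proof (clarify)
      fix x y assume "(x, y) \<in> composable D"
      then obtain a b where ab: "x = \<phi>1 a" "y = \<phi>1 b" "(a, b) \<in> composable C" by (rule composable_DE)
      then show "tc_comp C (\<psi>1 x) (\<psi>1 y) = \<psi>1 (tc_comp D x y)"
        using composable_arrows[OF ab(3)] comp_C[OF ab(3)] by (simp add: comp_D p1)
    qed
  qed (simp_all add: arrows_D objects_D dom_D cod_D unit_D p1 p0)
  then show thesis using that p1 p0 by blast
qed

end

lemma etc_iso_locI: "etale_category C \<Longrightarrow> etc_iso C D \<phi>1 \<phi>0 \<Longrightarrow> etc_iso_loc C D \<phi>1 \<phi>0"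
  by (simp add: etc_iso_loc_def)

lemma etc_iso_comp:
  assumes C: "etale_category C" and 1: "etc_iso C D \<phi>1 \<phi>0" and 2: "etc_iso D B \<psi>1 \<psi>0"
  shows "etc_iso C B (\<lambda>x. \<psi>1 (\<phi>1 x)) (\<lambda>x. \<psi>0 (\<phi>0 x))"
proof -
  interpret f: etc_iso_loc C D \<phi>1 \<phi>0 using etc_iso_locI[OF C 1] .
  interpret g: etc_iso_loc D B \<psi>1 \<psi>0 using etc_iso_locI[OF f.etale_D 2] .
  have "homeomorphic_map (tc_arr C) (tc_arr B) (\<lambda>x. \<psi>1 (\<phi>1 x))"
    "homeomorphic_map (tc_obj C) (tc_obj B) (\<lambda>x. \<psi>0 (\<phi>0 x))"
    using homeomorphic_map_compose[OF f.h1 g.h1] homeomorphic_map_compose[OF f.h0 g.h0] by (simp_all add: comp_def)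
  moreover have "tc_comp B (\<psi>1 (\<phi>1 a)) (\<psi>1 (\<phi>1 b)) = \<psi>1 (\<phi>1 (tc_comp C a b))" if "(a, b) \<in> composable C" for a b
    using f.comp_D[OF that] g.comp_D[of "\<phi>1 a" "\<phi>1 b"] f.composable_D f.composable_arrows[OF that] that by simp
  ultimately show ?thesis
    by (auto simp: etc_iso_def f.dom_D f.cod_D f.unit_D g.dom_D g.cod_D g.unit_D f.arrows_D f.objects_D)
qed

lemma is_iso_etc:
  assumes "etc_object v C" "etc_object v D" "etc_iso C D \<phi>1 \<phi>0"
  shows "is_iso (ETC v k) C D (rel_of C \<phi>1 \<phi>0)"
proof -
  have e: "etale_category C" "etale_category D"
    using assms(1,2) etc_object_spectral by (auto simp: spectral_category_def)
  interpret etc_iso_loc C D \<phi>1 \<phi>0 using etc_iso_locI[OF e(1) assms(3)] .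
  obtain \<psi>1 \<psi>0 where \<psi>: "etc_iso D C \<psi>1 \<psi>0"
    "\<And>a. a \<in> arrows C \<Longrightarrow> \<psi>1 (\<phi>1 a) = a" "\<And>b. b \<in> arrows D \<Longrightarrow> \<phi>1 (\<psi>1 b) = b"
    "\<And>p. p \<in> objects C \<Longrightarrow> \<psi>0 (\<phi>0 p) = p" "\<And>q. q \<in> objects D \<Longrightarrow> \<phi>0 (\<psi>0 q) = q"
    by (rule inverse) blast
  interpret I: etc_iso_loc D C \<psi>1 \<psi>0 using etc_iso_locI[OF e(2) \<psi>(1)] .
  have "comp_rel C (rel_of D \<psi>1 \<psi>0) (rel_of C \<phi>1 \<phi>0) = id_rel C"
    using \<psi>(2,4) arrows_D objects_D by (auto simp: comp_rel_def rel_of_def id_rel_def fun_eq_iff)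
  moreover have "comp_rel D (rel_of C \<phi>1 \<phi>0) (rel_of D \<psi>1 \<psi>0) = id_rel D"
    using \<psi>(3,5) I.arrows_D I.objects_D by (auto simp: comp_rel_def rel_of_def id_rel_def fun_eq_iff)
  ultimately show ?thesis
    using etc_morphism_rel_of[of k] I.etc_morphism_rel_of[of k] unfolding is_iso_def
    by (intro conjI bexI[of _ "rel_of D \<psi>1 \<psi>0"]) (simp_all add: ETC_def id_rel_def comp_rel_def)
qed

theorem (in spectral_etale) pt_iso: "etc_iso C (spec_ob (bis_ob C)) (pt C) (pt0 C)"
  unfolding etc_iso_def spec_ob_simps(1,2)
  using homeomorphic_pt homeomorphic_pt0 Dm_pt unit_pt0 comp_pt
  by (auto simp del: spec_ob_simps)

section \<open>The inclusions of universes\<close>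

lemma untag_tag [simp]: "untag (tag x) = x"
  by (simp add: tag_def untag_def)

lemma tag_inject [simp]: "tag x = tag y \<longleftrightarrow> x = y"
  by (simp add: tag_def)

lemma tag_iso: "drs_iso S (on_ob DRS_lift S) tag"
  by (auto simp: drs_iso_def DRS_lift_def bij_betw_def inj_on_def)

lemma homeomorphic_tag: "homeomorphic_map X (lift_topology X) tag"
proof (rule bijective_open_imp_homeomorphic_map)
  have open_lift: "openin (lift_topology X) W \<longleftrightarrow> (\<exists>U. openin X U \<and> W = untag -` U \<inter> tag ` topspace X)" for W
    by (simp add: lift_topology_def openin_pullback_topology)
  have pre: "untag -` U \<inter> tag ` topspace X = tag ` U" if "openin X U" for U
    using openin_subset[OF that] by auto
  have top: "topspace (lift_topology X) = tag ` topspace X"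
    by (auto simp: lift_topology_def topspace_pullback_topology)
  show "continuous_map X (lift_topology X) tag"
    unfolding continuous_map_def top
  proof (intro conjI allI impI)
    fix W assume "openin (lift_topology X) W"
    then obtain U where "openin X U" "W = untag -` U \<inter> tag ` topspace X" unfolding open_lift by blast
    then have U: "openin X U" "W = tag ` U" using pre by simp_all
    have "{x \<in> topspace X. tag x \<in> W} = U" using openin_subset[OF U(1)] U(2) by auto
    then show "openin X {x \<in> topspace X. tag x \<in> W}" using U(1) by simp
  qed auto
  show "open_map X (lift_topology X) tag" unfolding open_map_def
  proof (intro allI impI)
    fix U assume "openin X U"
    then show "openin (lift_topology X) (tag ` U)" unfolding open_lift using pre by metis
  qed
  show "tag ` topspace X = topspace (lift_topology X)" by (rule top[symmetric])
  show "inj_on tag (topspace X)" by (auto simp: inj_on_def)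
qed

lemma tag_etc_iso: "etc_iso C (on_ob ETC_lift C) tag tag"
  using homeomorphic_tag by (auto simp: etc_iso_def ETC_lift_def)

lemma drs_of_object: "drs_object v S \<Longrightarrow> drs S"
  by (cases v) (simp_all add: drsI)

lemma etale_of_object: "etc_object v C \<Longrightarrow> etale_category C"
  using etc_object_spectral by (auto simp: spectral_category_def)

lemma drs_object_lift: "drs_object v S \<Longrightarrow> drs_object v (on_ob DRS_lift S)"
  using drs_iso_loc.drs_object_T[OF drs_iso_locI[OF drs_of_object tag_iso]] .

lemma etc_object_lift: "etc_object v C \<Longrightarrow> etc_object v (on_ob ETC_lift C)"
  using etc_iso_loc.etc_object_D[OF etc_iso_locI[OF etale_of_object tag_etc_iso]] .

lemma untag_iso: "drs_iso (on_ob DRS_lift S) S untag"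
  by (auto simp: drs_iso_def DRS_lift_def bij_betw_def inj_on_def image_image)

text \<open>The inverse of the isomorphism \<open>tag\<close> agrees with \<open>untag\<close> on the spaces concerned, though \<open>untag\<close> is
  arbitrary elsewhere.\<close>

lemma untag_etc_iso: assumes "etale_category C" shows "etc_iso (on_ob ETC_lift C) C untag untag"
proof -
  interpret etc_iso_loc C "on_ob ETC_lift C" tag tag by (rule etc_iso_locI[OF assms tag_etc_iso])
  obtain \<psi>1 \<psi>0 where \<psi>: "etc_iso (on_ob ETC_lift C) C \<psi>1 \<psi>0" "\<And>a. a \<in> arrows C \<Longrightarrow> \<psi>1 (tag a) = a"
    "\<And>p. p \<in> objects C \<Longrightarrow> \<psi>0 (tag p) = p"
    by (rule inverse) blast
  have "homeomorphic_map (tc_arr (on_ob ETC_lift C)) (tc_arr C) untag"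
    using \<psi>(1,2) arrows_D by (intro homeomorphic_map_eq[of _ _ \<psi>1 untag]) (auto simp: etc_iso_def)
  moreover have "homeomorphic_map (tc_obj (on_ob ETC_lift C)) (tc_obj C) untag"
    using \<psi>(1,3) objects_D by (intro homeomorphic_map_eq[of _ _ \<psi>0 untag]) (auto simp: etc_iso_def)
  moreover have "untag (tc_comp (on_ob ETC_lift C) x y) = tc_comp C (untag x) (untag y)"
    "untag (tc_dom (on_ob ETC_lift C) x) = tc_dom C (untag x)"
    "untag (tc_cod (on_ob ETC_lift C) x) = tc_cod C (untag x)"
    "untag (tc_unit (on_ob ETC_lift C) x) = tc_unit C (untag x)" for x y
    by (simp_all add: ETC_lift_def)
  ultimately show ?thesis by (simp add: etc_iso_def)
qed

lemma carrier_DRS_lift [simp]: "carrier (on_ob DRS_lift S) = tag ` carrier S"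
  by (simp add: DRS_lift_def)

lemma DRS_lift_ar:
  "on_ar DRS_lift S T f = (\<lambda>X\<in>tag ` carrier S. tag (f (untag X)))"
  by (simp add: DRS_lift_def)

lemma DRS_lift_hom:
  assumes S: "drs_object v S" and T: "drs_object v T"
  shows "drs_morphism_of_type k S T f \<Longrightarrow>
      drs_morphism_of_type k (on_ob DRS_lift S) (on_ob DRS_lift T) (on_ar DRS_lift S T f)"
    and "drs_morphism_of_type k (on_ob DRS_lift S) (on_ob DRS_lift T) g \<Longrightarrow>
      drs_morphism_of_type k S T (\<lambda>a\<in>carrier S. untag (g (tag a)))"
proof -
  let ?S = "on_ob DRS_lift S" and ?T = "on_ob DRS_lift T"
  note d = drs_of_object[OF S] drs_of_object[OF T] drs_of_object[OF drs_object_lift[OF S]]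
    drs_of_object[OF drs_object_lift[OF T]]
  note tags = drs_iso_loc.morphism_T[OF drs_iso_locI[OF d(1) tag_iso], of k]
    drs_iso_loc.morphism_T[OF drs_iso_locI[OF d(2) tag_iso], of k]
    drs_iso_loc.morphism_T[OF drs_iso_locI[OF d(3) untag_iso], of k]
    drs_iso_loc.morphism_T[OF drs_iso_locI[OF d(4) untag_iso], of k]
  {
    assume f: "drs_morphism_of_type k S T f"
    then have fM: "f a \<in> carrier T" if "a \<in> carrier S" for a
      using that by (auto simp: drs_morphism_of_type_def drs_morphism_def)
    have "compose (carrier ?S) (compose (carrier S) (restrict tag (carrier T)) f) (restrict untag (carrier ?S)) =
        on_ar DRS_lift S T f"
      by (rule extensionalityI[of _ "carrier ?S"]) (auto simp: compose_def DRS_lift_ar fM)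
    then show "drs_morphism_of_type k ?S ?T (on_ar DRS_lift S T f)"
      using drs_morphism_of_type_compose[OF d(3,1,4) tags(3) drs_morphism_of_type_compose[OF d(1,2,4) f tags(2)]]
      by simp
  next
    assume g: "drs_morphism_of_type k ?S ?T g"
    then have gM: "g X \<in> carrier ?T" if "X \<in> carrier ?S" for X
      using that by (auto simp: drs_morphism_of_type_def drs_morphism_def)
    have "compose (carrier S) (compose (carrier ?S) (restrict untag (carrier ?T)) g) (restrict tag (carrier S)) =
        (\<lambda>a\<in>carrier S. untag (g (tag a)))"
    proof (rule extensionalityI[of _ "carrier S"])
      fix a assume a: "a \<in> carrier S"
      then have "g (tag a) \<in> carrier ?T" using gM by simp
      then show "compose (carrier S) (compose (carrier ?S) (restrict untag (carrier ?T)) g) (restrict tag (carrier S)) a =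
        (\<lambda>a\<in>carrier S. untag (g (tag a))) a" using a by (simp add: compose_def)
    qed (simp_all add: compose_extensional)
    then show "drs_morphism_of_type k S T (\<lambda>a\<in>carrier S. untag (g (tag a)))"
      using drs_morphism_of_type_compose[OF d(1,3,2) tags(1) drs_morphism_of_type_compose[OF d(3,4,2) g tags(4)]]
      by simp
  }
qed

lemma DRS_simps [simp]:
  "Ob (DRS v k) = {S. drs_object v S}" "Hom (DRS v k) S T = {f. drs_morphism_of_type k S T f}"
  "Idn (DRS v k) S = restrict id (carrier S)" "Cmp (DRS v k) S T U g f = compose (carrier S) g f"
  by (simp_all add: DRS_def)

lemma ETC_simps [simp]:
  "Ob (ETC v k) = {C. etc_object v C}" "Hom (ETC v k) C D = {f. etc_morphism_of_type k C D f}"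
  "Idn (ETC v k) C = id_rel C" "Cmp (ETC v k) C D B g f = comp_rel C g f"
  by (simp_all add: ETC_def id_rel_def comp_rel_def)

lemma drs_morphism_of_type_ext:
  "drs_morphism_of_type k S T f \<Longrightarrow> f \<in> carrier S \<rightarrow>\<^sub>E carrier T"
  by (simp add: drs_morphism_of_type_def drs_morphism_def)

lemma drs_morphism_of_type_id: assumes "drs S" shows "drs_morphism_of_type k S S (restrict id (carrier S))"
proof -
  have "drs_iso S S id" by (auto simp: drs_iso_def bij_betw_def)
  then show ?thesis using drs_iso_loc.morphism_T[OF drs_iso_locI[OF assms], of S id k] by simp
qed

lemma category_DRS: "category (DRS v k :: ('a rsg, 'a \<Rightarrow> 'a) cat)"
  unfolding category_def DRS_simps
proof (intro conjI ballI)
  fix S :: "'a rsg" assume S: "S \<in> {S. drs_object v S}"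
  then show "restrict id (carrier S) \<in> {f. drs_morphism_of_type k S S f}"
    using drs_morphism_of_type_id drs_of_object by blast
  fix T U :: "'a rsg" and f g assume "T \<in> {S. drs_object v S}" "U \<in> {S. drs_object v S}"
    "f \<in> {f. drs_morphism_of_type k S T f}" "g \<in> {f. drs_morphism_of_type k T U f}"
  then show "compose (carrier S) g f \<in> {f. drs_morphism_of_type k S U f}"
    using S drs_morphism_of_type_compose[of S T U k f g] drs_of_object by blast
next
  fix S T :: "'a rsg" and f assume "f \<in> {f. drs_morphism_of_type k S T f}"
  then have f: "f \<in> carrier S \<rightarrow>\<^sub>E carrier T" using drs_morphism_of_type_ext by blast
  then have "f \<in> extensional (carrier S)" by (simp add: PiE_iff)
  note f = f this
  show "compose (carrier S) f (restrict id (carrier S)) = f"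
    using f by (intro extensionalityI[of _ "carrier S"]) (auto simp: compose_def)
  show "compose (carrier S) (restrict id (carrier T)) f = f"
    using f by (intro extensionalityI[of _ "carrier S"]) (auto simp: compose_def)
next
  fix R S T U :: "'a rsg" and f g h assume "f \<in> {f. drs_morphism_of_type k R S f}" "g \<in> {f. drs_morphism_of_type k S T f}"
  then have "f \<in> carrier R \<rightarrow>\<^sub>E carrier S" using drs_morphism_of_type_ext by blast
  then show "compose (carrier R) (compose (carrier S) h g) f = compose (carrier R) h (compose (carrier R) g f)"
    by (intro extensionalityI[of _ "carrier R"]) (auto simp: compose_def)
qed

lemma etc_morphism_of_type_ext:
  assumes "etc_morphism_of_type k C D f"
  shows "fst f \<in> extensional (arrows C)" "snd f \<in> extensional (objects C)"
    "\<And>a b. a \<in> arrows C \<Longrightarrow> b \<in> fst f a \<Longrightarrow> b \<in> arrows D" "\<And>p. p \<in> objects C \<Longrightarrow> snd f p \<in> objects D"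
  using relational_covering_morphismD(1,2)[OF etc_morphism_of_typeD(1)[OF assms]] by (auto simp: PiE_iff)

lemma rel_map_eqI:
  assumes "fst f \<in> extensional A" "fst g \<in> extensional A" "snd f \<in> extensional B" "snd g \<in> extensional B"
    "\<And>a. a \<in> A \<Longrightarrow> fst f a = fst g a" "\<And>p. p \<in> B \<Longrightarrow> snd f p = snd g p"
  shows "f = g"
  using extensionalityI[OF assms(1,2,5)] extensionalityI[OF assms(3,4,6)] by (rule prod_eqI)

lemma comp_rel_simps [simp]:
  "a \<in> arrows C \<Longrightarrow> fst (comp_rel C g f) a = (\<Union>b\<in>fst f a. fst g b)"
  "p \<in> objects C \<Longrightarrow> snd (comp_rel C g f) p = snd g (snd f p)"
  "fst (comp_rel C g f) \<in> extensional (arrows C)" "snd (comp_rel C g f) \<in> extensional (objects C)"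
  by (simp_all add: comp_rel_def)

lemma rel_of_simps [simp]:
  "a \<in> arrows C \<Longrightarrow> fst (rel_of C f1 f0) a = {f1 a}" "p \<in> objects C \<Longrightarrow> snd (rel_of C f1 f0) p = f0 p"
  "fst (rel_of C f1 f0) \<in> extensional (arrows C)" "snd (rel_of C f1 f0) \<in> extensional (objects C)"
  by (simp_all add: rel_of_def)

lemma id_rel_simps [simp]:
  "a \<in> arrows C \<Longrightarrow> fst (id_rel C) a = {a}" "p \<in> objects C \<Longrightarrow> snd (id_rel C) p = p"
  "fst (id_rel C) \<in> extensional (arrows C)" "snd (id_rel C) \<in> extensional (objects C)"
  by (simp_all add: id_rel_def)

lemma topological_of_object: "etc_object v C \<Longrightarrow> topological_category C"
  using etale_of_object by (auto simp: etale_category_def)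

lemma category_ETC: "category (ETC v k :: ('c tcat, ('c, 'c) rel_map) cat)"
  unfolding category_def ETC_simps
proof (intro conjI ballI)
  fix C :: "'c tcat" assume C: "C \<in> {C. etc_object v C}"
  then show "id_rel C \<in> {f. etc_morphism_of_type k C C f}"
    using etc_morphism_of_type_id etc_object_spectral by blast
  fix D B :: "'c tcat" and f g assume "f \<in> {f. etc_morphism_of_type k C D f}" "g \<in> {f. etc_morphism_of_type k D B f}"
  then show "comp_rel C g f \<in> {f. etc_morphism_of_type k C B f}"
    using C etc_morphism_of_type_comp[of k C D f B g] topological_of_object by blast
next
  fix C D :: "'c tcat" and f assume "f \<in> {f. etc_morphism_of_type k C D f}"
  then have f: "etc_morphism_of_type k C D f" by simp
  note e = etc_morphism_of_type_ext[OF f]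
  show "comp_rel C f (id_rel C) = f"
    by (rule rel_map_eqI[of _ "arrows C" _ "objects C"]) (simp_all add: e)
  show "comp_rel C (id_rel D) f = f"
  proof (rule rel_map_eqI[of _ "arrows C" _ "objects C"])
    fix a assume a: "a \<in> arrows C"
    have "(\<Union>b\<in>fst f a. fst (id_rel D) b) = fst f a" using e(3)[OF a] by auto
    then show "fst (comp_rel C (id_rel D) f) a = fst f a" using a by simp
  qed (simp_all add: e)
next
  fix A C D B :: "'c tcat" and f g h assume "f \<in> {f. etc_morphism_of_type k A C f}" "g \<in> {f. etc_morphism_of_type k C D f}"
  then have fg: "etc_morphism_of_type k A C f" "etc_morphism_of_type k C D g" by simp_all
  note e = etc_morphism_of_type_ext[OF fg(1)]
  show "comp_rel A (comp_rel C h g) f = comp_rel A h (comp_rel A g f)"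
  proof (rule rel_map_eqI[of _ "arrows A" _ "objects A"])
    fix a assume a: "a \<in> arrows A"
    have "(\<Union>b\<in>fst f a. fst (comp_rel C h g) b) = (\<Union>b\<in>fst f a. \<Union>c\<in>fst g b. fst h c)"
      using e(3)[OF a] by (intro SUP_cong) simp_all
    then show "fst (comp_rel A (comp_rel C h g) f) a = fst (comp_rel A h (comp_rel A g f)) a" using a by simp
  qed (simp_all add: e(4))
qed

lemma ETC_lift_ar:
  "on_ar ETC_lift C D f = (\<lambda>X\<in>tag ` arrows C. tag ` fst f (untag X), \<lambda>X\<in>tag ` objects C. tag (snd f (untag X)))"
  by (simp add: ETC_lift_def)

lemma arrows_ETC_lift [simp]: "arrows (on_ob ETC_lift C) = tag ` arrows C"
  and objects_ETC_lift [simp]: "objects (on_ob ETC_lift C) = tag ` objects C"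
  by (simp_all add: ETC_lift_def homeomorphic_imp_surjective_map[OF homeomorphic_tag, symmetric])

definition unlift_rel :: "'c tcat \<Rightarrow> ('c set set, 'd set set) rel_map \<Rightarrow> ('c, 'd) rel_map" where
  "unlift_rel C g = (\<lambda>a\<in>arrows C. untag ` fst g (tag a), \<lambda>p\<in>objects C. untag (snd g (tag p)))"

lemma ETC_lift_hom:
  assumes C: "etc_object v C" and D: "etc_object v D"
  shows "etc_morphism_of_type k C D f \<Longrightarrow>
      etc_morphism_of_type k (on_ob ETC_lift C) (on_ob ETC_lift D) (on_ar ETC_lift C D f)"
    and "etc_morphism_of_type k (on_ob ETC_lift C) (on_ob ETC_lift D) g \<Longrightarrow>
      etc_morphism_of_type k C D (unlift_rel C g)"
proof -
  let ?C = "on_ob ETC_lift C" and ?D = "on_ob ETC_lift D"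
  note e = etale_of_object[OF C] etale_of_object[OF D]
    etale_of_object[OF etc_object_lift[OF C]] etale_of_object[OF etc_object_lift[OF D]]
  note t = topological_of_object[OF C] topological_of_object[OF D]
    topological_of_object[OF etc_object_lift[OF C]] topological_of_object[OF etc_object_lift[OF D]]
  note tags = etc_iso_loc.etc_morphism_rel_of[OF etc_iso_locI[OF e(1) tag_etc_iso], of k]
    etc_iso_loc.etc_morphism_rel_of[OF etc_iso_locI[OF e(2) tag_etc_iso], of k]
    etc_iso_loc.etc_morphism_rel_of[OF etc_iso_locI[OF e(3) untag_etc_iso[OF e(1)]], of k]
    etc_iso_loc.etc_morphism_rel_of[OF etc_iso_locI[OF e(4) untag_etc_iso[OF e(2)]], of k]
  {
    assume f: "etc_morphism_of_type k C D f"
    note x = etc_morphism_of_type_ext[OF f]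
    have "comp_rel ?C (comp_rel C (rel_of D tag tag) f) (rel_of ?C untag untag) = on_ar ETC_lift C D f"
    proof (rule rel_map_eqI[of _ "arrows ?C" _ "objects ?C"])
      fix X assume "X \<in> arrows ?C"
      then obtain a where a: "a \<in> arrows C" "X = tag a" by auto
      have "(\<Union>b\<in>fst f a. fst (rel_of D tag tag) b) = tag ` fst f a" using x(3)[OF a(1)] by auto
      then show "fst (comp_rel ?C (comp_rel C (rel_of D tag tag) f) (rel_of ?C untag untag)) X =
          fst (on_ar ETC_lift C D f) X" using a by (simp add: ETC_lift_ar)
    next
      fix X assume "X \<in> objects ?C"
      then obtain p where p: "p \<in> objects C" "X = tag p" by auto
      then show "snd (comp_rel ?C (comp_rel C (rel_of D tag tag) f) (rel_of ?C untag untag)) X =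
          snd (on_ar ETC_lift C D f) X" using x(4)[OF p(1)] by (simp add: ETC_lift_ar)
    qed (simp_all add: ETC_lift_ar del: arrows_ETC_lift objects_ETC_lift, simp_all)
    then show "etc_morphism_of_type k ?C ?D (on_ar ETC_lift C D f)"
      using etc_morphism_of_type_comp[OF tags(3) etc_morphism_of_type_comp[OF f tags(2) t(1)] t(3)] by simp
  next
    assume g: "etc_morphism_of_type k ?C ?D g"
    note x = etc_morphism_of_type_ext[OF g]
    have "comp_rel C (comp_rel ?C (rel_of ?D untag untag) g) (rel_of C tag tag) = unlift_rel C g"
    proof (rule rel_map_eqI[of _ "arrows C" _ "objects C"])
      fix a assume a: "a \<in> arrows C"
      then have a': "tag a \<in> arrows ?C" by simp
      have "(\<Union>b\<in>fst g (tag a). fst (rel_of ?D untag untag) b) = untag ` fst g (tag a)" using x(3)[OF a'] by auto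
      then show "fst (comp_rel C (comp_rel ?C (rel_of ?D untag untag) g) (rel_of C tag tag)) a =
          fst (unlift_rel C g) a" using a by (simp add: unlift_rel_def)
    next
      fix p assume p: "p \<in> objects C"
      then show "snd (comp_rel C (comp_rel ?C (rel_of ?D untag untag) g) (rel_of C tag tag)) p =
          snd (unlift_rel C g) p" using x(4)[of "tag p"] by (simp add: unlift_rel_def)
    qed (simp_all add: unlift_rel_def)
    then show "etc_morphism_of_type k C D (unlift_rel C g)"
      using etc_morphism_of_type_comp[OF tags(1) etc_morphism_of_type_comp[OF g tags(4) t(3)] t(1)] by simp
  }
qed

lemma covariant_DRS_lift: "covariant (DRS v k) (DRS v k)
    (DRS_lift :: ('a rsg, 'a \<Rightarrow> 'a, 'a set set rsg, 'a set set \<Rightarrow> 'a set set) fctr)"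
  unfolding covariant_def DRS_simps
proof (intro conjI ballI)
  fix S :: "'a rsg" assume S: "S \<in> {S. drs_object v S}"
  then show "on_ob DRS_lift S \<in> {S. drs_object v S}" using drs_object_lift by blast
  show "on_ar DRS_lift S S (restrict id (carrier S)) = restrict id (carrier (on_ob DRS_lift S))"
    by (rule extensionalityI[of _ "tag ` carrier S"]) (auto simp: DRS_lift_ar)
  fix T :: "'a rsg" and f assume T: "T \<in> {S. drs_object v S}" and f: "f \<in> {f. drs_morphism_of_type k S T f}"
  then show "on_ar DRS_lift S T f \<in> {f. drs_morphism_of_type k (on_ob DRS_lift S) (on_ob DRS_lift T) f}"
    using S DRS_lift_hom(1) by blast
  fix U :: "'a rsg" and g
  have "f a \<in> carrier T" if "a \<in> carrier S" for a using f that drs_morphism_of_type_ext by blast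
  then show "on_ar DRS_lift S U (compose (carrier S) g f) =
      compose (carrier (on_ob DRS_lift S)) (on_ar DRS_lift T U g) (on_ar DRS_lift S T f)"
    by (intro extensionalityI[of _ "tag ` carrier S"]) (auto simp: DRS_lift_ar compose_def)
qed

theorem fully_faithful_DRS_lift: "fully_faithful (DRS v k) (DRS v k)
    (DRS_lift :: ('a rsg, 'a \<Rightarrow> 'a, 'a set set rsg, 'a set set \<Rightarrow> 'a set set) fctr)"
  unfolding fully_faithful_def
proof (intro conjI ballI covariant_DRS_lift)
  fix S T :: "'a rsg" assume "S \<in> Ob (DRS v k)" "T \<in> Ob (DRS v k)"
  then have ST: "drs_object v S" "drs_object v T" by simp_all
  let ?G = "\<lambda>g. \<lambda>a\<in>carrier S. untag (g (tag a))"
  show "bij_betw (on_ar DRS_lift S T) (Hom (DRS v k) S T) (Hom (DRS v k) (on_ob DRS_lift S) (on_ob DRS_lift T))"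
  proof (rule bij_betw_byWitness[of _ ?G])
    show "\<forall>f\<in>Hom (DRS v k) S T. ?G (on_ar DRS_lift S T f) = f"
    proof
      fix f assume "f \<in> Hom (DRS v k) S T"
      then have "drs_morphism_of_type k S T f" by simp
      then have "f \<in> extensional (carrier S)" using drs_morphism_of_type_ext PiE_iff by metis
      then show "?G (on_ar DRS_lift S T f) = f"
        by (intro extensionalityI[of _ "carrier S"]) (auto simp: DRS_lift_ar)
    qed
    show "\<forall>g\<in>Hom (DRS v k) (on_ob DRS_lift S) (on_ob DRS_lift T). on_ar DRS_lift S T (?G g) = g"
    proof
      fix g assume "g \<in> Hom (DRS v k) (on_ob DRS_lift S) (on_ob DRS_lift T)"
      then have "drs_morphism_of_type k (on_ob DRS_lift S) (on_ob DRS_lift T) g" by simp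
      then have g: "g \<in> tag ` carrier S \<rightarrow>\<^sub>E tag ` carrier T"
        using drs_morphism_of_type_ext by (metis carrier_DRS_lift)
      show "on_ar DRS_lift S T (?G g) = g"
      proof (rule extensionalityI[of _ "tag ` carrier S"])
        fix X assume X: "X \<in> tag ` carrier S"
        then obtain a where a: "a \<in> carrier S" "X = tag a" by blast
        have "g X \<in> tag ` carrier T" using PiE_mem[OF g X] .
        then obtain b where "g X = tag b" by blast
        then have "tag (untag (g X)) = g X" by simp
        then show "on_ar DRS_lift S T (?G g) X = g X" using a by (simp add: DRS_lift_ar)
      qed (use g in \<open>auto simp: DRS_lift_ar PiE_iff\<close>)
    qed
    show "on_ar DRS_lift S T ` Hom (DRS v k) S T \<subseteq> Hom (DRS v k) (on_ob DRS_lift S) (on_ob DRS_lift T)"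
      using DRS_lift_hom(1)[OF ST] by auto
    show "?G ` Hom (DRS v k) (on_ob DRS_lift S) (on_ob DRS_lift T) \<subseteq> Hom (DRS v k) S T"
      using DRS_lift_hom(2)[OF ST] by auto
  qed
qed

lemma covariant_ETC_lift: "covariant (ETC v k) (ETC v k)
    (ETC_lift :: ('c tcat, ('c, 'c) rel_map, 'c set set tcat, ('c set set, 'c set set) rel_map) fctr)"
  unfolding covariant_def ETC_simps
proof (intro conjI ballI)
  fix C :: "'c tcat" assume C: "C \<in> {C. etc_object v C}"
  then show "on_ob ETC_lift C \<in> {C. etc_object v C}" using etc_object_lift by blast
  show "on_ar ETC_lift C C (id_rel C) = id_rel (on_ob ETC_lift C)"
    by (rule rel_map_eqI[of _ "tag ` arrows C" _ "tag ` objects C"]) (auto simp: ETC_lift_ar id_rel_def)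
  fix D :: "'c tcat" and f assume D: "D \<in> {C. etc_object v C}" and f: "f \<in> {f. etc_morphism_of_type k C D f}"
  then show "on_ar ETC_lift C D f \<in> {f. etc_morphism_of_type k (on_ob ETC_lift C) (on_ob ETC_lift D) f}"
    using C ETC_lift_hom(1) by blast
  fix B :: "'c tcat" and g
  have f': "etc_morphism_of_type k C D f" using f by simp
  note x = etc_morphism_of_type_ext[OF f']
  show "on_ar ETC_lift C B (comp_rel C g f) =
      comp_rel (on_ob ETC_lift C) (on_ar ETC_lift D B g) (on_ar ETC_lift C D f)"
  proof (rule rel_map_eqI[of _ "tag ` arrows C" _ "tag ` objects C"])
    fix X assume "X \<in> tag ` arrows C"
    then obtain a where a: "a \<in> arrows C" "X = tag a" by blast
    have "fst (on_ar ETC_lift D B g) (tag b) = tag ` fst g b" if "b \<in> fst f a" for b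
      using x(3)[OF a(1) that] by (simp add: ETC_lift_ar)
    then have "(\<Union>b\<in>fst f a. fst (on_ar ETC_lift D B g) (tag b)) = tag ` (\<Union>b\<in>fst f a. fst g b)" by auto
    moreover have "fst (on_ar ETC_lift C D f) X = tag ` fst f a" using a by (simp add: ETC_lift_ar)
    moreover have "fst (on_ar ETC_lift C B (comp_rel C g f)) X = tag ` (\<Union>b\<in>fst f a. fst g b)"
      using a by (simp add: ETC_lift_ar)
    ultimately show "fst (on_ar ETC_lift C B (comp_rel C g f)) X =
        fst (comp_rel (on_ob ETC_lift C) (on_ar ETC_lift D B g) (on_ar ETC_lift C D f)) X"
      using a by simp
  next
    fix X assume "X \<in> tag ` objects C"
    then obtain p where p: "p \<in> objects C" "X = tag p" by blast
    then show "snd (on_ar ETC_lift C B (comp_rel C g f)) X =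
        snd (comp_rel (on_ob ETC_lift C) (on_ar ETC_lift D B g) (on_ar ETC_lift C D f)) X"
      using x(4)[OF p(1)] by (simp add: ETC_lift_ar comp_rel_def)
  qed (simp_all add: ETC_lift_ar comp_rel_def)
qed

theorem fully_faithful_ETC_lift: "fully_faithful (ETC v k) (ETC v k)
    (ETC_lift :: ('c tcat, ('c, 'c) rel_map, 'c set set tcat, ('c set set, 'c set set) rel_map) fctr)"
  unfolding fully_faithful_def
proof (intro conjI ballI covariant_ETC_lift)
  fix C D :: "'c tcat" assume "C \<in> Ob (ETC v k)" "D \<in> Ob (ETC v k)"
  then have CD: "etc_object v C" "etc_object v D" by simp_all
  show "bij_betw (on_ar ETC_lift C D) (Hom (ETC v k) C D) (Hom (ETC v k) (on_ob ETC_lift C) (on_ob ETC_lift D))"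
  proof (rule bij_betw_byWitness[of _ "unlift_rel C"])
    show "\<forall>f\<in>Hom (ETC v k) C D. unlift_rel C (on_ar ETC_lift C D f) = f"
    proof
      fix f assume "f \<in> Hom (ETC v k) C D"
      then have f: "etc_morphism_of_type k C D f" by simp
      show "unlift_rel C (on_ar ETC_lift C D f) = f"
        by (rule rel_map_eqI[of _ "arrows C" _ "objects C"])
          (simp_all add: ETC_lift_ar unlift_rel_def image_image etc_morphism_of_type_ext[OF f])
    qed
    show "\<forall>g\<in>Hom (ETC v k) (on_ob ETC_lift C) (on_ob ETC_lift D). on_ar ETC_lift C D (unlift_rel C g) = g"
    proof
      fix g assume "g \<in> Hom (ETC v k) (on_ob ETC_lift C) (on_ob ETC_lift D)"
      then have g: "etc_morphism_of_type k (on_ob ETC_lift C) (on_ob ETC_lift D) g" by simp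
      note x = etc_morphism_of_type_ext[OF g, unfolded arrows_ETC_lift objects_ETC_lift]
      show "on_ar ETC_lift C D (unlift_rel C g) = g"
      proof (rule rel_map_eqI[of _ "tag ` arrows C" _ "tag ` objects C"])
        fix X assume X: "X \<in> tag ` arrows C"
        then obtain a where a: "a \<in> arrows C" "X = tag a" by blast
        have "tag (untag Y) = Y" if Y: "Y \<in> fst g X" for Y
        proof -
          obtain b where "Y = tag b" using x(3)[OF X Y] by blast
          then show ?thesis by simp
        qed
        then have "tag ` untag ` fst g X = fst g X" by (simp add: image_image)
        then show "fst (on_ar ETC_lift C D (unlift_rel C g)) X = fst g X"
          using a by (simp add: ETC_lift_ar unlift_rel_def)
      next
        fix X assume X: "X \<in> tag ` objects C"
        then obtain p where p: "p \<in> objects C" "X = tag p" by blast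
        obtain q where "snd g X = tag q" using x(4)[OF X] by blast
        then have "tag (untag (snd g X)) = snd g X" by simp
        then show "snd (on_ar ETC_lift C D (unlift_rel C g)) X = snd g X"
          using p by (simp add: ETC_lift_ar unlift_rel_def)
      qed (simp_all add: ETC_lift_ar x(1,2))
    qed
    show "on_ar ETC_lift C D ` Hom (ETC v k) C D \<subseteq> Hom (ETC v k) (on_ob ETC_lift C) (on_ob ETC_lift D)"
      using ETC_lift_hom(1)[OF CD] by auto
    show "unlift_rel C ` Hom (ETC v k) (on_ob ETC_lift C) (on_ob ETC_lift D) \<subseteq> Hom (ETC v k) C D"
      using ETC_lift_hom(2)[OF CD] by auto
  qed
qed

section \<open>The duality\<close>

theorem contravariant_Spec: "contravariant (DRS v k) (ETC v k)
    (Spec :: ('a rsg, 'a \<Rightarrow> 'a, 'a set tcat, ('a set, 'a set) rel_map) fctr)"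
  unfolding contravariant_def DRS_simps ETC_simps
proof (intro conjI ballI)
  fix S :: "'a rsg" assume "S \<in> {S. drs_object v S}"
  then have S: "drs_object v S" by simp
  show "on_ob Spec S \<in> {C. etc_object v C}" using etc_object_spec[OF S] by (simp add: Spec_def)
  show "on_ar Spec S S (restrict id (carrier S)) = id_rel (on_ob Spec S)"
    using spec_ar_id[OF drs_of_object[OF S]] by (simp add: Spec_def id_rel_def)
  fix T :: "'a rsg" and f assume "T \<in> {S. drs_object v S}" "f \<in> {f. drs_morphism_of_type k S T f}"
  then have T: "drs_object v T" and f: "drs_morphism_of_type k S T f" by simp_all
  show "on_ar Spec S T f \<in> {f. etc_morphism_of_type k (on_ob Spec T) (on_ob Spec S) f}"
    using etc_morphism_of_type_spec[OF drs_of_object[OF S] drs_of_object[OF T] f] by (simp add: Spec_def)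
  fix U :: "'a rsg" and g assume "U \<in> {S. drs_object v S}" "g \<in> {f. drs_morphism_of_type k T U f}"
  then have U: "drs_object v U" and g: "drs_morphism_of_type k T U g" by simp_all
  have "drs_hom S T f" "drs_hom T U g"
    using f g drs_homI[OF drs_of_object[OF S] drs_of_object[OF T]] drs_homI[OF drs_of_object[OF T] drs_of_object[OF U]]
    by (simp_all add: drs_morphism_of_type_def)
  then show "on_ar Spec S U (compose (carrier S) g f) = comp_rel (on_ob Spec U) (on_ar Spec S T f) (on_ar Spec T U g)"
    by (simp add: Spec_def comp_rel_def spec_ar_compose)
qed

theorem contravariant_Bis: "contravariant (ETC v k) (DRS v k)
    (Bis :: ('c tcat, ('c, 'c) rel_map, 'c set rsg, 'c set \<Rightarrow> 'c set) fctr)"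
  unfolding contravariant_def DRS_simps ETC_simps
proof (intro conjI ballI)
  fix C :: "'c tcat" assume "C \<in> {C. etc_object v C}"
  then have C: "etc_object v C" by simp
  show "on_ob Bis C \<in> {S. drs_object v S}" using drs_object_bis[OF C] by (simp add: Bis_def)
  show "on_ar Bis C C (id_rel C) = restrict id (carrier (on_ob Bis C))"
    using bis_ar_id[OF etc_object_spectral[OF C]] by (simp add: Bis_def)
  fix D :: "'c tcat" and f assume "D \<in> {C. etc_object v C}" "f \<in> {f. etc_morphism_of_type k C D f}"
  then have D: "etc_object v D" and f: "etc_morphism_of_type k C D f" by simp_all
  show "on_ar Bis C D f \<in> {f. drs_morphism_of_type k (on_ob Bis D) (on_ob Bis C) f}"
    using drs_morphism_of_type_bis[OF etc_object_spectral[OF C] etc_object_spectral[OF D] f] by (simp add: Bis_def)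
  fix B :: "'c tcat" and g assume "B \<in> {C. etc_object v C}" "g \<in> {f. etc_morphism_of_type k D B f}"
  then have B: "etc_object v B" and g: "etc_morphism_of_type k D B g" by simp_all
  have "rel_hom C D f" "rel_hom D B g"
    using etc_object_spectral[OF C] etc_object_spectral[OF D] etc_object_spectral[OF B]
      etc_morphism_of_typeD(1,2)[OF f] etc_morphism_of_typeD(1,2)[OF g] by (simp_all add: rel_homI)
  then show "on_ar Bis C B (comp_rel C g f) = compose (carrier (on_ob Bis B)) (on_ar Bis C D f) (on_ar Bis D B g)"
    by (simp add: Bis_def bis_ar_comp del: bis_ob_simps)
qed

lemma covariant_contra_comp:
  assumes "contravariant \<C> \<D> F" "contravariant \<D> \<B> G" shows "covariant \<C> \<B> (contra_comp G F)"
  using assms unfolding contravariant_def covariant_def contra_comp_def by simp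

text \<open>The isomorphism sends \<open>a\<close> to the set of prime filters containing it.  It is natural because a prime filter
  is related to one containing \<open>a\<close> exactly if it contains the image of \<open>a\<close>.\<close>

theorem natural_DRS: "naturally_isomorphic (DRS v k) (DRS v k)
    (DRS_lift :: ('a rsg, 'a \<Rightarrow> 'a, 'a set set rsg, 'a set set \<Rightarrow> 'a set set) fctr) (contra_comp Bis Spec)"
  unfolding naturally_isomorphic_def
proof (intro conjI exI ballI)
  show "covariant (DRS v k) (DRS v k) DRS_lift" by (rule covariant_DRS_lift)
  show "covariant (DRS v k) (DRS v k) (contra_comp Bis Spec)"
    using covariant_contra_comp[OF contravariant_Spec contravariant_Bis] .
  let ?\<eta> = "\<lambda>S. \<lambda>X\<in>carrier (on_ob DRS_lift S). basic (natural_order S) (untag X)"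
  have ob: "on_ob (contra_comp Bis Spec) S = bis_ob (spec_ob S)" for S
    by (simp add: contra_comp_def Bis_def Spec_def)
  fix S :: "'a rsg" assume "S \<in> Ob (DRS v k)"
  then have S: "drs_object v S" by simp
  interpret S: drs S by (rule drs_of_object[OF S])
  show "is_iso (DRS v k) (on_ob DRS_lift S) (on_ob (contra_comp Bis Spec) S) (?\<eta> S)"
    unfolding ob
    using is_iso_drs[OF drs_object_lift[OF S] drs_object_bis[OF etc_object_spec[OF S]]
        drs_iso_comp[OF untag_iso S.basic_iso]] .
  fix T :: "'a rsg" and f assume "T \<in> Ob (DRS v k)" "f \<in> Hom (DRS v k) S T"
  then have T: "drs_object v T" and f: "drs_morphism_of_type k S T f" by simp_all
  interpret drs_hom S T f
    using f drs_of_object[OF S] drs_of_object[OF T] by (simp add: drs_homI drs_morphism_of_type_def)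
  show "Cmp (DRS v k) (on_ob DRS_lift S) (on_ob (contra_comp Bis Spec) S) (on_ob (contra_comp Bis Spec) T)
      (on_ar (contra_comp Bis Spec) S T f) (?\<eta> S) =
    Cmp (DRS v k) (on_ob DRS_lift S) (on_ob DRS_lift T) (on_ob (contra_comp Bis Spec) T)
      (?\<eta> T) (on_ar DRS_lift S T f)"
    unfolding DRS_simps
  proof (rule extensionalityI[of _ "tag ` carrier S"])
    fix X assume "X \<in> tag ` carrier S"
    then obtain a where a: "a \<in> carrier S" "X = tag a" by blast
    have "basic (natural_order S) a \<in> compact_open_bisections (spec_ob S)"
      using S.compact_open_basic[OF a(1)] S.Dm_inj_basic S.Cd_inj_basic by (simp add: compact_open_bisections_def)
    then have "bis_ar (spec_ob T) (spec_ob S) (spec_ar S T f) (basic (natural_order S) a) = basic (natural_order T) (f a)"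
      using spec_ar_meets_basic[OF a(1)] by (simp add: bis_ar_def)
    then show "compose (carrier (on_ob DRS_lift S)) (on_ar (contra_comp Bis Spec) S T f) (?\<eta> S) X =
        compose (carrier (on_ob DRS_lift S)) (?\<eta> T) (on_ar DRS_lift S T f) X"
      using a f_M[OF a(1)] by (simp add: compose_def contra_comp_def Bis_def Spec_def DRS_lift_ar)
  qed (simp_all add: compose_def)
qed

context rel_hom
begin

lemma drs_hom_bis: "drs_hom (bis_ob D) (bis_ob C) (bis_ar C D f)"
  using D.B.drs_axioms C.B.drs_axioms drs_morphism_bis by (rule drs_homI)

text \<open>If every bisection around \<open>y\<close> meets \<open>f\<^sub>1(x)\<close> and the domains match, then the lift of \<open>y\<close> at the
  domain of \<open>x\<close> lies with \<open>x\<close> in one bisection and so is equal to \<open>x\<close>.\<close>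

lemma spec_bis_ar:
  assumes x: "x \<in> arrows C"
  shows "fst (spec_ar (bis_ob D) (bis_ob C) (bis_ar C D f)) (pt C x) = pt D ` f1 x"
proof -
  interpret H: drs_hom "bis_ob D" "bis_ob C" "bis_ar C D f" by (rule drs_hom_bis)
  have pull: "H.pull (pt0 C p) = pt0 D (f0 p)" if p: "p \<in> objects C" for p
  proof (intro Set.set_eqI iffI)
    fix e assume "e \<in> H.pull (pt0 C p)"
    then have e: "e \<in> rs_proj (bis_ob D)" "bis_ar C D f e \<in> pt0 C p" by auto
    obtain U where U: "compact_open D.X0 U" "e = D.u ` U" using e(1) by (rule D.proj_bisE)
    have "p \<in> pre0 U"
      using e(2) unfolding U(2) unit_pre[OF U(1)] C.unit_image_mem_pt0[OF compact_open_pre0[OF U(1)]] .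
    then show "e \<in> pt0 D (f0 p)" unfolding U(2) D.unit_image_mem_pt0[OF U(1)] by (simp add: pre0_def)
  next
    fix e assume "e \<in> pt0 D (f0 p)"
    then obtain U where U: "compact_open D.X0 U" "f0 p \<in> U" "e = D.u ` U" unfolding D.mem_pt0 by blast
    have "p \<in> pre0 U" using U(2) p by (simp add: pre0_def)
    then have "bis_ar C D f e \<in> pt0 C p"
      unfolding U(3) unit_pre[OF U(1)] C.unit_image_mem_pt0[OF compact_open_pre0[OF U(1)]] .
    moreover have "e \<in> rs_proj (bis_ob D)" using U mem_proj_bis by blast
    ultimately show "e \<in> H.pull (pt0 C p)" by simp
  qed
  note px = C.pt_prime[OF x]
  have Dpx: "H.pull (C.B.Dm (pt C x)) = pt0 D (f0 (C.d x))" using pull[of "C.d x"] C.Dm_pt(1)[OF x] x by simp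
  show ?thesis
  proof (intro Set.set_eqI iffI)
    fix P assume "P \<in> pt D ` f1 x"
    then obtain y where y: "y \<in> f1 x" "P = pt D y" by blast
    have yD: "y \<in> arrows D" using f1_arr[OF x y(1)] .
    have "bis_ar C D f B \<in> pt C x" if B: "B \<in> pt D y" for B
    proof -
      have B': "B \<in> D.cob" "y \<in> B" using B by simp_all
      then show ?thesis using bis_ar_eq[OF B'(1)] pre_cob[OF B'(1)] preI[OF x y(1) B'(2)] by simp
    qed
    then have "bis_ar C D f ` P \<subseteq> pt C x" unfolding y(2) by blast
    moreover have "D.B.Dm P = H.pull (C.B.Dm (pt C x))"
      unfolding Dpx y(2) D.Dm_pt(1)[OF yD] rcm(4)[OF x y(1)] ..
    ultimately show "P \<in> fst (spec_ar (bis_ob D) (bis_ob C) (bis_ar C D f)) (pt C x)"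
      unfolding H.mem_spec_ar[OF px] using D.pt_prime[OF yD] y(2) by simp
  next
    fix P assume "P \<in> fst (spec_ar (bis_ob D) (bis_ob C) (bis_ar C D f)) (pt C x)"
    then have P: "P \<in> D.B.PS" "bis_ar C D f ` P \<subseteq> pt C x" "D.B.Dm P = pt0 D (f0 (C.d x))"
      unfolding H.mem_spec_ar[OF px] Dpx by auto
    obtain y where y: "y \<in> arrows D" "P = pt D y" using P(1) by (rule D.pt_surj)
    have "D.d y = f0 (C.d x)"
      using P(3) y D.pt0_inj[of "D.d y" "f0 (C.d x)"] D.Dm_pt(1)[OF y(1)] x by simp
    then obtain t where t: "t \<in> arrows C" "C.d t = C.d x" "y \<in> f1 t" using rcm(9)[of "C.d x" y] x y by auto
    obtain B where B: "B \<in> D.cob" "y \<in> B" using D.cob_basis[OF openin_topspace y(1)] by blast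
    have "B \<in> P" using B y(2) by simp
    then have "bis_ar C D f B \<in> pt C x" using P(2) by blast
    then have "x \<in> pre B" using bis_ar_eq[OF B(1)] by simp
    moreover have "t \<in> pre B" using preI[OF t(1,3) B(2)] .
    ultimately have "t = x" using C.cob_inj_d[OF pre_cob[OF B(1)] _ _ t(2)] by blast
    then show "P \<in> pt D ` f1 x" using t(3) y(2) by blast
  qed
qed

text \<open>Objects are determined by their units, so the claim follows from the one on arrows.\<close>

lemma spec_bis_ar_objects:
  assumes p: "p \<in> objects C"
  shows "snd (spec_ar (bis_ob D) (bis_ob C) (bis_ar C D f)) (pt0 C p) = pt0 D (f0 p)"
proof -
  interpret H: drs_hom "bis_ob D" "bis_ob C" "bis_ar C D f" by (rule drs_hom_bis)
  have up: "C.u p \<in> arrows C" using p by simp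
  have uq: "D.u (f0 p) \<in> f1 (C.u p)" using rcm(12)[OF p] .
  have "pt D (D.u (f0 p)) \<in> fst (spec_ar (bis_ob D) (bis_ob C) (bis_ar C D f)) (pt C (C.u p))"
    unfolding spec_bis_ar[OF up] using uq by blast
  then have "D.B.Dm (pt D (D.u (f0 p))) = H.pull (C.B.Dm (pt C (C.u p)))"
    unfolding H.mem_spec_ar[OF C.pt_prime[OF up]] by blast
  then have "pt0 D (f0 p) = H.pull (pt0 C p)"
    using D.Dm_pt(1)[of "D.u (f0 p)"] C.Dm_pt(1)[OF up] p by simp
  then show ?thesis using C.pt0_prime[OF p] by simp
qed

end

text \<open>The isomorphism sends an arrow to the set of compact open bisections through it.\<close>

theorem natural_ETC: "naturally_isomorphic (ETC v k) (ETC v k)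
    (ETC_lift :: ('c tcat, ('c, 'c) rel_map, 'c set set tcat, ('c set set, 'c set set) rel_map) fctr) (contra_comp Spec Bis)"
  unfolding naturally_isomorphic_def
proof (intro conjI exI ballI)
  show "covariant (ETC v k) (ETC v k) ETC_lift" by (rule covariant_ETC_lift)
  show "covariant (ETC v k) (ETC v k) (contra_comp Spec Bis)"
    using covariant_contra_comp[OF contravariant_Bis contravariant_Spec] .
  let ?\<eta> = "\<lambda>C. rel_of (on_ob ETC_lift C) (\<lambda>X. pt C (untag X)) (\<lambda>X. pt0 C (untag X))"
  have ob: "on_ob (contra_comp Spec Bis) C = spec_ob (bis_ob C)" for C
    by (simp add: contra_comp_def Bis_def Spec_def)
  have ar: "on_ar (contra_comp Spec Bis) C D f = spec_ar (bis_ob D) (bis_ob C) (bis_ar C D f)" for C D f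
    by (simp add: contra_comp_def Bis_def Spec_def)
  fix C :: "'c tcat" assume "C \<in> Ob (ETC v k)"
  then have C: "etc_object v C" by simp
  interpret C: spectral_etale C by unfold_locales (rule etc_object_spectral[OF C])
  show "is_iso (ETC v k) (on_ob ETC_lift C) (on_ob (contra_comp Spec Bis) C) (?\<eta> C)"
    unfolding ob
    using is_iso_etc[OF etc_object_lift[OF C] etc_object_spec[OF drs_object_bis[OF C]]
        etc_iso_comp[OF etale_of_object[OF etc_object_lift[OF C]] untag_etc_iso[OF C.etale] C.pt_iso]] .
  fix D :: "'c tcat" and f assume "D \<in> Ob (ETC v k)" "f \<in> Hom (ETC v k) C D"
  then have D: "etc_object v D" and f: "etc_morphism_of_type k C D f" by simp_all
  interpret rel_hom C D f
    using rel_homI[OF etc_object_spectral[OF C] etc_object_spectral[OF D] etc_morphism_of_typeD(1,2)[OF f]] .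
  show "Cmp (ETC v k) (on_ob ETC_lift C) (on_ob (contra_comp Spec Bis) C) (on_ob (contra_comp Spec Bis) D)
      (on_ar (contra_comp Spec Bis) C D f) (?\<eta> C) =
    Cmp (ETC v k) (on_ob ETC_lift C) (on_ob ETC_lift D) (on_ob (contra_comp Spec Bis) D)
      (?\<eta> D) (on_ar ETC_lift C D f)"
    unfolding ETC_simps ar
  proof (rule rel_map_eqI[of _ "arrows (on_ob ETC_lift C)" _ "objects (on_ob ETC_lift C)"])
    fix X assume X: "X \<in> arrows (on_ob ETC_lift C)"
    then obtain x where x: "x \<in> arrows C" "X = tag x" by auto
    have "(\<Union>Y\<in>tag ` f1 x. fst (?\<eta> D) Y) = pt D ` f1 x" using f1_arr[OF x(1)] by auto
    then show "fst (comp_rel (on_ob ETC_lift C) (spec_ar (bis_ob D) (bis_ob C) (bis_ar C D f)) (?\<eta> C)) X =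
        fst (comp_rel (on_ob ETC_lift C) (?\<eta> D) (on_ar ETC_lift C D f)) X"
      using x spec_bis_ar[OF x(1)] by (simp add: ETC_lift_ar)
  next
    fix X assume X: "X \<in> objects (on_ob ETC_lift C)"
    then obtain p where p: "p \<in> objects C" "X = tag p" by auto
    then show "snd (comp_rel (on_ob ETC_lift C) (spec_ar (bis_ob D) (bis_ob C) (bis_ar C D f)) (?\<eta> C)) X =
        snd (comp_rel (on_ob ETC_lift C) (?\<eta> D) (on_ar ETC_lift C D f)) X"
      using spec_bis_ar_objects[OF p(1)] by (simp add: ETC_lift_ar)
  qed (simp_all del: arrows_ETC_lift objects_ETC_lift)
qed

theorem theorem1p7:
  fixes v :: version and k :: nat
  assumes "k \<in> {1, 2, 3, 4}"
  shows
    "category (DRS v k :: ('a rsg, 'a \<Rightarrow> 'a) cat) \<and>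
     category (ETC v k :: ('c tcat, ('c, 'c) rel_map) cat) \<and>
     contravariant (DRS v k) (ETC v k)
       (Spec :: ('a rsg, 'a \<Rightarrow> 'a, 'a set tcat, ('a set, 'a set) rel_map) fctr) \<and>
     contravariant (ETC v k) (DRS v k)
       (Bis :: ('c tcat, ('c, 'c) rel_map, 'c set rsg, 'c set \<Rightarrow> 'c set) fctr) \<and>
     fully_faithful (DRS v k) (DRS v k)
       (DRS_lift :: ('a rsg, 'a \<Rightarrow> 'a, 'a set set rsg, 'a set set \<Rightarrow> 'a set set) fctr) \<and>
     fully_faithful (ETC v k) (ETC v k)
       (ETC_lift :: ('c tcat, ('c, 'c) rel_map, 'c set set tcat, ('c set set, 'c set set) rel_map) fctr) \<and>
     naturally_isomorphic (DRS v k) (DRS v k)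
       (DRS_lift :: ('a rsg, 'a \<Rightarrow> 'a, 'a set set rsg, 'a set set \<Rightarrow> 'a set set) fctr)
       (contra_comp Bis Spec) \<and>
     naturally_isomorphic (ETC v k) (ETC v k)
       (ETC_lift :: ('c tcat, ('c, 'c) rel_map, 'c set set tcat, ('c set set, 'c set set) rel_map) fctr)
       (contra_comp Spec Bis)"
  by (intro conjI category_DRS category_ETC contravariant_Spec contravariant_Bis fully_faithful_DRS_lift
      fully_faithful_ETC_lift natural_DRS natural_ETC)

end
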